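(* Fix $\theta,\rho\in[0,1]$ and $\varepsilon>0$. Let $\eta_0$ be sampled from $\Upsilon^{(\theta;\rho)}$, let $(\eta_t)$ be the stochastic six-vertex model on $\mathbb Z$ with initial data $\eta_0$, and let $G_y(x)=G(x,y)$ be the entropy solution of $\partial_yG+\partial_x\varphi(G)=0$ on $\mathbb R\times[0,1]$ with $G(x,0)=\theta\mathbf 1_{x\le0}+\rho\mathbf 1_{x>0}$. Then $$\lim_{N\to\infty}\mathbb P\Big[\max_{-N/\varepsilon<X_1<X_2<N/\varepsilon}\Big|\frac1N\sum_{x=X_1}^{X_2}\eta_N(x)-\int_{X_1/N}^{X_2/N}G_1(x)\,dx\Big|>\varepsilon\Big]=0.$$
   Context: Fix $0<b_1<b_2<1$, $\kappa=\frac{1-b_1}{1-b_2}$, $\varphi(z)=\frac{\kappa z}{(\kappa-1)z+1}$. Entropy solution: the unique bounded weak solution satisfying the Kružkov entropy inequalities. $\Upsilon^{(\theta;\rho)}$ is the product measure on $\{0,1\}^{\mathbb Z}$ with $P[\eta(x)=1]=\theta$ for $x\le0$ and $=\rho$ for $x>0$. The stochastic six-vertex model is the discrete-time Markov process on $\{0,1\}^{\mathbb Z}$ defined (for finitely many particles) as follows: at step $t$ take independent $\chi_t(x)\sim$ Bernoulli$(b_1)$ and $j_t(x)$ with $P[j_t(x)=r]=(1-b_2)b_2^{r-1}$, $r\ge1$; label particles at time $t-1$ as $p_{t-1}(-M)<\dots<p_{t-1}(N)$ ($p(i)=-\infty$ below, $+\infty$ above the range) and for $k=-M,\dots,N$ in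 order, with $x=p_{t-1}(k)$: if $p_t(k-1)<x$, set $p_t(k)=x$ if $\chi_t(x)=1$ and $p_t(k)=\min\{x+j_t(x),p_{t-1}(k+1)\}$ if $\chi_t(x)=0$; if $p_t(k-1)=x$, set $p_t(k)=\min\{x+j_t(x),p_{t-1}(k+1)\}$. With infinitely many particles the same rules are applied through a Harris-type construction (on finite time horizons space-time almost surely splits into finite non-interacting blocks). *)

theory Defs
  imports "HOL-Probability.Probability"
begin

text \<open>Sources of randomness: the initial occupation variables eta_0(x), and for each
  time step t >= 1 and site x the variables chi_t(x) and j_t(x).\<close>

datatype sv_src = Init int | Chi nat int | Jmp nat int

definition sv_law :: "real \<Rightarrow> real \<Rightarrow> real \<Rightarrow> real \<Rightarrow> sv_src \<Rightarrow> nat pmf" where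
  "sv_law b1 b2 \<theta> \<rho> i = (case i of
      Init x \<Rightarrow> map_pmf of_bool (bernoulli_pmf (if x \<le> 0 then \<theta> else \<rho>))
    | Chi t x \<Rightarrow> map_pmf of_bool (bernoulli_pmf b1)
    | Jmp t x \<Rightarrow> map_pmf Suc (geometric_pmf (1 - b2)))"

definition sv_space :: "real \<Rightarrow> real \<Rightarrow> real \<Rightarrow> real \<Rightarrow> (sv_src \<Rightarrow> nat) measure" where
  "sv_space b1 b2 \<theta> \<rho> = (\<Pi>\<^sub>M i\<in>UNIV. measure_pmf (sv_law b1 b2 \<theta> \<rho> i))"

text \<open>One time step for finitely many particles, given as the increasing list of their
  positions p_{t-1}(-M) < ... < p_{t-1}(N). The argument prev is p_t(k-1)
  (None standing for minus infinity). A missing next particle means p_{t-1}(k+1) = +infinity.\<close>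

fun sv_step :: "(int \<Rightarrow> bool) \<Rightarrow> (int \<Rightarrow> nat) \<Rightarrow> int option \<Rightarrow> int list \<Rightarrow> int list" where
  "sv_step chi j prev [] = []"
| "sv_step chi j prev (x # rest) =
     (let jump = (case rest of [] \<Rightarrow> x + int (j x) | y # _ \<Rightarrow> min (x + int (j x)) y);
          new = (if prev = Some x then jump else if chi x then x else jump)
      in new # sv_step chi j (Some new) rest)"

fun sv_trunc :: "(sv_src \<Rightarrow> nat) \<Rightarrow> nat \<Rightarrow> nat \<Rightarrow> int list" where
  "sv_trunc \<omega> M 0 = sorted_list_of_set {x. \<bar>x\<bar> \<le> int M \<and> \<omega> (Init x) = 1}"
| "sv_trunc \<omega> M (Suc t) =
     sv_step (\<lambda>x. \<omega> (Chi (Suc t) x) = 1) (\<lambda>x. \<omega> (Jmp (Suc t) x)) None (sv_trunc \<omega> M t)"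

text \<open>Infinite-volume process (Harris-type construction): eta_t(x) is the eventual value,
  as the truncation M tends to infinity, of the truncated finite-particle process.\<close>

definition sv_config :: "(sv_src \<Rightarrow> nat) \<Rightarrow> nat \<Rightarrow> int \<Rightarrow> bool" where
  "sv_config \<omega> t x \<longleftrightarrow> (\<forall>\<^sub>F M in sequentially. x \<in> set (sv_trunc \<omega> M t))"

definition sv_kappa :: "real \<Rightarrow> real \<Rightarrow> real" where
  "sv_kappa b1 b2 = (1 - b1) / (1 - b2)"

definition sv_phi :: "real \<Rightarrow> real \<Rightarrow> real \<Rightarrow> real" where
  "sv_phi b1 b2 z = sv_kappa b1 b2 * z / ((sv_kappa b1 b2 - 1) * z + 1)"

definition test_function ::
  "(real \<Rightarrow> real \<Rightarrow> real) \<Rightarrow> (real \<Rightarrow> real \<Rightarrow> real) \<Rightarrow> (real \<Rightarrow> real \<Rightarrow> real) \<Rightarrow> bool" where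
  "test_function \<psi> \<psi>x \<psi>y \<longleftrightarrow>
     (\<forall>x y. 0 \<le> \<psi> x y) \<and>
     (\<exists>R. \<forall>x y. R < \<bar>x\<bar> + \<bar>y\<bar> \<longrightarrow> \<psi> x y = 0) \<and>
     continuous_on UNIV (\<lambda>(x, y). \<psi>x x y) \<and>
     continuous_on UNIV (\<lambda>(x, y). \<psi>y x y) \<and>
     (\<forall>x y. ((\<lambda>s. \<psi> s y) has_real_derivative \<psi>x x y) (at x)) \<and>
     (\<forall>x y. ((\<lambda>s. \<psi> x s) has_real_derivative \<psi>y x y) (at y))"

text \<open>Kruzkov entropy solution of d_y G + d_x f(G) = 0 on R x [0,1] with initial data G0:
  G is measurable, takes values in [0,1] (the range of densities, where the flux is defined;
  in particular G is bounded), and for every real k and every test function psi >= 0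
    int_{R x [0,1]} (|G-k| psi_y + sgn(G-k)(f(G)-f(k)) psi_x)
      + int_R |G0(x)-k| psi(x,0) dx - int_R |G(x,1)-k| psi(x,1) dx >= 0.
  The boundary terms encode the initial condition and identify G(.,1) with the trace of
  the solution at time 1.\<close>

definition entropy_solution ::
  "(real \<Rightarrow> real) \<Rightarrow> (real \<Rightarrow> real) \<Rightarrow> (real \<Rightarrow> real \<Rightarrow> real) \<Rightarrow> bool" where
  "entropy_solution f G0 G \<longleftrightarrow>
     (\<lambda>p. G (fst p) (snd p)) \<in> borel_measurable (borel :: (real \<times> real) measure) \<and>
     (\<forall>x y. 0 \<le> y \<and> y \<le> 1 \<longrightarrow> 0 \<le> G x y \<and> G x y \<le> 1) \<and>
     (\<forall>k \<psi> \<psi>x \<psi>y. test_function \<psi> \<psi>x \<psi>y \<longrightarrow>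
        0 \<le> set_lebesgue_integral lborel (UNIV \<times> {0..1})
               (\<lambda>p. \<bar>G (fst p) (snd p) - k\<bar> * \<psi>y (fst p) (snd p)
                    + sgn (G (fst p) (snd p) - k) * (f (G (fst p) (snd p)) - f k)
                      * \<psi>x (fst p) (snd p))
             + (\<integral>x. \<bar>G0 x - k\<bar> * \<psi> x 0 \<partial>lborel)
             - (\<integral>x. \<bar>G x 1 - k\<bar> * \<psi> x 1 \<partial>lborel))"

end

theory Submission
  imports Defs
begin

text \<open>
  The particle dynamics is a six-vertex model: a travelling particle is a horizontal path, and by
  the memoryless geometric jumps every vertex acts independently. Far to the left there are almost
  surely locks, which decouple the finite box from what lies beyond it, so the left boundary of the
  quadrant may be fed with the stationary flux \<open>f \<theta>\<close>.

  For a constant density \<open>k\<close> and boundary flux \<open>f k\<close> the vertex model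
  is stationary with product law. Driving all densities by the same noise, discrepancies of opposite
  sign annihilate upon meeting and are never created, so on a mesoscopic block almost always one of
  two systems dominates the other. Comparing with the stationary systems of a fine grid of densities
  shows that the flux of a block is nearly \<open>f\<close> of its density. By monotonicity the
  mean height obeys one of the inequalities of the Riemann problem exactly: it lies above the
  heights of the intermediate densities for \<open>\<rho> \<le> \<theta>\<close> and below the
  two outer ones for \<open>\<theta> < \<rho>\<close>. The other inequality follows from the
  approximate conservation law by a discrete Gronwall argument, since \<open>f\<close> is concave.

  On the side of the equation, suitable test functions in the Kruzkov inequalities bound
  \<open>G(\<cdot>, 1)\<close> on both sides of each characteristic, which identifies its
  integrals with differences of the limit height.
\<close>

section \<open>Independent coordinates\<close>

text \<open>Nothing controls the fluctuations of the density of the Riemann system inside a block,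
  so the relation "flux = \<open>f\<close> of density" cannot be averaged directly. The estimates
  that are needed are affine in the density, however: the fan requires \<open>f\<close> below a
  supporting line, the shock \<open>f\<close> above a chord, and affine inequalities survive
  expectation. This is why the conservation law is only used for the mean height \<open>av\<close>.
  Convergence of the mean is upgraded to convergence in L1 because the random height lies, path by
  path, on one side of a stationary height, and the latter concentrates.

  Bad blocks are rare because a perimeter is compared with an area. A rectangle lets in at most as
  many discrepancies as it has boundary edges, each meeting destroys a pair with the fixed
  probability \<open>gam\<close>, and opposite discrepancies on the sides of an
  \<open>l\<close>-block meet with probability at least (b1 b2)^(2 l). For fixed \<open>l\<close>
  the expected number of opposite pairs in \<open>I * J\<close> blocks is thus of order I + J only.
  Limits are therefore taken in the order: grid fineness \<open>n\<close>, block size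
  \<open>l\<close>, then \<open>N\<close>.\<close>

definition dep_on :: "'i set \<Rightarrow> (('i \<Rightarrow> 'a) \<Rightarrow> 'b) \<Rightarrow> bool" where
  "dep_on I F \<longleftrightarrow> (\<forall>\<omega> \<omega>'. (\<forall>i\<in>I. \<omega> i = \<omega>' i) \<longrightarrow> F \<omega> = F \<omega>')"

lemma dep_onI: "(\<And>\<omega> \<omega>'. (\<And>i. i \<in> I \<Longrightarrow> \<omega> i = \<omega>' i) \<Longrightarrow> F \<omega> = F \<omega>') \<Longrightarrow> dep_on I F"
  unfolding dep_on_def by blast

lemma dep_onD: "dep_on I F \<Longrightarrow> (\<And>i. i \<in> I \<Longrightarrow> \<omega> i = \<omega>' i) \<Longrightarrow> F \<omega> = F \<omega>'"
  unfolding dep_on_def by blast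

lemma dep_on_mono: "dep_on I F \<Longrightarrow> I \<subseteq> J \<Longrightarrow> dep_on J F"
  unfolding dep_on_def by blast

lemma dep_on_comp1: "dep_on I F \<Longrightarrow> dep_on I (\<lambda>\<omega>. h (F \<omega>))"
  unfolding dep_on_def by metis

lemma dep_on_all: "(\<And>x. x \<in> S \<Longrightarrow> dep_on I (F x)) \<Longrightarrow> dep_on I (\<lambda>\<omega>. \<forall>x\<in>S. F x \<omega>)"
  unfolding dep_on_def by metis

lemma dep_on_coord: "i \<in> I \<Longrightarrow> dep_on I (\<lambda>\<omega>. P (\<omega> i))"
  unfolding dep_on_def by metis

lemma dep_on_const: "dep_on I (\<lambda>\<omega>. c)"
  unfolding dep_on_def by simp

locale coordinate_space =
  fixes M :: "'i \<Rightarrow> 'a measure"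
  assumes prob_space_coord: "prob_space (M i)" and space_coord: "space (M i) = UNIV"
begin

abbreviation "PM \<equiv> PiM UNIV M"

abbreviation pr :: "(('i \<Rightarrow> 'a) \<Rightarrow> bool) \<Rightarrow> real" where "pr P \<equiv> measure PM {\<omega>. P \<omega>}"

abbreviation ev :: "(('i \<Rightarrow> 'a) \<Rightarrow> bool) \<Rightarrow> bool" where "ev P \<equiv> {\<omega>. P \<omega>} \<in> sets PM"

sublocale product_prob_space M UNIV
  using prob_space_coord by (intro product_prob_spaceI)

lemma space_PM [simp]: "space PM = UNIV"
  by (simp add: space_PiM space_coord)

lemma indep_coordinates: "indep_vars M (\<lambda>i \<omega>. \<omega> i) UNIV"
proof -
  have "distr PM PM (\<lambda>x. \<lambda>i\<in>UNIV. x i) = PM"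
    by (simp add: restrict_UNIV distr_id[unfolded id_def])
  moreover have "distr PM (M i) (\<lambda>\<omega>. \<omega> i) = M i" for i
    by (rule PiM_component) simp
  ultimately show ?thesis
    by (subst indep_vars_iff_distr_eq_PiM') auto
qed

text \<open>Dependence on coordinates is the pointwise notion \<open>dep_on\<close>, kept apart from
  measurability \<open>ev\<close>, because it is provable by plain recursion over the dynamics.
  Independence follows since both events factor through the restrictions to \<open>I\<close> and
  \<open>J\<close>, which are independent under the product measure.\<close>

lemma pr_indep:
  assumes A: "ev A" and B: "ev B" and "dep_on I A" "dep_on J B" "I \<inter> J = {}"
  shows "pr (\<lambda>\<omega>. A \<omega> \<and> B \<omega>) = pr A * pr B"
proof -
  define K where "K = case_bool I J"
  have "indep_vars (\<lambda>j. PiM (K j) M) (\<lambda>j \<omega>. restrict (\<lambda>i. \<omega> i) (K j)) UNIV"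
    using assms(5) by (intro indep_vars_restrict[OF indep_coordinates])
      (auto simp: disjoint_family_on_def K_def split: bool.splits)
  then have iv: "indep_var (PiM I M) (\<lambda>\<omega>. restrict \<omega> I) (PiM J M) (\<lambda>\<omega>. restrict \<omega> J)"
    unfolding indep_var_def by (rule indep_vars_cong[THEN iffD1, rotated -1])
      (auto simp: K_def split: bool.splits)
  have nonempty: "\<exists>w. w \<in> space PM" by simp
  then obtain w :: "'i \<Rightarrow> 'a" where "w \<in> space PM" by blast
  \<comment> \<open>Completing a partial configuration by the fixed point \<open>w\<close> is
    measurable; it turns \<open>A\<close> and \<open>B\<close> into events of the factor
    spaces.\<close>
  have ext: "(\<lambda>y i. if i \<in> L then y i else w i) \<in> measurable (PiM L M) PM" for L
  proof (rule measurable_PiM_single')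
    show "(\<lambda>y. if i \<in> L then y i else w i) \<in> measurable (PiM L M) (M i)" for i
      by (cases "i \<in> L") (auto simp: space_coord)
  qed (auto simp: space_coord)
  let ?A = "{y \<in> space (PiM I M). A (\<lambda>i. if i \<in> I then y i else w i)}"
  let ?B = "{y \<in> space (PiM J M). B (\<lambda>i. if i \<in> J then y i else w i)}"
  have sA: "?A \<in> sets (PiM I M)"
    using measurable_sets[OF ext A, of I] by (simp add: vimage_def Int_def conj_commute)
  have sB: "?B \<in> sets (PiM J M)"
    using measurable_sets[OF ext B, of J] by (simp add: vimage_def Int_def conj_commute)
  have a: "A (\<lambda>i. if i \<in> I then (restrict \<omega> I) i else w i) = A \<omega>" for \<omega>
    by (rule dep_onD[OF assms(3)]) auto
  have b: "B (\<lambda>i. if i \<in> J then (restrict \<omega> J) i else w i) = B \<omega>" for \<omega>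
    by (rule dep_onD[OF assms(4)]) auto
  have spI: "restrict \<omega> L \<in> space (PiM L M)" for \<omega> L
    by (auto simp: space_PiM space_coord)
  have "prob ((\<lambda>x. (restrict x I, restrict x J)) -` (?A \<times> ?B) \<inter> space PM) =
      prob ((\<lambda>\<omega>. restrict \<omega> I) -` ?A \<inter> space PM) * prob ((\<lambda>\<omega>. restrict \<omega> J) -` ?B \<inter> space PM)"
    by (rule indep_varD[OF iv sA sB])
  then show ?thesis
    by (simp only: vimage_def mem_Times_iff fst_conv snd_conv mem_Collect_eq a b spI) simp
qed

lemma pr_nonneg: "0 \<le> pr P" by simp

lemma pr_le_1: "pr P \<le> 1" by (rule prob_le_1)

lemma pr_mono: "(\<And>\<omega>. P \<omega> \<Longrightarrow> Q \<omega>) \<Longrightarrow> ev Q \<Longrightarrow> pr P \<le> pr Q"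
  by (rule finite_measure_mono) auto

lemma pr_not: "ev P \<Longrightarrow> pr (\<lambda>\<omega>. \<not> P \<omega>) = 1 - pr P"
  using prob_compl[of "{\<omega>. P \<omega>}"] by (simp add: Compl_eq_Diff_UNIV[symmetric] Collect_neg_eq)

lemma pr_disj_eq:
  assumes "ev P" "ev Q" "\<And>\<omega>. P \<omega> \<Longrightarrow> Q \<omega> \<Longrightarrow> False"
  shows "pr (\<lambda>\<omega>. P \<omega> \<or> Q \<omega>) = pr P + pr Q"
  using finite_measure_Union[OF assms(1,2)] assms(3) by (auto simp: Collect_disj_eq)

lemma pr_disj_le:
  assumes "ev P" "ev Q"
  shows "pr (\<lambda>\<omega>. P \<omega> \<or> Q \<omega>) \<le> pr P + pr Q"
  using measure_Un_le[OF assms] by (auto simp: Collect_disj_eq)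

lemma ev_iff_pred: "ev P \<longleftrightarrow> Measurable.pred PM P"
  by (simp add: pred_def)

lemma pr_split:
  assumes "ev P" "ev Q"
  shows "pr P = pr (\<lambda>\<omega>. P \<omega> \<and> Q \<omega>) + pr (\<lambda>\<omega>. P \<omega> \<and> \<not> Q \<omega>)"
proof -
  have [measurable]: "Measurable.pred PM P" "Measurable.pred PM Q"
    using assms by (simp_all only: ev_iff_pred)
  have "pr (\<lambda>\<omega>. (P \<omega> \<and> Q \<omega>) \<or> (P \<omega> \<and> \<not> Q \<omega>)) = pr (\<lambda>\<omega>. P \<omega> \<and> Q \<omega>) + pr (\<lambda>\<omega>. P \<omega> \<and> \<not> Q \<omega>)"
    by (rule pr_disj_eq) (auto simp only: ev_iff_pred, measurable)
  moreover have "(\<lambda>\<omega>. (P \<omega> \<and> Q \<omega>) \<or> (P \<omega> \<and> \<not> Q \<omega>)) = P" by auto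
  ultimately show ?thesis by simp
qed

lemma pr_Bex_le:
  assumes "finite S" "\<And>x. x \<in> S \<Longrightarrow> ev (P x)"
  shows "pr (\<lambda>\<omega>. \<exists>x\<in>S. P x \<omega>) \<le> (\<Sum>x\<in>S. pr (P x))"
proof -
  have "{\<omega>. \<exists>x\<in>S. P x \<omega>} = (\<Union>x\<in>S. {\<omega>. P x \<omega>})" by auto
  then show ?thesis using finite_measure_subadditive_finite[of S "\<lambda>x. {\<omega>. P x \<omega>}"] assms by auto
qed

lemma pr_cylinder:
  assumes "finite J" "\<And>i. i \<in> J \<Longrightarrow> X i \<in> sets (M i)"
  shows "pr (\<lambda>\<omega>. \<forall>i\<in>J. \<omega> i \<in> X i) = (\<Prod>i\<in>J. measure (M i) (X i))"
proof -
  have "{\<omega>. \<forall>i\<in>J. \<omega> i \<in> X i} = prod_emb UNIV M J (Pi\<^sub>E J X)"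
    by (auto simp: prod_emb_def space_coord PiE_def Pi_def)
  then show ?thesis using measure_PiM_emb[of J X] assms by simp
qed

lemma ev_coord: "{x. P x} \<in> sets (M i) \<Longrightarrow> ev (\<lambda>\<omega>. P (\<omega> i))"
proof -
  assume P: "{x. P x} \<in> sets (M i)"
  have "(\<lambda>\<omega>. \<omega> i) -` {x. P x} \<inter> space PM \<in> sets PM"
    by (rule measurable_sets[OF _ P]) simp
  then show ?thesis by (simp add: vimage_def)
qed

lemma pr_coord: "{x. P x} \<in> sets (M i) \<Longrightarrow> pr (\<lambda>\<omega>. P (\<omega> i)) = measure (M i) {x. P x}"
  using pr_cylinder[of "{i}" "\<lambda>_. {x. P x}"] by simp

end

section \<open>Second-moment bounds for sums of pairwise independent indicators\<close>

context prob_space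
begin

text \<open>Pairwise independence suffices: the off-diagonal terms cancel against the square of the
  mean, and each of the \<open>n\<close> diagonal terms costs at most 1.\<close>

lemma sum_indicator_second_moment:
  fixes A :: "nat \<Rightarrow> 'a \<Rightarrow> bool"
  assumes meas: "\<And>i. i < n \<Longrightarrow> {\<omega>\<in>space M. A i \<omega>} \<in> sets M"
    and p: "\<And>i. i < n \<Longrightarrow> prob {\<omega>\<in>space M. A i \<omega>} = p"
    and pp: "\<And>i j. i < n \<Longrightarrow> j < n \<Longrightarrow> i \<noteq> j \<Longrightarrow> prob {\<omega>\<in>space M. A i \<omega> \<and> A j \<omega>} = p\<^sup>2"
    and "0 \<le> p" "p \<le> 1"
  shows "expectation (\<lambda>\<omega>. ((\<Sum>i<n. of_bool (A i \<omega>)) - real n * p)\<^sup>2) \<le> real n"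
    and "integrable M (\<lambda>\<omega>. ((\<Sum>i<n. of_bool (A i \<omega>)) - real n * p)\<^sup>2)"
proof -
  have [measurable]: "Measurable.pred M (A i)" if "i < n" for i using meas[OF that] by (simp add: pred_def)
  have int1: "integrable M (\<lambda>\<omega>. of_bool (A i \<omega>) :: real)" if "i < n" for i
    using that by (intro integrable_const_bound[where B=1]) auto
  have int2: "integrable M (\<lambda>\<omega>. of_bool (A i \<omega>) * of_bool (A j \<omega>) :: real)" if "i < n" "j < n" for i j
    using that by (intro integrable_const_bound[where B=1]) auto
  have E1: "expectation (\<lambda>\<omega>. of_bool (A i \<omega>)) = p" if "i < n" for i
  proof -
    have "expectation (\<lambda>\<omega>. of_bool (A i \<omega>) :: real) = expectation (indicator {\<omega>\<in>space M. A i \<omega>})"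
      by (rule Bochner_Integration.integral_cong) (auto simp: indicator_def)
    also have "\<dots> = prob {\<omega>\<in>space M. A i \<omega>}"
      using meas[OF that] by (subst Bochner_Integration.integral_indicator) (auto intro!: arg_cong[where f=prob])
    finally show ?thesis using p[OF that] by simp
  qed
  have E2: "expectation (\<lambda>\<omega>. of_bool (A i \<omega>) * of_bool (A j \<omega>)) = (if i = j then p else p\<^sup>2)"
    if "i < n" "j < n" for i j
  proof -
    have "expectation (\<lambda>\<omega>. of_bool (A i \<omega>) * of_bool (A j \<omega>) :: real) =
        expectation (indicator {\<omega>\<in>space M. A i \<omega> \<and> A j \<omega>})"
      by (rule Bochner_Integration.integral_cong) (auto simp: indicator_def)
    also have "\<dots> = prob {\<omega>\<in>space M. A i \<omega> \<and> A j \<omega>}"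
      using that by (subst Bochner_Integration.integral_indicator) (auto intro!: arg_cong[where f=prob])
    finally show ?thesis using pp[OF that] p[OF that(1)] by auto
  qed
  have sq: "((\<Sum>i<n. a i) - c)\<^sup>2 = (\<Sum>i<n. \<Sum>j<n. a i * a j) - 2 * c * (\<Sum>i<n. a i) + c\<^sup>2"
    for a :: "nat \<Rightarrow> real" and c
    by (simp add: power2_diff power2_eq_square sum_product algebra_simps)
  have eq: "((\<Sum>i<n. of_bool (A i \<omega>)) - real n * p)\<^sup>2 =
      (\<Sum>i<n. \<Sum>j<n. of_bool (A i \<omega>) * of_bool (A j \<omega>)) - 2 * real n * p * (\<Sum>i<n. of_bool (A i \<omega>)) + (real n * p)\<^sup>2" for \<omega>
    unfolding sq by (simp only: mult.assoc)
  have i1: "integrable M (\<lambda>\<omega>. (\<Sum>i<n. \<Sum>j<n. of_bool (A i \<omega>) * of_bool (A j \<omega>)) :: real)"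
    by (intro Bochner_Integration.integrable_sum int2) auto
  have i2: "integrable M (\<lambda>\<omega>. 2 * real n * p * (\<Sum>i<n. of_bool (A i \<omega>)) :: real)"
    by (intro integrable_mult_right Bochner_Integration.integrable_sum int1) auto
  show int: "integrable M (\<lambda>\<omega>. ((\<Sum>i<n. of_bool (A i \<omega>)) - real n * p)\<^sup>2)"
    unfolding eq using i1 i2 by (simp del: sum_of_bool_eq sum_mult_of_bool_eq sum_of_bool_mult_eq)
  have S2: "expectation (\<lambda>\<omega>. (\<Sum>i<n. \<Sum>j<n. of_bool (A i \<omega>) * of_bool (A j \<omega>)) :: real) =
      (\<Sum>i<n. \<Sum>j<n. (if i = j then p else p\<^sup>2))"
    by (subst Bochner_Integration.integral_sum, force intro!: Bochner_Integration.integrable_sum int2,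
        intro sum.cong refl, subst Bochner_Integration.integral_sum, force intro!: int2,
        intro sum.cong refl E2) auto
  have "expectation (\<lambda>\<omega>. ((\<Sum>i<n. of_bool (A i \<omega>)) - real n * p)\<^sup>2) =
     (\<Sum>i<n. \<Sum>j<n. (if i = j then p else p\<^sup>2)) - 2 * real n * p * (\<Sum>i<n. p) + (real n * p)\<^sup>2"
    unfolding eq using i1 i2 by (simp add: int1 S2 E1 prob_space del: sum_of_bool_eq sum_mult_of_bool_eq sum_of_bool_mult_eq of_bool_conj)
  also have "(\<Sum>i<n. \<Sum>j<n. (if i = j then p else p\<^sup>2)) \<le> (\<Sum>i<n. \<Sum>j<n. p\<^sup>2 + (if i = j then 1 else 0))"
    using order_trans[OF assms(5), of "p\<^sup>2 + 1"] by (intro sum_mono) auto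
  also have "\<dots> = (real n * p)\<^sup>2 + real n"
    by (simp add: sum.distrib power2_eq_square algebra_simps)
  finally show "expectation (\<lambda>\<omega>. ((\<Sum>i<n. of_bool (A i \<omega>)) - real n * p)\<^sup>2) \<le> real n"
    by (simp add: power2_eq_square)
qed

text \<open>Jensen's inequality, in the form that the variance of |X| is nonnegative.\<close>

lemma expectation_abs_le_sqrt:
  fixes X :: "'a \<Rightarrow> real"
  assumes [measurable]: "X \<in> borel_measurable M" and "integrable M (\<lambda>\<omega>. (X \<omega>)\<^sup>2)"
    and "expectation (\<lambda>\<omega>. (X \<omega>)\<^sup>2) \<le> c"
  shows "expectation (\<lambda>\<omega>. \<bar>X \<omega>\<bar>) \<le> sqrt c"
proof -
  have int: "integrable M X"
    by (rule square_integrable_imp_integrable) fact+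
  have "0 \<le> variance (\<lambda>\<omega>. \<bar>X \<omega>\<bar>)" by (rule variance_positive)
  also have "\<dots> = expectation (\<lambda>\<omega>. (X \<omega>)\<^sup>2) - (expectation (\<lambda>\<omega>. \<bar>X \<omega>\<bar>))\<^sup>2"
    using int assms(2) by (subst variance_eq) auto
  finally have "(expectation (\<lambda>\<omega>. \<bar>X \<omega>\<bar>))\<^sup>2 \<le> c" using assms(3) by simp
  then show ?thesis by (rule real_le_rsqrt)
qed

lemma chebyshev_second_moment:
  fixes X :: "'a \<Rightarrow> real"
  assumes [measurable]: "X \<in> borel_measurable M" and "integrable M (\<lambda>\<omega>. (X \<omega>)\<^sup>2)"
    and "expectation (\<lambda>\<omega>. (X \<omega>)\<^sup>2) \<le> c" and "0 < a"
  shows "prob {\<omega>\<in>space M. a < \<bar>X \<omega>\<bar>} \<le> c / a\<^sup>2"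
proof -
  have "prob {\<omega>\<in>space M. a < \<bar>X \<omega>\<bar>} \<le> prob {\<omega>\<in>space M. a\<^sup>2 \<le> (X \<omega>)\<^sup>2}"
    using assms(4) by (intro finite_measure_mono) (auto intro: power_mono simp: abs_le_square_iff[symmetric])
  also have "\<dots> \<le> expectation (\<lambda>\<omega>. (X \<omega>)\<^sup>2) / a\<^sup>2"
    using assms(2,4) by (intro integral_Markov_inequality_measure[where A="{}"]) auto
  also have "\<dots> \<le> c / a\<^sup>2" using assms(3) by (simp add: divide_right_mono)
  finally show ?thesis .
qed

end

section \<open>The six-vertex dynamics on the quadrant\<close>

text \<open>A vertex receives a path from below if \<open>a\<close> and one from the left if \<open>b\<close>. A single incoming path goes
  straight iff \<open>c\<close> (vertical) respectively \<open>d\<close> (horizontal) holds, and turns otherwise. \<open>Vx t x\<close> and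
  \<open>Hx t x\<close> tell whether a path enters the vertex in row \<open>t\<close> and column \<open>x\<close> from below and from the left.\<close>

definition vtop :: "bool \<Rightarrow> bool \<Rightarrow> bool \<Rightarrow> bool \<Rightarrow> bool" where
  "vtop c d a b = (if a = b then a else if a then c else \<not> d)"

definition vright :: "bool \<Rightarrow> bool \<Rightarrow> bool \<Rightarrow> bool \<Rightarrow> bool" where
  "vright c d a b = (if a = b then a else if a then \<not> c else d)"

function (sequential) Vx :: "(nat \<Rightarrow> nat \<Rightarrow> bool) \<Rightarrow> (nat \<Rightarrow> nat \<Rightarrow> bool) \<Rightarrow> (nat \<Rightarrow> bool) \<Rightarrow> (nat \<Rightarrow> bool) \<Rightarrow> nat \<Rightarrow> nat \<Rightarrow> bool"
  and Hx :: "(nat \<Rightarrow> nat \<Rightarrow> bool) \<Rightarrow> (nat \<Rightarrow> nat \<Rightarrow> bool) \<Rightarrow> (nat \<Rightarrow> bool) \<Rightarrow> (nat \<Rightarrow> bool) \<Rightarrow> nat \<Rightarrow> nat \<Rightarrow> bool" where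
  "Vx c d v h 0 x = v x"
| "Vx c d v h (Suc t) x = vtop (c t x) (d t x) (Vx c d v h t x) (Hx c d v h t x)"
| "Hx c d v h t 0 = h t"
| "Hx c d v h t (Suc x) = vright (c t x) (d t x) (Vx c d v h t x) (Hx c d v h t x)"
  by pat_completeness auto
termination
  by (relation "Wellfounded.measure (case_sum (\<lambda>(c, d, v, h, t, x). t + x) (\<lambda>(c, d, v, h, t, x). t + x))") auto

lemma VH_induct [case_names VH]:
  assumes "\<And>t x. (\<And>s y. s + y < t + x \<Longrightarrow> P s y) \<Longrightarrow> P t x"
  shows "P (t::nat) (x::nat)"
proof (induction "t + x" arbitrary: t x rule: less_induct)
  case less
  show ?case by (rule assms) (rule less)
qed

text \<open>Adding an incoming path at a vertex never removes an outgoing one: if both edges enter,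
  both leave, and if none enters, none leaves.\<close>

lemma VH_mono:
  assumes "\<And>x. v x \<Longrightarrow> v' x" "\<And>t. h t \<Longrightarrow> h' t"
  shows "(Vx c d v h t x \<longrightarrow> Vx c d v' h' t x) \<and> (Hx c d v h t x \<longrightarrow> Hx c d v' h' t x)"
proof (induction t x rule: VH_induct)
  case (VH t x)
  have "Vx c d v h t x \<longrightarrow> Vx c d v' h' t x"
  proof (cases t)
    case (Suc s)
    then show ?thesis using VH[of s x] by (auto simp: vtop_def)
  qed (auto intro: assms)
  moreover have "Hx c d v h t x \<longrightarrow> Hx c d v' h' t x"
  proof (cases x)
    case (Suc y)
    then show ?thesis using VH[of t y] by (auto simp: vright_def)
  qed (auto intro: assms)
  ultimately show ?case ..
qed

text \<open>Light cone of an edge. A vertical edge enters row \<open>t\<close> from below and so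
  reads only rows before \<open>t\<close>, but its own column; a horizontal edge enters column
  \<open>x\<close> from the left and reads only columns before \<open>x\<close>, but its own
  row.\<close>

lemma VH_cong:
  "((\<forall>s<t. \<forall>y\<le>x. c s y = c' s y \<and> d s y = d' s y) \<and> (\<forall>y\<le>x. v y = v' y) \<and> (\<forall>s<t. h s = h' s)
      \<longrightarrow> Vx c d v h t x = Vx c' d' v' h' t x) \<and>
   ((\<forall>s\<le>t. \<forall>y<x. c s y = c' s y \<and> d s y = d' s y) \<and> (\<forall>y<x. v y = v' y) \<and> (\<forall>s\<le>t. h s = h' s)
      \<longrightarrow> Hx c d v h t x = Hx c' d' v' h' t x)"
proof (induction t x rule: VH_induct)
  case (VH t x)
  show ?case
  proof (intro conjI impI, goal_cases)
    case 1
    show ?case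
    proof (cases t)
      case 0
      then show ?thesis using 1 by simp
    next
      case (Suc s)
      have "Vx c d v h s x = Vx c' d' v' h' s x" "Hx c d v h s x = Hx c' d' v' h' s x"
        using VH[of s x] 1 Suc by auto
      then show ?thesis using 1 Suc by simp
    qed
  next
    case 2
    show ?case
    proof (cases x)
      case 0
      then show ?thesis using 2 by simp
    next
      case (Suc y)
      have "Vx c d v h t y = Vx c' d' v' h' t y" "Hx c d v h t y = Hx c' d' v' h' t y"
        using VH[of t y] 2 Suc by auto
      then show ?thesis using 2 Suc by simp
    qed
  qed
qed

lemma vertex_conservation:
  "of_bool (vtop c d a b) + of_bool (vright c d a b) = (of_bool a + of_bool b :: real)"
  by (auto simp: vtop_def vright_def)

text \<open>Conservation of paths in the rectangle with rows below \<open>t\<close> and columns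
  \<open>m\<close> to \<open>m + x - 1\<close>: the height difference of opposite corners is the
  same along both boundary routes.\<close>

lemma height_change:
  fixes c d v h
  defines "V \<equiv> Vx c d v h" and "H \<equiv> Hx c d v h"
  shows "(\<Sum>s<t. of_bool (H s m)) - (\<Sum>z<x. of_bool (V t (m + z))) =
    (\<Sum>s<t. of_bool (H s (m + x))) - (\<Sum>z<x. of_bool (V 0 (m + z)) :: real)"
proof (induction x)
  case (Suc x)
  have "(\<Sum>s<t. of_bool (H s (Suc y))) - (\<Sum>s<t. of_bool (H s y)) = (of_bool (V 0 y) - of_bool (V t y) :: real)" for y
  proof (induction t)
    case (Suc t)
    have "of_bool (V (Suc t) y) + of_bool (H t (Suc y)) = (of_bool (V t y) + of_bool (H t y) :: real)"
      unfolding V_def H_def Vx.simps Hx.simps by (rule vertex_conservation)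
    then show ?case using Suc by (simp del: sum_of_bool_eq)
  qed (simp del: sum_of_bool_eq)
  from this[of "m + x"] show ?case using Suc by (simp del: sum_of_bool_eq)
qed (simp del: sum_of_bool_eq)

text \<open>With \<open>c\<close> and \<open>d\<close> both true a vertex is transparent: vertical
  and horizontal edges cross without influencing each other.\<close>

lemma straight_column:
  "(\<And>s. t \<le> s \<Longrightarrow> s < t + i \<Longrightarrow> c s y \<and> d s y) \<Longrightarrow> Vx c d v h (t + i) y = Vx c d v h t y"
  by (induction i) (auto simp: vtop_def)

lemma straight_row:
  "(\<And>y. x \<le> y \<Longrightarrow> y < x + j \<Longrightarrow> c t y \<and> d t y) \<Longrightarrow> Hx c d v h t (x + j) = Hx c d v h t x"
  by (induction j) (auto simp: vright_def)

text \<open>One field of uniform variables drives the systems of all boundary densities at once: the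
  boundary edge \<open>Vn x\<close> or \<open>Hn t\<close> is occupied iff its variable is below the density.\<close>

datatype src = Cn nat nat | Dn nat nat | Vn nat | Hn nat

definition unif :: "real measure" where "unif = uniform_measure lborel {0..1}"

lemma prob_space_unif: "prob_space unif"
  unfolding unif_def by (rule prob_space_uniform_measure) auto

lemma space_unif [simp]: "space unif = UNIV" and sets_unif [measurable_cong, simp]: "sets unif = sets borel"
  by (simp_all add: unif_def)

lemma measure_unif: "0 \<le> p \<Longrightarrow> p \<le> 1 \<Longrightarrow> measure unif {x. x \<le> p} = p"
proof -
  assume "0 \<le> p" "p \<le> 1"
  then have "{0..1} \<inter> {x. x \<le> p} = {0..p}" by auto
  then show ?thesis using \<open>0 \<le> p\<close> unfolding unif_def
    by (subst measure_uniform_measure) auto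
qed

section \<open>All vertex systems on one probability space\<close>

locale six_vertex =
  fixes b1 b2 :: real
  assumes b1: "0 < b1" "b1 < 1" and b2: "0 < b2" "b2 < 1"
begin

sublocale coordinate_space "\<lambda>_::src. unif"
  by (rule coordinate_space.intro) (simp_all add: prob_space_unif)

definition VS where
  "VS v h \<omega> = Vx (\<lambda>t x. \<omega> (Cn t x) \<le> b1) (\<lambda>t x. \<omega> (Dn t x) \<le> b2) (v \<omega>) (h \<omega>)"

definition HS where
  "HS v h \<omega> = Hx (\<lambda>t x. \<omega> (Cn t x) \<le> b1) (\<lambda>t x. \<omega> (Dn t x) \<le> b2) (v \<omega>) (h \<omega>)"

definition thrV :: "(nat \<Rightarrow> real) \<Rightarrow> (src \<Rightarrow> real) \<Rightarrow> nat \<Rightarrow> bool" where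
  "thrV p \<omega> x \<longleftrightarrow> \<omega> (Vn x) \<le> p x"

definition thrH :: "real \<Rightarrow> (src \<Rightarrow> real) \<Rightarrow> nat \<Rightarrow> bool" where
  "thrH q \<omega> t \<longleftrightarrow> \<omega> (Hn t) \<le> q"

abbreviation "VT p q \<equiv> VS (thrV p) (thrH q)"
abbreviation "HT p q \<equiv> HS (thrV p) (thrH q)"

lemma VS_0: "VS v h \<omega> 0 x = v \<omega> x"
  and VS_Suc: "VS v h \<omega> (Suc t) x = vtop (\<omega> (Cn t x) \<le> b1) (\<omega> (Dn t x) \<le> b2) (VS v h \<omega> t x) (HS v h \<omega> t x)"
  and HS_0: "HS v h \<omega> t 0 = h \<omega> t"
  and HS_Suc: "HS v h \<omega> t (Suc x) = vright (\<omega> (Cn t x) \<le> b1) (\<omega> (Dn t x) \<le> b2) (VS v h \<omega> t x) (HS v h \<omega> t x)"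
  by (simp_all add: VS_def HS_def)

lemma measurable_coord [measurable]: "(\<lambda>\<omega>. \<omega> i) \<in> borel_measurable PM"
proof -
  have "measurable PM unif = borel_measurable PM" by (rule measurable_cong_sets) simp_all
  then show ?thesis using measurable_component_singleton[of i UNIV "\<lambda>_. unif"] by simp
qed

lemma measurable_thrV [measurable]: "Measurable.pred PM (\<lambda>\<omega>. thrV p \<omega> x)"
  unfolding thrV_def by measurable

lemma measurable_thrH [measurable]: "Measurable.pred PM (\<lambda>\<omega>. thrH p \<omega> x)"
  unfolding thrH_def by measurable

lemma measurable_VHS:
  assumes [measurable]: "\<And>x. Measurable.pred PM (\<lambda>\<omega>. v \<omega> x)" "\<And>x. Measurable.pred PM (\<lambda>\<omega>. h \<omega> x)"
  shows "Measurable.pred PM (\<lambda>\<omega>. VS v h \<omega> t x) \<and> Measurable.pred PM (\<lambda>\<omega>. HS v h \<omega> t x)"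
proof (induction t x rule: VH_induct)
  case (VH t x)
  have "Measurable.pred PM (\<lambda>\<omega>. VS v h \<omega> t x)"
  proof (cases t)
    case (Suc s)
    have [measurable]: "Measurable.pred PM (\<lambda>\<omega>. VS v h \<omega> s x)" "Measurable.pred PM (\<lambda>\<omega>. HS v h \<omega> s x)"
      using VH[of s x] Suc by auto
    show ?thesis unfolding Suc VS_Suc vtop_def by measurable
  qed (simp add: VS_0)
  moreover have "Measurable.pred PM (\<lambda>\<omega>. HS v h \<omega> t x)"
  proof (cases x)
    case (Suc y)
    have [measurable]: "Measurable.pred PM (\<lambda>\<omega>. VS v h \<omega> t y)" "Measurable.pred PM (\<lambda>\<omega>. HS v h \<omega> t y)"
      using VH[of t y] Suc by auto
    show ?thesis unfolding Suc HS_Suc vright_def by measurable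
  qed (simp add: HS_0)
  ultimately show ?case ..
qed

lemma measurable_VT [measurable]: "Measurable.pred PM (\<lambda>\<omega>. VT p q \<omega> t x)"
  and measurable_HT [measurable]: "Measurable.pred PM (\<lambda>\<omega>. HT p q \<omega> t x)"
  using measurable_VHS[of "thrV p" "thrH q"] by auto

definition depV :: "nat \<Rightarrow> nat \<Rightarrow> src set" where
  "depV t x = {i. case i of Cn s y \<Rightarrow> s < t \<and> y \<le> x | Dn s y \<Rightarrow> s < t \<and> y \<le> x | Vn y \<Rightarrow> y \<le> x | Hn s \<Rightarrow> s < t}"

definition depH :: "nat \<Rightarrow> nat \<Rightarrow> src set" where
  "depH t x = {i. case i of Cn s y \<Rightarrow> s \<le> t \<and> y < x | Dn s y \<Rightarrow> s \<le> t \<and> y < x | Vn y \<Rightarrow> y < x | Hn s \<Rightarrow> s \<le> t}"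

lemma dep_VS:
  assumes "\<And>x. dep_on {Vn x} (\<lambda>\<omega>. v \<omega> x)" "\<And>t. dep_on {Hn t} (\<lambda>\<omega>. h \<omega> t)"
  shows "dep_on (depV t x) (\<lambda>\<omega>. VS v h \<omega> t x)"
proof (rule dep_onI)
  fix \<omega> \<omega>' :: "src \<Rightarrow> real"
  assume *: "\<And>i. i \<in> depV t x \<Longrightarrow> \<omega> i = \<omega>' i"
  have "v \<omega> y = v \<omega>' y" if "y \<le> x" for y
    using that by (intro dep_onD[OF assms(1)] *) (auto simp: depV_def)
  moreover have "h \<omega> y = h \<omega>' y" if "y < t" for y
    using that by (intro dep_onD[OF assms(2)] *) (auto simp: depV_def)
  ultimately show "VS v h \<omega> t x = VS v h \<omega>' t x"
    unfolding VS_def using * by (intro VH_cong[THEN conjunct1, THEN mp]) (auto simp: depV_def)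
qed

lemma dep_HS:
  assumes "\<And>x. dep_on {Vn x} (\<lambda>\<omega>. v \<omega> x)" "\<And>t. dep_on {Hn t} (\<lambda>\<omega>. h \<omega> t)"
  shows "dep_on (depH t x) (\<lambda>\<omega>. HS v h \<omega> t x)"
proof (rule dep_onI)
  fix \<omega> \<omega>' :: "src \<Rightarrow> real"
  assume *: "\<And>i. i \<in> depH t x \<Longrightarrow> \<omega> i = \<omega>' i"
  have "v \<omega> y = v \<omega>' y" if "y < x" for y
    using that by (intro dep_onD[OF assms(1)] *) (auto simp: depH_def)
  moreover have "h \<omega> y = h \<omega>' y" if "y \<le> t" for y
    using that by (intro dep_onD[OF assms(2)] *) (auto simp: depH_def)
  ultimately show "HS v h \<omega> t x = HS v h \<omega>' t x"
    unfolding HS_def using * by (intro VH_cong[THEN conjunct2, THEN mp]) (auto simp: depH_def)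
qed

lemma dep_thrV: "dep_on {Vn x} (\<lambda>\<omega>. thrV p \<omega> x)" and dep_thrH: "dep_on {Hn t} (\<lambda>\<omega>. thrH q \<omega> t)"
  by (auto simp: thrV_def thrH_def dep_on_def)

lemma dep_VT: "depV t x \<subseteq> I \<Longrightarrow> dep_on I (\<lambda>\<omega>. VT p q \<omega> t x)"
  by (rule dep_on_mono[OF dep_VS[OF dep_thrV dep_thrH]])

lemma dep_HT: "depH t x \<subseteq> I \<Longrightarrow> dep_on I (\<lambda>\<omega>. HT p q \<omega> t x)"
  by (rule dep_on_mono[OF dep_HS[OF dep_thrV dep_thrH]])

lemma pr_le: "0 \<le> p \<Longrightarrow> p \<le> 1 \<Longrightarrow> pr (\<lambda>\<omega>. \<omega> i \<le> p) = p"
  by (subst pr_coord) (auto simp: measure_unif)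

text \<open>\<open>R\<close> is any event that does not look at this vertex, so the identity can be
  used under a running conjunction. The three terms are the disjoint cases of both edges entering,
  only \<open>a\<close>, and only \<open>b\<close>; in the last two the outcome is decided by an
  independent coin.\<close>

lemma pr_vertex:
  fixes t m
  defines "c \<equiv> \<lambda>\<omega>. \<omega> (Cn t m) \<le> b1" and "d \<equiv> \<lambda>\<omega>. \<omega> (Dn t m) \<le> b2" and "I \<equiv> - {Cn t m, Dn t m}"
  assumes ev: "ev a" "ev b" "ev R" and dep: "dep_on I a" "dep_on I b" "dep_on I R"
  shows "pr (\<lambda>\<omega>. vtop (c \<omega>) (d \<omega>) (a \<omega>) (b \<omega>) \<and> R \<omega>) =
      pr (\<lambda>\<omega>. a \<omega> \<and> b \<omega> \<and> R \<omega>) + b1 * (pr (\<lambda>\<omega>. a \<omega> \<and> R \<omega>) - pr (\<lambda>\<omega>. a \<omega> \<and> b \<omega> \<and> R \<omega>))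
      + (1 - b2) * (pr (\<lambda>\<omega>. b \<omega> \<and> R \<omega>) - pr (\<lambda>\<omega>. a \<omega> \<and> b \<omega> \<and> R \<omega>))" (is ?top)
    and "pr (\<lambda>\<omega>. vright (c \<omega>) (d \<omega>) (a \<omega>) (b \<omega>) \<and> R \<omega>) =
      pr (\<lambda>\<omega>. a \<omega> \<and> b \<omega> \<and> R \<omega>) + (1 - b1) * (pr (\<lambda>\<omega>. a \<omega> \<and> R \<omega>) - pr (\<lambda>\<omega>. a \<omega> \<and> b \<omega> \<and> R \<omega>))
      + b2 * (pr (\<lambda>\<omega>. b \<omega> \<and> R \<omega>) - pr (\<lambda>\<omega>. a \<omega> \<and> b \<omega> \<and> R \<omega>))" (is ?right)
proof -
  have [measurable]: "Measurable.pred PM a" "Measurable.pred PM b" "Measurable.pred PM R"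
    using ev by (simp_all only: ev_iff_pred)
  have [measurable]: "Measurable.pred PM c" "Measurable.pred PM d"
    unfolding c_def d_def by measurable
  have evs: "ev c" "ev d" "ev (\<lambda>\<omega>. \<not> c \<omega>)" "ev (\<lambda>\<omega>. \<not> d \<omega>)"
    unfolding ev_iff_pred by measurable
  have dc: "dep_on {Cn t m} c" "dep_on {Dn t m} d" "dep_on {Cn t m} (\<lambda>\<omega>. \<not> c \<omega>)" "dep_on {Dn t m} (\<lambda>\<omega>. \<not> d \<omega>)"
    by (auto simp: c_def d_def dep_on_def)
  have pc: "pr c = b1" "pr d = b2" "pr (\<lambda>\<omega>. \<not> c \<omega>) = 1 - b1" "pr (\<lambda>\<omega>. \<not> d \<omega>) = 1 - b2"
    using pr_not[OF evs(1)] pr_not[OF evs(2)] b1 b2 by (auto simp: c_def d_def pr_le)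
  have da: "dep_on I (\<lambda>\<omega>. a \<omega> \<and> \<not> b \<omega> \<and> R \<omega>)" "dep_on I (\<lambda>\<omega>. b \<omega> \<and> \<not> a \<omega> \<and> R \<omega>)"
    using dep unfolding dep_on_def by metis+
  have ea: "ev (\<lambda>\<omega>. a \<omega> \<and> \<not> b \<omega> \<and> R \<omega>)" "ev (\<lambda>\<omega>. b \<omega> \<and> \<not> a \<omega> \<and> R \<omega>)"
    "ev (\<lambda>\<omega>. a \<omega> \<and> R \<omega>)" "ev (\<lambda>\<omega>. b \<omega> \<and> R \<omega>)" "ev (\<lambda>\<omega>. a \<omega> \<and> b \<omega> \<and> R \<omega>)"
    unfolding ev_iff_pred by measurable
  have sa: "pr (\<lambda>\<omega>. a \<omega> \<and> \<not> b \<omega> \<and> R \<omega>) = pr (\<lambda>\<omega>. a \<omega> \<and> R \<omega>) - pr (\<lambda>\<omega>. a \<omega> \<and> b \<omega> \<and> R \<omega>)"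
    using pr_split[OF ea(3) ev(2)] by (simp add: conj_ac)
  have sb: "pr (\<lambda>\<omega>. b \<omega> \<and> \<not> a \<omega> \<and> R \<omega>) = pr (\<lambda>\<omega>. b \<omega> \<and> R \<omega>) - pr (\<lambda>\<omega>. a \<omega> \<and> b \<omega> \<and> R \<omega>)"
    using pr_split[OF ea(4) ev(1)] by (simp add: conj_ac)
  have dec: "pr (\<lambda>\<omega>. (a \<omega> \<and> b \<omega> \<and> R \<omega>) \<or> ((a \<omega> \<and> \<not> b \<omega> \<and> R \<omega>) \<and> X \<omega>) \<or> ((b \<omega> \<and> \<not> a \<omega> \<and> R \<omega>) \<and> Y \<omega>)) =
     pr (\<lambda>\<omega>. a \<omega> \<and> b \<omega> \<and> R \<omega>) + pr X * (pr (\<lambda>\<omega>. a \<omega> \<and> R \<omega>) - pr (\<lambda>\<omega>. a \<omega> \<and> b \<omega> \<and> R \<omega>))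
      + pr Y * (pr (\<lambda>\<omega>. b \<omega> \<and> R \<omega>) - pr (\<lambda>\<omega>. a \<omega> \<and> b \<omega> \<and> R \<omega>))"
    if X: "ev X" "dep_on {Cn t m} X" and Y: "ev Y" "dep_on {Dn t m} Y" for X Y
  proof -
    have [measurable]: "Measurable.pred PM X" "Measurable.pred PM Y"
      using X(1) Y(1) by (simp_all only: ev_iff_pred)
    have e: "ev (\<lambda>\<omega>. (a \<omega> \<and> \<not> b \<omega> \<and> R \<omega>) \<and> X \<omega>)" "ev (\<lambda>\<omega>. (b \<omega> \<and> \<not> a \<omega> \<and> R \<omega>) \<and> Y \<omega>)"
       "ev (\<lambda>\<omega>. ((a \<omega> \<and> \<not> b \<omega> \<and> R \<omega>) \<and> X \<omega>) \<or> ((b \<omega> \<and> \<not> a \<omega> \<and> R \<omega>) \<and> Y \<omega>))"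
      unfolding ev_iff_pred by measurable
    have "pr (\<lambda>\<omega>. (a \<omega> \<and> b \<omega> \<and> R \<omega>) \<or> ((a \<omega> \<and> \<not> b \<omega> \<and> R \<omega>) \<and> X \<omega>) \<or> ((b \<omega> \<and> \<not> a \<omega> \<and> R \<omega>) \<and> Y \<omega>)) =
      pr (\<lambda>\<omega>. a \<omega> \<and> b \<omega> \<and> R \<omega>) + (pr (\<lambda>\<omega>. (a \<omega> \<and> \<not> b \<omega> \<and> R \<omega>) \<and> X \<omega>) + pr (\<lambda>\<omega>. (b \<omega> \<and> \<not> a \<omega> \<and> R \<omega>) \<and> Y \<omega>))"
      by (subst pr_disj_eq[OF ea(5) e(3)], blast, subst pr_disj_eq[OF e(1,2)], blast, rule refl)
    moreover have "pr (\<lambda>\<omega>. (a \<omega> \<and> \<not> b \<omega> \<and> R \<omega>) \<and> X \<omega>) = pr (\<lambda>\<omega>. a \<omega> \<and> \<not> b \<omega> \<and> R \<omega>) * pr X"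
      by (rule pr_indep[OF ea(1) X(1) da(1) X(2)]) (auto simp: I_def)
    moreover have "pr (\<lambda>\<omega>. (b \<omega> \<and> \<not> a \<omega> \<and> R \<omega>) \<and> Y \<omega>) = pr (\<lambda>\<omega>. b \<omega> \<and> \<not> a \<omega> \<and> R \<omega>) * pr Y"
      by (rule pr_indep[OF ea(2) Y(1) da(2) Y(2)]) (auto simp: I_def)
    ultimately show ?thesis unfolding sa sb by (simp add: mult.commute)
  qed
  have "(\<lambda>\<omega>. vtop (c \<omega>) (d \<omega>) (a \<omega>) (b \<omega>) \<and> R \<omega>) =
    (\<lambda>\<omega>. (a \<omega> \<and> b \<omega> \<and> R \<omega>) \<or> ((a \<omega> \<and> \<not> b \<omega> \<and> R \<omega>) \<and> c \<omega>) \<or> ((b \<omega> \<and> \<not> a \<omega> \<and> R \<omega>) \<and> \<not> d \<omega>))"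
    by (auto simp: vtop_def fun_eq_iff)
  then show ?top using dec[OF evs(1) dc(1) evs(4) dc(4)] by (simp only: pc)
  have "(\<lambda>\<omega>. vright (c \<omega>) (d \<omega>) (a \<omega>) (b \<omega>) \<and> R \<omega>) =
    (\<lambda>\<omega>. (a \<omega> \<and> b \<omega> \<and> R \<omega>) \<or> ((a \<omega> \<and> \<not> b \<omega> \<and> R \<omega>) \<and> \<not> c \<omega>) \<or> ((b \<omega> \<and> \<not> a \<omega> \<and> R \<omega>) \<and> d \<omega>))"
    by (auto simp: vright_def fun_eq_iff)
  then show ?right using dec[OF evs(3) dc(3) evs(2) dc(2)] by (simp only: pc)
qed

end

section \<open>Stationary systems and discrepancies\<close>

declare sum_of_bool_eq [simp del] sum_mult_of_bool_eq [simp del] sum_of_bool_mult_eq [simp del]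

lemma dep_on_conj: "dep_on I F \<Longrightarrow> dep_on I G \<Longrightarrow> dep_on I (\<lambda>\<omega>. F \<omega> \<and> G \<omega>)"
  and dep_on_disj: "dep_on I F \<Longrightarrow> dep_on I G \<Longrightarrow> dep_on I (\<lambda>\<omega>. F \<omega> \<or> G \<omega>)"
  and dep_on_not: "dep_on I F \<Longrightarrow> dep_on I (\<lambda>\<omega>. \<not> F \<omega>)"
  unfolding dep_on_def by metis+

context six_vertex
begin

lemma expectation_of_bool: "ev P \<Longrightarrow> expectation (\<lambda>\<omega>. of_bool (P \<omega>)) = pr P"
proof -
  assume P: "ev P"
  have "(\<lambda>\<omega>. of_bool (P \<omega>) :: real) = indicator {\<omega>. P \<omega>}" by (auto simp: indicator_def)
  then show ?thesis using P by simp
qed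

lemma integrable_of_bool: "ev P \<Longrightarrow> integrable PM (\<lambda>\<omega>. of_bool (P \<omega>) :: real)"
proof -
  assume P: "ev P"
  have "(\<lambda>\<omega>. of_bool (P \<omega>) :: real) = indicator {\<omega>. P \<omega>}" by (auto simp: indicator_def)
  then show ?thesis using P by (simp add: emeasure_eq_measure)
qed

section \<open>Stationarity of the Bernoulli product law\<close>

context
  fixes k f :: real
  assumes k: "0 \<le> k" "k \<le> 1" and f: "0 \<le> f" "f \<le> 1"
    and balance: "k * (1 - f) * (1 - b1) = (1 - k) * f * (1 - b2)"
begin

text \<open>The row is updated from left to right. After \<open>m\<close> vertices the staircase
  consisting of the tops of the columns before \<open>m\<close>, the horizontal edge entering column
  \<open>m\<close>, and the bottoms of the other columns is still product Bernoulli.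
  \<open>Q\<close> carries along an event of earlier rows.\<close>

lemma stationary_scan:
  fixes t n :: nat and Q :: "(src \<Rightarrow> real) \<Rightarrow> bool" and q :: real
  defines "W \<equiv> \<lambda>m x \<omega>. if x < m then VT (\<lambda>_. k) f \<omega> (Suc t) x else VT (\<lambda>_. k) f \<omega> t x"
  assumes evQ: "ev Q"
    and depQ: "dep_on {i. case i of Cn s y \<Rightarrow> s < t | Dn s y \<Rightarrow> s < t | Vn y \<Rightarrow> True | Hn s \<Rightarrow> s < t} Q"
    and base: "\<And>S. S \<subseteq> {..<n} \<Longrightarrow> pr (\<lambda>\<omega>. Q \<omega> \<and> (\<forall>x\<in>S. VT (\<lambda>_. k) f \<omega> t x)) = q * k ^ card S"
    and "m \<le> n" "S \<subseteq> {..<n}"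
  shows "pr (\<lambda>\<omega>. Q \<omega> \<and> (\<forall>x\<in>S. W m x \<omega>)) = q * k ^ card S \<and>
    pr (\<lambda>\<omega>. HT (\<lambda>_. k) f \<omega> t m \<and> Q \<omega> \<and> (\<forall>x\<in>S. W m x \<omega>)) = q * f * k ^ card S"
  using \<open>m \<le> n\<close> \<open>S \<subseteq> {..<n}\<close>
proof (induction m arbitrary: S)
  have [measurable]: "Measurable.pred PM Q" using evQ by (simp only: ev_iff_pred)
  have [measurable]: "Measurable.pred PM (\<lambda>\<omega>. W m x \<omega>)" for m x
    unfolding W_def by measurable
  {
    case 0
    have fin: "finite S" using 0 by (auto intro: finite_subset)
    then have evR: "ev (\<lambda>\<omega>. Q \<omega> \<and> (\<forall>x\<in>S. VT (\<lambda>_. k) f \<omega> t x))" "ev (\<lambda>\<omega>. \<omega> (Hn t) \<le> f)"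
      unfolding ev_iff_pred by measurable
    have "dep_on (- {Hn t}) (\<lambda>\<omega>. Q \<omega> \<and> (\<forall>x\<in>S. VT (\<lambda>_. k) f \<omega> t x))"
      by (intro dep_on_conj dep_on_all dep_VT dep_on_mono[OF depQ]) (auto simp: depV_def)
    moreover have "dep_on {Hn t} (\<lambda>\<omega>. \<omega> (Hn t) \<le> f)" by (auto simp: dep_on_def)
    ultimately have "pr (\<lambda>\<omega>. \<omega> (Hn t) \<le> f \<and> Q \<omega> \<and> (\<forall>x\<in>S. VT (\<lambda>_. k) f \<omega> t x)) =
       pr (\<lambda>\<omega>. \<omega> (Hn t) \<le> f) * pr (\<lambda>\<omega>. Q \<omega> \<and> (\<forall>x\<in>S. VT (\<lambda>_. k) f \<omega> t x))"
      using evR by (intro pr_indep) auto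
    also have "\<dots> = f * (q * k ^ card S)" using base 0 f by (simp add: pr_le)
    finally show ?case using base 0 by (simp add: W_def HS_0 thrH_def)
  next
    case (Suc m)
    let ?a = "\<lambda>\<omega>. VT (\<lambda>_. k) f \<omega> t m" and ?b = "\<lambda>\<omega>. HT (\<lambda>_. k) f \<omega> t m"
    define T where "T = S - {m}"
    let ?R = "\<lambda>\<omega>. Q \<omega> \<and> (\<forall>x\<in>T. W m x \<omega>)"
    define r where "r = q * k ^ card (T)"
    have fin: "finite T" unfolding T_def using Suc.prems by (auto intro: finite_subset)
    have mT: "m \<notin> T" by (simp add: T_def)
    have mn: "m < n" using Suc.prems by simp
    have sub: "T \<subseteq> {..<n}" "insert m (T) \<subseteq> {..<n}" using Suc.prems by (auto simp: T_def)
    have card: "card (insert m (T)) = Suc (card (T))" using fin mT by simp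
    note IH = Suc.IH[OF less_imp_le[OF mn] sub(1)] Suc.IH[OF less_imp_le[OF mn] sub(2), unfolded card]
    have Wm: "W m m = (\<lambda>\<omega>. ?a \<omega>)" by (simp add: W_def fun_eq_iff)
    have R: "pr ?R = r" "pr (\<lambda>\<omega>. ?b \<omega> \<and> ?R \<omega>) = f * r" "pr (\<lambda>\<omega>. ?a \<omega> \<and> ?R \<omega>) = k * r"
      "pr (\<lambda>\<omega>. ?a \<omega> \<and> ?b \<omega> \<and> ?R \<omega>) = k * f * r"
    proof -
      have ins: "(\<forall>x\<in>insert m (T). W m x \<omega>) = (?a \<omega> \<and> (\<forall>x\<in>T. W m x \<omega>))" for \<omega>
        using fun_cong[OF Wm, of \<omega>] by auto
      have c1: "(\<lambda>\<omega>. Q \<omega> \<and> ?a \<omega> \<and> (\<forall>x\<in>T. W m x \<omega>)) = (\<lambda>\<omega>. ?a \<omega> \<and> ?R \<omega>)" by (intro ext) blast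
      have c2: "(\<lambda>\<omega>. ?b \<omega> \<and> Q \<omega> \<and> ?a \<omega> \<and> (\<forall>x\<in>T. W m x \<omega>)) = (\<lambda>\<omega>. ?a \<omega> \<and> ?b \<omega> \<and> ?R \<omega>)" by (intro ext) blast
      show "pr ?R = r" "pr (\<lambda>\<omega>. ?b \<omega> \<and> ?R \<omega>) = f * r"
        using IH(1) by (simp_all add: r_def)
      show "pr (\<lambda>\<omega>. ?a \<omega> \<and> ?R \<omega>) = k * r" "pr (\<lambda>\<omega>. ?a \<omega> \<and> ?b \<omega> \<and> ?R \<omega>) = k * f * r"
        using IH(2) unfolding ins c1 c2 by (simp_all add: r_def)
    qed
    have ev: "ev ?a" "ev ?b" "ev ?R" unfolding ev_iff_pred using fin by measurable
    have depW: "dep_on (- {Cn t m, Dn t m}) (\<lambda>\<omega>. W m x \<omega>)" if "x \<noteq> m" for x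
      unfolding W_def using that by (cases "x < m") (auto intro!: dep_VT simp: depV_def)
    have dep: "dep_on (- {Cn t m, Dn t m}) ?a" "dep_on (- {Cn t m, Dn t m}) ?b" "dep_on (- {Cn t m, Dn t m}) ?R"
      subgoal by (rule dep_VT) (auto simp: depV_def)
      subgoal by (rule dep_HT) (auto simp: depH_def)
      subgoal using mT by (intro dep_on_conj dep_on_all depW dep_on_mono[OF depQ]) auto
      done
    \<comment> \<open>The marginals of the two outgoing edges; the \<open>balance\<close> equation
      says precisely that they equal those of the incoming ones.\<close>
    have bal: "k * f + b1 * (k - k * f) + (1 - b2) * (f - k * f) = k"
      "k * f + (1 - b1) * (k - k * f) + b2 * (f - k * f) = f"
      using balance by (simp_all add: algebra_simps)
    have top: "pr (\<lambda>\<omega>. VT (\<lambda>_. k) f \<omega> (Suc t) m \<and> ?R \<omega>) = k * r"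
    proof -
      have "pr (\<lambda>\<omega>. VT (\<lambda>_. k) f \<omega> (Suc t) m \<and> ?R \<omega>) = k * f * r + b1 * (k * r - k * f * r) + (1 - b2) * (f * r - k * f * r)"
        unfolding VS_Suc by (subst pr_vertex(1)[OF ev dep]) (simp only: R)
      also have "\<dots> = (k * f + b1 * (k - k * f) + (1 - b2) * (f - k * f)) * r" by (simp add: algebra_simps)
      finally show ?thesis by (simp only: bal)
    qed
    have right: "pr (\<lambda>\<omega>. HT (\<lambda>_. k) f \<omega> t (Suc m) \<and> ?R \<omega>) = f * r"
    proof -
      have "pr (\<lambda>\<omega>. HT (\<lambda>_. k) f \<omega> t (Suc m) \<and> ?R \<omega>) = k * f * r + (1 - b1) * (k * r - k * f * r) + b2 * (f * r - k * f * r)"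
        unfolding HS_Suc by (subst pr_vertex(2)[OF ev dep]) (simp only: R)
      also have "\<dots> = (k * f + (1 - b1) * (k - k * f) + b2 * (f - k * f)) * r" by (simp add: algebra_simps)
      finally show ?thesis by (simp only: bal)
    qed
    \<comment> \<open>Both outgoing edges are used iff both incoming ones are. Together with the two
      marginals this determines the joint law of the outgoing pair and yields its
      independence.\<close>
    have both: "pr (\<lambda>\<omega>. HT (\<lambda>_. k) f \<omega> t (Suc m) \<and> VT (\<lambda>_. k) f \<omega> (Suc t) m \<and> ?R \<omega>) = k * f * r"
    proof -
      have "(\<lambda>\<omega>. HT (\<lambda>_. k) f \<omega> t (Suc m) \<and> VT (\<lambda>_. k) f \<omega> (Suc t) m \<and> ?R \<omega>) = (\<lambda>\<omega>. ?a \<omega> \<and> ?b \<omega> \<and> ?R \<omega>)"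
        by (auto simp: HS_Suc VS_Suc vtop_def vright_def fun_eq_iff split: if_splits)
      then show ?thesis using R(4) by simp
    qed
    have W': "W (Suc m) x = W m x" if "x \<noteq> m" for x
      using that by (auto simp: W_def fun_eq_iff less_Suc_eq)
    have W'': "(\<forall>x\<in>T. W (Suc m) x \<omega>) = (\<forall>x\<in>T. W m x \<omega>)" for \<omega>
      using W' mT by (metis)
    show ?case
    proof (cases "m \<in> S")
      case False
      then have S: "S = T" by (auto simp: T_def)
      show ?thesis unfolding S W'' using R(1) right by (simp add: r_def mult_ac)
    next
      case True
      then have S: "S = insert m T" by (auto simp: T_def)
      have W3: "(\<forall>x\<in>insert m T. W (Suc m) x \<omega>) = (VT (\<lambda>_. k) f \<omega> (Suc t) m \<and> (\<forall>x\<in>T. W m x \<omega>))" for \<omega>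
        using W''[of \<omega>] by (auto simp: W_def)
      have c1: "(Q \<omega> \<and> VT (\<lambda>_. k) f \<omega> (Suc t) m \<and> (\<forall>x\<in>T. W m x \<omega>)) =
          (VT (\<lambda>_. k) f \<omega> (Suc t) m \<and> ?R \<omega>)" for \<omega> by blast
      show ?thesis unfolding S W3 card c1 using top both by (simp add: r_def mult_ac)
    qed
  }
qed

text \<open>The scan is applied row by row, with \<open>Q\<close> describing the horizontal edges at
  column \<open>n\<close> in earlier rows. Hence the edges along a corner in space-time are
  independent, of density \<open>k\<close> on the horizontal cut and \<open>f\<close> on the
  vertical one.\<close>

lemma stationary_product:
  assumes "S \<subseteq> {..<n}" "S2 \<subseteq> {..<t}"
  shows "pr (\<lambda>\<omega>. (\<forall>s\<in>S2. HT (\<lambda>_. k) f \<omega> s n) \<and> (\<forall>x\<in>S. VT (\<lambda>_. k) f \<omega> t x)) = f ^ card S2 * k ^ card S"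
  using assms
proof (induction t arbitrary: S S2)
  case 0
  have fin: "finite S" using 0 by (auto intro: finite_subset)
  have "pr (\<lambda>\<omega>. \<forall>i\<in>Vn ` S. \<omega> i \<in> {..k}) = (\<Prod>i\<in>Vn ` S. measure unif {..k})"
    using fin by (intro pr_cylinder) auto
  also have "\<dots> = k ^ card S" using measure_unif[OF k]
    by (simp add: card_image inj_on_def atMost_def)
  finally show ?case using 0 by (simp add: VS_0 thrV_def)
next
  case (Suc t)
  let ?Q = "\<lambda>\<omega>. \<forall>s\<in>S2 - {t}. HT (\<lambda>_. k) f \<omega> s n"
  have fin: "finite S2" using Suc.prems by (auto intro: finite_subset)
  have evQ: "ev ?Q" using fin unfolding ev_iff_pred by measurable
  have S2: "S2 - {t} \<subseteq> {..<t}" using Suc.prems by auto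
  have depQ: "dep_on {i. case i of Cn s y \<Rightarrow> s < t | Dn s y \<Rightarrow> s < t | Vn y \<Rightarrow> True | Hn s \<Rightarrow> s < t} ?Q"
    using S2 by (intro dep_on_all dep_HT) (auto simp: depH_def split: src.splits)
  have base: "pr (\<lambda>\<omega>. ?Q \<omega> \<and> (\<forall>x\<in>S. VT (\<lambda>_. k) f \<omega> t x)) = f ^ card (S2 - {t}) * k ^ card S"
    if "S \<subseteq> {..<n}" for S
    using Suc.IH[OF that S2] .
  have W: "(\<forall>x\<in>S. if x < n then VT (\<lambda>_. k) f \<omega> (Suc t) x else VT (\<lambda>_. k) f \<omega> t x) =
      (\<forall>x\<in>S. VT (\<lambda>_. k) f \<omega> (Suc t) x)" for \<omega>
    using Suc.prems by auto
  have scan: "pr (\<lambda>\<omega>. ?Q \<omega> \<and> (\<forall>x\<in>S. VT (\<lambda>_. k) f \<omega> (Suc t) x)) = f ^ card (S2 - {t}) * k ^ card S \<and>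
      pr (\<lambda>\<omega>. HT (\<lambda>_. k) f \<omega> t n \<and> ?Q \<omega> \<and> (\<forall>x\<in>S. VT (\<lambda>_. k) f \<omega> (Suc t) x)) = f ^ card (S2 - {t}) * f * k ^ card S"
    unfolding W[symmetric]
  proof (rule stationary_scan[where Q="?Q" and t=t and n=n and q="f ^ card (S2 - {t})" and m=n and S=S])
    show "ev ?Q" by (rule evQ)
    show "dep_on {i. case i of Cn s y \<Rightarrow> s < t | Dn s y \<Rightarrow> s < t | Vn y \<Rightarrow> True | Hn s \<Rightarrow> s < t} ?Q"
      by (rule depQ)
    show "pr (\<lambda>\<omega>. ?Q \<omega> \<and> (\<forall>x\<in>S. VT (\<lambda>_. k) f \<omega> t x)) = f ^ card (S2 - {t}) * k ^ card S"
      if "S \<subseteq> {..<n}" for S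
      using that by (rule base)
    show "n \<le> n" "S \<subseteq> {..<n}" using Suc.prems by auto
  qed
  show ?case
  proof (cases "t \<in> S2")
    case True
    then have "card S2 = Suc (card (S2 - {t}))" by (rule card.remove[OF fin])
    moreover have "(\<forall>s\<in>S2. HT (\<lambda>_. k) f \<omega> s n) = (HT (\<lambda>_. k) f \<omega> t n \<and> ?Q \<omega>)" for \<omega>
      using True by auto
    ultimately show ?thesis using scan by (simp only: conj_assoc power_Suc mult_ac)
  next
    case False
    then have "S2 - {t} = S2" by auto
    then show ?thesis using scan by (simp only:)
  qed
qed

lemma stationary_V: "pr (\<lambda>\<omega>. VT (\<lambda>_. k) f \<omega> t x) = k"
  using stationary_product[of "{x}" "Suc x" "{}" t] by simp

lemma stationary_VV: "x \<noteq> y \<Longrightarrow> pr (\<lambda>\<omega>. VT (\<lambda>_. k) f \<omega> t x \<and> VT (\<lambda>_. k) f \<omega> t y) = k\<^sup>2"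
  using stationary_product[of "{x, y}" "Suc (max x y)" "{}" t]
  by (simp add: power2_eq_square less_Suc_eq_le)

lemma stationary_H: "pr (\<lambda>\<omega>. HT (\<lambda>_. k) f \<omega> t x) = f"
  using stationary_product[of "{}" x "{t}" "Suc t"] by simp

lemma stationary_HH: "s \<noteq> t \<Longrightarrow> pr (\<lambda>\<omega>. HT (\<lambda>_. k) f \<omega> s x \<and> HT (\<lambda>_. k) f \<omega> t x) = f\<^sup>2"
  using stationary_product[of "{}" x "{s, t}" "Suc (max s t)"]
  by (simp add: power2_eq_square less_Suc_eq_le)

lemma stationary_V_sum:
  fixes n t x :: nat
  defines "X \<equiv> \<lambda>\<omega>. (\<Sum>i<n. of_bool (VT (\<lambda>_. k) f \<omega> t (x + i))) - real n * k"
  shows "expectation (\<lambda>\<omega>. \<bar>X \<omega>\<bar>) \<le> sqrt n" and "0 < a \<Longrightarrow> pr (\<lambda>\<omega>. a < \<bar>X \<omega>\<bar>) \<le> n / a\<^sup>2"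
proof -
  have [measurable]: "X \<in> borel_measurable PM" unfolding X_def by measurable
  have 1: "expectation (\<lambda>\<omega>. (X \<omega>)\<^sup>2) \<le> real n" "integrable PM (\<lambda>\<omega>. (X \<omega>)\<^sup>2)"
    unfolding X_def
    using sum_indicator_second_moment[of n "\<lambda>i \<omega>. VT (\<lambda>_. k) f \<omega> t (x + i)" k] stationary_V stationary_VV k
    by (simp_all add: ev_iff_pred)
  show "expectation (\<lambda>\<omega>. \<bar>X \<omega>\<bar>) \<le> sqrt n"
    by (rule expectation_abs_le_sqrt[OF _ 1(2,1)]) measurable
  show "pr (\<lambda>\<omega>. a < \<bar>X \<omega>\<bar>) \<le> n / a\<^sup>2" if "0 < a"
    using chebyshev_second_moment[OF _ 1(2,1) that] by simp
qed

lemma stationary_H_sum: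
  fixes n t x :: nat
  defines "X \<equiv> \<lambda>\<omega>. (\<Sum>i<n. of_bool (HT (\<lambda>_. k) f \<omega> (t + i) x)) - real n * f"
  shows "expectation (\<lambda>\<omega>. \<bar>X \<omega>\<bar>) \<le> sqrt n" and "0 < a \<Longrightarrow> pr (\<lambda>\<omega>. a < \<bar>X \<omega>\<bar>) \<le> n / a\<^sup>2"
proof -
  have [measurable]: "X \<in> borel_measurable PM" unfolding X_def by measurable
  have 1: "expectation (\<lambda>\<omega>. (X \<omega>)\<^sup>2) \<le> real n" "integrable PM (\<lambda>\<omega>. (X \<omega>)\<^sup>2)"
    unfolding X_def
    using sum_indicator_second_moment[of n "\<lambda>i \<omega>. HT (\<lambda>_. k) f \<omega> (t + i) x" f] stationary_H stationary_HH f
    by (simp_all add: ev_iff_pred)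
  show "expectation (\<lambda>\<omega>. \<bar>X \<omega>\<bar>) \<le> sqrt n"
    by (rule expectation_abs_le_sqrt[OF _ 1(2,1)]) measurable
  show "pr (\<lambda>\<omega>. a < \<bar>X \<omega>\<bar>) \<le> n / a\<^sup>2" if "0 < a"
    using chebyshev_second_moment[OF _ 1(2,1) that] by simp
qed

end

section \<open>Coupling of two systems: monotonicity and discrepancies\<close>

lemma VT_mono: "(\<And>x. p x \<le> p' x) \<Longrightarrow> q \<le> q' \<Longrightarrow> VT p q \<omega> t x \<Longrightarrow> VT p' q' \<omega> t x"
  and HT_mono: "(\<And>x. p x \<le> p' x) \<Longrightarrow> q \<le> q' \<Longrightarrow> HT p q \<omega> t x \<Longrightarrow> HT p' q' \<omega> t x"
  unfolding VS_def HS_def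
  using VH_mono[of "thrV p \<omega>" "thrV p' \<omega>" "thrH q \<omega>" "thrH q' \<omega>"]
  by (meson thrV_def thrH_def order_trans)+

lemma HT_cong: "(\<And>y. y < x \<Longrightarrow> p y = p' y) \<Longrightarrow> HT p q \<omega> t x = HT p' q \<omega> t x"
  unfolding HS_def by (intro VH_cong[THEN conjunct2, THEN mp]) (auto simp: thrV_def)

lemma VT_cong: "(\<And>y. y \<le> x \<Longrightarrow> p y = p' y) \<Longrightarrow> VT p q \<omega> t x = VT p' q \<omega> t x"
  unfolding VS_def by (intro VH_cong[THEN conjunct1, THEN mp]) (auto simp: thrV_def)

text \<open>Opposite discrepancies of two systems driven by the same noise annihilate with probability
  \<open>gam\<close> whenever they meet in a vertex, and discrepancies are never created.\<close>

definition gam :: real where "gam = b1 * (1 - b2) + (1 - b1) * b2"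

lemma gam_pos: "0 < gam" unfolding gam_def using b1 b2 by (simp add: add_pos_pos)

context
  fixes p1 p2 :: "nat \<Rightarrow> real" and q1 q2 :: real
begin

definition meet :: "nat \<Rightarrow> nat \<Rightarrow> (src \<Rightarrow> real) \<Rightarrow> bool" where
  "meet t x \<omega> \<longleftrightarrow>
     (VT p1 q1 \<omega> t x \<and> \<not> VT p2 q2 \<omega> t x \<and> \<not> HT p1 q1 \<omega> t x \<and> HT p2 q2 \<omega> t x) \<or>
     (\<not> VT p1 q1 \<omega> t x \<and> VT p2 q2 \<omega> t x \<and> HT p1 q1 \<omega> t x \<and> \<not> HT p2 q2 \<omega> t x)"

text \<open>The opposite discrepancies sit on the lower and the left side of a block with corner (t,
  x). If both travelled straight they would meet at the vertex (t + i, x + j).\<close>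

definition opp :: "nat \<Rightarrow> nat \<Rightarrow> nat \<Rightarrow> nat \<Rightarrow> (src \<Rightarrow> real) \<Rightarrow> bool" where
  "opp t x i j \<omega> \<longleftrightarrow>
     (VT p1 q1 \<omega> t (x + j) \<and> \<not> VT p2 q2 \<omega> t (x + j) \<and> \<not> HT p1 q1 \<omega> (t + i) x \<and> HT p2 q2 \<omega> (t + i) x) \<or>
     (\<not> VT p1 q1 \<omega> t (x + j) \<and> VT p2 q2 \<omega> t (x + j) \<and> HT p1 q1 \<omega> (t + i) x \<and> \<not> HT p2 q2 \<omega> (t + i) x)"

lemma measurable_meet [measurable]: "Measurable.pred PM (meet t x)"
  unfolding meet_def[abs_def] by measurable

lemma measurable_opp [measurable]: "Measurable.pred PM (opp t x i j)"
  unfolding opp_def[abs_def] by measurable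

text \<open>Only discrepancies of the sign "first without second" are counted. They are conserved
  except at a \<open>meet\<close> vertex with \<open>c\<close> \<noteq> \<open>d\<close>: there one
  system turns exactly when the other goes straight, so both paths leave by the same edge.\<close>

lemma meet_annihilation:
  "pr (\<lambda>\<omega>. VT p1 q1 \<omega> t x \<and> \<not> VT p2 q2 \<omega> t x) + pr (\<lambda>\<omega>. HT p1 q1 \<omega> t x \<and> \<not> HT p2 q2 \<omega> t x)
   - pr (\<lambda>\<omega>. VT p1 q1 \<omega> (Suc t) x \<and> \<not> VT p2 q2 \<omega> (Suc t) x)
   - pr (\<lambda>\<omega>. HT p1 q1 \<omega> t (Suc x) \<and> \<not> HT p2 q2 \<omega> t (Suc x)) = pr (meet t x) * gam"
proof -
  let ?c = "\<lambda>\<omega>. \<omega> (Cn t x) \<le> b1" and ?d = "\<lambda>\<omega>. \<omega> (Dn t x) \<le> b2"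
  let ?A = "\<lambda>\<omega>. VT p1 q1 \<omega> t x \<and> \<not> VT p2 q2 \<omega> t x" and ?B = "\<lambda>\<omega>. HT p1 q1 \<omega> t x \<and> \<not> HT p2 q2 \<omega> t x"
  let ?A' = "\<lambda>\<omega>. VT p1 q1 \<omega> (Suc t) x \<and> \<not> VT p2 q2 \<omega> (Suc t) x"
  let ?B' = "\<lambda>\<omega>. HT p1 q1 \<omega> t (Suc x) \<and> \<not> HT p2 q2 \<omega> t (Suc x)"
  have evs: "ev ?A" "ev ?B" "ev ?A'" "ev ?B'" "ev (\<lambda>\<omega>. meet t x \<omega> \<and> ?c \<omega> \<noteq> ?d \<omega>)" "ev (meet t x)"
    "ev (\<lambda>\<omega>. ?c \<omega> \<noteq> ?d \<omega>)" "ev ?c" "ev ?d" "ev (\<lambda>\<omega>. \<not> ?c \<omega>)" "ev (\<lambda>\<omega>. \<not> ?d \<omega>)"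
    "ev (\<lambda>\<omega>. ?c \<omega> \<and> \<not> ?d \<omega>)" "ev (\<lambda>\<omega>. \<not> ?c \<omega> \<and> ?d \<omega>)"
    unfolding ev_iff_pred by measurable
  have "of_bool (?A \<omega>) + of_bool (?B \<omega>) - of_bool (?A' \<omega>) - of_bool (?B' \<omega>) =
      (of_bool (meet t x \<omega> \<and> ?c \<omega> \<noteq> ?d \<omega>) :: real)" for \<omega>
    unfolding VS_Suc HS_Suc meet_def vtop_def vright_def
    by (cases "VT p1 q1 \<omega> t x"; cases "VT p2 q2 \<omega> t x"; cases "HT p1 q1 \<omega> t x"; cases "HT p2 q2 \<omega> t x") auto
  then have "expectation (\<lambda>\<omega>. of_bool (?A \<omega>) + of_bool (?B \<omega>) - of_bool (?A' \<omega>) - of_bool (?B' \<omega>)) =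
      expectation (\<lambda>\<omega>. of_bool (meet t x \<omega> \<and> ?c \<omega> \<noteq> ?d \<omega>) :: real)"
    by (simp only:)
  then have "pr ?A + pr ?B - pr ?A' - pr ?B' = pr (\<lambda>\<omega>. meet t x \<omega> \<and> ?c \<omega> \<noteq> ?d \<omega>)"
    by (simp only: expectation_of_bool[OF evs(5)] expectation_of_bool[OF evs(1)] expectation_of_bool[OF evs(2)]
        expectation_of_bool[OF evs(3)] expectation_of_bool[OF evs(4)] Bochner_Integration.integral_add
        Bochner_Integration.integral_diff Bochner_Integration.integrable_add Bochner_Integration.integrable_diff
        integrable_of_bool[OF evs(1)] integrable_of_bool[OF evs(2)] integrable_of_bool[OF evs(3)] integrable_of_bool[OF evs(4)])
  also have "\<dots> = pr (meet t x) * pr (\<lambda>\<omega>. ?c \<omega> \<noteq> ?d \<omega>)"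
  proof (rule pr_indep[OF evs(6,7)])
    show "dep_on (- {Cn t x, Dn t x}) (meet t x)"
      unfolding meet_def[abs_def]
      by (intro dep_on_disj dep_on_conj dep_on_not dep_VT dep_HT)
        (auto simp: depV_def depH_def)
    show "dep_on {Cn t x, Dn t x} (\<lambda>\<omega>. ?c \<omega> \<noteq> ?d \<omega>)" by (auto simp: dep_on_def)
  qed auto
  also have "pr (\<lambda>\<omega>. ?c \<omega> \<noteq> ?d \<omega>) = gam"
  proof -
    have "(\<lambda>\<omega>. ?c \<omega> \<noteq> ?d \<omega>) = (\<lambda>\<omega>. (?c \<omega> \<and> \<not> ?d \<omega>) \<or> (\<not> ?c \<omega> \<and> ?d \<omega>))" by auto
    then have "pr (\<lambda>\<omega>. ?c \<omega> \<noteq> ?d \<omega>) = pr (\<lambda>\<omega>. ?c \<omega> \<and> \<not> ?d \<omega>) + pr (\<lambda>\<omega>. \<not> ?c \<omega> \<and> ?d \<omega>)"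
      using pr_disj_eq[OF evs(12,13)] by simp
    moreover have "pr (\<lambda>\<omega>. ?c \<omega> \<and> \<not> ?d \<omega>) = pr ?c * pr (\<lambda>\<omega>. \<not> ?d \<omega>)"
      by (rule pr_indep[OF evs(8,11), of "{Cn t x}" "{Dn t x}"]) (auto simp: dep_on_def)
    moreover have "pr (\<lambda>\<omega>. \<not> ?c \<omega> \<and> ?d \<omega>) = pr (\<lambda>\<omega>. \<not> ?c \<omega>) * pr ?d"
      by (rule pr_indep[OF evs(10,9), of "{Cn t x}" "{Dn t x}"]) (auto simp: dep_on_def)
    ultimately show ?thesis using pr_not[OF evs(8)] pr_not[OF evs(9)] b1 b2 by (simp add: gam_def pr_le)
  qed
  finally show ?thesis .
qed

text \<open>Telescoping the annihilation identity over the rectangle leaves the discrepancies that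
  enter through its lower and left sides, at most one per edge. The bound is a perimeter, whereas
  the number of vertices is an area.\<close>

lemma sum_meet_le: "(\<Sum>t<T. \<Sum>x<X. pr (meet t (m + x))) \<le> (real T + real X) / gam"
proof -
  let ?v = "\<lambda>t x. pr (\<lambda>\<omega>. VT p1 q1 \<omega> t x \<and> \<not> VT p2 q2 \<omega> t x)"
  let ?h = "\<lambda>t x. pr (\<lambda>\<omega>. HT p1 q1 \<omega> t x \<and> \<not> HT p2 q2 \<omega> t x)"
  have row: "(\<Sum>x<X. pr (meet t (m + x))) * gam = (\<Sum>x<X. ?v t (m + x)) - (\<Sum>x<X. ?v (Suc t) (m + x)) + ?h t m - ?h t (m + X)" for t
  proof (induction X)
    case (Suc X)
    then show ?case using meet_annihilation[of t "m + X"] by (simp add: distrib_right)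
  qed simp
  have "(\<Sum>t<T. \<Sum>x<X. pr (meet t (m + x))) * gam =
      (\<Sum>x<X. ?v 0 (m + x)) - (\<Sum>x<X. ?v T (m + x)) + (\<Sum>t<T. ?h t m) - (\<Sum>t<T. ?h t (m + X))"
    by (induction T) (simp_all add: row distrib_right)
  also have "\<dots> \<le> (\<Sum>x<X. 1) - 0 + (\<Sum>t<T. 1) - 0"
    by (intro add_mono diff_mono sum_mono sum_nonneg pr_le_1 pr_nonneg)
  finally show ?thesis using gam_pos by (simp add: field_simps)
qed

text \<open>If all vertices on the two straight routes are transparent, which has probability (b1
  b2)^(i + j) independently of \<open>opp\<close>, both discrepancies arrive at the same
  vertex.\<close>

lemma opp_le_meet: "pr (opp t x i j) * (b1 * b2) ^ (i + j) \<le> pr (meet (t + i) (x + j))"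
proof -
  \<comment> \<open>The two routes without the meeting vertex. Their sources are disjoint from those
    deciding \<open>opp\<close>, which lie below row \<open>t\<close> or left of column
    \<open>x\<close>.\<close>
  define Z where "Z = (\<lambda>s. (s, x + j)) ` {t..<t + i} \<union> Pair (t + i) ` {x..<x + j}"
  define JC where "JC = (\<lambda>(s, y). Cn s y) ` Z"
  define JD where "JD = (\<lambda>(s, y). Dn s y) ` Z"
  define B where "B = (\<lambda>i. {y. y \<le> (case i of Cn _ _ \<Rightarrow> b1 | _ \<Rightarrow> b2)})"
  let ?S = "\<lambda>\<omega>. \<forall>i\<in>JC \<union> JD. \<omega> i \<in> B i"
  have fin: "finite Z" by (simp add: Z_def)
  have "card Z = i + j" unfolding Z_def
    by (subst card_Un_disjoint) (auto simp: card_image inj_on_def)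
  then have cards: "card JC = i + j" "card JD = i + j"
    unfolding JC_def JD_def by (simp_all add: card_image inj_on_def split_beta prod_eq_iff)
  have "pr ?S = (\<Prod>i\<in>JC \<union> JD. measure unif (B i))"
    using fin by (intro pr_cylinder) (auto simp: JC_def JD_def B_def)
  also have "\<dots> = (\<Prod>i\<in>JC. measure unif (B i)) * (\<Prod>i\<in>JD. measure unif (B i))"
    using fin by (intro prod.union_disjoint) (auto simp: JC_def JD_def)
  also have "(\<Prod>i\<in>JC. measure unif (B i)) = (\<Prod>i\<in>JC. b1)"
    using b1 by (intro prod.cong) (auto simp: JC_def B_def measure_unif)
  also have "(\<Prod>i\<in>JD. measure unif (B i)) = (\<Prod>i\<in>JD. b2)"
    using b2 by (intro prod.cong) (auto simp: JD_def B_def measure_unif)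
  finally have prS: "pr ?S = (b1 * b2) ^ (i + j)" by (simp add: cards power_mult_distrib)
  have evS: "ev ?S" unfolding ev_iff_pred B_def using fin by (simp add: JC_def JD_def) measurable
  have evo: "ev (opp t x i j)" unfolding ev_iff_pred by measurable
  have "pr (opp t x i j) * (b1 * b2) ^ (i + j) = pr (\<lambda>\<omega>. opp t x i j \<omega> \<and> ?S \<omega>)"
    unfolding prS[symmetric]
  proof (rule pr_indep[symmetric, OF evo evS])
    show "dep_on (depV t (x + j) \<union> depH (t + i) x) (opp t x i j)"
      unfolding opp_def[abs_def]
      by (intro dep_on_disj dep_on_conj dep_on_not dep_VT dep_HT) auto
    show "dep_on (JC \<union> JD) ?S" unfolding dep_on_def by metis
    show "(depV t (x + j) \<union> depH (t + i) x) \<inter> (JC \<union> JD) = {}"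
      by (auto simp: depV_def depH_def JC_def JD_def Z_def)
  qed
  also have "\<dots> \<le> pr (meet (t + i) (x + j))"
  proof (rule pr_mono)
    fix \<omega> assume \<omega>: "opp t x i j \<omega> \<and> ?S \<omega>"
    have S: "\<omega> (Cn s y) \<le> b1 \<and> \<omega> (Dn s y) \<le> b2" if "(s, y) \<in> Z" for s y
    proof -
      have "Cn s y \<in> JC" "Dn s y \<in> JD" using that by (force simp: JC_def JD_def)+
      then show ?thesis using \<omega> unfolding B_def by force
    qed
    have "VT p q \<omega> (t + i) (x + j) = VT p q \<omega> t (x + j)" "HT p q \<omega> (t + i) (x + j) = HT p q \<omega> (t + i) x" for p q
      unfolding VS_def HS_def by (intro straight_column straight_row S; auto simp: Z_def)+
    then show "meet (t + i) (x + j) \<omega>" using \<omega> by (auto simp: meet_def opp_def)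
  qed (simp add: ev_iff_pred)
  finally show ?thesis .
qed

end

end

section \<open>Height functions for step initial densities\<close>

lemma sum_by_parts_weight:
  fixes b :: "nat \<Rightarrow> real"
  shows "1 \<le> J \<Longrightarrow> (\<Sum>j\<in>{1..<J}. real j * (b j - b (Suc j))) = (\<Sum>j\<in>{1..<J}. b j) - (real J - 1) * b J"
proof (induction J rule: nat_induct_at_least[where m=1])
  case (Suc J)
  then show ?case by (simp add: algebra_simps)
qed simp

text \<open>The transport speed j / (i + i0) is that of the ray through the point, seen from an apex
  \<open>i0\<close> steps in the past. Summation by parts turns the weights j into 1, so the row sum
  grows by the factor (i + 1 + i0) / (i + i0) per step. The product telescopes, and
  \<open>i0\<close> > 0 keeps it finite.\<close>

lemma discrete_gronwall_fan:
  fixes B r :: "nat \<Rightarrow> nat \<Rightarrow> real"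
  assumes step: "\<And>i j. i < I \<Longrightarrow> 1 \<le> j \<Longrightarrow> j < J \<Longrightarrow>
      B (Suc i) j \<le> B i j + real j / (real i + i0) * (B i j - B i (Suc j)) + r i j"
    and init: "\<And>j. 1 \<le> j \<Longrightarrow> j < J \<Longrightarrow> B 0 j \<le> 0" and bnd: "\<And>i. i < I \<Longrightarrow> 0 \<le> B i J"
    and i0: "0 < i0" and r: "\<And>i j. 0 \<le> r i j" and J: "1 \<le> J"
  shows "(\<Sum>j\<in>{1..<J}. B I j) \<le> (real I + i0) / i0 * (\<Sum>i<I. \<Sum>j<J. r i j)"
proof -
  define D where "D = (\<lambda>i. \<Sum>j\<in>{1..<J}. B i j)"
  define R where "R = (\<lambda>i. \<Sum>j<J. r i j)"
  have R: "0 \<le> R i" "(\<Sum>j\<in>{1..<J}. r i j) \<le> R i" for i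
    unfolding R_def using r by (auto intro: sum_nonneg sum_mono2)
  have D: "D (Suc i) \<le> D i * ((real i + 1 + i0) / (real i + i0)) + R i" if "i < I" for i
  proof -
    have p: "0 < real i + i0" using i0 by simp
    have "D (Suc i) \<le> (\<Sum>j\<in>{1..<J}. B i j + real j / (real i + i0) * (B i j - B i (Suc j)) + r i j)"
      unfolding D_def using step[OF that] by (intro sum_mono) auto
    also have "\<dots> = D i + (\<Sum>j\<in>{1..<J}. real j * (B i j - B i (Suc j))) / (real i + i0) + (\<Sum>j\<in>{1..<J}. r i j)"
      by (simp add: D_def sum.distrib sum_divide_distrib)
    also have "\<dots> = D i + (D i - (real J - 1) * B i J) / (real i + i0) + (\<Sum>j\<in>{1..<J}. r i j)"
      unfolding D_def using sum_by_parts_weight[OF J, of "B i"] by simp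
    also have "\<dots> \<le> D i + D i / (real i + i0) + R i"
      using R(2)[of i] bnd[OF that] p J by (intro add_mono divide_right_mono) auto
    also have "D i + D i / (real i + i0) = D i * ((real i + 1 + i0) / (real i + i0))"
      using p by (simp add: field_simps)
    finally show ?thesis .
  qed
  have "i \<le> I \<Longrightarrow> D i / (real i + i0) \<le> (\<Sum>i'<i. R i') / i0" for i
  proof (induction i)
    case 0
    have "D 0 \<le> 0" unfolding D_def using init by (intro sum_nonpos) auto
    then show ?case using i0 by (simp add: divide_nonpos_pos)
  next
    case (Suc i)
    have p: "0 < real i + i0" "0 < real (Suc i) + i0" using i0 by auto
    have "D (Suc i) / (real (Suc i) + i0) \<le> (D i * ((real i + 1 + i0) / (real i + i0)) + R i) / (real (Suc i) + i0)"
      using D[of i] Suc.prems p by (intro divide_right_mono) auto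
    also have "\<dots> = D i / (real i + i0) + R i / (real (Suc i) + i0)"
      using p by (simp add: field_simps)
    also have "\<dots> \<le> (\<Sum>i'<i. R i') / i0 + R i / i0"
      using Suc R(1)[of i] i0 by (intro add_mono divide_left_mono) auto
    finally show ?case by (simp add: add_divide_distrib)
  qed
  from this[of I] have "D I \<le> (\<Sum>i'<I. R i') / i0 * (real I + i0)"
    using i0 by (simp add: pos_divide_le_eq)
  then show ?thesis by (simp add: D_def R_def mult_ac)
qed

text \<open>With a constant speed the transport term telescopes to boundary values of favourable
  sign, so no growth factor appears.\<close>

lemma discrete_gronwall_shock:
  fixes B r :: "nat \<Rightarrow> nat \<Rightarrow> real"
  assumes step: "\<And>i j. i < I \<Longrightarrow> j < J \<Longrightarrow> B (Suc i) j \<le> B i j + s * (B i j - B i (Suc j)) + r i j"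
    and init: "\<And>j. j < J \<Longrightarrow> B 0 j \<le> 0"
    and bnd: "\<And>i. i < I \<Longrightarrow> 0 \<le> B i J" "\<And>i. i < I \<Longrightarrow> B i 0 \<le> 0" and s: "0 \<le> s"
  shows "(\<Sum>j<J. B I j) \<le> (\<Sum>i<I. \<Sum>j<J. r i j)"
proof -
  have "i \<le> I \<Longrightarrow> (\<Sum>j<J. B i j) \<le> (\<Sum>i'<i. \<Sum>j<J. r i' j)" for i
  proof (induction i)
    case 0
    then show ?case using init by (auto intro: sum_nonpos)
  next
    case (Suc i)
    then have i: "i < I" by simp
    have "(\<Sum>j<J. B (Suc i) j) \<le> (\<Sum>j<J. B i j + s * (B i j - B i (Suc j)) + r i j)"
      using step[OF i] by (intro sum_mono) auto
    also have "\<dots> = (\<Sum>j<J. B i j) + s * (\<Sum>j<J. B i j - B i (Suc j)) + (\<Sum>j<J. r i j)"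
      by (simp add: sum.distrib sum_distrib_left)
    also have "(\<Sum>j<J. B i j - B i (Suc j)) = B i 0 - B i J"
      by (rule sum_lessThan_telescope')
    also have "s * (B i 0 - B i J) \<le> 0"
      using bnd[OF i] s by (intro mult_nonneg_nonpos) auto
    finally show ?case using Suc by simp
  qed
  then show ?thesis by simp
qed

text \<open>Converts a bound on the sum into a bound on a single term: falling by at most 1 per
  step, \<open>b\<close> stays above half of \<open>b j0\<close> for at least
  \<open>b j0 / 2\<close> steps.\<close>

lemma slowly_decreasing_sum_bound:
  fixes b :: "nat \<Rightarrow> real"
  assumes "\<And>j. j < J \<Longrightarrow> b j - 1 \<le> b (Suc j)" and nonneg: "\<And>j. 1 \<le> j \<Longrightarrow> j < J \<Longrightarrow> 0 \<le> b j"
    and "1 \<le> j0" "real j0 + b j0 + 1 \<le> real J" "0 \<le> b j0"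
  shows "(b j0)\<^sup>2 / 4 \<le> (\<Sum>j\<in>{1..<J}. b j)"
proof -
  define u where "u = nat \<lceil>b j0 / 2\<rceil>"
  have u: "b j0 / 2 \<le> real u" "real u < b j0 / 2 + 1" using assms(5) unfolding u_def by linarith+
  have uJ: "j0 + u \<le> J" using u assms(4,5) by linarith
  have low: "b j0 - real i \<le> b (j0 + i)" if "i \<le> u" for i
    using that
  proof (induction i)
    case (Suc i)
    then show ?case using assms(1)[of "j0 + i"] uJ by simp
  qed simp
  have "(b j0)\<^sup>2 / 4 = b j0 / 2 * (b j0 / 2)" by (simp add: power2_eq_square)
  also have "\<dots> \<le> real u * (b j0 / 2)" using u assms(5) by (intro mult_right_mono) auto
  also have "\<dots> = (\<Sum>i<u. b j0 / 2)" by simp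
  also have "\<dots> \<le> (\<Sum>i<u. b (j0 + i))"
  proof (rule sum_mono)
    fix i assume "i \<in> {..<u}"
    then have "real i + 1 \<le> real u" by auto
    then show "b j0 / 2 \<le> b (j0 + i)" using low[of i] u \<open>i \<in> {..<u}\<close> by simp
  qed
  also have "\<dots> = (\<Sum>j\<in>{j0..<j0 + u}. b j)"
    by (rule sum.reindex_bij_witness[where i="\<lambda>j. j - j0" and j="\<lambda>i. j0 + i"]) auto
  also have "\<dots> \<le> (\<Sum>j\<in>{1..<J}. b j)"
    using uJ assms(3) nonneg by (intro sum_mono2) auto
  finally show ?thesis .
qed

lemma sum_arith_progression_le:
  fixes g :: "nat \<Rightarrow> real"
  assumes "\<And>t. 0 \<le> g t" "a < l"
  shows "(\<Sum>i<I. g (l * i + a)) \<le> (\<Sum>t<l * I. g t)"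
proof -
  have "(\<Sum>i<I. g (l * i + a)) = sum g ((\<lambda>i. l * i + a) ` {..<I})"
    using assms(2) by (subst sum.reindex) (auto simp: inj_on_def)
  also have "\<dots> \<le> (\<Sum>t<l * I. g t)"
  proof (rule sum_mono2)
    show "(\<lambda>i. l * i + a) ` {..<I} \<subseteq> {..<l * I}"
    proof clarsimp
      fix i assume "i < I"
      then have "l * Suc i \<le> l * I" by (intro mult_le_mono2) simp
      then show "l * i + a < l * I" using assms(2) by simp
    qed
  qed (use assms in auto)
  finally show ?thesis .
qed

locale riemann_problem = six_vertex b1 b2 for b1 b2 :: real +
  fixes \<theta> \<rho> :: real
  assumes b12: "b1 < b2" and theta: "0 \<le> \<theta>" "\<theta> \<le> 1" and rho: "0 \<le> \<rho>" "\<rho> \<le> 1"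
begin

definition \<kappa> :: real where "\<kappa> = sv_kappa b1 b2"

definition f :: "real \<Rightarrow> real" where "f = sv_phi b1 b2"

section \<open>The flux function\<close>

lemma kappa_gt_1: "1 < \<kappa>"
  unfolding \<kappa>_def sv_kappa_def using b12 b2 by simp

lemma f_eq: "f z = \<kappa> * z / ((\<kappa> - 1) * z + 1)"
  by (simp add: f_def sv_phi_def \<kappa>_def)

lemma f_0 [simp]: "f 0 = 0" and f_1 [simp]: "f 1 = 1"
  using kappa_gt_1 by (simp_all add: f_eq)

text \<open>Exact chord slope of the Moebius function \<open>f\<close>. Monotonicity, the Lipschitz
  constant \<kappa> and concavity are all read off from it.\<close>

lemma f_diff:
  assumes "0 \<le> a" "0 \<le> b"
  shows "f b - f a = \<kappa> / (((\<kappa> - 1) * a + 1) * ((\<kappa> - 1) * b + 1)) * (b - a)"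
proof -
  have "0 < (\<kappa> - 1) * a + 1" "0 < (\<kappa> - 1) * b + 1"
    using assms kappa_gt_1 by (auto intro!: add_nonneg_pos)
  then show ?thesis unfolding f_eq by (simp add: field_simps)
qed

lemma f_lipschitz:
  assumes "0 \<le> a" "a \<le> b"
  shows "0 \<le> f b - f a" "f b - f a \<le> \<kappa> * (b - a)"
proof -
  have D: "1 \<le> (\<kappa> - 1) * a + 1" "1 \<le> (\<kappa> - 1) * b + 1"
    using assms kappa_gt_1 by auto
  have "1 * 1 \<le> ((\<kappa> - 1) * a + 1) * ((\<kappa> - 1) * b + 1)"
    using D by (intro mult_mono) auto
  then have "0 \<le> \<kappa> / (((\<kappa> - 1) * a + 1) * ((\<kappa> - 1) * b + 1))"
    "\<kappa> / (((\<kappa> - 1) * a + 1) * ((\<kappa> - 1) * b + 1)) \<le> \<kappa>"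
    using kappa_gt_1 by (auto simp: divide_le_eq)
  then show "0 \<le> f b - f a" "f b - f a \<le> \<kappa> * (b - a)"
    unfolding f_diff[OF assms(1) order_trans[OF assms]]
    using assms by (intro mult_nonneg_nonneg mult_right_mono; simp)+
qed

lemma f_mono: "0 \<le> a \<Longrightarrow> a \<le> b \<Longrightarrow> f a \<le> f b"
  using f_lipschitz[of a b] by simp

lemma f_bounds: "0 \<le> a \<Longrightarrow> a \<le> 1 \<Longrightarrow> 0 \<le> f a" "0 \<le> a \<Longrightarrow> a \<le> 1 \<Longrightarrow> f a \<le> 1"
  using f_mono[of 0 a] f_mono[of a 1] by auto

lemma f_abs_lipschitz: "0 \<le> a \<Longrightarrow> 0 \<le> b \<Longrightarrow> \<bar>f a - f b\<bar> \<le> \<kappa> * \<bar>a - b\<bar>"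
  using f_lipschitz[of a b] f_lipschitz[of b a] by (cases "a \<le> b") auto

text \<open>This is where the flux function comes from: \<open>f k\<close> is the horizontal density
  for which the vertex weights preserve the vertical density \<open>k\<close>.\<close>

lemma f_balance:
  assumes "0 \<le> k"
  shows "k * (1 - f k) * (1 - b1) = (1 - k) * f k * (1 - b2)"
proof -
  have D: "0 < (\<kappa> - 1) * k + 1" using assms kappa_gt_1 by (auto intro!: add_nonneg_pos)
  have "1 - b1 = \<kappa> * (1 - b2)" using b2 by (simp add: \<kappa>_def sv_kappa_def)
  moreover have "1 - f k = (1 - k) / ((\<kappa> - 1) * k + 1)" using D unfolding f_eq by (simp add: field_simps)
  ultimately show ?thesis by (simp add: f_eq)
qed

section \<open>Random heights, their comparison and their means\<close>

text \<open>The quadrant starts far to the left of the jump of the density, which is placed at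
  column \<open>m\<close>; all later estimates are uniform in \<open>m\<close>.\<close>

definition pm :: "nat \<Rightarrow> nat \<Rightarrow> real" where "pm m x = (if x < m then \<theta> else \<rho>)"

abbreviation "VR m \<equiv> VT (pm m) (f \<theta>)"
abbreviation "HR m \<equiv> HT (pm m) (f \<theta>)"

definition height :: "(nat \<Rightarrow> real) \<Rightarrow> real \<Rightarrow> nat \<Rightarrow> (src \<Rightarrow> real) \<Rightarrow> nat \<Rightarrow> nat \<Rightarrow> real" where
  "height p q m \<omega> t x = (\<Sum>s<t. of_bool (HT p q \<omega> s m)) - (\<Sum>z<x. of_bool (VT p q \<omega> t (m + z)))"

text \<open>The same height read along the other boundary route: along the initial row and up column
  \<open>m + x\<close>, instead of up column \<open>m\<close> and along row \<open>t\<close>. Time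
  increments and changes of the left data are visible in this form, space increments and changes of
  the right data in the definition.\<close>

lemma height_alt: "height p q m \<omega> t x =
    (\<Sum>s<t. of_bool (HT p q \<omega> s (m + x))) - (\<Sum>z<x. of_bool (\<omega> (Vn (m + z)) \<le> p (m + z)))"
  unfolding height_def VS_def HS_def by (subst height_change) (simp add: thrV_def)

lemma height_x: "height p q m \<omega> t x - height p q m \<omega> t (x + n) = (\<Sum>j<n. of_bool (VT p q \<omega> t (m + x + j)))"
  unfolding height_def by (induction n) (simp_all add: add_ac)

lemma height_t: "height p q m \<omega> (t + n) x - height p q m \<omega> t x = (\<Sum>i<n. of_bool (HT p q \<omega> (t + i) (m + x)))"
  unfolding height_alt by (induction n) (simp_all add: add_ac)

lemma height_measurable [measurable]: "(\<lambda>\<omega>. height p q m \<omega> t x) \<in> borel_measurable PM"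
  unfolding height_def by measurable

lemma height_bound: "\<bar>height p q m \<omega> t x\<bar> \<le> real t + real x"
proof -
  have "(\<Sum>s<t. of_bool (HT p q \<omega> s m)) \<le> (\<Sum>s<t. 1::real)" "(\<Sum>z<x. of_bool (VT p q \<omega> t (m + z))) \<le> (\<Sum>z<x. 1::real)"
    by (intro sum_mono; simp)+
  moreover have "0 \<le> (\<Sum>s<t. of_bool (HT p q \<omega> s m) :: real)" "0 \<le> (\<Sum>z<x. of_bool (VT p q \<omega> t (m + z)) :: real)"
    by (intro sum_nonneg; simp)+
  ultimately show ?thesis unfolding height_def by simp
qed

lemma integrable_height: "integrable PM (\<lambda>\<omega>. height p q m \<omega> t x)"
  by (rule integrable_const_bound[where B="real t + real x"]) (use height_bound in auto)

lemma height_mono_left: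
  assumes "\<And>x. p x \<le> p' x" "q \<le> q'" "\<And>x. m \<le> x \<Longrightarrow> p x = p' x"
  shows "height p q m \<omega> t x \<le> height p' q' m \<omega> t x"
  unfolding height_alt using assms HT_mono[OF assms(1,2)]
  by (intro diff_mono sum_mono) (auto simp: of_bool_def)

lemma height_mono_right:
  assumes "\<And>x. p x \<le> p' x" "\<And>x. x < m \<Longrightarrow> p x = p' x"
  shows "height p' q m \<omega> t x \<le> height p q m \<omega> t x"
  unfolding height_def using assms(2) VT_mono[OF assms(1) order_refl[of q]] HT_cong[of m p p' q \<omega>]
  by (intro diff_mono sum_mono) (auto simp: of_bool_def)

abbreviation "hR m \<equiv> height (pm m) (f \<theta>) m"
abbreviation "hS k \<equiv> height (\<lambda>_. k) (f k)"

text \<open>The intermediate system has density \<open>k\<close> on the left and \<rho> on the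
  right. Lowering the right density raises the height, and so does raising the left density together
  with the boundary flux.\<close>

lemma height_compare_fan:
  assumes "\<rho> \<le> k" "k \<le> \<theta>"
  shows "hS k m \<omega> t x \<le> hR m \<omega> t x"
proof -
  have "hS k m \<omega> t x \<le> height (\<lambda>x. if x < m then k else \<rho>) (f k) m \<omega> t x"
    using assms by (intro height_mono_right) auto
  also have "\<dots> \<le> hR m \<omega> t x"
    using assms rho by (intro height_mono_left) (auto simp: pm_def intro!: f_mono)
  finally show ?thesis .
qed

lemma height_compare_shock:
  assumes "\<theta> \<le> k" "k \<le> \<rho>"
  shows "hR m \<omega> t x \<le> hS k m \<omega> t x"
proof -
  have "hR m \<omega> t x \<le> height (\<lambda>x. if x < m then k else \<rho>) (f k) m \<omega> t x"
    using assms theta by (intro height_mono_left) (auto simp: pm_def intro!: f_mono)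
  also have "\<dots> \<le> hS k m \<omega> t x"
    using assms by (intro height_mono_right) auto
  finally show ?thesis .
qed

lemma stationary_height:
  assumes "0 \<le> k" "k \<le> 1"
  shows "expectation (\<lambda>\<omega>. \<bar>hS k m \<omega> t x - (f k * real t - k * real x)\<bar>) \<le> sqrt t + sqrt x"
proof -
  let ?A = "\<lambda>\<omega>. (\<Sum>s<t. of_bool (HT (\<lambda>_. k) (f k) \<omega> s m)) - real t * f k"
  let ?B = "\<lambda>\<omega>. (\<Sum>z<x. of_bool (VT (\<lambda>_. k) (f k) \<omega> t (m + z))) - real x * k"
  note st = assms f_bounds[OF assms] f_balance[OF assms(1)]
  have bnd: "\<bar>(\<Sum>s<n. of_bool (P s)) - real n * c\<bar> \<le> real n + real n * \<bar>c\<bar>" for P :: "nat \<Rightarrow> bool" and n c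
  proof -
    have "(\<Sum>s<n. of_bool (P s)) \<le> (\<Sum>s<n. 1::real)" "0 \<le> (\<Sum>s<n. of_bool (P s) :: real)"
      by (intro sum_mono sum_nonneg; simp)+
    then show ?thesis using abs_triangle_ineq4[of "\<Sum>s<n. of_bool (P s)" "real n * c"] by (simp add: abs_mult)
  qed
  have int: "integrable PM (\<lambda>\<omega>. \<bar>?A \<omega>\<bar>)" "integrable PM (\<lambda>\<omega>. \<bar>?B \<omega>\<bar>)"
    by (rule integrable_const_bound[where B="real t + real t * \<bar>f k\<bar>"], use bnd in auto)
      (rule integrable_const_bound[where B="real x + real x * \<bar>k\<bar>"], use bnd in auto)
  have i1: "integrable PM (\<lambda>\<omega>. \<bar>hS k m \<omega> t x - (f k * real t - k * real x)\<bar>)"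
    by (intro integrable_abs Bochner_Integration.integrable_diff integrable_height integrable_const)
  have eq: "hS k m \<omega> t x - (f k * real t - k * real x) = ?A \<omega> - ?B \<omega>" for \<omega>
    by (simp add: height_def mult.commute)
  have "expectation (\<lambda>\<omega>. \<bar>hS k m \<omega> t x - (f k * real t - k * real x)\<bar>) \<le> expectation (\<lambda>\<omega>. \<bar>?A \<omega>\<bar> + \<bar>?B \<omega>\<bar>)"
    by (rule integral_mono[OF i1 Bochner_Integration.integrable_add[OF int]]) (unfold eq, rule abs_triangle_ineq4)
  also have "\<dots> = expectation (\<lambda>\<omega>. \<bar>?A \<omega>\<bar>) + expectation (\<lambda>\<omega>. \<bar>?B \<omega>\<bar>)"
    by (rule Bochner_Integration.integral_add[OF int])
  also have "\<dots> \<le> sqrt t + sqrt x"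
    using stationary_H_sum(1)[OF st, where n=t and t=0 and x=m] stationary_V_sum(1)[OF st, where n=x and t=t and x=m]
    by (intro add_mono) (simp_all only: add_0)
  finally show ?thesis .
qed

definition av :: "nat \<Rightarrow> nat \<Rightarrow> nat \<Rightarrow> real" where "av m t x = expectation (\<lambda>\<omega>. hR m \<omega> t x)"

lemma stationary_height_mean:
  assumes "0 \<le> k" "k \<le> 1"
  shows "expectation (\<lambda>\<omega>. hS k m \<omega> t x) = f k * real t - k * real x"
proof -
  note st = assms f_bounds[OF assms] f_balance[OF assms(1)]
  have "expectation (\<lambda>\<omega>. of_bool (HT (\<lambda>_. k) (f k) \<omega> s m)) = f k" for s
    using stationary_H[OF st] by (subst expectation_of_bool) (auto simp: ev_iff_pred)
  moreover have "expectation (\<lambda>\<omega>. of_bool (VT (\<lambda>_. k) (f k) \<omega> t z)) = k" for z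
    using stationary_V[OF st] by (subst expectation_of_bool) (auto simp: ev_iff_pred)
  moreover have "integrable PM (\<lambda>\<omega>. of_bool (HT (\<lambda>_. k) (f k) \<omega> s m) :: real)"
    "integrable PM (\<lambda>\<omega>. of_bool (VT (\<lambda>_. k) (f k) \<omega> s z) :: real)" for s z
    by (auto intro!: integrable_of_bool simp: ev_iff_pred)
  ultimately show ?thesis unfolding height_def by simp
qed

lemma av_origin: "av m t 0 = f \<theta> * real t"
proof -
  have "hR m \<omega> t 0 = hS \<theta> m \<omega> t 0" for \<omega>
    unfolding height_def using HT_cong[of m "pm m" "\<lambda>_. \<theta>"] by (simp add: pm_def)
  then show ?thesis using stationary_height_mean[OF theta, of m t 0] by (simp add: av_def)
qed

lemma av_initial: "av m 0 x = - \<rho> * real x"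
proof -
  have "hR m \<omega> 0 x = hS \<rho> m \<omega> 0 x" for \<omega>
    unfolding height_alt by (simp add: pm_def)
  then show ?thesis using stationary_height_mean[OF rho, of m 0 x] by (simp add: av_def)
qed

lemma av_fan: "\<rho> \<le> k \<Longrightarrow> k \<le> \<theta> \<Longrightarrow> f k * real t - k * real x \<le> av m t x"
proof -
  assume k: "\<rho> \<le> k" "k \<le> \<theta>"
  have "expectation (\<lambda>\<omega>. hS k m \<omega> t x) \<le> expectation (\<lambda>\<omega>. hR m \<omega> t x)"
    using k by (intro integral_mono integrable_height height_compare_fan)
  then show ?thesis using stationary_height_mean[of k m t x] theta rho k unfolding av_def by simp
qed

lemma av_shock: "\<theta> \<le> k \<Longrightarrow> k \<le> \<rho> \<Longrightarrow> av m t x \<le> f k * real t - k * real x"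
proof -
  assume k: "\<theta> \<le> k" "k \<le> \<rho>"
  have "expectation (\<lambda>\<omega>. hR m \<omega> t x) \<le> expectation (\<lambda>\<omega>. hS k m \<omega> t x)"
    using k by (intro integral_mono integrable_height height_compare_shock)
  then show ?thesis using stationary_height_mean[of k m t x] theta rho k unfolding av_def by simp
qed

lemma av_x: "av m t x - av m t (x + n) = expectation (\<lambda>\<omega>. \<Sum>j<n. of_bool (VR m \<omega> t (m + x + j)))"
  unfolding av_def height_x[symmetric] by (simp add: integrable_height)

lemma av_t: "av m (t + n) x - av m t x = expectation (\<lambda>\<omega>. \<Sum>i<n. of_bool (HR m \<omega> (t + i) (m + x)))"
  unfolding av_def height_t[symmetric] by (simp add: integrable_height)

lemma expectation_sum_of_bool_bounds:
  assumes "\<And>i. ev (P i)"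
  shows "0 \<le> expectation (\<lambda>\<omega>. \<Sum>i<n. of_bool (P i \<omega>) :: real)" "expectation (\<lambda>\<omega>. \<Sum>i<n. of_bool (P i \<omega>) :: real) \<le> real n"
proof -
  have eq: "expectation (\<lambda>\<omega>. \<Sum>i<n. of_bool (P i \<omega>) :: real) = (\<Sum>i<n. pr (P i))"
    by (subst Bochner_Integration.integral_sum) (auto simp: integrable_of_bool assms expectation_of_bool)
  show "0 \<le> expectation (\<lambda>\<omega>. \<Sum>i<n. of_bool (P i \<omega>) :: real)" "expectation (\<lambda>\<omega>. \<Sum>i<n. of_bool (P i \<omega>) :: real) \<le> real n"
    unfolding eq using sum_mono[of "{..<n}" "\<lambda>i. pr (P i)" "\<lambda>_. 1"] by (auto intro!: sum_nonneg)
qed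

lemma av_x_bounds: "0 \<le> av m t x - av m t (x + n)" "av m t x - av m t (x + n) \<le> real n"
  unfolding av_x by (rule expectation_sum_of_bool_bounds; simp add: ev_iff_pred)+

lemma av_t_bounds: "0 \<le> av m (t + n) x - av m t x" "av m (t + n) x - av m t x \<le> real n"
  unfolding av_t by (rule expectation_sum_of_bool_bounds; simp add: ev_iff_pred)+

end

section \<open>Local equilibrium of blocks\<close>

lemma sum_of_bool_less:
  "(\<Sum>j<l. of_bool (P j)) < (\<Sum>j<l. of_bool (Q j) :: real) \<Longrightarrow> \<exists>j<l. \<not> P j \<and> Q j"
proof (rule ccontr)
  assume *: "(\<Sum>j<l. of_bool (P j)) < (\<Sum>j<l. of_bool (Q j) :: real)" "\<not> (\<exists>j<l. \<not> P j \<and> Q j)"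
  have "(\<Sum>j<l. of_bool (Q j)) \<le> (\<Sum>j<l. of_bool (P j) :: real)"
    using *(2) by (intro sum_mono) auto
  then show False using *(1) by simp
qed

lemma sum_of_bool_bounds: "0 \<le> (\<Sum>j<l. of_bool (P j) :: real)" "(\<Sum>j<l. of_bool (P j)) \<le> real l"
  using sum_mono[of "{..<l}" "\<lambda>j. of_bool (P j) :: real" "\<lambda>_. 1"] by (auto intro: sum_nonneg)

context riemann_problem
begin

definition blkV :: "(nat \<Rightarrow> real) \<Rightarrow> real \<Rightarrow> nat \<Rightarrow> nat \<Rightarrow> nat \<Rightarrow> (src \<Rightarrow> real) \<Rightarrow> real" where
  "blkV p q l t x \<omega> = (\<Sum>j<l. of_bool (VT p q \<omega> t (x + j)))"

definition blkH :: "(nat \<Rightarrow> real) \<Rightarrow> real \<Rightarrow> nat \<Rightarrow> nat \<Rightarrow> nat \<Rightarrow> (src \<Rightarrow> real) \<Rightarrow> real" where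
  "blkH p q l t x \<omega> = (\<Sum>i<l. of_bool (HT p q \<omega> (t + i) x))"

text \<open>\<theta> and \<rho> are added because comparison with these two stationary systems
  confines the density of a block to the interval between them, up to 1/n.\<close>

definition grid :: "nat \<Rightarrow> real set" where
  "grid n = (\<lambda>i. real i / real n) ` {..n} \<union> {\<theta>, \<rho>}"

lemma grid_unit: "k \<in> grid n \<Longrightarrow> 0 \<le> k \<and> k \<le> 1"
  using theta rho by (auto simp: grid_def divide_le_eq)

lemma finite_grid: "finite (grid n)" and card_grid: "card (grid n) \<le> n + 3"
proof -
  show "finite (grid n)" by (simp add: grid_def)
  have "card (grid n) \<le> card ((\<lambda>i. real i / real n) ` {..n}) + card {\<theta>, \<rho>}"
    unfolding grid_def by (rule card_Un_le)
  also have "card ((\<lambda>i. real i / real n) ` {..n}) \<le> card {..n}" by (rule card_image_le) simp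
  also have "card {\<theta>, \<rho>} \<le> 2" by (simp add: card_insert_if)
  finally show "card (grid n) \<le> n + 3" by simp
qed

definition oppk :: "real \<Rightarrow> nat \<Rightarrow> nat \<Rightarrow> nat \<Rightarrow> nat \<Rightarrow> nat \<Rightarrow> (src \<Rightarrow> real) \<Rightarrow> bool" where
  "oppk k m = opp (pm m) (\<lambda>_. k) (f \<theta>) (f k)"

definition meetk :: "real \<Rightarrow> nat \<Rightarrow> nat \<Rightarrow> nat \<Rightarrow> (src \<Rightarrow> real) \<Rightarrow> bool" where
  "meetk k m = meet (pm m) (\<lambda>_. k) (f \<theta>) (f k)"

definition bad :: "nat \<Rightarrow> nat \<Rightarrow> nat \<Rightarrow> nat \<Rightarrow> nat \<Rightarrow> (src \<Rightarrow> real) \<Rightarrow> bool" where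
  "bad n l m t x \<omega> \<longleftrightarrow> (\<exists>k\<in>grid n.
      (\<exists>i\<in>{..<l}. \<exists>j\<in>{..<l}. oppk k m t x i j \<omega>) \<or>
      real l / real n < \<bar>blkV (\<lambda>_. k) (f k) l t x \<omega> - real l * k\<bar> \<or>
      real l / real n < \<bar>blkH (\<lambda>_. k) (f k) l t x \<omega> - real l * f k\<bar>)"

lemma measurable_blk [measurable]: "blkV p q l t x \<in> borel_measurable PM" "blkH p q l t x \<in> borel_measurable PM"
  unfolding blkV_def[abs_def] blkH_def[abs_def] by measurable

lemma measurable_oppk [measurable]: "Measurable.pred PM (oppk k m t x i j)"
  unfolding oppk_def by measurable

lemma measurable_bad [measurable]: "Measurable.pred PM (bad n l m t x)"
  unfolding bad_def[abs_def] using finite_grid by measurable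

lemma blk_bounds: "0 \<le> blkV p q l t x \<omega>" "blkV p q l t x \<omega> \<le> real l"
    "0 \<le> blkH p q l t x \<omega>" "blkH p q l t x \<omega> \<le> real l"
  unfolding blkV_def blkH_def by (rule sum_of_bool_bounds)+

text \<open>If the systems differed in opposite directions in density and in flux, some column and
  some row of the block would carry opposite discrepancies.\<close>

lemma no_opp_order:
  assumes "\<forall>i\<in>{..<l}. \<forall>j\<in>{..<l}. \<not> oppk k m t x i j \<omega>"
  shows "\<not> (blkV (pm m) (f \<theta>) l t x \<omega> < blkV (\<lambda>_. k) (f k) l t x \<omega> \<and> blkH (\<lambda>_. k) (f k) l t x \<omega> < blkH (pm m) (f \<theta>) l t x \<omega>)"
    and "\<not> (blkV (\<lambda>_. k) (f k) l t x \<omega> < blkV (pm m) (f \<theta>) l t x \<omega> \<and> blkH (pm m) (f \<theta>) l t x \<omega> < blkH (\<lambda>_. k) (f k) l t x \<omega>)"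
proof -
  show "\<not> (blkV (pm m) (f \<theta>) l t x \<omega> < blkV (\<lambda>_. k) (f k) l t x \<omega> \<and> blkH (\<lambda>_. k) (f k) l t x \<omega> < blkH (pm m) (f \<theta>) l t x \<omega>)"
  proof
    assume *: "blkV (pm m) (f \<theta>) l t x \<omega> < blkV (\<lambda>_. k) (f k) l t x \<omega> \<and> blkH (\<lambda>_. k) (f k) l t x \<omega> < blkH (pm m) (f \<theta>) l t x \<omega>"
    obtain j where "j < l" "\<not> VR m \<omega> t (x + j)" "VT (\<lambda>_. k) (f k) \<omega> t (x + j)"
      using sum_of_bool_less[OF *[THEN conjunct1, unfolded blkV_def]] by blast
    moreover obtain i where "i < l" "\<not> HT (\<lambda>_. k) (f k) \<omega> (t + i) x" "HR m \<omega> (t + i) x"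
      using sum_of_bool_less[OF *[THEN conjunct2, unfolded blkH_def]] by blast
    ultimately show False using assms by (auto simp: oppk_def opp_def)
  qed
  show "\<not> (blkV (\<lambda>_. k) (f k) l t x \<omega> < blkV (pm m) (f \<theta>) l t x \<omega> \<and> blkH (pm m) (f \<theta>) l t x \<omega> < blkH (\<lambda>_. k) (f k) l t x \<omega>)"
  proof
    assume *: "blkV (\<lambda>_. k) (f k) l t x \<omega> < blkV (pm m) (f \<theta>) l t x \<omega> \<and> blkH (pm m) (f \<theta>) l t x \<omega> < blkH (\<lambda>_. k) (f k) l t x \<omega>"
    obtain j where "j < l" "VR m \<omega> t (x + j)" "\<not> VT (\<lambda>_. k) (f k) \<omega> t (x + j)"
      using sum_of_bool_less[OF *[THEN conjunct1, unfolded blkV_def]] by blast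
    moreover obtain i where "i < l" "HT (\<lambda>_. k) (f k) \<omega> (t + i) x" "\<not> HR m \<omega> (t + i) x"
      using sum_of_bool_less[OF *[THEN conjunct2, unfolded blkH_def]] by blast
    ultimately show False using assms by (auto simp: oppk_def opp_def)
  qed
qed

text \<open>Comparison with the stationary systems of all grid densities pins down the flux of a block by its
  density.\<close>

lemma block_flux:
  assumes nb: "\<not> bad n l m t x \<omega>" and n: "1 \<le> n" and l: "1 \<le> l"
  defines "d \<equiv> blkV (pm m) (f \<theta>) l t x \<omega> / real l" and "g \<equiv> blkH (pm m) (f \<theta>) l t x \<omega> / real l"
  shows "\<bar>g - f d\<bar> \<le> (2 * \<kappa> + 1) / real n"
    and "min \<theta> \<rho> - 1 / real n \<le> d" and "d \<le> max \<theta> \<rho> + 1 / real n"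
proof -
  have l0: "0 < real l" and n0: "0 < real n" using l n by auto
  have d01: "0 \<le> d" "d \<le> 1" and g01: "0 \<le> g" "g \<le> 1"
    using blk_bounds[of "pm m" "f \<theta>" l t x \<omega>] l0 by (auto simp: d_def g_def)
  let ?V = "\<lambda>k. blkV (\<lambda>_. k) (f k) l t x \<omega>" and ?H = "\<lambda>k. blkH (\<lambda>_. k) (f k) l t x \<omega>"
  have near: "\<bar>?V k / real l - k\<bar> \<le> 1 / real n" "\<bar>?H k / real l - f k\<bar> \<le> 1 / real n"
    and noopp: "\<forall>i\<in>{..<l}. \<forall>j\<in>{..<l}. \<not> oppk k m t x i j \<omega>" if "k \<in> grid n" for k
  proof -
    have *: "\<bar>?V k - real l * k\<bar> \<le> real l / real n" "\<bar>?H k - real l * f k\<bar> \<le> real l / real n"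
      using nb that unfolding bad_def by (meson not_le)+
    have "?V k / real l - k = (?V k - real l * k) / real l" "?H k / real l - f k = (?H k - real l * f k) / real l"
      using l0 by (auto simp: field_simps)
    then show "\<bar>?V k / real l - k\<bar> \<le> 1 / real n" "\<bar>?H k / real l - f k\<bar> \<le> 1 / real n"
      using * l0 by (simp_all add: divide_le_eq)
    show "\<forall>i\<in>{..<l}. \<forall>j\<in>{..<l}. \<not> oppk k m t x i j \<omega>" using nb that unfolding bad_def by blast
  qed
  have up: "g \<le> f k + 1 / real n" if k: "k \<in> grid n" and "d < k - 1 / real n" for k
  proof (rule ccontr)
    assume "\<not> ?thesis"
    then have "d < ?V k / real l" "?H k / real l < g" using that near[OF k] by linarith+
    then show False using no_opp_order(1)[OF noopp[OF k]] l0 unfolding d_def g_def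
      by (auto simp: divide_less_cancel)
  qed
  have dn: "f k - 1 / real n \<le> g" if k: "k \<in> grid n" and "k + 1 / real n < d" for k
  proof (rule ccontr)
    assume "\<not> ?thesis"
    then have "?V k / real l < d" "g < ?H k / real l" using that near[OF k] by linarith+
    then show False using no_opp_order(2)[OF noopp[OF k]] l0 unfolding d_def g_def
      by (auto simp: divide_less_cancel)
  qed
  have "g \<le> f d + (2 * \<kappa> + 1) / real n"
  proof (cases "nat \<lfloor>real n * d\<rfloor> + 2 \<le> n")
    case True
    \<comment> \<open>The smallest index whose density exceeds \<open>d\<close> by more than 1/n,
      since the comparison has to survive the 1/n error of the stationary density.\<close>
    define i where "i = nat \<lfloor>real n * d\<rfloor> + 2"
    define k where "k = real i / real n"
    have ri: "real i = of_int \<lfloor>real n * d\<rfloor> + 2" unfolding i_def using d01 n0 by simp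
    have "i \<le> n" using True by (simp add: i_def)
    then have "k \<in> grid n" by (auto simp: grid_def k_def)
    moreover have "real n * d < real i - 1" "real i \<le> real n * d + 2" unfolding ri by linarith+
    then have kd: "d < k - 1 / real n" "k \<le> d + 2 / real n" using n0 by (auto simp: k_def field_simps)
    ultimately have "g \<le> f k + 1 / real n" using up by blast
    also have "f k \<le> f d + \<kappa> * (k - d)" using f_lipschitz[of d k] d01 kd n0 by (simp add: field_simps)
    also have "\<kappa> * (k - d) \<le> \<kappa> * (2 / real n)" using kd kappa_gt_1 by (intro mult_left_mono) auto
    finally show ?thesis by (simp add: add_divide_distrib mult.commute)
  next
    \<comment> \<open>No such density is left below 1. Then \<open>d\<close> is within 1/n of 1 and
      the trivial bound \<open>g\<close> \<le> 1 suffices.\<close>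
    case False
    moreover have "0 \<le> \<lfloor>real n * d\<rfloor>" using d01 n0 by simp
    ultimately have "int n - 1 \<le> \<lfloor>real n * d\<rfloor>" by linarith
    then have "real n - 1 \<le> real n * d" by linarith
    then have "1 - d \<le> 1 / real n" using n0 by (simp add: field_simps)
    moreover have "1 \<le> f d + \<kappa> * (1 - d)" using f_lipschitz[of d 1] d01 by simp
    ultimately have "1 \<le> f d + \<kappa> * (1 / real n)"
      using kappa_gt_1 mult_left_mono[of "1 - d" "1 / real n" \<kappa>] by simp
    moreover have "\<kappa> * (1 / real n) \<le> (2 * \<kappa> + 1) / real n"
      using kappa_gt_1 n0 by (simp add: divide_right_mono)
    ultimately show ?thesis using g01 by linarith
  qed
  moreover have "f d - (2 * \<kappa> + 1) / real n \<le> g"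
  proof (cases "2 \<le> nat \<lceil>real n * d\<rceil>")
    case True
    define i where "i = nat \<lceil>real n * d\<rceil> - 2"
    define k where "k = real i / real n"
    have ri: "real i = of_int \<lceil>real n * d\<rceil> - 2" unfolding i_def using True by (simp add: of_nat_diff)
    have lt: "real n * d > real i + 1" "real i \<ge> real n * d - 2" unfolding ri by linarith+
    have "real n * d \<le> real n" using d01 n0 by (simp add: mult_left_le)
    then have "real i \<le> real n" using lt by linarith
    then have "k \<in> grid n" by (auto simp: grid_def k_def)
    moreover have "(real i + 1) / real n < d" "d \<le> (real i + 2) / real n"
      using lt n0 by (simp_all add: pos_divide_less_eq pos_le_divide_eq mult.commute)
    then have kd: "k + 1 / real n < d" "d - 2 / real n \<le> k" by (simp_all add: k_def add_divide_distrib)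
    ultimately have "f k - 1 / real n \<le> g" using dn by blast
    moreover have "f d \<le> f k + \<kappa> * (d - k)"
      using f_lipschitz[of k d] kd n0 by (simp add: k_def field_simps)
    moreover have "\<kappa> * (d - k) \<le> \<kappa> * (2 / real n)" using kd kappa_gt_1 by (intro mult_left_mono) auto
    ultimately show ?thesis by (simp add: add_divide_distrib mult.commute)
  next
    case False
    then have "real n * d \<le> 1" by linarith
    then have "d \<le> 1 / real n" using n0 by (simp add: field_simps)
    moreover have "f d \<le> \<kappa> * d" using f_lipschitz[of 0 d] d01 by simp
    ultimately have "f d \<le> \<kappa> * (1 / real n)"
      using kappa_gt_1 mult_left_mono[of d "1 / real n" \<kappa>] by simp
    moreover have "\<kappa> * (1 / real n) \<le> (2 * \<kappa> + 1) / real n"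
      using kappa_gt_1 n0 by (simp add: divide_right_mono)
    ultimately show ?thesis using g01 by linarith
  qed
  ultimately show "\<bar>g - f d\<bar> \<le> (2 * \<kappa> + 1) / real n" by linarith
  have "?V (min \<theta> \<rho>) \<le> blkV (pm m) (f \<theta>) l t x \<omega>"
  proof -
    have "VT (\<lambda>_. min \<theta> \<rho>) (f (min \<theta> \<rho>)) \<omega> t y \<longrightarrow> VR m \<omega> t y" for y
      using theta rho VT_mono[of "\<lambda>_. min \<theta> \<rho>" "pm m" "f (min \<theta> \<rho>)" "f \<theta>" \<omega> t y] f_mono[of "min \<theta> \<rho>" \<theta>]
      by (auto simp: pm_def)
    then show ?thesis unfolding blkV_def by (intro sum_mono) auto
  qed
  then have "?V (min \<theta> \<rho>) / real l \<le> d" using l0 by (simp add: d_def divide_right_mono)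
  moreover have "min \<theta> \<rho> \<in> grid n" "max \<theta> \<rho> \<in> grid n" by (auto simp: grid_def min_def max_def)
  ultimately show "min \<theta> \<rho> - 1 / real n \<le> d" using near(1)[of "min \<theta> \<rho>"] by linarith
  have "blkV (pm m) (f \<theta>) l t x \<omega> \<le> ?V (max \<theta> \<rho>)"
  proof -
    have "VR m \<omega> t y \<longrightarrow> VT (\<lambda>_. max \<theta> \<rho>) (f (max \<theta> \<rho>)) \<omega> t y" for y
      using theta rho VT_mono[of "pm m" "\<lambda>_. max \<theta> \<rho>" "f \<theta>" "f (max \<theta> \<rho>)" \<omega> t y] f_mono[of \<theta> "max \<theta> \<rho>"]
      by (auto simp: pm_def)
    then show ?thesis unfolding blkV_def by (intro sum_mono) auto
  qed
  then have "d \<le> ?V (max \<theta> \<rho>) / real l" using l0 by (simp add: d_def divide_right_mono)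
  then show "d \<le> max \<theta> \<rho> + 1 / real n"
    using near(1)[of "max \<theta> \<rho>"] \<open>max \<theta> \<rho> \<in> grid n\<close> by linarith
qed

section \<open>Averaged flux inequalities and the number of bad blocks\<close>

text \<open>The affine bound \<open>cs\<close> can be averaged without any control of the variance
  of the block density. The sign \<sigma> = 1 serves the fan and \<sigma> = -1 the shock.\<close>

lemma flux_inequality:
  assumes \<sigma>: "\<sigma> = 1 \<or> \<sigma> = (-1::real)" and s: "0 \<le> s" "s \<le> S" and c: "\<bar>c\<bar> \<le> C0" and n: "1 \<le> n" and l: "1 \<le> l"
    and cs: "\<And>d. min \<theta> \<rho> \<le> d \<Longrightarrow> d \<le> max \<theta> \<rho> \<Longrightarrow> \<sigma> * f d \<le> \<sigma> * (c + s * d)"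
  shows "\<sigma> * ((av m (t + l) x - av m t x) / real l) \<le> \<sigma> * (c + s * ((av m t x - av m t (x + l)) / real l))
      + ((3 * \<kappa> + 1 + S) / real n + (1 + C0 + S) * pr (bad n l m t (m + x)))"
proof -
  have l0: "0 < real l" and n0: "0 < real n" using l n by auto
  define d where "d = (\<lambda>\<omega>. blkV (pm m) (f \<theta>) l t (m + x) \<omega> / real l)"
  define g where "g = (\<lambda>\<omega>. blkH (pm m) (f \<theta>) l t (m + x) \<omega> / real l)"
  define e where "e = (3 * \<kappa> + 1 + S) / real n"
  have [measurable]: "d \<in> borel_measurable PM" "g \<in> borel_measurable PM"
    unfolding d_def g_def by measurable
  have d01: "0 \<le> d \<omega>" "d \<omega> \<le> 1" and g01: "0 \<le> g \<omega>" "g \<omega> \<le> 1" for \<omega>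
    using blk_bounds[of "pm m" "f \<theta>" l t "m + x" \<omega>] l0 by (auto simp: d_def g_def)
  have e0: "0 \<le> e" using kappa_gt_1 s by (simp add: e_def)
  have pw: "\<sigma> * g \<omega> \<le> \<sigma> * (c + s * d \<omega>) + (e + (1 + C0 + S) * of_bool (bad n l m t (m + x) \<omega>))" for \<omega>
  proof (cases "bad n l m t (m + x) \<omega>")
    case True
    have "\<bar>s * d \<omega>\<bar> \<le> S" using s d01[of \<omega>] mult_mono[of s S "d \<omega>" 1] by (simp add: abs_mult)
    then have "\<sigma> * g \<omega> - \<sigma> * (c + s * d \<omega>) \<le> 1 + C0 + S"
      using \<sigma> c g01[of \<omega>] by auto
    then show ?thesis using True e0 by simp
  next
    case False
    have bf: "\<bar>g \<omega> - f (d \<omega>)\<bar> \<le> (2 * \<kappa> + 1) / real n" "min \<theta> \<rho> - 1 / real n \<le> d \<omega>" "d \<omega> \<le> max \<theta> \<rho> + 1 / real n"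
      using block_flux[OF False n l] by (simp_all add: d_def g_def)
    \<comment> \<open>\<open>cs\<close> is available only between \<theta> and \<rho>, so the
      density is projected to that interval, which moves it by at most 1/n.\<close>
    define d' where "d' = max (min \<theta> \<rho>) (min (max \<theta> \<rho>) (d \<omega>))"
    have d': "min \<theta> \<rho> \<le> d'" "d' \<le> max \<theta> \<rho>" "\<bar>d \<omega> - d'\<bar> \<le> 1 / real n" "0 \<le> d'"
      using bf(2,3) theta rho n0 unfolding d'_def by (auto simp: min_def max_def split: if_splits)
    have "\<bar>f (d \<omega>) - f d'\<bar> \<le> \<kappa> * \<bar>d \<omega> - d'\<bar>" using d01 d' by (intro f_abs_lipschitz) auto
    also have "\<dots> \<le> \<kappa> * (1 / real n)" using kappa_gt_1 d'(3) by (intro mult_left_mono) auto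
    finally have 1: "\<bar>f (d \<omega>) - f d'\<bar> \<le> \<kappa> / real n" by simp
    have "\<bar>s * d \<omega> - s * d'\<bar> = s * \<bar>d \<omega> - d'\<bar>" using s by (simp add: right_diff_distrib[symmetric] abs_mult)
    also have "\<dots> \<le> S * (1 / real n)" using s d'(3) by (intro mult_mono) auto
    finally have 2: "\<bar>s * d \<omega> - s * d'\<bar> \<le> S / real n" by simp
    have "e = (2 * \<kappa> + 1) / real n + \<kappa> / real n + S / real n" by (simp add: e_def add_divide_distrib)
    then show ?thesis using \<sigma> bf(1) 1 2 cs[OF d'(1,2)] False by auto
  qed
  have int: "integrable PM d" "integrable PM g"
    by (rule integrable_const_bound[where B=1]; use d01 g01 in auto)+
  have intb: "integrable PM (\<lambda>\<omega>. of_bool (bad n l m t (m + x) \<omega>) :: real)"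
    by (rule integrable_of_bool) (simp add: ev_iff_pred)
  have "expectation (\<lambda>\<omega>. \<sigma> * g \<omega>) \<le>
      expectation (\<lambda>\<omega>. \<sigma> * (c + s * d \<omega>) + (e + (1 + C0 + S) * of_bool (bad n l m t (m + x) \<omega>)))"
    using int intb by (intro integral_mono pw) auto
  also have "\<dots> = \<sigma> * (c + s * expectation d) + (e + (1 + C0 + S) * pr (bad n l m t (m + x)))"
    using int intb P.prob_space by (simp add: expectation_of_bool ev_iff_pred)
  finally have *: "\<sigma> * expectation g \<le> \<sigma> * (c + s * expectation d) + (e + (1 + C0 + S) * pr (bad n l m t (m + x)))"
    using int by simp
  have "expectation g = (av m (t + l) x - av m t x) / real l"
    unfolding g_def blkH_def av_t by simp
  moreover have "expectation d = (av m t x - av m t (x + l)) / real l"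
    unfolding d_def blkV_def av_x by simp
  ultimately show ?thesis using * unfolding e_def by simp
qed

text \<open>Union bound over the grid. The last term is Chebyshev, once for the density and once for
  the flux, with variance at most l and deviation l / n.\<close>

lemma pr_bad_le:
  assumes n: "1 \<le> n" and l: "1 \<le> l"
  shows "pr (bad n l m t x) \<le> (\<Sum>k\<in>grid n. (\<Sum>i<l. \<Sum>j<l. pr (oppk k m t x i j)) + 2 * (real n)\<^sup>2 / real l)"
proof -
  have l0: "0 < real l" and n0: "0 < real n" using l n by auto
  have "pr (bad n l m t x) \<le> (\<Sum>k\<in>grid n. pr (\<lambda>\<omega>.
      (\<exists>i\<in>{..<l}. \<exists>j\<in>{..<l}. oppk k m t x i j \<omega>) \<or>
      real l / real n < \<bar>blkV (\<lambda>_. k) (f k) l t x \<omega> - real l * k\<bar> \<or>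
      real l / real n < \<bar>blkH (\<lambda>_. k) (f k) l t x \<omega> - real l * f k\<bar>))"
    unfolding bad_def using finite_grid by (intro pr_Bex_le) (auto simp: ev_iff_pred)
  also have "\<dots> \<le> (\<Sum>k\<in>grid n. (\<Sum>i<l. \<Sum>j<l. pr (oppk k m t x i j)) + 2 * (real n)\<^sup>2 / real l)"
  proof (rule sum_mono)
    fix k assume k: "k \<in> grid n"
    then have k01: "0 \<le> k" "k \<le> 1" using grid_unit by auto
    note st = k01 f_bounds[OF k01] f_balance[OF k01(1)]
    have pos: "0 < real l / real n" using l0 n0 by simp
    have cheb: "real l / (real l / real n)\<^sup>2 = (real n)\<^sup>2 / real l"
      using l0 n0 by (simp add: power2_eq_square field_simps)
    let ?O = "\<lambda>\<omega>. \<exists>i\<in>{..<l}. \<exists>j\<in>{..<l}. oppk k m t x i j \<omega>"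
    let ?A = "\<lambda>\<omega>. real l / real n < \<bar>blkV (\<lambda>_. k) (f k) l t x \<omega> - real l * k\<bar>"
    let ?B = "\<lambda>\<omega>. real l / real n < \<bar>blkH (\<lambda>_. k) (f k) l t x \<omega> - real l * f k\<bar>"
    have ev: "ev ?O" "ev ?A" "ev ?B" "ev (\<lambda>\<omega>. ?A \<omega> \<or> ?B \<omega>)" unfolding ev_iff_pred by measurable
    have "pr ?O \<le> (\<Sum>i<l. pr (\<lambda>\<omega>. \<exists>j\<in>{..<l}. oppk k m t x i j \<omega>))"
      by (intro pr_Bex_le) (auto simp: ev_iff_pred)
    also have "\<dots> \<le> (\<Sum>i<l. \<Sum>j<l. pr (oppk k m t x i j))"
      by (intro sum_mono pr_Bex_le) (auto simp: ev_iff_pred)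
    finally have "pr ?O \<le> (\<Sum>i<l. \<Sum>j<l. pr (oppk k m t x i j))" .
    moreover have "pr ?A \<le> (real n)\<^sup>2 / real l" "pr ?B \<le> (real n)\<^sup>2 / real l"
      using stationary_V_sum(2)[OF st pos, where n=l and t=t and x=x]
        stationary_H_sum(2)[OF st pos, where n=l and t=t and x=x]
      unfolding cheb blkV_def blkH_def by auto
    moreover have "pr (\<lambda>\<omega>. ?O \<omega> \<or> ?A \<omega> \<or> ?B \<omega>) \<le> pr ?O + (pr ?A + pr ?B)"
      using pr_disj_le[OF ev(1,4)] pr_disj_le[OF ev(2,3)] by linarith
    ultimately show "pr (\<lambda>\<omega>. ?O \<omega> \<or> ?A \<omega> \<or> ?B \<omega>) \<le> (\<Sum>i<l. \<Sum>j<l. pr (oppk k m t x i j)) + 2 * (real n)\<^sup>2 / real l"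
      by linarith
  qed
  finally show ?thesis .
qed

text \<open>For a fixed offset (a, b) distinct blocks use distinct vertices, so the sum over blocks
  is at most the sum over all vertices. The exponent 2 l covers every a + b.\<close>

lemma sum_oppk_le:
  assumes "a < l" "b < l"
  shows "(\<Sum>i<I. \<Sum>j<J. pr (oppk k m (l * i) (m + l * j) a b)) \<le> (real (l * I) + real (l * J)) / gam / (b1 * b2) ^ (2 * l)"
proof -
  define \<beta> where "\<beta> = (b1 * b2) ^ (2 * l)"
  have bb: "0 < b1 * b2" "b1 * b2 \<le> 1" using b1 b2 by (auto intro: mult_le_one)
  then have \<beta>: "0 < \<beta>" unfolding \<beta>_def by simp
  have om: "pr (oppk k m t x a b) \<le> pr (meetk k m (t + a) (x + b)) / \<beta>" for t x
  proof -
    have "pr (oppk k m t x a b) * \<beta> \<le> pr (oppk k m t x a b) * (b1 * b2) ^ (a + b)"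
      unfolding \<beta>_def using bb assms by (intro mult_left_mono power_decreasing) auto
    also have "\<dots> \<le> pr (meetk k m (t + a) (x + b))"
      unfolding oppk_def meetk_def by (rule opp_le_meet)
    finally show ?thesis using \<beta> by (simp add: pos_le_divide_eq)
  qed
  have "(\<Sum>i<I. \<Sum>j<J. pr (oppk k m (l * i) (m + l * j) a b)) \<le>
      (\<Sum>i<I. \<Sum>j<J. pr (meetk k m (l * i + a) (m + (l * j + b))) / \<beta>)"
    unfolding add.assoc[symmetric] by (intro sum_mono om)
  also have "\<dots> = (\<Sum>i<I. \<Sum>j<J. pr (meetk k m (l * i + a) (m + (l * j + b)))) / \<beta>"
    by (simp add: sum_divide_distrib)
  also have "\<dots> \<le> (\<Sum>i<I. \<Sum>x<l * J. pr (meetk k m (l * i + a) (m + x))) / \<beta>"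
    using \<beta> assms by (intro divide_right_mono sum_mono sum_arith_progression_le[where g="\<lambda>x. pr (meetk k m _ (m + x))"]) auto
  also have "\<dots> \<le> (\<Sum>t<l * I. \<Sum>x<l * J. pr (meetk k m t (m + x))) / \<beta>"
    using \<beta> assms by (intro divide_right_mono sum_arith_progression_le[where g="\<lambda>t. \<Sum>x<l * J. pr (meetk k m t (m + x))"])
      (auto intro: sum_nonneg)
  also have "\<dots> \<le> (real (l * I) + real (l * J)) / gam / \<beta>"
    using \<beta> unfolding meetk_def by (intro divide_right_mono sum_meet_le) auto
  finally show ?thesis unfolding \<beta>_def .
qed

text \<open>The first summand is of perimeter order in \<open>I\<close> and \<open>J\<close>; the
  second is of area order, but with a factor that is small once \<open>l\<close> is large depending
  on \<open>n\<close>.\<close>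

lemma sum_bad_le:
  assumes n: "1 \<le> n" and l: "1 \<le> l"
  shows "(\<Sum>i<I. \<Sum>j<J. pr (bad n l m (l * i) (m + l * j))) \<le>
    real (n + 3) * ((real l)\<^sup>2 * ((real (l * I) + real (l * J)) / gam / (b1 * b2) ^ (2 * l)) + real I * real J * (2 * (real n)\<^sup>2 / real l))"
    (is "_ \<le> real (n + 3) * ?R")
proof -
  define Y where "Y = (real (l * I) + real (l * J)) / gam / (b1 * b2) ^ (2 * l)"
  have Y0: "0 \<le> Y" unfolding Y_def using gam_pos b1 b2 by simp
  have "(\<Sum>i<I. \<Sum>j<J. pr (bad n l m (l * i) (m + l * j))) \<le>
    (\<Sum>i<I. \<Sum>j<J. \<Sum>k\<in>grid n. (\<Sum>a<l. \<Sum>b<l. pr (oppk k m (l * i) (m + l * j) a b)) + 2 * (real n)\<^sup>2 / real l)"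
    by (intro sum_mono pr_bad_le n l)
  also have "\<dots> = (\<Sum>i<I. \<Sum>k\<in>grid n. \<Sum>j<J. (\<Sum>a<l. \<Sum>b<l. pr (oppk k m (l * i) (m + l * j) a b)) + 2 * (real n)\<^sup>2 / real l)"
    by (intro sum.cong refl sum.swap)
  also have "\<dots> = (\<Sum>k\<in>grid n. \<Sum>i<I. \<Sum>j<J. (\<Sum>a<l. \<Sum>b<l. pr (oppk k m (l * i) (m + l * j) a b)) + 2 * (real n)\<^sup>2 / real l)"
    by (rule sum.swap)
  also have "\<dots> \<le> (\<Sum>k\<in>grid n. ?R)"
  proof (rule sum_mono)
    fix k
    have "(\<Sum>i<I. \<Sum>j<J. \<Sum>a<l. \<Sum>b<l. pr (oppk k m (l * i) (m + l * j) a b)) =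
      (\<Sum>i<I. \<Sum>a<l. \<Sum>j<J. \<Sum>b<l. pr (oppk k m (l * i) (m + l * j) a b))"
      by (intro sum.cong refl sum.swap)
    also have "\<dots> = (\<Sum>i<I. \<Sum>a<l. \<Sum>b<l. \<Sum>j<J. pr (oppk k m (l * i) (m + l * j) a b))"
      by (intro sum.cong refl sum.swap)
    also have "\<dots> = (\<Sum>a<l. \<Sum>i<I. \<Sum>b<l. \<Sum>j<J. pr (oppk k m (l * i) (m + l * j) a b))"
      by (rule sum.swap)
    also have "\<dots> = (\<Sum>a<l. \<Sum>b<l. \<Sum>i<I. \<Sum>j<J. pr (oppk k m (l * i) (m + l * j) a b))"
      by (intro sum.cong refl sum.swap)
    also have "\<dots> \<le> (\<Sum>a<l. \<Sum>b<l. Y)"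
      unfolding Y_def by (intro sum_mono sum_oppk_le) auto
    also have "\<dots> = (real l)\<^sup>2 * Y" by (simp add: power2_eq_square)
    finally show "(\<Sum>i<I. \<Sum>j<J. (\<Sum>a<l. \<Sum>b<l. pr (oppk k m (l * i) (m + l * j) a b)) + 2 * (real n)\<^sup>2 / real l) \<le> ?R"
      unfolding Y_def[symmetric] by (simp add: sum.distrib)
  qed
  also have "\<dots> = real (card (grid n)) * ?R" by simp
  also have "\<dots> \<le> real (n + 3) * ?R"
  proof (rule mult_right_mono)
    show "real (card (grid n)) \<le> real (n + 3)" using card_grid[of n] by (rule of_nat_mono)
    show "0 \<le> ?R" using Y0 unfolding Y_def[symmetric] by simp
  qed
  finally show ?thesis .
qed

text \<open>The defect of the averaged flux inequality for the block (i, j); \<open>S\<close> bounds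
  the slope and \<open>C0\<close> the constant term of the affine comparison.\<close>

definition err :: "nat \<Rightarrow> nat \<Rightarrow> real \<Rightarrow> real \<Rightarrow> nat \<Rightarrow> nat \<Rightarrow> nat \<Rightarrow> real" where
  "err n l S C0 m i j = (3 * \<kappa> + 1 + S) / real n + (1 + C0 + S) * pr (bad n l m (l * i) (m + l * j))"

text \<open>The constants are chosen one after the other, each taking a third of the error:
  \<open>n\<close> for the discretisation, \<open>l\<close> for Chebyshev, \<open>I0\<close> for
  perimeter against area. None of them depends on \<open>m\<close>.\<close>

lemma sum_err_small:
  assumes "0 < \<eta>" "0 \<le> S" "0 \<le> C0"
  obtains n l I0 where "1 \<le> n" "1 \<le> l" "1 \<le> I0"
    "\<And>m I J. I0 \<le> I \<Longrightarrow> I0 \<le> J \<Longrightarrow> (\<Sum>i<I. \<Sum>j<J. err n l S C0 m i j) \<le> \<eta> * real I * real J"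
proof -
  define n where "n = nat \<lceil>3 * (3 * \<kappa> + 1 + S) / \<eta>\<rceil> + 1"
  have n: "1 \<le> n" "3 * (3 * \<kappa> + 1 + S) / \<eta> \<le> real n" unfolding n_def by (simp, linarith)
  then have n3: "(3 * \<kappa> + 1 + S) / real n \<le> \<eta> / 3" using assms by (simp add: field_simps)
  define W where "W = (1 + C0 + S) * real (n + 3)"
  have W0: "0 \<le> W" unfolding W_def using assms by simp
  define l where "l = nat \<lceil>3 * W * (2 * (real n)\<^sup>2) / \<eta>\<rceil> + 1"
  have l: "1 \<le> l" "3 * W * (2 * (real n)\<^sup>2) / \<eta> \<le> real l" unfolding l_def by (simp, linarith)
  then have l3: "W * (2 * (real n)\<^sup>2 / real l) \<le> \<eta> / 3" using assms by (simp add: field_simps)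
  define Kc where "Kc = W * ((real l)\<^sup>2 * (real l / gam / (b1 * b2) ^ (2 * l)))"
  have Kc0: "0 \<le> Kc" unfolding Kc_def using W0 gam_pos b1 b2 by simp
  define I0 where "I0 = nat \<lceil>6 * Kc / \<eta>\<rceil> + 1"
  have I0: "1 \<le> I0" "6 * Kc / \<eta> \<le> real I0" unfolding I0_def by (simp, linarith)
  then have I3: "Kc \<le> \<eta> / 6 * real I0" using assms by (simp add: field_simps)
  show ?thesis
  proof (rule that[OF n(1) l(1) I0(1)])
    fix m I J assume IJ: "I0 \<le> I" "I0 \<le> J"
    have "(\<Sum>i<I. \<Sum>j<J. err n l S C0 m i j) = real I * real J * ((3 * \<kappa> + 1 + S) / real n) +
        (1 + C0 + S) * (\<Sum>i<I. \<Sum>j<J. pr (bad n l m (l * i) (m + l * j)))"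
      unfolding err_def by (simp add: sum.distrib sum_distrib_left)
    also have "\<dots> \<le> real I * real J * (\<eta> / 3) + (1 + C0 + S) * (real (n + 3) *
        ((real l)\<^sup>2 * ((real (l * I) + real (l * J)) / gam / (b1 * b2) ^ (2 * l)) + real I * real J * (2 * (real n)\<^sup>2 / real l)))"
      using assms n3 by (intro add_mono mult_left_mono sum_bad_le n(1) l(1)) auto
    also have "\<dots> = real I * real J * (\<eta> / 3) + (Kc * (real I + real J) + real I * real J * (W * (2 * (real n)\<^sup>2 / real l)))"
    proof -
      have e: "(real (l * I) + real (l * J)) / gam / (b1 * b2) ^ (2 * l) = real l / gam / (b1 * b2) ^ (2 * l) * (real I + real J)"
        by (simp add: distrib_left add_divide_distrib)
      have alg: "a * (b * (c * (z * s) + ij * q)) = a * b * (c * z) * s + ij * (a * b * q)" for a b c z s ij q :: real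
        by (simp add: algebra_simps)
      show ?thesis unfolding Kc_def W_def e by (simp only: alg)
    qed
    also have "\<dots> \<le> real I * real J * (\<eta> / 3) + (\<eta> / 3 * real I * real J + real I * real J * (\<eta> / 3))"
    proof (intro add_mono mult_left_mono l3)
      have "Kc * real I \<le> \<eta> / 6 * real J * real I" "Kc * real J \<le> \<eta> / 6 * real I * real J"
        using IJ assms(1) by (intro mult_right_mono order_trans[OF I3] mult_left_mono; simp)+
      then show "Kc * (real I + real J) \<le> \<eta> / 3 * real I * real J"
        by (simp add: distrib_left mult_ac)
    qed auto
    also have "\<dots> = \<eta> * real I * real J" by simp
    finally show "(\<Sum>i<I. \<Sum>j<J. err n l S C0 m i j) \<le> \<eta> * real I * real J" .
  qed
qed

end

section \<open>The hydrodynamic limit of the height\<close>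

text \<open>Passes from a sum over the block corners of the last full block row to the single point
  (N, x). The sum forces \<open>b j\<close> \<le> \<beta> / 2 * I at a corner just right of
  \<open>x\<close>; moving from there to (N, x) costs 2 l, absorbed by the other half of \<beta>.
  The lower bound on \<open>L\<close> leaves room to the right for a slowly decreasing stretch
  starting from a value up to \<open>I\<close>.\<close>

lemma lattice_bound_extends:
  fixes W :: "nat \<Rightarrow> nat \<Rightarrow> real" and l L N x :: nat
  assumes l: "1 \<le> l" and L: "2 * C + 4 \<le> real L" and C: "0 \<le> C"
    and step: "\<And>I j. l * I \<le> N \<Longrightarrow> N < l * I + l \<Longrightarrow> x \<le> l * j \<Longrightarrow> l * j \<le> x + l \<Longrightarrow>
        W N x \<le> W (l * I) (l * j) + 2 * real l"
    and nonneg: "\<And>t x. 0 \<le> W t x" and slow: "\<And>t x. W t x - real l \<le> W t (x + l)"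
    and ub: "\<And>t x. W t x \<le> real t"
    and sum: "(\<Sum>j\<in>{1..<L * (N div l)}. W (l * (N div l)) (l * j) / real l) \<le> \<beta>\<^sup>2 / 16 * (real (N div l))\<^sup>2"
    and N: "l \<le> N" "4 * real l \<le> \<beta> * real N" "real x \<le> C * real N" and \<beta>: "0 < \<beta>"
  shows "W N x \<le> \<beta> * real N"
proof -
  define I where "I = N div l"
  define j where "j = x div l + 1"
  define b where "b = (\<lambda>j. W (l * I) (l * j) / real l)"
  have l0: "0 < l" using l by simp
  have I: "l * I \<le> N" "N < l * I + l" using l0 dividend_less_div_times[OF l0, of N] by (auto simp: I_def mult.commute)
  have I1: "1 \<le> I" using N(1) l0 by (simp add: I_def div_greater_zero_iff Suc_le_eq)
  have j: "x \<le> l * j" "l * j \<le> x + l" "1 \<le> j"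
    using dividend_less_div_times[OF l0, of x] by (auto simp: j_def mult.commute)
  have bI: "b j \<le> real I" for j using ub[of "l * I" "l * j"] l0 by (simp add: b_def divide_le_eq mult.commute)
  have "real l * real j \<le> C * real N + real l" using j(2) N(3) by (metis (mono_tags) add_mono le_refl of_nat_add of_nat_le_iff of_nat_mult order_trans)
  also have "real N \<le> real l * (real I + 1)" using I(2) by (metis (mono_tags) distrib_left less_imp_le mult.right_neutral of_nat_add of_nat_le_iff of_nat_mult of_nat_1)
  then have "C * real N \<le> C * (real l * (real I + 1))" using C by (rule mult_left_mono)
  finally have "real l * real j \<le> real l * (C * (real I + 1) + 1)" by (simp add: algebra_simps)
  then have "real j \<le> C * (real I + 1) + 1" using l0 by simp
  then have "real j + real I + 1 \<le> C * (real I + 1) + 1 + real I + 1" by simp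
  also have "\<dots> \<le> (2 * C + 4) * real I"
  proof -
    have "C * 1 \<le> C * real I" using C I1 by (intro mult_left_mono) auto
    then show ?thesis using I1 by (simp add: algebra_simps)
  qed
  also have "\<dots> \<le> real L * real I" using L by (intro mult_right_mono) auto
  finally have jL: "real j + real I + 1 \<le> real (L * I)" by simp
  have "(b j)\<^sup>2 / 4 \<le> (\<Sum>j\<in>{1..<L * I}. b j)"
  proof (rule slowly_decreasing_sum_bound)
    show "b j' - 1 \<le> b (Suc j')" for j'
      using divide_right_mono[OF slow[of "l * I" "l * j'"], of "real l"] l0
      by (simp add: b_def diff_divide_distrib add.commute)
    show "real j + b j + 1 \<le> real (L * I)" using bI[of j] jL by linarith
  qed (use nonneg l0 j(3) in \<open>auto simp: b_def\<close>)
  also have "\<dots> \<le> \<beta>\<^sup>2 / 16 * (real I)\<^sup>2" using sum by (simp add: b_def I_def)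
  finally have "(b j)\<^sup>2 \<le> (\<beta> / 2 * real I)\<^sup>2" by (simp add: power_mult_distrib power_divide)
  then have "b j \<le> \<beta> / 2 * real I" by (rule power2_le_imp_le) (use \<beta> in simp)
  then have "W (l * I) (l * j) \<le> \<beta> / 2 * (real l * real I)" using l0 by (simp add: b_def divide_le_eq mult_ac)
  also have "\<dots> \<le> \<beta> / 2 * real N" using I(1) \<beta> by (intro mult_left_mono) (auto simp flip: of_nat_mult)
  finally show ?thesis using step[OF I j(1,2)] N(2) by simp
qed

context riemann_problem
begin

section \<open>Rarefaction fan: upper bound for the mean height\<close>

text \<open>The Legendre (Hopf-Lax) formula for the height of the rarefaction wave, as envelope of
  the mean stationary heights of intermediate densities.\<close>

definition fan :: "real \<Rightarrow> real \<Rightarrow> real" where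
  "fan t x = Sup ((\<lambda>k. f k * t - k * x) ` {\<rho>..\<theta>})"

lemma fan_attained:
  assumes "\<rho> \<le> \<theta>"
  obtains k where "\<rho> \<le> k" "k \<le> \<theta>" "fan t x = f k * t - k * x" "\<And>k'. \<rho> \<le> k' \<Longrightarrow> k' \<le> \<theta> \<Longrightarrow> f k' * t - k' * x \<le> f k * t - k * x"
proof -
  have D: "(\<kappa> - 1) * k + 1 \<noteq> 0" if "\<rho> \<le> k" for k
    using that rho kappa_gt_1 by (smt (verit) mult_nonneg_nonneg)
  have "continuous_on {\<rho>..\<theta>} (\<lambda>k. f k * t - k * x)"
    unfolding f_eq by (intro continuous_intros) (use D in auto)
  then obtain k where k: "k \<in> {\<rho>..\<theta>}" "\<forall>y\<in>{\<rho>..\<theta>}. f y * t - y * x \<le> f k * t - k * x"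
    using continuous_attains_sup[of "{\<rho>..\<theta>}" "\<lambda>k. f k * t - k * x"] assms by auto
  have "fan t x = f k * t - k * x" unfolding fan_def
    using k by (intro cSup_eq_maximum) auto
  then show ?thesis using k that by auto
qed

lemma fan_ge:
  assumes "\<rho> \<le> k" "k \<le> \<theta>"
  shows "f k * t - k * x \<le> fan t x"
proof -
  have "\<rho> \<le> \<theta>" using assms by simp
  from fan_attained[OF this, of t x] assms show ?thesis by metis
qed

lemma fan_scale:
  assumes "\<rho> \<le> \<theta>" "0 < c"
  shows "fan (c * t) (c * x) = c * fan t x"
proof -
  obtain k where k: "\<rho> \<le> k" "k \<le> \<theta>" "fan t x = f k * t - k * x" "\<And>k'. \<rho> \<le> k' \<Longrightarrow> k' \<le> \<theta> \<Longrightarrow> f k' * t - k' * x \<le> f k * t - k * x"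
    using fan_attained[OF assms(1), of t x] by metis
  obtain k' where k': "\<rho> \<le> k'" "k' \<le> \<theta>" "fan (c * t) (c * x) = f k' * (c * t) - k' * (c * x)"
    using fan_attained[OF assms(1), of "c * t" "c * x"] by metis
  have "fan (c * t) (c * x) = c * (f k' * t - k' * x)" using k'(3) by (simp add: algebra_simps)
  also have "\<dots> \<le> c * fan t x" using k k' assms by (intro mult_left_mono) auto
  finally have "fan (c * t) (c * x) \<le> c * fan t x" .
  moreover have "c * fan t x \<le> fan (c * t) (c * x)"
    using fan_ge[OF k(1,2), of "c * t" "c * x"] unfolding k(3) by (simp add: algebra_simps)
  ultimately show ?thesis by simp
qed

text \<open>The excess of the mean height over the fan is transported along the rays of the fan,
  because the supporting line of \<open>f\<close> at the local maximiser bounds the flux from above.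
  The weighted Gronwall lemma then sums the defects.\<close>

lemma fan_upper:
  assumes le: "\<rho> \<le> \<theta>" and \<beta>: "0 < \<beta>" and C: "0 \<le> C"
  shows "\<exists>N0. \<forall>N\<ge>N0. \<forall>m x. real x \<le> C * real N \<longrightarrow> av m N x - fan (real N) (real x) \<le> \<beta> * real N"
proof -
  \<comment> \<open>Ratio of the width to the height of the region. For rays faster than \<kappa>
    the fan is the plane of density \<rho>, and \<open>real i + i0\<close> can be as large as 2 I,
    hence 2 * \<kappa>; the rest is the room asked for by
    \<open>lattice_bound_extends\<close>.\<close>
  define L where "L = nat \<lceil>2 * C + 2 * \<kappa> + 4\<rceil>"
  have L: "2 * C + 2 * \<kappa> + 4 \<le> real L" unfolding L_def using C kappa_gt_1 by linarith
  then have L0: "0 < real L" "2 * C + 4 \<le> real L" "2 * \<kappa> \<le> real L" using C kappa_gt_1 by linarith+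
  \<comment> \<open>Relative size of the shift of the apex. Its cost in the row sum takes one half
    of \<beta>^2 / 16, and the defects, through \<eta>, take the other half.\<close>
  define \<epsilon>0 where "\<epsilon>0 = min 1 (\<beta>\<^sup>2 / (32 * real L))"
  have \<epsilon>0: "0 < \<epsilon>0" "\<epsilon>0 \<le> 1" "\<epsilon>0 * real L \<le> \<beta>\<^sup>2 / 32"
    using \<beta> L0 unfolding \<epsilon>0_def by (auto simp: min_def field_simps)
  define S where "S = real L / \<epsilon>0"
  have S0: "0 \<le> S" unfolding S_def using L0 \<epsilon>0 by simp
  define \<eta> where "\<eta> = \<beta>\<^sup>2 / 32 / ((1 + 1 / \<epsilon>0) * real L)"
  have \<eta>: "0 < \<eta>" unfolding \<eta>_def using \<beta> \<epsilon>0 L0 by (intro divide_pos_pos mult_pos_pos add_pos_pos) auto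
  have \<eta>': "(1 + 1 / \<epsilon>0) * (\<eta> * real L) = \<beta>\<^sup>2 / 32"
  proof -
    have "0 < (1 + 1 / \<epsilon>0) * real L" using \<epsilon>0 L0 by (intro mult_pos_pos add_pos_pos) auto
    then have "\<eta> * ((1 + 1 / \<epsilon>0) * real L) = \<beta>\<^sup>2 / 32" unfolding \<eta>_def by (metis less_irrefl nonzero_eq_divide_eq)
    then show ?thesis by (simp only: mult_ac)
  qed
  obtain n l I0 where n: "1 \<le> n" and l: "1 \<le> l" and I0: "1 \<le> I0"
    and err: "\<And>m I J. I0 \<le> I \<Longrightarrow> I0 \<le> J \<Longrightarrow> (\<Sum>i<I. \<Sum>j<J. err n l S (S + 1) m i j) \<le> \<eta> * real I * real J"
    using sum_err_small[OF \<eta> S0, of "S + 1"] S0 by auto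
  have l0: "0 < real l" using l by simp
  define N0 where "N0 = max (l * I0) (nat \<lceil>4 * real l / \<beta>\<rceil>)"
  have "av m N x - fan (real N) (real x) \<le> \<beta> * real N" if N: "N0 \<le> N" and x: "real x \<le> C * real N" for N m x
  proof -
    define I where "I = N div l"
    define J where "J = L * I"
    have NI: "l * I0 \<le> N" "4 * real l / \<beta> \<le> real N" using N unfolding N0_def by linarith+
    have I: "I0 \<le> I" unfolding I_def using NI(1) l by (simp add: less_eq_div_iff_mult_less_eq mult.commute)
    then have I1: "1 \<le> I" using I0 by simp
    have L1: "1 \<le> L" using L0 by linarith
    have J: "I0 \<le> J" "1 \<le> J" unfolding J_def using I I1 L1 by (auto intro: order_trans[OF I] simp: Suc_le_eq)
    define i0 where "i0 = \<epsilon>0 * real I"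
    have i0: "0 < i0" unfolding i0_def using \<epsilon>0 I1 by simp
    define A where "A = (\<lambda>i j. av m (l * i) (l * j) / real l)"
    \<comment> \<open>Comparison with a fan whose apex lies \<open>i0\<close> steps in the past,
      lowered by \<open>f \<rho> * i0\<close>. The shift keeps the speeds j / (i + i0) below
      \<open>S\<close>, and the lowered fan still dominates the initial mean height.\<close>
    define B where "B = (\<lambda>i j. A i j - (fan (real i + i0) (real j) - f \<rho> * i0))"
    have step: "B (Suc i) j \<le> B i j + real j / (real i + i0) * (B i j - B i (Suc j)) + err n l S (S + 1) m i j"
      if i: "i < I" and j: "j < J" for i j
    proof -
      define \<tau> where "\<tau> = real i + i0"
      define s where "s = real j / \<tau>"
      have \<tau>: "0 < \<tau>" unfolding \<tau>_def using i0 by simp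
      have "s \<le> real J / i0" unfolding s_def \<tau>_def using i0 j by (intro frac_le) auto
      also have "\<dots> = S" unfolding J_def i0_def S_def using I1 by simp
      finally have s: "0 \<le> s" "s \<le> S" using \<tau> by (auto simp: s_def)
      obtain k where k: "\<rho> \<le> k" "k \<le> \<theta>" "fan \<tau> (real j) = f k * \<tau> - k * real j"
        and kmax: "\<And>k'. \<rho> \<le> k' \<Longrightarrow> k' \<le> \<theta> \<Longrightarrow> f k' * \<tau> - k' * real j \<le> f k * \<tau> - k * real j"
        using fan_attained[OF le, of \<tau> "real j"] by metis
      have k01: "0 \<le> k" "k \<le> 1" using k rho theta by auto
      \<comment> \<open>The line of slope \<open>s\<close> through the maximiser \<open>k\<close>
        supports the graph of \<open>f\<close> from above on the whole interval.\<close>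
      define c where "c = f k - k * s"
      have cmax: "f d \<le> c + s * d" if "\<rho> \<le> d" "d \<le> \<theta>" for d
      proof -
        have "\<tau> * (f d - d * s) \<le> \<tau> * (f k - k * s)"
          using kmax[OF that] \<tau> by (simp add: s_def algebra_simps)
        then have "f d - d * s \<le> f k - k * s" using \<tau> by (rule mult_left_le_imp_le)
        then show ?thesis by (simp add: c_def algebra_simps)
      qed
      have "0 \<le> k * s" "k * s \<le> 1 * S" using k01 s mult_mono[of k 1 s S] by auto
      then have cb: "\<bar>c\<bar> \<le> S + 1" using f_bounds[OF k01] unfolding c_def by auto
      have "1 * ((av m (l * i + l) (l * j) - av m (l * i) (l * j)) / real l) \<le>
          1 * (c + s * ((av m (l * i) (l * j) - av m (l * i) (l * j + l)) / real l))
          + ((3 * \<kappa> + 1 + S) / real n + (1 + (S + 1) + S) * pr (bad n l m (l * i) (m + l * j)))"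
        by (rule flux_inequality[OF _ s cb n l]) (use cmax le in auto)
      then have A: "A (Suc i) j \<le> A i j + c + s * (A i j - A i (Suc j)) + err n l S (S + 1) m i j"
        unfolding A_def err_def by (simp add: add.commute[of l] diff_divide_distrib)
      have "f k * (\<tau> + 1) - k * real j \<le> fan (\<tau> + 1) (real j)" by (rule fan_ge[OF k(1,2)])
      then have F1: "fan \<tau> (real j) + f k \<le> fan (\<tau> + 1) (real j)" unfolding k(3) by (simp add: algebra_simps)
      have "f k * \<tau> - k * (real j + 1) \<le> fan \<tau> (real j + 1)" by (rule fan_ge[OF k(1,2)])
      then have "fan \<tau> (real j) - fan \<tau> (real j + 1) \<le> k" unfolding k(3) by (simp add: algebra_simps)
      then have "s * (fan \<tau> (real j) - fan \<tau> (real j + 1)) \<le> s * k" using s by (intro mult_left_mono) auto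
      then have F: "fan \<tau> (real j) + c + s * (fan \<tau> (real j) - fan \<tau> (real j + 1)) \<le> fan (\<tau> + 1) (real j)"
        using F1 unfolding c_def by (simp add: mult.commute)
      have e: "fan (real (Suc i) + i0) (real j) = fan (\<tau> + 1) (real j)" "fan (real i + i0) (real (Suc j)) = fan \<tau> (real j + 1)"
        by (simp_all add: \<tau>_def add_ac)
      have "B (Suc i) j \<le> B i j + s * (B i j - B i (Suc j)) + err n l S (S + 1) m i j"
        using A F unfolding B_def e \<tau>_def[symmetric] by (simp add: algebra_simps)
      then show ?thesis by (simp add: s_def \<tau>_def)
    qed
    have init: "B 0 j \<le> 0" for j
      using fan_ge[OF order_refl le, of i0 "real j"] l0
      by (simp add: B_def A_def av_initial)
    \<comment> \<open>At the right edge the ray is faster than \<kappa>, so the fan is attained at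
      \<rho> and the exact lower bound \<open>av_fan\<close> at density \<rho> applies.\<close>
    have bnd: "0 \<le> B i J" if "i < I" for i
    proof -
      obtain k where k: "\<rho> \<le> k" "k \<le> \<theta>" "fan (real i + i0) (real J) = f k * (real i + i0) - k * real J"
        using fan_attained[OF le, of "real i + i0" "real J"] by metis
      have "real i + i0 \<le> 2 * real I" using that \<epsilon>0 unfolding i0_def
        by (smt (verit) mult_left_le_one_le mult_nonneg_nonneg of_nat_0_le_iff of_nat_less_iff)
      then have "\<kappa> * (real i + i0) \<le> \<kappa> * (2 * real I)" using kappa_gt_1 by (intro mult_left_mono) auto
      also have "\<dots> \<le> real J" unfolding J_def using L0(3) by (simp add: mult.assoc[symmetric] mult.commute[of \<kappa>] mult_right_mono)
      finally have J': "\<kappa> * (real i + i0) \<le> real J" .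
      have "(f k - f \<rho>) * (real i + i0) \<le> \<kappa> * (k - \<rho>) * (real i + i0)"
        using f_lipschitz[OF rho(1) k(1)] i0 by (intro mult_right_mono) auto
      also have "\<dots> \<le> (k - \<rho>) * real J"
        using mult_left_mono[OF J', of "k - \<rho>"] k(1) by (simp add: mult_ac)
      finally have F: "fan (real i + i0) (real J) - f \<rho> * i0 \<le> f \<rho> * real i - \<rho> * real J"
        unfolding k(3) by (simp add: algebra_simps)
      have "real l * (f \<rho> * real i - \<rho> * real J) \<le> av m (l * i) (l * J)"
        using av_fan[OF order_refl le, of "l * i" "l * J" m] by (simp add: algebra_simps)
      then have "f \<rho> * real i - \<rho> * real J \<le> A i J" unfolding A_def using l0 by (simp add: le_divide_eq mult.commute)
      then show ?thesis using F unfolding B_def by simp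
    qed
    have errnn: "0 \<le> err n l S (S + 1) m i j" for i j
      unfolding err_def using S0 kappa_gt_1 by simp
    have "(\<Sum>j\<in>{1..<J}. B I j) \<le> (real I + i0) / i0 * (\<Sum>i<I. \<Sum>j<J. err n l S (S + 1) m i j)"
      by (rule discrete_gronwall_fan[OF step init bnd i0 errnn J(2)])
    also have "\<dots> \<le> (real I + i0) / i0 * (\<eta> * real I * real J)"
      using err[OF I J(1)] i0 by (intro mult_left_mono) auto
    also have "(real I + i0) / i0 = 1 + 1 / \<epsilon>0" unfolding i0_def using I1 \<epsilon>0 by (simp add: field_simps)
    also have "(1 + 1 / \<epsilon>0) * (\<eta> * real I * real J) = (1 + 1 / \<epsilon>0) * (\<eta> * real L) * (real I)\<^sup>2"
      unfolding J_def by (simp add: power2_eq_square mult_ac)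
    finally have sumB: "(\<Sum>j\<in>{1..<J}. B I j) \<le> \<beta>\<^sup>2 / 32 * (real I)\<^sup>2" unfolding \<eta>' .
    define W where "W = (\<lambda>t x. av m t x - fan (real t) (real x))"
    have Wl: "W (l * I) (l * j) / real l = A I j - fan (real I) (real j)" for j
      unfolding W_def A_def using fan_scale[OF le l0, of "real I" "real j"] l0 by (simp add: diff_divide_distrib)
    have "W N x \<le> \<beta> * real N"
    proof (rule lattice_bound_extends[OF l L0(2) C])
      fix t x
      obtain k where k: "\<rho> \<le> k" "k \<le> \<theta>" "fan (real t) (real x) = f k * real t - k * real x"
        using fan_attained[OF le, of "real t" "real x"] by metis
      show "0 \<le> W t x" using av_fan[OF k(1,2), of t x m] unfolding W_def k(3) by simp
      obtain k' where k': "\<rho> \<le> k'" "k' \<le> \<theta>" "fan (real t) (real (x + l)) = f k' * real t - k' * real (x + l)"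
        using fan_attained[OF le, of "real t" "real (x + l)"] by metis
      have "fan (real t) (real (x + l)) \<le> fan (real t) (real x)"
        using fan_ge[OF k'(1,2), of "real t" "real x"] k'(1) rho unfolding k'(3) by (simp add: algebra_simps)
          (smt (verit) mult_nonneg_nonneg of_nat_0_le_iff)
      then show "W t x - real l \<le> W t (x + l)" unfolding W_def using av_x_bounds(2)[of m t x l] by linarith
      have "av m t x \<le> - \<rho> * real x + real t" using av_t_bounds(2)[of m 0 t x] av_initial[of m x] by simp
      moreover have "- \<rho> * real x \<le> fan (real t) (real x)"
        using fan_ge[OF order_refl le, of "real t" "real x"] f_bounds(1)[OF rho] by (smt (verit) mult_nonneg_nonneg of_nat_0_le_iff mult_minus_left)
      ultimately show "W t x \<le> real t" unfolding W_def by linarith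
    next
      fix I' j assume ij: "l * I' \<le> N" "N < l * I' + l" "x \<le> l * j" "l * j \<le> x + l"
      obtain k where k: "\<rho> \<le> k" "k \<le> \<theta>" "fan (real (l * I')) (real (l * j)) = f k * real (l * I') - k * real (l * j)"
        using fan_attained[OF le, of "real (l * I')" "real (l * j)"] by metis
      have k01: "0 \<le> k" "k \<le> 1" using k rho theta by auto
      have "f k * real (l * I') \<le> f k * real N" "k * real x \<le> k * real (l * j)"
        using ij(1,3) f_bounds[OF k01] k01 by (intro mult_left_mono; simp del: of_nat_mult)+
      then have "fan (real (l * I')) (real (l * j)) \<le> fan (real N) (real x)"
        using fan_ge[OF k(1,2), of "real N" "real x"] unfolding k(3) by linarith
      moreover have "real (N - l * I') \<le> real l" "real (l * j - x) \<le> real l" using ij by linarith+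
      then have "av m N x \<le> av m (l * I') x + real l" "av m (l * I') x \<le> av m (l * I') (l * j) + real l"
        using order_trans[OF av_t_bounds(2)[of m "l * I'" "N - l * I'" x]]
          order_trans[OF av_x_bounds(2)[of m "l * I'" x "l * j - x"]] ij by fastforce+
      ultimately show "W N x \<le> W (l * I') (l * j) + 2 * real l" unfolding W_def by linarith
    next
      \<comment> \<open>Moving the apex back costs at most \<open>i0\<close> per corner, as
        \<open>f\<close> takes values in [0, 1].\<close>
      have "(\<Sum>j\<in>{1..<J}. W (l * I) (l * j) / real l) \<le> (\<Sum>j\<in>{1..<J}. B I j + i0)"
      proof (rule sum_mono)
        fix j
        obtain k where k: "\<rho> \<le> k" "k \<le> \<theta>" "fan (real I + i0) (real j) = f k * (real I + i0) - k * real j"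
          using fan_attained[OF le, of "real I + i0" "real j"] by metis
        have k01: "0 \<le> k" "k \<le> 1" using k rho theta by auto
        have "(f k - f \<rho>) * i0 \<le> 1 * i0" using f_bounds[OF k01] f_bounds[OF rho] i0 by (intro mult_right_mono) auto
        then have "fan (real I + i0) (real j) - f \<rho> * i0 \<le> fan (real I) (real j) + i0"
          using fan_ge[OF k(1,2), of "real I" "real j"] unfolding k(3) by (simp add: algebra_simps)
        then show "W (l * I) (l * j) / real l \<le> B I j + i0" unfolding Wl B_def by linarith
      qed
      also have "\<dots> \<le> \<beta>\<^sup>2 / 32 * (real I)\<^sup>2 + real J * i0"
      proof -
        have "real (J - 1) * i0 \<le> real J * i0" using i0 by (intro mult_right_mono) auto
        then show ?thesis using sumB by (simp add: sum.distrib)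
      qed
      also have "real J * i0 = \<epsilon>0 * real L * (real I)\<^sup>2" unfolding J_def i0_def by (simp add: power2_eq_square)
      also have "\<dots> \<le> \<beta>\<^sup>2 / 32 * (real I)\<^sup>2" using \<epsilon>0(3) by (rule mult_right_mono) simp
      finally show "(\<Sum>j\<in>{1..<L * (N div l)}. W (l * (N div l)) (l * j) / real l) \<le> \<beta>\<^sup>2 / 16 * (real (N div l))\<^sup>2"
        unfolding I_def J_def by simp
      have "l * 1 \<le> l * I0" using I0 by (intro mult_le_mono2)
      then show "l \<le> N" using order_trans[OF _ NI(1), of "l * 1"] by (simp only: mult_1_right)
      show "4 * real l \<le> \<beta> * real N" using NI(2) \<beta> by (simp add: field_simps)
    qed (use x \<beta> in auto)
    then show ?thesis unfolding W_def .
  qed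
  then show ?thesis by blast
qed

section \<open>Shock: lower bound for the mean height\<close>

text \<open>The lower envelope of the two outer planes; they cross along x = speed * t.\<close>

definition shock :: "real \<Rightarrow> real \<Rightarrow> real" where
  "shock t x = min (f \<theta> * t - \<theta> * x) (f \<rho> * t - \<rho> * x)"

text \<open>The Rankine-Hugoniot speed.\<close>

definition speed :: real where "speed = (f \<rho> - f \<theta>) / (\<rho> - \<theta>)"

lemma speed_bounds:
  assumes "\<theta> < \<rho>"
  shows "0 \<le> speed" "speed \<le> \<kappa>"
  using f_lipschitz[of \<theta> \<rho>] assms theta by (auto simp: speed_def divide_le_eq)

lemma speed_rho: "\<theta> < \<rho> \<Longrightarrow> f \<rho> = f \<theta> - speed * \<theta> + speed * \<rho>"
proof -
  assume "\<theta> < \<rho>"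
  then have "speed * (\<rho> - \<theta>) = f \<rho> - f \<theta>" by (simp add: speed_def)
  then show ?thesis by (simp add: algebra_simps)
qed

text \<open>Concavity of \<open>f\<close>: by \<open>f_diff\<close> the slope of the chord from
  \<theta> decreases in its right endpoint.\<close>

lemma f_above_chord:
  assumes "\<theta> < \<rho>" "\<theta> \<le> d" "d \<le> \<rho>"
  shows "f \<theta> - speed * \<theta> + speed * d \<le> f d"
proof -
  have D: "1 \<le> (\<kappa> - 1) * z + 1" if "0 \<le> z" for z using that kappa_gt_1 by auto
  have "speed = \<kappa> / (((\<kappa> - 1) * \<theta> + 1) * ((\<kappa> - 1) * \<rho> + 1))"
    unfolding speed_def using f_diff[OF theta(1) rho(1)] assms(1) by simp
  also have "\<dots> \<le> \<kappa> / (((\<kappa> - 1) * \<theta> + 1) * ((\<kappa> - 1) * d + 1))"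
    using assms theta rho kappa_gt_1
    by (intro divide_left_mono mult_left_mono mult_pos_pos add_right_mono order_less_le_trans[OF zero_less_one D]) auto
  finally have "speed * (d - \<theta>) \<le> \<kappa> / (((\<kappa> - 1) * \<theta> + 1) * ((\<kappa> - 1) * d + 1)) * (d - \<theta>)"
    using assms by (intro mult_right_mono) auto
  also have "\<dots> = f d - f \<theta>" using f_diff[of \<theta> d] theta assms by simp
  finally show ?thesis by (simp add: algebra_simps)
qed

lemma shock_scale: "0 < c \<Longrightarrow> shock (c * t) (c * x) = c * shock t x"
  unfolding shock_def by (simp add: min_mult_distrib_left algebra_simps)

text \<open>The transport speed is the constant shock speed, so the comparison starts at time 0
  without a shifted apex. The exact inequality \<open>av_shock\<close> makes the deficit
  \<open>B\<close> nonnegative, which is also the boundary condition at \<open>J\<close>.\<close>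

lemma shock_lower:
  assumes less: "\<theta> < \<rho>" and \<beta>: "0 < \<beta>" and C: "0 \<le> C"
  shows "\<exists>N0. \<forall>N\<ge>N0. \<forall>m x. real x \<le> C * real N \<longrightarrow> shock (real N) (real x) - av m N x \<le> \<beta> * real N"
proof -
  define L where "L = nat \<lceil>2 * C + 4\<rceil>"
  have L: "2 * C + 4 \<le> real L" unfolding L_def using C by linarith
  then have L0: "0 < real L" using C by linarith
  define \<eta> where "\<eta> = \<beta>\<^sup>2 / 16 / real L"
  have \<eta>: "0 < \<eta>" unfolding \<eta>_def using \<beta> L0 by simp
  define c where "c = f \<theta> - speed * \<theta>"
  note sp = speed_bounds[OF less]
  have "0 \<le> speed * \<theta>" "speed * \<theta> \<le> \<kappa> * 1"
    using sp theta mult_mono[of speed \<kappa> \<theta> 1] by auto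
  then have cb: "\<bar>c\<bar> \<le> \<kappa> + 1" unfolding c_def using f_bounds[OF theta] by auto
  have k0: "0 \<le> \<kappa>" using kappa_gt_1 by simp
  obtain n l I0 where n: "1 \<le> n" and l: "1 \<le> l" and I0: "1 \<le> I0"
    and err: "\<And>m I J. I0 \<le> I \<Longrightarrow> I0 \<le> J \<Longrightarrow> (\<Sum>i<I. \<Sum>j<J. err n l \<kappa> (\<kappa> + 1) m i j) \<le> \<eta> * real I * real J"
    using sum_err_small[OF \<eta> k0, of "\<kappa> + 1"] k0 by auto
  have l0: "0 < real l" using l by simp
  define N0 where "N0 = max (l * I0) (nat \<lceil>4 * real l / \<beta>\<rceil>)"
  have "shock (real N) (real x) - av m N x \<le> \<beta> * real N" if N: "N0 \<le> N" and x: "real x \<le> C * real N" for N m x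
  proof -
    define I where "I = N div l"
    define J where "J = L * I"
    have NI: "l * I0 \<le> N" "4 * real l / \<beta> \<le> real N" using N unfolding N0_def by linarith+
    have I: "I0 \<le> I" unfolding I_def using NI(1) l by (simp add: less_eq_div_iff_mult_less_eq mult.commute)
    then have I1: "1 \<le> I" using I0 by simp
    have L1: "1 \<le> L" using L0 by linarith
    have J: "I0 \<le> J" "1 \<le> J" unfolding J_def using I I1 L1 by (auto intro: order_trans[OF I] simp: Suc_le_eq)
    define W where "W = (\<lambda>t x. shock (real t) (real x) - av m t x)"
    define A where "A = (\<lambda>i j. av m (l * i) (l * j) / real l)"
    define B where "B = (\<lambda>i j. shock (real i) (real j) - A i j)"
    have Wl: "W (l * i) (l * j) / real l = B i j" for i j
      unfolding W_def A_def B_def using shock_scale[OF l0, of "real i" "real j"] l0 by (simp add: diff_divide_distrib)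
    have Wnn: "0 \<le> W t x" for t x
      using av_shock[OF order_refl less_imp_le[OF less], of m t x] av_shock[OF less_imp_le[OF less] order_refl, of m t x]
      unfolding W_def shock_def by simp
    have Bnn: "0 \<le> B i j" for i j using Wnn[of "l * i" "l * j"] Wl[of i j] l0 by (metis divide_nonneg_pos)
    have step: "B (Suc i) j \<le> B i j + speed * (B i j - B i (Suc j)) + err n l \<kappa> (\<kappa> + 1) m i j" for i j
    proof -
      have "- 1 * ((av m (l * i + l) (l * j) - av m (l * i) (l * j)) / real l) \<le>
          - 1 * (c + speed * ((av m (l * i) (l * j) - av m (l * i) (l * j + l)) / real l))
          + ((3 * \<kappa> + 1 + \<kappa>) / real n + (1 + (\<kappa> + 1) + \<kappa>) * pr (bad n l m (l * i) (m + l * j)))"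
      proof (rule flux_inequality[OF _ sp cb n l])
        show "- 1 * f d \<le> - 1 * (c + speed * d)" if "min \<theta> \<rho> \<le> d" "d \<le> max \<theta> \<rho>" for d
          using f_above_chord[OF less, of d] less that by (simp add: c_def)
      qed simp
      then have A: "A i j + c + speed * (A i j - A i (Suc j)) - err n l \<kappa> (\<kappa> + 1) m i j \<le> A (Suc i) j"
        unfolding A_def err_def by (simp add: add.commute[of l] diff_divide_distrib)
      let ?P1 = "\<lambda>t x. f \<theta> * t - \<theta> * x" and ?P2 = "\<lambda>t x. f \<rho> * t - \<rho> * x"
      \<comment> \<open>Both planes solve the same linear difference equation with constant
        \<open>c\<close>; for the plane of \<rho> this is the Rankine-Hugoniot relation. Their
        minimum is therefore a subsolution.\<close>
      have P1: "?P1 (t + 1) x = (1 + speed) * ?P1 t x + c - speed * ?P1 t (x + 1)" for t x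
        unfolding c_def by (simp add: algebra_simps)
      have P2: "?P2 (t + 1) x = (1 + speed) * ?P2 t x + c - speed * ?P2 t (x + 1)" for t x
        unfolding c_def using speed_rho[OF less] by (simp add: algebra_simps)
      have "speed * shock (real i) (real j + 1) \<le> speed * ?P1 (real i) (real j + 1)"
        "speed * shock (real i) (real j + 1) \<le> speed * ?P2 (real i) (real j + 1)"
        using sp by (intro mult_left_mono; simp add: shock_def)+
      then have "shock (real i + 1) (real j) \<le> (1 + speed) * shock (real i) (real j) + c - speed * shock (real i) (real j + 1)"
        using P1[of "real i" "real j"] P2[of "real i" "real j"] unfolding shock_def[of "real i + 1"] shock_def[of _ "real j"]
        by (smt (verit, best) min_def)
      then show ?thesis using A unfolding B_def by (simp add: algebra_simps)
    qed
    have "(\<Sum>j<J. B I j) \<le> (\<Sum>i<I. \<Sum>j<J. err n l \<kappa> (\<kappa> + 1) m i j)"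
    proof (rule discrete_gronwall_shock[where B=B and s=speed])
      show "B (Suc i) j \<le> B i j + speed * (B i j - B i (Suc j)) + err n l \<kappa> (\<kappa> + 1) m i j" for i j by (rule step)
      show "0 \<le> B i J" for i by (rule Bnn)
      show "0 \<le> speed" by (rule sp(1))
      show "B 0 j \<le> 0" for j using l0 by (simp add: B_def A_def av_initial shock_def)
      show "B i 0 \<le> 0" for i using l0 by (simp add: B_def A_def av_origin shock_def)
    qed
    also have "\<dots> \<le> \<eta> * real I * real J" by (rule err[OF I J(1)])
    also have "\<dots> = \<beta>\<^sup>2 / 16 * (real I)\<^sup>2" unfolding \<eta>_def J_def using L0 by (simp add: power2_eq_square)
    finally have sumB: "(\<Sum>j<J. B I j) \<le> \<beta>\<^sup>2 / 16 * (real I)\<^sup>2" .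
    have mono: "a * real (y::nat) \<le> real y" "0 \<le> a * real y" if "0 \<le> a" "a \<le> 1" for a y
      using that by (auto simp: mult_left_le_one_le)
    have "W N x \<le> \<beta> * real N"
    proof (rule lattice_bound_extends[OF l L C])
      fix t x
      show "0 \<le> W t x" by (rule Wnn)
      have "shock (real t) (real x) - real l \<le> shock (real t) (real (x + l))"
        using mono(1)[OF theta, of l] mono(1)[OF rho, of l] unfolding shock_def by (simp add: algebra_simps min_def)
      then show "W t x - real l \<le> W t (x + l)" unfolding W_def using av_x_bounds(1)[of m t x l] by linarith
      have "- \<rho> * real x \<le> av m t x" using av_t_bounds(1)[of m 0 t x] av_initial[of m x] by simp
      moreover have "shock (real t) (real x) \<le> real t - \<rho> * real x"
        using mono(1)[OF f_bounds[OF rho], of t] unfolding shock_def by (simp add: min_def)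
      ultimately show "W t x \<le> real t" unfolding W_def by simp
    next
      fix I' j assume ij: "l * I' \<le> N" "N < l * I' + l" "x \<le> l * j" "l * j \<le> x + l"
      have "a * real N \<le> a * real (l * I') + real l" "b * real (l * j) \<le> b * real x + real l"
        if "0 \<le> a" "a \<le> 1" "0 \<le> b" "b \<le> 1" for a b
      proof -
        have "a * real (N - l * I') \<le> real (N - l * I')" "b * real (l * j - x) \<le> real (l * j - x)"
          using mono that by blast+
        then show "a * real N \<le> a * real (l * I') + real l" "b * real (l * j) \<le> b * real x + real l"
          using ij by (simp_all add: of_nat_diff right_diff_distrib del: of_nat_mult)
      qed
      from this[OF f_bounds[OF theta] theta] this[OF f_bounds[OF rho] rho]
      have "shock (real N) (real x) \<le> shock (real (l * I')) (real (l * j)) + 2 * real l"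
        unfolding shock_def by (simp add: min_def del: of_nat_mult)
      moreover have "av m (l * I') x \<le> av m N x"
        using av_t_bounds(1)[of m "l * I'" "N - l * I'" x] ij by simp
      moreover have "av m (l * I') (l * j) \<le> av m (l * I') x"
        using av_x_bounds(1)[of m "l * I'" x "l * j - x"] ij by simp
      ultimately show "W N x \<le> W (l * I') (l * j) + 2 * real l" unfolding W_def by linarith
    next
      have "(\<Sum>j\<in>{1..<J}. B I j) \<le> (\<Sum>j<J. B I j)" using Bnn by (intro sum_mono2) auto
      then show "(\<Sum>j\<in>{1..<L * (N div l)}. W (l * (N div l)) (l * j) / real l) \<le> \<beta>\<^sup>2 / 16 * (real (N div l))\<^sup>2"
        using sumB unfolding Wl I_def J_def by simp
      have "l * 1 \<le> l * I0" using I0 by (intro mult_le_mono2)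
      then show "l \<le> N" using order_trans[OF _ NI(1), of "l * 1"] by (simp only: mult_1_right)
      show "4 * real l \<le> \<beta> * real N" using NI(2) \<beta> by (simp add: field_simps)
    qed (use x \<beta> in auto)
    then show ?thesis unfolding W_def .
  qed
  then show ?thesis by blast
qed

section \<open>L1 convergence of the height\<close>

definition prof :: "real \<Rightarrow> real \<Rightarrow> real" where
  "prof t x = (if \<rho> \<le> \<theta> then fan t x else shock t x)"

lemma prof_scale: "0 < c \<Longrightarrow> prof (c * t) (c * x) = c * prof t x"
  by (simp add: prof_def fan_scale shock_scale)

text \<open>Pathwise, the part of X - h of the wrong sign is at most |Y - h|; it has to be added
  twice to turn the signed difference into the absolute value.\<close>

lemma expectation_abs_one_sided:
  fixes h :: real
  assumes "integrable PM X" "integrable PM Y" "\<sigma> = 1 \<or> \<sigma> = (-1::real)" "\<And>\<omega>. \<sigma> * Y \<omega> \<le> \<sigma> * X \<omega>"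
  shows "expectation (\<lambda>\<omega>. \<bar>X \<omega> - h\<bar>) \<le> \<sigma> * (expectation X - h) + 2 * expectation (\<lambda>\<omega>. \<bar>Y \<omega> - h\<bar>)"
proof -
  have "expectation (\<lambda>\<omega>. \<bar>X \<omega> - h\<bar>) \<le> expectation (\<lambda>\<omega>. \<sigma> * (X \<omega> - h) + 2 * \<bar>Y \<omega> - h\<bar>)"
  proof (rule integral_mono)
    fix \<omega> show "\<bar>X \<omega> - h\<bar> \<le> \<sigma> * (X \<omega> - h) + 2 * \<bar>Y \<omega> - h\<bar>"
      using assms(3) assms(4)[of \<omega>] by (auto simp: abs_real_def)
  qed (use assms in auto)
  also have "\<dots> = \<sigma> * (expectation X - h) + 2 * expectation (\<lambda>\<omega>. \<bar>Y \<omega> - h\<bar>)"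
    using assms(1,2) P.prob_space by simp
  finally show ?thesis .
qed

theorem height_hydrodynamics:
  assumes \<beta>: "0 < \<beta>" and C: "0 \<le> C"
  shows "\<exists>N0. \<forall>N\<ge>N0. \<forall>m x. real x \<le> C * real N \<longrightarrow>
    expectation (\<lambda>\<omega>. \<bar>hR m \<omega> N x - prof (real N) (real x)\<bar>) \<le> \<beta> * real N"
proof -
  define \<sigma> :: real where "\<sigma> = (if \<rho> \<le> \<theta> then 1 else -1)"
  have \<sigma>: "\<sigma> = 1 \<or> \<sigma> = -1" by (simp add: \<sigma>_def)
  have "\<exists>N0. \<forall>N\<ge>N0. \<forall>m x. real x \<le> C * real N \<longrightarrow> \<sigma> * (av m N x - prof (real N) (real x)) \<le> \<beta> / 2 * real N"
  proof (cases "\<rho> \<le> \<theta>")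
    case True
    then show ?thesis using fan_upper[OF True, of "\<beta> / 2" C] \<beta> C by (simp add: \<sigma>_def prof_def)
  next
    case False
    then show ?thesis using shock_lower[of "\<beta> / 2" C] \<beta> C by (simp add: \<sigma>_def prof_def)
  qed
  then obtain N0 where N0: "\<And>N m x. N0 \<le> N \<Longrightarrow> real x \<le> C * real N \<Longrightarrow> \<sigma> * (av m N x - prof (real N) (real x)) \<le> \<beta> / 2 * real N"
    by blast
  \<comment> \<open>From this size on the fluctuations of the stationary heights, of order sqrt N,
    stay below half of the allowed error.\<close>
  define N1 where "N1 = nat \<lceil>(4 * (1 + sqrt C) / \<beta>)\<^sup>2\<rceil>"
  have "expectation (\<lambda>\<omega>. \<bar>hR m \<omega> N x - prof (real N) (real x)\<bar>) \<le> \<beta> * real N"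
    if N: "max N0 N1 \<le> N" and x: "real x \<le> C * real N" for N m x
  proof -
    \<comment> \<open>The density whose plane realises the profile at this point; its stationary
      height is the one-sided comparison that concentrates around the same value.\<close>
    obtain k where k: "min \<theta> \<rho> \<le> k" "k \<le> max \<theta> \<rho>" "prof (real N) (real x) = f k * real N - k * real x"
    proof (cases "\<rho> \<le> \<theta>")
      case True
      obtain k where "\<rho> \<le> k" "k \<le> \<theta>" "fan (real N) (real x) = f k * real N - k * real x"
        using fan_attained[OF True, of "real N" "real x"] by metis
      then show ?thesis using True by (intro that[of k]) (auto simp: prof_def)
    next
      case False
      show ?thesis
      proof (cases "f \<theta> * real N - \<theta> * real x \<le> f \<rho> * real N - \<rho> * real x")
        assume "f \<theta> * real N - \<theta> * real x \<le> f \<rho> * real N - \<rho> * real x"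
        then show ?thesis using False by (intro that[of \<theta>]) (auto simp: prof_def shock_def)
      next
        assume "\<not> f \<theta> * real N - \<theta> * real x \<le> f \<rho> * real N - \<rho> * real x"
        then show ?thesis using False by (intro that[of \<rho>]) (auto simp: prof_def shock_def)
      qed
    qed
    have k01: "0 \<le> k" "k \<le> 1" using k theta rho by auto
    have cmp: "\<sigma> * hS k m \<omega> N x \<le> \<sigma> * hR m \<omega> N x" for \<omega>
      using k height_compare_fan[of k m \<omega> N x] height_compare_shock[of k m \<omega> N x] by (auto simp: \<sigma>_def)
    have "expectation (\<lambda>\<omega>. \<bar>hR m \<omega> N x - prof (real N) (real x)\<bar>) \<le>
        \<sigma> * (av m N x - prof (real N) (real x)) + 2 * expectation (\<lambda>\<omega>. \<bar>hS k m \<omega> N x - prof (real N) (real x)\<bar>)"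
      unfolding av_def by (rule expectation_abs_one_sided[OF integrable_height integrable_height \<sigma> cmp])
    also have "\<dots> \<le> \<beta> / 2 * real N + 2 * (sqrt (real N) + sqrt (real x))"
      using N0[of N x m] N x stationary_height[OF k01, of m N x] unfolding k(3) by (intro add_mono mult_left_mono) auto
    also have "sqrt (real x) \<le> sqrt C * sqrt (real N)"
      using x by (simp flip: real_sqrt_mult)
    also have "2 * (sqrt (real N) + sqrt C * sqrt (real N)) \<le> \<beta> / 2 * real N"
    proof -
      have "(4 * (1 + sqrt C) / \<beta>)\<^sup>2 \<le> real N" using N unfolding N1_def by linarith
      then have "4 * (1 + sqrt C) / \<beta> \<le> sqrt (real N)" by (rule real_le_rsqrt)
      then have "4 * (1 + sqrt C) \<le> \<beta> * sqrt (real N)" using \<beta> by (simp add: field_simps)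
      then have "4 * (1 + sqrt C) * sqrt (real N) \<le> \<beta> * sqrt (real N) * sqrt (real N)" by (rule mult_right_mono) simp
      then show ?thesis by (simp add: algebra_simps)
    qed
    finally show ?thesis by simp
  qed
  then show ?thesis by blast
qed

end

section \<open>The entropy solution at time one\<close>

text \<open>The simplest C1 cutoff; one continuous derivative is what \<open>test_function\<close>
  asks for.\<close>

definition sqp :: "real \<Rightarrow> real" where "sqp z = (max 0 z)\<^sup>2"

lemma DERIV_sqp: "(sqp has_real_derivative 2 * max 0 z) (at z)"
proof -
  consider "0 < z" | "z < 0" | "z = 0" by linarith
  then show ?thesis
  proof cases
    case 1
    have "((\<lambda>z. z\<^sup>2) has_real_derivative 2 * max 0 z) (at z)"
      using 1 by (auto intro!: derivative_eq_intros)
    then show ?thesis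
      by (rule has_field_derivative_transform_within_open[of _ _ _ "{0<..}"]) (use 1 in \<open>auto simp: sqp_def\<close>)
  next
    case 2
    have "((\<lambda>z. 0) has_real_derivative 2 * max 0 z) (at z)" using 2 by simp
    then show ?thesis
      by (rule has_field_derivative_transform_within_open[of _ _ _ "{..<0}"]) (use 2 in \<open>auto simp: sqp_def\<close>)
  next
    case 3
    have "((\<lambda>h. (sqp (0 + h) - sqp 0) / h) \<longlongrightarrow> 0) (at 0)"
    proof (rule Lim_null_comparison)
      show "\<forall>\<^sub>F h in at 0. norm ((sqp (0 + h) - sqp 0) / h) \<le> \<bar>h\<bar>"
        by (auto simp: eventually_at_filter sqp_def power2_eq_square max_def abs_mult intro!: always_eventually)
      show "((\<lambda>h. \<bar>h\<bar>) \<longlongrightarrow> 0) (at (0::real))" by (auto intro!: tendsto_eq_intros)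
    qed
    then show ?thesis using 3 by (simp add: DERIV_def)
  qed
qed

lemma sqp_pos: "0 < z \<Longrightarrow> 0 < sqp z" and sqp_nonneg: "0 \<le> sqp z" and sqp_zero: "z \<le> 0 \<Longrightarrow> sqp z = 0"
  by (auto simp: sqp_def max_def)

lemma continuous_sqp [continuous_intros]:
  "continuous_on S g \<Longrightarrow> continuous_on S (\<lambda>x. sqp (g x))"
  unfolding sqp_def by (intro continuous_intros)

lemma DERIV_sqp_chain:
  "(g has_real_derivative g') (at x) \<Longrightarrow> ((\<lambda>x. sqp (g x)) has_real_derivative 2 * max 0 (g x) * g') (at x)"
  by (rule DERIV_chain2[OF DERIV_sqp])

text \<open>A bump over the trapezoid between the lines x = c y - b and x = a + \<beta> y. The
  factor \<open>T\<close> cuts off in y to make the support compact. Its peak at y = -7/2 lies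
  before time 0, so that it is positive and strictly decreasing on [0, 1].\<close>

lemma test_function_region:
  fixes a b \<beta> c :: real
  defines "T \<equiv> \<lambda>y. sqp (2 - y) * sqp (y + 9)"
    and "T' \<equiv> \<lambda>y. - (2 * max 0 (2 - y)) * sqp (y + 9) + sqp (2 - y) * (2 * max 0 (y + 9))"
    and "l1 \<equiv> \<lambda>x y. a + \<beta> * y - x" and "l2 \<equiv> \<lambda>x y. x + b - c * y"
  shows "test_function (\<lambda>x y. sqp (l1 x y) * sqp (l2 x y) * T y)
     (\<lambda>x y. (- (2 * max 0 (l1 x y)) * sqp (l2 x y) + sqp (l1 x y) * (2 * max 0 (l2 x y))) * T y)
     (\<lambda>x y. (\<beta> * (2 * max 0 (l1 x y)) * sqp (l2 x y) - c * (sqp (l1 x y) * (2 * max 0 (l2 x y)))) * T y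
          + sqp (l1 x y) * sqp (l2 x y) * T' y)"
  unfolding test_function_def
proof (intro conjI allI)
  show "0 \<le> sqp (l1 x y) * sqp (l2 x y) * T y" for x y
    unfolding T_def by (intro mult_nonneg_nonneg sqp_nonneg)
  show "\<exists>R. \<forall>x y. R < \<bar>x\<bar> + \<bar>y\<bar> \<longrightarrow> sqp (l1 x y) * sqp (l2 x y) * T y = 0"
  proof (intro exI[of _ "9 + \<bar>a\<bar> + \<bar>b\<bar> + 9 * \<bar>\<beta>\<bar> + 9 * \<bar>c\<bar>"] allI impI, rule ccontr)
    fix x y
    assume R: "9 + \<bar>a\<bar> + \<bar>b\<bar> + 9 * \<bar>\<beta>\<bar> + 9 * \<bar>c\<bar> < \<bar>x\<bar> + \<bar>y\<bar>" and "sqp (l1 x y) * sqp (l2 x y) * T y \<noteq> 0"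
    then have "sqp (l1 x y) \<noteq> 0" "sqp (l2 x y) \<noteq> 0" "sqp (2 - y) \<noteq> 0" "sqp (y + 9) \<noteq> 0"
      unfolding T_def by simp_all
    then have "0 < l1 x y" "0 < l2 x y" "0 < 2 - y" "0 < y + 9"
      using sqp_zero[of "l1 x y"] sqp_zero[of "l2 x y"] sqp_zero[of "2 - y"] sqp_zero[of "y + 9"] by linarith+
    then have *: "x < a + \<beta> * y" "c * y - b < x" "\<bar>y\<bar> \<le> 9" by (auto simp: l1_def l2_def)
    have "\<bar>\<beta> * y\<bar> \<le> 9 * \<bar>\<beta>\<bar>" "\<bar>c * y\<bar> \<le> 9 * \<bar>c\<bar>"
      using *(3) by (simp_all add: abs_mult mult.commute[of 9] mult_left_mono)
    then show False using * R by linarith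
  qed
  show "continuous_on UNIV (\<lambda>(x, y). (- (2 * max 0 (l1 x y)) * sqp (l2 x y) + sqp (l1 x y) * (2 * max 0 (l2 x y))) * T y)"
    unfolding T_def l1_def l2_def split_beta by (intro continuous_intros)
  show "continuous_on UNIV (\<lambda>(x, y). (\<beta> * (2 * max 0 (l1 x y)) * sqp (l2 x y) - c * (sqp (l1 x y) * (2 * max 0 (l2 x y)))) * T y
          + sqp (l1 x y) * sqp (l2 x y) * T' y)"
    unfolding T_def T'_def l1_def l2_def split_beta by (intro continuous_intros)
  fix x y
  have T: "(T has_real_derivative T' y) (at y)"
    unfolding T_def T'_def by (rule DERIV_cong, rule DERIV_mult DERIV_sqp_chain)
      (auto intro!: derivative_eq_intros DERIV_sqp_chain)
  have x1: "((\<lambda>s. sqp (l1 s y)) has_real_derivative 2 * max 0 (l1 x y) * (-1)) (at x)"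
    and x2: "((\<lambda>s. sqp (l2 s y)) has_real_derivative 2 * max 0 (l2 x y) * 1) (at x)"
    and y1: "((\<lambda>s. sqp (l1 x s)) has_real_derivative 2 * max 0 (l1 x y) * \<beta>) (at y)"
    and y2: "((\<lambda>s. sqp (l2 x s)) has_real_derivative 2 * max 0 (l2 x y) * (-c)) (at y)"
    unfolding l1_def l2_def by (rule DERIV_sqp_chain; auto intro!: derivative_eq_intros)+
  show "((\<lambda>s. sqp (l1 s y) * sqp (l2 s y) * T y) has_real_derivative
      (- (2 * max 0 (l1 x y)) * sqp (l2 x y) + sqp (l1 x y) * (2 * max 0 (l2 x y))) * T y) (at x)"
    by (rule DERIV_cong[OF DERIV_mult[OF DERIV_mult[OF x1 x2] DERIV_const[of "T y"]]]) (simp add: algebra_simps)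
  show "((\<lambda>s. sqp (l1 x s) * sqp (l2 x s) * T s) has_real_derivative
      (\<beta> * (2 * max 0 (l1 x y)) * sqp (l2 x y) - c * (sqp (l1 x y) * (2 * max 0 (l2 x y)))) * T y
          + sqp (l1 x y) * sqp (l2 x y) * T' y) (at y)"
    by (rule DERIV_cong[OF DERIV_mult[OF DERIV_mult[OF y1 y2] T]]) (simp add: algebra_simps)
qed

lemma test_function_supp:
  assumes "test_function \<psi> \<psi>x \<psi>y"
  obtains R where "0 < R" "\<And>x y. R \<le> \<bar>x\<bar> \<or> R \<le> \<bar>y\<bar> \<Longrightarrow> \<psi> x y = 0 \<and> \<psi>x x y = 0 \<and> \<psi>y x y = 0"
proof -
  obtain R where R: "\<And>x y. R < \<bar>x\<bar> + \<bar>y\<bar> \<Longrightarrow> \<psi> x y = 0" using assms unfolding test_function_def by blast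
  have dx: "((\<lambda>s. \<psi> s y) has_real_derivative \<psi>x x y) (at x)" and dy: "((\<lambda>s. \<psi> x s) has_real_derivative \<psi>y x y) (at y)" for x y
    using assms unfolding test_function_def by blast+
  show ?thesis
  proof (rule that[of "\<bar>R\<bar> + 1"])
    fix x y :: real assume "\<bar>R\<bar> + 1 \<le> \<bar>x\<bar> \<or> \<bar>R\<bar> + 1 \<le> \<bar>y\<bar>"
    then have *: "R < \<bar>x\<bar> + \<bar>y\<bar>" by linarith
    have "((\<lambda>s. 0) has_real_derivative \<psi>x x y) (at x)"
      by (rule has_field_derivative_transform_within_open[OF dx, of "{s. R < \<bar>s\<bar> + \<bar>y\<bar>}"])
        (use * R in \<open>auto intro!: open_Collect_less continuous_intros\<close>)
    then have "\<psi>x x y = 0" using DERIV_unique DERIV_const by blast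
    have "((\<lambda>s. 0) has_real_derivative \<psi>y x y) (at y)"
      by (rule has_field_derivative_transform_within_open[OF dy, of "{s. R < \<bar>x\<bar> + \<bar>s\<bar>}"])
        (use * R in \<open>auto intro!: open_Collect_less continuous_intros\<close>)
    then have "\<psi>y x y = 0" using DERIV_unique DERIV_const by blast
    then show "\<psi> x y = 0 \<and> \<psi>x x y = 0 \<and> \<psi>y x y = 0" using R[OF *] \<open>\<psi>x x y = 0\<close> by simp
  qed auto
qed

lemma integrable_compact_support_2:
  fixes h g :: "real \<times> real \<Rightarrow> real"
  assumes h: "continuous_on UNIV h" and supp: "\<And>x y. R \<le> \<bar>x\<bar> \<or> R \<le> \<bar>y\<bar> \<Longrightarrow> h (x, y) = 0"
    and [measurable]: "g \<in> borel_measurable borel" and g: "\<And>p. \<bar>g p\<bar> \<le> C"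
  shows "integrable lborel (\<lambda>p. g p * h p)"
proof -
  have [measurable]: "h \<in> borel_measurable borel" using h by (rule borel_measurable_continuous_onI)
  have "compact (h ` cbox (-R, -R) (R, R))" by (intro compact_continuous_image continuous_on_subset[OF h]) auto
  then have "bounded (h ` cbox (-R, -R) (R, R))" by (rule compact_imp_bounded)
  then obtain B where "\<forall>z\<in>h ` cbox (-R, -R) (R, R). norm z \<le> B" unfolding bounded_iff ..
  then have B: "\<And>p. p \<in> cbox (-R, -R) (R, R) \<Longrightarrow> \<bar>h p\<bar> \<le> B" by auto
  have C: "0 \<le> C" using g[of undefined] by linarith
  show ?thesis
  proof (rule integrableI_bounded_set[where A="cbox (-R, -R) (R, R)" and B="C * B"])
    show "AE p in lborel. p \<in> cbox (-R, -R) (R, R) \<longrightarrow> norm (g p * h p) \<le> C * B"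
      using B g C by (auto simp: abs_mult intro!: mult_mono)
    show "AE p in lborel. p \<notin> cbox (- R, - R) (R, R) \<longrightarrow> g p * h p = 0"
    proof (rule AE_I2, rule impI)
      fix p :: "real \<times> real" assume "p \<notin> cbox (- R, - R) (R, R)"
      then have "R \<le> \<bar>fst p\<bar> \<or> R \<le> \<bar>snd p\<bar>" by (cases p) (auto simp: cbox_Pair_eq)
      then show "g p * h p = 0" using supp[of "fst p" "snd p"] by simp
    qed
  qed (auto simp: emeasure_lborel_cbox_eq)
qed

lemma integrable_compact_support_1:
  fixes h g :: "real \<Rightarrow> real"
  assumes h: "continuous_on UNIV h" and supp: "\<And>x. R \<le> \<bar>x\<bar> \<Longrightarrow> h x = 0"
    and [measurable]: "g \<in> borel_measurable borel" and g: "\<And>p. \<bar>g p\<bar> \<le> C"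
  shows "integrable lborel (\<lambda>p. g p * h p)"
proof -
  have [measurable]: "h \<in> borel_measurable borel" using h by (rule borel_measurable_continuous_onI)
  have "compact (h ` {-R..R})" by (intro compact_continuous_image continuous_on_subset[OF h]) auto
  then have "bounded (h ` {-R..R})" by (rule compact_imp_bounded)
  then obtain B where "\<forall>z\<in>h ` {-R..R}. norm z \<le> B" unfolding bounded_iff ..
  then have B: "\<And>p. p \<in> {-R..R} \<Longrightarrow> \<bar>h p\<bar> \<le> B" by auto
  have C: "0 \<le> C" using g[of undefined] by linarith
  show ?thesis
  proof (rule integrableI_bounded_set[where A="{-R..R}" and B="C * B"])
    show "AE p in lborel. p \<in> {-R..R} \<longrightarrow> norm (g p * h p) \<le> C * B"
      using B g C by (auto simp: abs_mult intro!: mult_mono)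
    show "AE p in lborel. p \<notin> {-R..R} \<longrightarrow> g p * h p = 0"
      using supp by (intro AE_I2) auto
  qed (auto simp: emeasure_lborel_Icc_eq)
qed

text \<open>The divergence theorem on the strip. It evaluates the constant terms that arise when two
  Kruzkov inequalities are added.\<close>

lemma test_function_integrals:
  assumes tf: "test_function \<psi> \<psi>x \<psi>y"
  defines "st \<equiv> UNIV \<times> {0..1::real}"
  shows "integrable lborel (\<lambda>p. indicator st p * \<psi>x (fst p) (snd p))"
    and "integrable lborel (\<lambda>p. indicator st p * \<psi>y (fst p) (snd p))"
    and "(\<integral>p. indicator st p * \<psi>x (fst p) (snd p) \<partial>lborel) = 0"
    and "(\<integral>p. indicator st p * \<psi>y (fst p) (snd p) \<partial>lborel) = (\<integral>x. \<psi> x 1 \<partial>lborel) - (\<integral>x. \<psi> x 0 \<partial>lborel)"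
    and "\<And>y. continuous_on UNIV (\<lambda>x. \<psi> x y)"
proof -
  have cx: "continuous_on UNIV (\<lambda>p. \<psi>x (fst p) (snd p))" and cy: "continuous_on UNIV (\<lambda>p. \<psi>y (fst p) (snd p))"
    using tf unfolding test_function_def split_beta by blast+
  have dx: "((\<lambda>s. \<psi> s y) has_real_derivative \<psi>x x y) (at x)" and dy: "((\<lambda>s. \<psi> x s) has_real_derivative \<psi>y x y) (at y)" for x y
    using tf unfolding test_function_def by blast+
  obtain R where R: "0 < R" "\<And>x y. R \<le> \<bar>x\<bar> \<or> R \<le> \<bar>y\<bar> \<Longrightarrow> \<psi> x y = 0 \<and> \<psi>x x y = 0 \<and> \<psi>y x y = 0"
    using test_function_supp[OF tf] by blast
  have [measurable]: "st \<in> sets borel" unfolding st_def by (intro borel_closed closed_Times) auto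
  show ix: "integrable lborel (\<lambda>p. indicator st p * \<psi>x (fst p) (snd p))"
    by (rule integrable_compact_support_2[OF cx, where C=1]) (use R in \<open>auto simp: indicator_def\<close>)
  show iy: "integrable lborel (\<lambda>p. indicator st p * \<psi>y (fst p) (snd p))"
    by (rule integrable_compact_support_2[OF cy, where C=1]) (use R in \<open>auto simp: indicator_def\<close>)
  show cont: "\<And>y. continuous_on UNIV (\<lambda>x. \<psi> x y)"
    using dx DERIV_isCont continuous_at_imp_continuous_on by blast
  have sti: "indicator st (x, y) = (indicator {0..1} y :: real)" for x y by (auto simp: st_def indicator_def)
  have c1: "continuous_on UNIV (\<lambda>x. \<psi>x x y)" for y
  proof -
    have "continuous_on UNIV (\<lambda>x. (x, y))" by (intro continuous_intros)
    from continuous_on_compose2[OF cx this] show ?thesis by simp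
  qed
  have c2: "continuous_on UNIV (\<lambda>y. \<psi>y x y)" for x
  proof -
    have "continuous_on UNIV (\<lambda>y. (x, y))" by (intro continuous_intros)
    from continuous_on_compose2[OF cy this] show ?thesis by simp
  qed
  have "(\<integral>x. \<psi>x x y \<partial>lborel) = 0" for y
  proof -
    have "(\<integral>x. \<psi>x x y \<partial>lborel) = (\<integral>x. indicator {-R..R} x *\<^sub>R \<psi>x x y \<partial>lborel)"
    proof (rule Bochner_Integration.integral_cong[OF refl])
      fix x
      have "R \<le> \<bar>x\<bar>" if "x \<notin> {-R..R}" using that by auto
      then show "\<psi>x x y = indicator {-R..R} x *\<^sub>R \<psi>x x y" using R(2)[of x y] by (cases "x \<in> {-R..R}") auto
    qed
    also have "\<dots> = \<psi> R y - \<psi> (-R) y"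
      using R(1) by (intro integral_FTC_atLeastAtMost continuous_on_subset[OF c1])
        (auto intro!: has_field_derivative_at_within[OF dx] simp flip: has_real_derivative_iff_has_vector_derivative)
    also have "\<dots> = 0" using R(2)[of R y] R(2)[of "-R" y] R(1) by simp
    finally show ?thesis .
  qed
  then have "(\<integral>y. (\<integral>x. indicator st (x, y) * \<psi>x x y \<partial>lborel) \<partial>lborel) = 0"
    by (simp add: sti)
  moreover have "(\<integral>y. (\<integral>x. indicator st (x, y) * \<psi>x x y \<partial>lborel) \<partial>lborel) =
      (\<integral>p. indicator st p * \<psi>x (fst p) (snd p) \<partial>lborel)"
  proof -
    have e: "(\<lambda>(x, y). indicator st (x, y) * \<psi>x x y) = (\<lambda>p. indicator st p * \<psi>x (fst p) (snd p))"
      by (auto simp: fun_eq_iff)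
    show ?thesis
      by (rule lborel_pair.integral_snd[of "\<lambda>x y. indicator st (x, y) * \<psi>x x y", unfolded lborel_prod e, OF ix])
  qed
  ultimately show "(\<integral>p. indicator st p * \<psi>x (fst p) (snd p) \<partial>lborel) = 0" by simp
  have "(\<integral>y. indicator st (x, y) * \<psi>y x y \<partial>lborel) = \<psi> x 1 - \<psi> x 0" for x
    using integral_FTC_atLeastAtMost[of 0 1 "\<psi> x" "\<psi>y x"] continuous_on_subset[OF c2[of x]]
    by (auto simp: sti intro!: has_field_derivative_at_within[OF dy] simp flip: has_real_derivative_iff_has_vector_derivative)
  moreover have "(\<integral>x. (\<integral>y. indicator st (x, y) * \<psi>y x y \<partial>lborel) \<partial>lborel) =
      (\<integral>p. indicator st p * \<psi>y (fst p) (snd p) \<partial>lborel)"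
  proof -
    have e: "(\<lambda>(x, y). indicator st (x, y) * \<psi>y x y) = (\<lambda>p. indicator st p * \<psi>y (fst p) (snd p))"
      by (auto simp: fun_eq_iff)
    show ?thesis
      by (rule lborel_pair.integral_fst[of "\<lambda>x y. indicator st (x, y) * \<psi>y x y", unfolded lborel_prod e, OF iy])
  qed
  ultimately have "(\<integral>p. indicator st p * \<psi>y (fst p) (snd p) \<partial>lborel) = (\<integral>x. \<psi> x 1 - \<psi> x 0 \<partial>lborel)"
    by simp
  also have "\<dots> = (\<integral>x. \<psi> x 1 \<partial>lborel) - (\<integral>x. \<psi> x 0 \<partial>lborel)"
    using integrable_compact_support_1[OF cont, where R=R and g="\<lambda>_. 1" and C=1] R
    by (intro Bochner_Integration.integral_diff) auto
  finally show "(\<integral>p. indicator st p * \<psi>y (fst p) (snd p) \<partial>lborel) = (\<integral>x. \<psi> x 1 \<partial>lborel) - (\<integral>x. \<psi> x 0 \<partial>lborel)" .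
qed

text \<open>On an interval of width h, the integral of \<open>u\<close> and the increment of
  \<open>P\<close> differ by at most h times the oscillation of \<open>K\<close>. The oscillations
  of a monotone \<open>K\<close> telescope, so a mesh of width h leaves an error of at most
  h.\<close>

lemma integral_eq_of_monotone_density:
  fixes u K P :: "real \<Rightarrow> real"
  assumes [measurable]: "u \<in> borel_measurable borel" and u: "\<And>x. 0 \<le> u x \<and> u x \<le> 1"
    and dens: "\<And>a b. a < b \<Longrightarrow> AE x in lborel. a < x \<and> x < b \<longrightarrow> min (K a) (K b) \<le> u x \<and> u x \<le> max (K a) (K b)"
    and P: "\<And>a b. a < b \<Longrightarrow> min (K a) (K b) * (b - a) \<le> P a - P b \<and> P a - P b \<le> max (K a) (K b) * (b - a)"
    and mono: "mono K \<or> antimono K" and K: "\<And>x. 0 \<le> K x \<and> K x \<le> 1" and "a \<le> b"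
  shows "(LINT x:{a..b}|lborel. u x) = P a - P b"
proof (cases "a = b")
  case True
  have "(LINT x:{a..a}|lborel. u x) = 0"
    unfolding set_lebesgue_integral_def
  proof (rule integral_eq_zero_AE)
    show "AE x in lborel. indicator {a..a} x *\<^sub>R u x = 0"
      using AE_lborel_singleton[of a] by eventually_elim (auto simp: indicator_def)
  qed
  then show ?thesis using True by simp
next
  case False
  then have ab: "a < b" using \<open>a \<le> b\<close> by simp
  have int: "set_integrable lborel {p..q} u" for p q
    unfolding set_integrable_def
    by (rule integrableI_bounded_set[where A="{p..q}" and B=1]) (use u in \<open>auto simp: indicator_def emeasure_lborel_Icc_eq\<close>)
  have iint: "interval_lebesgue_integrable lborel (ereal p) (ereal q) u" if "p \<le> q" for p q
  proof -
    have "set_integrable lborel {p<..<q} u" by (rule set_integrable_subset[OF int[of p q]]) auto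
    then show ?thesis using that by (simp add: interval_lebesgue_integrable_def)
  qed
  have piece: "\<bar>(LBINT x=ereal p..ereal q. u x) - (P p - P q)\<bar> \<le> \<bar>K p - K q\<bar> * (q - p)" if pq: "p < q" for p q
  proof -
    let ?lo = "min (K p) (K q)" and ?hi = "max (K p) (K q)"
    have cint: "integrable lborel (\<lambda>x. indicator {p..q} x *\<^sub>R (c::real))" for c
      by (rule integrableI_bounded_set[where A="{p..q}" and B="\<bar>c\<bar>"]) (auto simp: indicator_def emeasure_lborel_Icc_eq)
    have cval: "(\<integral>x. indicator {p..q} x *\<^sub>R (c::real) \<partial>lborel) = c * (q - p)" for c
      using pq by simp
    have ae: "AE x in lborel. p \<le> x \<and> x \<le> q \<longrightarrow> ?lo \<le> u x \<and> u x \<le> ?hi"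
      using dens[OF pq] AE_lborel_singleton[of p] AE_lborel_singleton[of q] by eventually_elim auto
    have "?lo * (q - p) \<le> (LINT x:{p..q}|lborel. u x)"
      unfolding cval[symmetric] set_lebesgue_integral_def
      by (rule integral_mono_AE[OF cint int[unfolded set_integrable_def]]) (use ae in \<open>auto simp: indicator_def\<close>)
    moreover have "(LINT x:{p..q}|lborel. u x) \<le> ?hi * (q - p)"
      unfolding cval[symmetric] set_lebesgue_integral_def
      by (rule integral_mono_AE[OF int[unfolded set_integrable_def] cint]) (use ae in \<open>auto simp: indicator_def\<close>)
    ultimately have "\<bar>(LINT x:{p..q}|lborel. u x) - (P p - P q)\<bar> \<le> ?hi * (q - p) - ?lo * (q - p)"
      using P[OF pq] by linarith
    also have "\<dots> = \<bar>K p - K q\<bar> * (q - p)" by (auto simp: min_def max_def algebra_simps)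
    finally show ?thesis using pq by (simp add: interval_integral_Icc)
  qed
  have "\<bar>(LBINT x=ereal a..ereal b. u x) - (P a - P b)\<bar> \<le> (b - a) / real n" if n: "1 \<le> n" for n
  proof -
    define h where "h = (b - a) / real n"
    define X where "X = (\<lambda>i. a + real i * h)"
    have h: "0 < h" using ab n by (simp add: h_def)
    have X: "X i < X (Suc i)" "X (Suc i) - X i = h" "a \<le> X i" for i using h by (auto simp: X_def algebra_simps)
    have "\<bar>(LBINT x=ereal a..ereal (X i). u x) - (P a - P (X i))\<bar> \<le> \<bar>K a - K (X i)\<bar> * h" for i
    proof (induction i)
      case 0
      then show ?case by (simp add: X_def)
    next
      case (Suc i)
      have "(LBINT x=ereal a..ereal (X i). u x) + (LBINT x=ereal (X i)..ereal (X (Suc i)). u x) = (LBINT x=ereal a..ereal (X (Suc i)). u x)"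
        using X[of i] iint[of a "X (Suc i)"] by (intro interval_integral_sum) (auto simp: min_def max_def)
      moreover have "\<bar>K a - K (X i)\<bar> + \<bar>K (X i) - K (X (Suc i))\<bar> = \<bar>K a - K (X (Suc i))\<bar>"
        using mono X(1)[of i] X(3)[of i] unfolding mono_def antimono_def by (smt (verit))
      then have "\<bar>K a - K (X i)\<bar> * h + \<bar>K (X i) - K (X (Suc i))\<bar> * h = \<bar>K a - K (X (Suc i))\<bar> * h"
        by (simp flip: distrib_right)
      ultimately show ?case using Suc piece[OF X(1), of i] unfolding X(2) by linarith
    qed
    from this[of n] have "\<bar>(LBINT x=ereal a..ereal b. u x) - (P a - P b)\<bar> \<le> \<bar>K a - K b\<bar> * h"
      using n by (simp add: X_def h_def)
    also have "\<dots> \<le> 1 * h" using K[of a] K[of b] h by (intro mult_right_mono) auto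
    finally show ?thesis by (simp add: h_def)
  qed
  then have "\<bar>(LBINT x=ereal a..ereal b. u x) - (P a - P b)\<bar> \<le> (b - a) * inverse (real (Suc n))" for n
    by (metis Suc_eq_plus1 add_leE add.commute divide_inverse le_add1)
  then have "\<bar>(LBINT x=ereal a..ereal b. u x) - (P a - P b)\<bar> \<le> (b - a) * 0"
    by (intro LIMSEQ_le_const[OF tendsto_mult_left[OF LIMSEQ_inverse_real_of_nat]]) auto
  then show ?thesis using ab by (simp add: interval_integral_Icc)
qed

section \<open>One-sided entropies on trapezoids\<close>

context riemann_problem
begin

context
  fixes G :: "real \<Rightarrow> real \<Rightarrow> real"
  assumes ent: "entropy_solution f (\<lambda>x. if x \<le> 0 then \<theta> else \<rho>) G"
begin

definition strip :: "(real \<times> real) set" where "strip = UNIV \<times> {0..1}"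

text \<open>\<open>entropy_solution\<close> bounds \<open>G\<close> only for times in [0, 1]; the
  cutoff makes the bounds 0 and 1 hold everywhere.\<close>

definition Gs :: "real \<times> real \<Rightarrow> real" where "Gs p = (if p \<in> strip then G (fst p) (snd p) else 0)"

definition G0 :: "real \<Rightarrow> real" where "G0 x = (if x \<le> 0 then \<theta> else \<rho>)"

lemma strip_measurable [measurable]: "strip \<in> sets borel"
  unfolding strip_def by (intro borel_closed closed_Times) auto

lemma f_measurable [measurable]: "f \<in> borel_measurable borel"
  unfolding f_eq[abs_def] by measurable

lemma Gs_measurable [measurable]: "Gs \<in> borel_measurable borel"
proof -
  have [measurable]: "(\<lambda>p. G (fst p) (snd p)) \<in> borel_measurable borel"
    using ent unfolding entropy_solution_def by blast
  show ?thesis unfolding Gs_def[abs_def] by measurable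
qed

lemma Gs_unit: "0 \<le> Gs p" "Gs p \<le> 1"
  using ent unfolding entropy_solution_def Gs_def strip_def by (auto simp: mem_Times_iff)

lemma G1_Gs: "G x 1 = Gs (x, 1)" by (simp add: Gs_def strip_def)

lemma G1_measurable [measurable]: "(\<lambda>x. G x 1) \<in> borel_measurable borel"
  unfolding G1_Gs by measurable

lemma G1_unit: "0 \<le> G x 1 \<and> G x 1 \<le> 1" unfolding G1_Gs using Gs_unit by auto

lemma G0_measurable [measurable]: "G0 \<in> borel_measurable borel" unfolding G0_def[abs_def] by measurable

lemma G0_unit: "0 \<le> G0 x" "G0 x \<le> 1" using theta rho by (auto simp: G0_def)

lemma kruzkov:
  assumes "test_function \<psi> \<psi>x \<psi>y"
  shows "0 \<le> (\<integral>p. indicator strip p * \<bar>Gs p - k\<bar> * \<psi>y (fst p) (snd p)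
        + indicator strip p * (sgn (Gs p - k) * (f (Gs p) - f k)) * \<psi>x (fst p) (snd p) \<partial>lborel)
      + (\<integral>x. \<bar>G0 x - k\<bar> * \<psi> x 0 \<partial>lborel) - (\<integral>x. \<bar>G x 1 - k\<bar> * \<psi> x 1 \<partial>lborel)"
proof -
  have "set_lebesgue_integral lborel (UNIV \<times> {0..1})
               (\<lambda>p. \<bar>G (fst p) (snd p) - k\<bar> * \<psi>y (fst p) (snd p)
                    + sgn (G (fst p) (snd p) - k) * (f (G (fst p) (snd p)) - f k)
                      * \<psi>x (fst p) (snd p)) =
      (\<integral>p. indicator strip p * \<bar>Gs p - k\<bar> * \<psi>y (fst p) (snd p)
        + indicator strip p * (sgn (Gs p - k) * (f (Gs p) - f k)) * \<psi>x (fst p) (snd p) \<partial>lborel)"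
    unfolding set_lebesgue_integral_def strip_def[symmetric]
    by (rule Bochner_Integration.integral_cong[OF refl]) (auto simp: indicator_def Gs_def)
  then show ?thesis using ent assms unfolding entropy_solution_def G0_def by (metis (no_types, lifting))
qed

text \<open>Used with \<open>k0\<close> an endpoint of [0, 1], where |z - k0| is affine: the sum of
  the Kruzkov inequalities for \<open>k\<close> and \<open>k0\<close> is twice a one-sided entropy
  inequality. The contributions of \<open>c1\<close> and \<open>c2\<close> cancel by
  \<open>test_function_integrals\<close>.\<close>

lemma half_entropy:
  assumes tf: "test_function \<psi> \<psi>x \<psi>y"
    and [measurable]: "E \<in> borel_measurable borel" "Q \<in> borel_measurable borel"
    and E: "\<And>z. 0 \<le> z \<Longrightarrow> z \<le> 1 \<Longrightarrow> \<bar>z - k\<bar> + \<bar>z - k0\<bar> = 2 * E z + c1"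
    and Q: "\<And>z. 0 \<le> z \<Longrightarrow> z \<le> 1 \<Longrightarrow> sgn (z - k) * (f z - f k) + sgn (z - k0) * (f z - f k0) = 2 * Q z + c2"
    and EQ: "\<And>z. 0 \<le> z \<Longrightarrow> z \<le> 1 \<Longrightarrow> \<bar>E z\<bar> \<le> 1 \<and> \<bar>Q z\<bar> \<le> 1"
  shows "0 \<le> (\<integral>p. indicator strip p * E (Gs p) * \<psi>y (fst p) (snd p) + indicator strip p * Q (Gs p) * \<psi>x (fst p) (snd p) \<partial>lborel)
      + (\<integral>x. E (G0 x) * \<psi> x 0 \<partial>lborel) - (\<integral>x. E (G x 1) * \<psi> x 1 \<partial>lborel)"
    and "integrable lborel (\<lambda>p. indicator strip p * E (Gs p) * \<psi>y (fst p) (snd p) + indicator strip p * Q (Gs p) * \<psi>x (fst p) (snd p))"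
    and "integrable lborel (\<lambda>x. E (G x 1) * \<psi> x 1)"
proof -
  note ti = test_function_integrals[OF tf, folded strip_def]
  obtain R where R: "0 < R" "\<And>x y. R \<le> \<bar>x\<bar> \<or> R \<le> \<bar>y\<bar> \<Longrightarrow> \<psi> x y = 0 \<and> \<psi>x x y = 0 \<and> \<psi>y x y = 0"
    using test_function_supp[OF tf] by blast
  have cx: "continuous_on UNIV (\<lambda>p. \<psi>x (fst p) (snd p))" and cy: "continuous_on UNIV (\<lambda>p. \<psi>y (fst p) (snd p))"
    using tf unfolding test_function_def split_beta by blast+
  have iy: "integrable lborel (\<lambda>p. indicator strip p * w (Gs p) * \<psi>y (fst p) (snd p))"
    and ix: "integrable lborel (\<lambda>p. indicator strip p * w (Gs p) * \<psi>x (fst p) (snd p))"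
    if [measurable]: "w \<in> borel_measurable borel" and w: "\<And>z. 0 \<le> z \<Longrightarrow> z \<le> 1 \<Longrightarrow> \<bar>w z\<bar> \<le> B" for w :: "real \<Rightarrow> real" and B
  proof -
    have "\<bar>indicator strip p * w (Gs p)\<bar> \<le> \<bar>B\<bar>" for p
      using w[OF Gs_unit(1,2), of p] by (auto simp: indicator_def)
    then show "integrable lborel (\<lambda>p. indicator strip p * w (Gs p) * \<psi>y (fst p) (snd p))"
      "integrable lborel (\<lambda>p. indicator strip p * w (Gs p) * \<psi>x (fst p) (snd p))"
      by (intro integrable_compact_support_2[OF cy, where R=R and C="\<bar>B\<bar>"] integrable_compact_support_2[OF cx, where R=R and C="\<bar>B\<bar>"];
          use R in auto)+
  qed
  have i0: "integrable lborel (\<lambda>x. w (G0 x) * \<psi> x y)" and i1: "integrable lborel (\<lambda>x. w (G x 1) * \<psi> x y)"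
    if [measurable]: "w \<in> borel_measurable borel" and w: "\<And>z. 0 \<le> z \<Longrightarrow> z \<le> 1 \<Longrightarrow> \<bar>w z\<bar> \<le> B" for w :: "real \<Rightarrow> real" and B y
    using w G0_unit G1_unit R(2)
    by (intro integrable_compact_support_1[OF ti(5), where R=R and C=B]; auto)+
  have fb: "\<bar>f z\<bar> \<le> 1" if "0 \<le> z" "z \<le> 1" for z using f_bounds[OF that] by simp
  define A where "A = (\<lambda>k p. indicator strip p * \<bar>Gs p - k\<bar> * \<psi>y (fst p) (snd p)
        + indicator strip p * (sgn (Gs p - k) * (f (Gs p) - f k)) * \<psi>x (fst p) (snd p))"
  have intA: "integrable lborel (A k)" for k
    unfolding A_def
  proof (intro Bochner_Integration.integrable_add iy[of "\<lambda>z. \<bar>z - k\<bar>" "1 + \<bar>k\<bar>"] ix[of "\<lambda>z. sgn (z - k) * (f z - f k)" "1 + \<bar>f k\<bar>"])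
    fix z :: real assume z: "0 \<le> z" "z \<le> 1"
    show "\<bar>\<bar>z - k\<bar>\<bar> \<le> 1 + \<bar>k\<bar>" using z by linarith
    have "\<bar>sgn (z - k)\<bar> * \<bar>f z - f k\<bar> \<le> 1 * (1 + \<bar>f k\<bar>)"
      using fb[OF z] by (intro mult_mono) (auto simp: abs_sgn_eq)
    then show "\<bar>sgn (z - k) * (f z - f k)\<bar> \<le> 1 + \<bar>f k\<bar>" by (simp add: abs_mult)
  qed auto
  define H where "H = (\<lambda>p. indicator strip p * E (Gs p) * \<psi>y (fst p) (snd p) + indicator strip p * Q (Gs p) * \<psi>x (fst p) (snd p))"
  show intH: "integrable lborel (\<lambda>p. indicator strip p * E (Gs p) * \<psi>y (fst p) (snd p) + indicator strip p * Q (Gs p) * \<psi>x (fst p) (snd p))"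
    using EQ by (intro Bochner_Integration.integrable_add iy[of E 1] ix[of Q 1]) auto
  show int1: "integrable lborel (\<lambda>x. E (G x 1) * \<psi> x 1)" using EQ by (intro i1[of E 1]) auto
  have int0: "integrable lborel (\<lambda>x. E (G0 x) * \<psi> x 0)" using EQ by (intro i0[of E 1]) auto
  have intp: "integrable lborel (\<lambda>x. \<psi> x y)" for y using i0[of "\<lambda>_. 1" 1 y] by simp
  have "A k p + A k0 p = 2 * H p + (c1 * (indicator strip p * \<psi>y (fst p) (snd p)) + c2 * (indicator strip p * \<psi>x (fst p) (snd p)))" for p
  proof -
    have "A k p + A k0 p = indicator strip p * (\<bar>Gs p - k\<bar> + \<bar>Gs p - k0\<bar>) * \<psi>y (fst p) (snd p)
        + indicator strip p * (sgn (Gs p - k) * (f (Gs p) - f k) + sgn (Gs p - k0) * (f (Gs p) - f k0)) * \<psi>x (fst p) (snd p)"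
      unfolding A_def by (simp only: distrib_left distrib_right add_ac)
    then show ?thesis unfolding E[OF Gs_unit] Q[OF Gs_unit] H_def by (simp add: algebra_simps)
  qed
  then have "(\<integral>p. A k p + A k0 p \<partial>lborel) = (\<integral>p. 2 * H p + (c1 * (indicator strip p * \<psi>y (fst p) (snd p)) + c2 * (indicator strip p * \<psi>x (fst p) (snd p))) \<partial>lborel)"
    by simp
  also have "\<dots> = 2 * (\<integral>p. H p \<partial>lborel) + c1 * ((\<integral>x. \<psi> x 1 \<partial>lborel) - (\<integral>x. \<psi> x 0 \<partial>lborel))"
    using intH ti(1-4) by (simp add: H_def[symmetric])
  finally have S: "(\<integral>p. A k p \<partial>lborel) + (\<integral>p. A k0 p \<partial>lborel) = 2 * (\<integral>p. H p \<partial>lborel) + c1 * ((\<integral>x. \<psi> x 1 \<partial>lborel) - (\<integral>x. \<psi> x 0 \<partial>lborel))"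
    using intA by simp
  have ab: "(\<lambda>z. \<bar>z - k\<bar>) \<in> borel_measurable borel" "\<And>z. 0 \<le> z \<Longrightarrow> z \<le> 1 \<Longrightarrow> \<bar>\<bar>z - k\<bar>\<bar> \<le> 1 + \<bar>k\<bar>" for k :: real
    by auto
  have "(\<integral>x. \<bar>u x - k\<bar> * \<psi> x y \<partial>lborel) + (\<integral>x. \<bar>u x - k0\<bar> * \<psi> x y \<partial>lborel) = 2 * (\<integral>x. E (u x) * \<psi> x y \<partial>lborel) + c1 * (\<integral>x. \<psi> x y \<partial>lborel)"
    if u: "\<And>x. 0 \<le> u x \<and> u x \<le> 1" and i: "\<And>k. integrable lborel (\<lambda>x. \<bar>u x - k\<bar> * \<psi> x y)" "integrable lborel (\<lambda>x. E (u x) * \<psi> x y)" for u y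
  proof -
    have "\<bar>u x - k\<bar> * \<psi> x y + \<bar>u x - k0\<bar> * \<psi> x y = 2 * (E (u x) * \<psi> x y) + c1 * \<psi> x y" for x
    proof -
      have "\<bar>u x - k\<bar> * \<psi> x y + \<bar>u x - k0\<bar> * \<psi> x y = (2 * E (u x) + c1) * \<psi> x y"
        using E[of "u x"] u[of x] by (simp flip: distrib_right)
      then show ?thesis by (simp add: distrib_right)
    qed
    then have "(\<integral>x. \<bar>u x - k\<bar> * \<psi> x y + \<bar>u x - k0\<bar> * \<psi> x y \<partial>lborel) = (\<integral>x. 2 * (E (u x) * \<psi> x y) + c1 * \<psi> x y \<partial>lborel)"
      by simp
    then show ?thesis using i intp by simp
  qed
  note tr = this
  have 0: "(\<integral>x. \<bar>G0 x - k\<bar> * \<psi> x 0 \<partial>lborel) + (\<integral>x. \<bar>G0 x - k0\<bar> * \<psi> x 0 \<partial>lborel) = 2 * (\<integral>x. E (G0 x) * \<psi> x 0 \<partial>lborel) + c1 * (\<integral>x. \<psi> x 0 \<partial>lborel)"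
    by (rule tr[OF _ i0[OF ab] int0]) (use G0_unit in auto)
  have 1: "(\<integral>x. \<bar>G x 1 - k\<bar> * \<psi> x 1 \<partial>lborel) + (\<integral>x. \<bar>G x 1 - k0\<bar> * \<psi> x 1 \<partial>lborel) = 2 * (\<integral>x. E (G x 1) * \<psi> x 1 \<partial>lborel) + c1 * (\<integral>x. \<psi> x 1 \<partial>lborel)"
    by (rule tr[OF _ i1[OF ab] int1]) (use G1_unit in auto)
  show "0 \<le> (\<integral>p. indicator strip p * E (Gs p) * \<psi>y (fst p) (snd p) + indicator strip p * Q (Gs p) * \<psi>x (fst p) (snd p) \<partial>lborel)
      + (\<integral>x. E (G0 x) * \<psi> x 0 \<partial>lborel) - (\<integral>x. E (G x 1) * \<psi> x 1 \<partial>lborel)"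
    using kruzkov[OF tf, of k] kruzkov[OF tf, of k0] S 0 1 unfolding A_def H_def right_diff_distrib by linarith
qed

text \<open>By the flux hypothesis, entropy can only leave the trapezoid through its lateral sides,
  which move with speed \<beta> on the right and \<open>c\<close> on the left. As none is present at
  time 0, none is left at time 1; the strict decrease of \<open>T\<close> excludes it at
  intermediate times as well.\<close>

lemma region_vanishing:
  assumes [measurable]: "E \<in> borel_measurable borel" "Q \<in> borel_measurable borel"
    and E: "\<And>z. 0 \<le> z \<Longrightarrow> z \<le> 1 \<Longrightarrow> \<bar>z - k\<bar> + \<bar>z - k0\<bar> = 2 * E z + c1"
    and Q: "\<And>z. 0 \<le> z \<Longrightarrow> z \<le> 1 \<Longrightarrow> sgn (z - k) * (f z - f k) + sgn (z - k0) * (f z - f k0) = 2 * Q z + c2"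
    and EQ: "\<And>z. 0 \<le> z \<Longrightarrow> z \<le> 1 \<Longrightarrow> \<bar>E z\<bar> \<le> 1 \<and> \<bar>Q z\<bar> \<le> 1"
    and Enn: "\<And>z. 0 \<le> E z"
    and flux: "AE p in lborel. p \<in> strip \<longrightarrow> \<beta> * E (Gs p) \<le> Q (Gs p) \<and> Q (Gs p) \<le> c * E (Gs p)"
    and init: "\<And>x. - b < x \<Longrightarrow> x < a \<Longrightarrow> E (G0 x) = 0"
  shows "AE x in lborel. c - b < x \<and> x < a + \<beta> \<longrightarrow> E (G x 1) = 0"
    and "AE p in lborel. p \<in> strip \<and> c * snd p - b < fst p \<and> fst p < a + \<beta> * snd p \<longrightarrow> E (Gs p) = 0"
proof -
  define T where "T = (\<lambda>y. sqp (2 - y) * sqp (y + 9))"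
  define T' where "T' = (\<lambda>y. - (2 * max 0 (2 - y)) * sqp (y + 9) + sqp (2 - y) * (2 * max 0 (y + 9)))"
  define l1 where "l1 = (\<lambda>x y. a + \<beta> * y - x)"
  define l2 where "l2 = (\<lambda>x y. x + b - c * y)"
  define \<psi> where "\<psi> = (\<lambda>x y. sqp (l1 x y) * sqp (l2 x y) * T y)"
  define \<psi>x where "\<psi>x = (\<lambda>x y. (- (2 * max 0 (l1 x y)) * sqp (l2 x y) + sqp (l1 x y) * (2 * max 0 (l2 x y))) * T y)"
  define \<psi>y where "\<psi>y = (\<lambda>x y. (\<beta> * (2 * max 0 (l1 x y)) * sqp (l2 x y) - c * (sqp (l1 x y) * (2 * max 0 (l2 x y)))) * T y
          + sqp (l1 x y) * sqp (l2 x y) * T' y)"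
  have tf: "test_function \<psi> \<psi>x \<psi>y"
    unfolding \<psi>_def \<psi>x_def \<psi>y_def T_def T'_def l1_def l2_def by (rule test_function_region)
  have T0: "0 < T y" "T' y < 0" if "0 \<le> y" "y \<le> 1" for y
  proof -
    show "0 < T y" using that unfolding T_def by (intro mult_pos_pos sqp_pos) auto
    have "T' y = 2 * (2 - y) * (y + 9) * ((2 - y) - (y + 9))"
      using that unfolding T'_def sqp_def by (simp add: power2_eq_square algebra_simps max_def)
    also have "\<dots> < 0" using that by (intro mult_pos_neg mult_pos_pos) auto
    finally show "T' y < 0" .
  qed
  note he = half_entropy[OF tf _ _ E Q EQ]
  define H where "H = (\<lambda>p. indicator strip p * E (Gs p) * \<psi>y (fst p) (snd p) + indicator strip p * Q (Gs p) * \<psi>x (fst p) (snd p))"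
  define F where "F = (\<lambda>p. indicator strip p * (sqp (l1 (fst p) (snd p)) * sqp (l2 (fst p) (snd p)) * T' (snd p) * E (Gs p)))"
  have HF: "AE p in lborel. H p \<le> F p \<and> F p \<le> 0"
    using flux
  proof eventually_elim
    case (elim p)
    show ?case
    proof (cases "p \<in> strip")
      case True
      define x y where "x = fst p" and "y = snd p"
      have y: "0 \<le> y" "y \<le> 1" using True by (auto simp: strip_def y_def mem_Times_iff)
      have fl: "\<beta> * E (Gs p) - Q (Gs p) \<le> 0" "Q (Gs p) - c * E (Gs p) \<le> 0" using elim True by auto
      \<comment> \<open>The contributions of the two lateral sides, nonpositive by the flux
        hypothesis; \<open>F\<close> retains only the term with the derivative of
        \<open>T\<close>.\<close>
      have "H p - F p = T y * (2 * max 0 (l1 x y) * sqp (l2 x y)) * (\<beta> * E (Gs p) - Q (Gs p))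
          + T y * (sqp (l1 x y) * (2 * max 0 (l2 x y))) * (Q (Gs p) - c * E (Gs p))"
        unfolding H_def F_def \<psi>x_def \<psi>y_def x_def[symmetric] y_def[symmetric] using True by (simp add: algebra_simps)
      also have "\<dots> \<le> 0 + 0"
        using T0[OF y] fl by (intro add_mono mult_nonneg_nonpos mult_nonneg_nonneg sqp_nonneg) auto
      finally have "H p \<le> F p" by simp
      moreover have "F p \<le> 0"
        unfolding F_def x_def[symmetric] y_def[symmetric] using True T0[OF y] Enn[of "Gs p"]
        by (simp add: mult_nonneg_nonpos mult_nonpos_nonneg sqp_nonneg)
      ultimately show ?thesis by simp
    qed (simp add: H_def F_def)
  qed
  have intH: "integrable lborel H" unfolding H_def by (rule he(2)) auto
  have init0: "(\<integral>x. E (G0 x) * \<psi> x 0 \<partial>lborel) = 0"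
  proof (rule integral_eq_zero_AE, rule AE_I2)
    fix x
    show "E (G0 x) * \<psi> x 0 = 0"
    proof (cases "- b < x \<and> x < a")
      case False
      then have "l1 x 0 \<le> 0 \<or> l2 x 0 \<le> 0" by (auto simp: l1_def l2_def)
      then show ?thesis by (auto simp: \<psi>_def sqp_zero)
    qed (use init in simp)
  qed
  have int1: "integrable lborel (\<lambda>x. E (G x 1) * \<psi> x 1)" by (rule he(3)) auto
  have \<psi>nn: "0 \<le> \<psi> x 1" for x using tf unfolding test_function_def by blast
  have main: "(\<integral>x. E (G x 1) * \<psi> x 1 \<partial>lborel) \<le> (\<integral>p. H p \<partial>lborel)"
    using he(1) init0 unfolding H_def by simp
  have Hnp: "AE p in lborel. 0 \<le> - H p" using HF by eventually_elim linarith
  then have "0 \<le> (\<integral>p. - H p \<partial>lborel)" by (rule integral_nonneg_AE)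
  then have "(\<integral>p. H p \<partial>lborel) \<le> 0" by simp
  moreover have g1: "0 \<le> (\<integral>x. E (G x 1) * \<psi> x 1 \<partial>lborel)"
    by (intro Bochner_Integration.integral_nonneg mult_nonneg_nonneg Enn \<psi>nn)
  ultimately have z: "(\<integral>x. E (G x 1) * \<psi> x 1 \<partial>lborel) = 0" "(\<integral>p. - H p \<partial>lborel) = 0" using main by auto
  have "AE x in lborel. E (G x 1) * \<psi> x 1 = 0"
    using integral_nonneg_eq_0_iff_AE[OF int1] z(1) Enn \<psi>nn by simp
  then show "AE x in lborel. c - b < x \<and> x < a + \<beta> \<longrightarrow> E (G x 1) = 0"
  proof eventually_elim
    case (elim x)
    have "0 < \<psi> x 1" if "c - b < x" "x < a + \<beta>"
      unfolding \<psi>_def using that T0(1)[of 1] by (intro mult_pos_pos sqp_pos) (auto simp: l1_def l2_def)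
    then show ?case using elim by auto
  qed
  have "AE p in lborel. - H p = 0"
    using integral_nonneg_eq_0_iff_AE[of lborel "\<lambda>p. - H p"] intH z(2) Hnp by simp
  then show "AE p in lborel. p \<in> strip \<and> c * snd p - b < fst p \<and> fst p < a + \<beta> * snd p \<longrightarrow> E (Gs p) = 0"
    using HF
  proof eventually_elim
    case (elim p)
    show ?case
    proof (intro impI)
      assume p: "p \<in> strip \<and> c * snd p - b < fst p \<and> fst p < a + \<beta> * snd p"
      then have "0 \<le> snd p" "snd p \<le> 1" by (auto simp: strip_def mem_Times_iff)
      then have "sqp (l1 (fst p) (snd p)) * sqp (l2 (fst p) (snd p)) * T' (snd p) < 0"
        using p T0(2) by (intro mult_pos_neg mult_pos_pos sqp_pos) (auto simp: l1_def l2_def)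
      moreover have "F p = 0" using elim by simp
      ultimately show "E (Gs p) = 0" using p by (auto simp: F_def)
    qed
  qed
qed

text \<open>The entropy is (z - k)^+, obtained with \<open>k0 = 0\<close>.\<close>

lemma upper_region:
  assumes k: "0 \<le> k" "k \<le> 1"
    and flux: "AE p in lborel. p \<in> strip \<longrightarrow> k < Gs p \<longrightarrow> \<beta> * (Gs p - k) \<le> f (Gs p) - f k \<and> f (Gs p) - f k \<le> c * (Gs p - k)"
    and init: "\<And>x. - b < x \<Longrightarrow> x < a \<Longrightarrow> G0 x \<le> k"
  shows "AE x in lborel. c - b < x \<and> x < a + \<beta> \<longrightarrow> G x 1 \<le> k"
    and "AE p in lborel. p \<in> strip \<and> c * snd p - b < fst p \<and> fst p < a + \<beta> * snd p \<longrightarrow> Gs p \<le> k"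
proof -
  define E where "E = (\<lambda>z. max 0 (z - k))"
  define Q where "Q = (\<lambda>z. if k < z then f z - f k else 0)"
  have fl: "AE p in lborel. p \<in> strip \<longrightarrow> \<beta> * E (Gs p) \<le> Q (Gs p) \<and> Q (Gs p) \<le> c * E (Gs p)"
    using flux by eventually_elim (auto simp: E_def Q_def max_def)
  have E0: "E z = 0 \<longleftrightarrow> z \<le> k" for z by (auto simp: E_def max_def)
  have hE: "\<bar>z - k\<bar> + \<bar>z - 0\<bar> = 2 * E z + k" if "0 \<le> z" "z \<le> 1" for z
    using that by (auto simp: E_def max_def)
  have hQ: "sgn (z - k) * (f z - f k) + sgn (z - 0) * (f z - f 0) = 2 * Q z + f k" if "0 \<le> z" "z \<le> 1" for z
    using that k by (cases "z = 0") (auto simp: Q_def sgn_if)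
  have hEQ: "\<bar>E z\<bar> \<le> 1 \<and> \<bar>Q z\<bar> \<le> 1" if "0 \<le> z" "z \<le> 1" for z
    using that k f_bounds[OF that] f_bounds[OF k] by (auto simp: E_def Q_def max_def)
  have m: "E \<in> borel_measurable borel" "Q \<in> borel_measurable borel"
    unfolding E_def Q_def by measurable
  note r = region_vanishing[OF m hE hQ hEQ _ fl, where b=b and a=a]
  show "AE x in lborel. c - b < x \<and> x < a + \<beta> \<longrightarrow> G x 1 \<le> k"
    using r(1) init unfolding E0 by (auto simp: E_def)
  show "AE p in lborel. p \<in> strip \<and> c * snd p - b < fst p \<and> fst p < a + \<beta> * snd p \<longrightarrow> Gs p \<le> k"
    using r(2) init unfolding E0 by (auto simp: E_def)
qed

text \<open>The mirror image, with entropy (k - z)^+ and \<open>k0 = 1\<close>.\<close>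

lemma lower_region:
  assumes k: "0 \<le> k" "k \<le> 1"
    and flux: "AE p in lborel. p \<in> strip \<longrightarrow> Gs p < k \<longrightarrow> \<beta> * (k - Gs p) \<le> f k - f (Gs p) \<and> f k - f (Gs p) \<le> c * (k - Gs p)"
    and init: "\<And>x. - b < x \<Longrightarrow> x < a \<Longrightarrow> k \<le> G0 x"
  shows "AE x in lborel. c - b < x \<and> x < a + \<beta> \<longrightarrow> k \<le> G x 1"
    and "AE p in lborel. p \<in> strip \<and> c * snd p - b < fst p \<and> fst p < a + \<beta> * snd p \<longrightarrow> k \<le> Gs p"
proof -
  define E where "E = (\<lambda>z. max 0 (k - z))"
  define Q where "Q = (\<lambda>z. if z < k then f k - f z else 0)"
  have fl: "AE p in lborel. p \<in> strip \<longrightarrow> \<beta> * E (Gs p) \<le> Q (Gs p) \<and> Q (Gs p) \<le> c * E (Gs p)"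
    using flux by eventually_elim (auto simp: E_def Q_def max_def)
  have E0: "E z = 0 \<longleftrightarrow> k \<le> z" for z by (auto simp: E_def max_def)
  have hE: "\<bar>z - k\<bar> + \<bar>z - 1\<bar> = 2 * E z + (1 - k)" if "0 \<le> z" "z \<le> 1" for z
    using that by (auto simp: E_def max_def)
  have hQ: "sgn (z - k) * (f z - f k) + sgn (z - 1) * (f z - f 1) = 2 * Q z + (1 - f k)" if "0 \<le> z" "z \<le> 1" for z
    using that k by (cases "z = 1") (auto simp: Q_def sgn_if)
  have hEQ: "\<bar>E z\<bar> \<le> 1 \<and> \<bar>Q z\<bar> \<le> 1" if "0 \<le> z" "z \<le> 1" for z
    using that k f_bounds[OF that] f_bounds[OF k] by (auto simp: E_def Q_def max_def)
  have m: "E \<in> borel_measurable borel" "Q \<in> borel_measurable borel"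
    unfolding E_def Q_def by measurable
  note r = region_vanishing[OF m hE hQ hEQ _ fl, where b=b and a=a]
  show "AE x in lborel. c - b < x \<and> x < a + \<beta> \<longrightarrow> k \<le> G x 1"
    using r(1) init unfolding E0 by (auto simp: E_def)
  show "AE p in lborel. p \<in> strip \<and> c * snd p - b < fst p \<and> fst p < a + \<beta> * snd p \<longrightarrow> k \<le> Gs p"
    using r(2) init unfolding E0 by (auto simp: E_def)
qed

lemma AE_exhaust:
  assumes "\<And>n::nat. AE x in M. A n x \<longrightarrow> R x" "\<And>x. B x \<Longrightarrow> \<exists>n. A n x"
  shows "AE x in M. B x \<longrightarrow> R x"
proof -
  have "AE x in M. \<forall>n. A n x \<longrightarrow> R x" unfolding AE_all_countable using assms(1) by blast
  then show ?thesis by eventually_elim (use assms(2) in blast)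
qed

text \<open>All chord slopes of \<open>f\<close> lie between 0 and \<kappa>, so trapezoids with
  sides of these speeds are admissible, and growing ones exhaust the strip. Afterwards only the
  chords of \<open>f\<close> between \<theta> and \<rho> matter.\<close>

lemma max_principle:
  "AE p in lborel. p \<in> strip \<longrightarrow> min \<theta> \<rho> \<le> Gs p \<and> Gs p \<le> max \<theta> \<rho>"
  "AE x in lborel. min \<theta> \<rho> \<le> G x 1 \<and> G x 1 \<le> max \<theta> \<rho>"
proof -
  have hi: "0 \<le> max \<theta> \<rho>" "max \<theta> \<rho> \<le> 1" and lo: "0 \<le> min \<theta> \<rho>" "min \<theta> \<rho> \<le> 1" using theta rho by auto
  have flu: "AE p in lborel. p \<in> strip \<longrightarrow> max \<theta> \<rho> < Gs p \<longrightarrow>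
      0 * (Gs p - max \<theta> \<rho>) \<le> f (Gs p) - f (max \<theta> \<rho>) \<and> f (Gs p) - f (max \<theta> \<rho>) \<le> \<kappa> * (Gs p - max \<theta> \<rho>)"
    using f_lipschitz[OF hi(1)] by (intro AE_I2) auto
  have fll: "AE p in lborel. p \<in> strip \<longrightarrow> Gs p < min \<theta> \<rho> \<longrightarrow>
      0 * (min \<theta> \<rho> - Gs p) \<le> f (min \<theta> \<rho>) - f (Gs p) \<and> f (min \<theta> \<rho>) - f (Gs p) \<le> \<kappa> * (min \<theta> \<rho> - Gs p)"
    using f_lipschitz[OF Gs_unit(1)] by (intro AE_I2) auto
  have g0: "G0 x \<le> max \<theta> \<rho>" "min \<theta> \<rho> \<le> G0 x" for x by (auto simp: G0_def)
  note u = upper_region[OF hi flu, of "real n" "real n" for n] and w = lower_region[OF lo fll, of "real n" "real n" for n]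
  have ex: "\<exists>n. \<kappa> * snd p - real n < fst p \<and> fst p < real n + 0 * snd p" for p
  proof -
    obtain n where "\<bar>fst p\<bar> + \<bar>\<kappa> * snd p\<bar> < real n" using reals_Archimedean2 by blast
    then show ?thesis by (intro exI[of _ n]) (simp, linarith)
  qed
  have ex1: "\<exists>n. \<kappa> - real n < x \<and> x < real n + 0" for x
    using ex[of "(x, 1)"] by simp
  have "AE p in lborel. p \<in> strip \<longrightarrow> Gs p \<le> max \<theta> \<rho>"
    by (rule AE_exhaust[OF u(2)]) (use g0 ex in auto)
  moreover have "AE p in lborel. p \<in> strip \<longrightarrow> min \<theta> \<rho> \<le> Gs p"
    by (rule AE_exhaust[OF w(2)]) (use g0 ex in auto)
  ultimately show "AE p in lborel. p \<in> strip \<longrightarrow> min \<theta> \<rho> \<le> Gs p \<and> Gs p \<le> max \<theta> \<rho>"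
    by eventually_elim auto
  have "AE x in lborel. True \<longrightarrow> G x 1 \<le> max \<theta> \<rho>"
    by (rule AE_exhaust[OF u(1)]) (use g0 ex1 in auto)
  moreover have "AE x in lborel. True \<longrightarrow> min \<theta> \<rho> \<le> G x 1"
    by (rule AE_exhaust[OF w(1)]) (use g0 ex1 in auto)
  ultimately show "AE x in lborel. min \<theta> \<rho> \<le> G x 1 \<and> G x 1 \<le> max \<theta> \<rho>"
    by eventually_elim auto
qed

section \<open>Bounds along rays at time one\<close>

text \<open>The deficit below \<open>k\<close> is transported with speed at least \<open>s\<close>,
  so it cannot enter the region left of the ray of speed \<open>s\<close>, where it is absent
  initially. The three lemmas that follow treat the other side of the ray and the other
  sign.\<close>

lemma G1_ge_left:
  assumes k: "min \<theta> \<rho> \<le> k" "k \<le> \<theta>"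
    and s: "\<And>z. min \<theta> \<rho> \<le> z \<Longrightarrow> z \<le> max \<theta> \<rho> \<Longrightarrow> z < k \<Longrightarrow> s * (k - z) \<le> f k - f z"
  shows "AE x in lborel. x < s \<longrightarrow> k \<le> G x 1"
proof -
  have k01: "0 \<le> k" "k \<le> 1" using k theta rho by auto
  have fl: "AE p in lborel. p \<in> strip \<longrightarrow> Gs p < k \<longrightarrow> s * (k - Gs p) \<le> f k - f (Gs p) \<and> f k - f (Gs p) \<le> \<kappa> * (k - Gs p)"
    using max_principle(1) by eventually_elim (use s f_lipschitz(2)[OF Gs_unit(1)] in auto)
  show ?thesis
  proof (rule AE_exhaust[OF lower_region(1)[OF k01 fl, of "real n" 0 for n]])
    show "k \<le> G0 x" if "x < 0" for x using that k by (simp add: G0_def)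
    show "\<exists>n. \<kappa> - real n < x \<and> x < 0 + s" if "x < s" for x
    proof -
      obtain n where "\<kappa> - x < real n" using reals_Archimedean2 by blast
      then show ?thesis using that by (intro exI[of _ n]) auto
    qed
  qed
qed

lemma G1_le_right:
  assumes k: "\<rho> \<le> k" "k \<le> max \<theta> \<rho>"
    and s: "\<And>z. min \<theta> \<rho> \<le> z \<Longrightarrow> z \<le> max \<theta> \<rho> \<Longrightarrow> k < z \<Longrightarrow> f z - f k \<le> s * (z - k)"
  shows "AE x in lborel. s < x \<longrightarrow> G x 1 \<le> k"
proof -
  have k01: "0 \<le> k" "k \<le> 1" using k theta rho by auto
  have fl: "AE p in lborel. p \<in> strip \<longrightarrow> k < Gs p \<longrightarrow> 0 * (Gs p - k) \<le> f (Gs p) - f k \<and> f (Gs p) - f k \<le> s * (Gs p - k)"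
    using max_principle(1) by eventually_elim (use s f_lipschitz(1)[OF k01(1)] in auto)
  show ?thesis
  proof (rule AE_exhaust[OF upper_region(1)[OF k01 fl, of 0 "real n" for n]])
    show "G0 x \<le> k" if "- 0 < x" for x using that k by (simp add: G0_def)
    show "\<exists>n. s - 0 < x \<and> x < real n + 0" if "s < x" for x
      using reals_Archimedean2[of x] that by auto
  qed
qed

lemma G1_le_left:
  assumes k: "\<theta> \<le> k" "k \<le> max \<theta> \<rho>"
    and s: "\<And>z. min \<theta> \<rho> \<le> z \<Longrightarrow> z \<le> max \<theta> \<rho> \<Longrightarrow> k < z \<Longrightarrow> s * (z - k) \<le> f z - f k"
  shows "AE x in lborel. x < s \<longrightarrow> G x 1 \<le> k"
proof -
  have k01: "0 \<le> k" "k \<le> 1" using k theta rho by auto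
  have fl: "AE p in lborel. p \<in> strip \<longrightarrow> k < Gs p \<longrightarrow> s * (Gs p - k) \<le> f (Gs p) - f k \<and> f (Gs p) - f k \<le> \<kappa> * (Gs p - k)"
    using max_principle(1) by eventually_elim (use s f_lipschitz(2)[OF k01(1)] in auto)
  show ?thesis
  proof (rule AE_exhaust[OF upper_region(1)[OF k01 fl, of "real n" 0 for n]])
    show "G0 x \<le> k" if "x < 0" for x using that k by (simp add: G0_def)
    show "\<exists>n. \<kappa> - real n < x \<and> x < 0 + s" if "x < s" for x
    proof -
      obtain n where "\<kappa> - x < real n" using reals_Archimedean2 by blast
      then show ?thesis using that by (intro exI[of _ n]) auto
    qed
  qed
qed

lemma G1_ge_right:
  assumes k: "min \<theta> \<rho> \<le> k" "k \<le> \<rho>"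
    and s: "\<And>z. min \<theta> \<rho> \<le> z \<Longrightarrow> z \<le> max \<theta> \<rho> \<Longrightarrow> z < k \<Longrightarrow> f k - f z \<le> s * (k - z)"
  shows "AE x in lborel. s < x \<longrightarrow> k \<le> G x 1"
proof -
  have k01: "0 \<le> k" "k \<le> 1" using k theta rho by auto
  have fl: "AE p in lborel. p \<in> strip \<longrightarrow> Gs p < k \<longrightarrow> 0 * (k - Gs p) \<le> f k - f (Gs p) \<and> f k - f (Gs p) \<le> s * (k - Gs p)"
    using max_principle(1) by eventually_elim (use s f_lipschitz(1)[OF Gs_unit(1)] in auto)
  show ?thesis
  proof (rule AE_exhaust[OF lower_region(1)[OF k01 fl, of 0 "real n" for n]])
    show "k \<le> G0 x" if "- 0 < x" for x using that k by (simp add: G0_def)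
    show "\<exists>n. s - 0 < x \<and> x < real n + 0" if "s < x" for x
      using reals_Archimedean2[of x] that by auto
  qed
qed

theorem entropy_profile:
  assumes "a \<le> b"
  shows "(LINT x:{a..b}|lborel. G x 1) = prof 1 a - prof 1 b"
proof (cases "\<rho> \<le> \<theta>")
  case True
  \<comment> \<open>A maximiser in the Legendre formula, that is, the negative of a subgradient of
    \<open>fan 1\<close>. Any choice is antitone in \<open>x\<close> and can serve as density
    profile.\<close>
  define K where "K = (\<lambda>x. SOME k. \<rho> \<le> k \<and> k \<le> \<theta> \<and> fan 1 x = f k * 1 - k * x)"
  have K: "\<rho> \<le> K x \<and> K x \<le> \<theta> \<and> fan 1 x = f (K x) * 1 - K x * x" for x
    unfolding K_def by (rule someI_ex) (use fan_attained[OF True, of 1 x] in metis)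
  have Kmax: "f z - z * x \<le> f (K x) - K x * x" if "\<rho> \<le> z" "z \<le> \<theta>" for x z
    using fan_ge[OF that, of 1 x] K[of x] by simp
  have P: "K b * (b - a) \<le> fan 1 a - fan 1 b \<and> fan 1 a - fan 1 b \<le> K a * (b - a)" for a b
    using fan_ge[of "K b" 1 a] fan_ge[of "K a" 1 b] K[of a] K[of b] by (simp add: algebra_simps)
  have anti: "K b \<le> K a" if "a < b" for a b
  proof -
    have "K b * (b - a) \<le> K a * (b - a)" using P[of b a] by linarith
    then show ?thesis using that by simp
  qed
  have mm: "min \<theta> \<rho> = \<rho>" "max \<theta> \<rho> = \<theta>" using True by auto
  show ?thesis unfolding prof_def if_P[OF True]
  proof (rule integral_eq_of_monotone_density[where K=K])
    fix a b :: real assume ab: "a < b"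
    \<comment> \<open>Maximality of \<open>K b\<close> at the point b says that the chords of
      \<open>f\<close> going down from \<open>K b\<close> have slope at least b.\<close>
    have "AE x in lborel. x < b \<longrightarrow> K b \<le> G x 1"
      by (rule G1_ge_left) (use K[of b] Kmax[of _ b] mm in \<open>auto simp: algebra_simps\<close>)
    moreover have "AE x in lborel. a < x \<longrightarrow> G x 1 \<le> K a"
      by (rule G1_le_right) (use K[of a] Kmax[of _ a] mm in \<open>auto simp: algebra_simps\<close>)
    ultimately show "AE x in lborel. a < x \<and> x < b \<longrightarrow> min (K a) (K b) \<le> G x 1 \<and> G x 1 \<le> max (K a) (K b)"
      by eventually_elim auto
    show "min (K a) (K b) * (b - a) \<le> fan 1 a - fan 1 b \<and> fan 1 a - fan 1 b \<le> max (K a) (K b) * (b - a)"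
      using P[of b a] anti[OF ab] by (simp add: min_absorb2 max_absorb1)
  next
    show "mono K \<or> antimono K" using anti by (intro disjI2 antimonoI) (metis less_eq_real_def)
    show "0 \<le> K x \<and> K x \<le> 1" for x using K[of x] theta rho by auto
  qed (use G1_unit assms in auto)
next
  case False
  then have less: "\<theta> < \<rho>" by simp
  define K where "K = (\<lambda>x. if x < speed then \<theta> else \<rho>)"
  have mm: "min \<theta> \<rho> = \<theta>" "max \<theta> \<rho> = \<rho>" using less by auto
  have chord: "speed * (z - \<theta>) \<le> f z - f \<theta>" "f \<rho> - f z \<le> speed * (\<rho> - z)" if "\<theta> \<le> z" "z \<le> \<rho>" for z
    using f_above_chord[OF less that] speed_rho[OF less] by (auto simp: algebra_simps)
  have left: "AE x in lborel. x < speed \<longrightarrow> G x 1 \<le> \<theta>"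
    by (rule G1_le_left) (use chord less in auto)
  have right: "AE x in lborel. speed < x \<longrightarrow> \<rho> \<le> G x 1"
    by (rule G1_ge_right) (use chord less in auto)
  have sh: "shock 1 x = (if x < speed then f \<theta> - \<theta> * x else f \<rho> - \<rho> * x)" for x
  proof -
    have "f \<rho> - \<rho> * x - (f \<theta> - \<theta> * x) = (\<rho> - \<theta>) * (speed - x)"
      using speed_rho[OF less] by (simp add: algebra_simps)
    moreover have "0 \<le> (\<rho> - \<theta>) * (speed - x)" if "x < speed" using that less by simp
    moreover have "(\<rho> - \<theta>) * (speed - x) \<le> 0" if "\<not> x < speed" using that less by (simp add: mult_nonneg_nonpos)
    ultimately show ?thesis unfolding shock_def by (cases "x < speed") (simp_all add: min_def)
  qed
  show ?thesis unfolding prof_def if_not_P[OF False]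
  proof (rule integral_eq_of_monotone_density[where K=K])
    fix a b :: real assume ab: "a < b"
    show "AE x in lborel. a < x \<and> x < b \<longrightarrow> min (K a) (K b) \<le> G x 1 \<and> G x 1 \<le> max (K a) (K b)"
      using left right max_principle(2) by eventually_elim (use ab less in \<open>auto simp: K_def\<close>)
    have "(\<rho> - \<theta>) * (b - speed) \<ge> 0" if "speed \<le> b" using that less by simp
    moreover have "(\<rho> - \<theta>) * (speed - a) \<ge> 0" if "a < speed" using that less by simp
    ultimately show "min (K a) (K b) * (b - a) \<le> shock 1 a - shock 1 b \<and> shock 1 a - shock 1 b \<le> max (K a) (K b) * (b - a)"
      using ab less speed_rho[OF less] by (auto simp: sh K_def algebra_simps)
  next
    show "mono K \<or> antimono K" using less by (intro disjI1 monoI) (auto simp: K_def)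
    show "0 \<le> K x \<and> K x \<le> 1" for x using theta rho by (auto simp: K_def)
  qed (use G1_unit assms in auto)
qed

end

end

section \<open>The particle system site by site\<close>

text \<open>A row of the particle dynamics read site by site: the carry entering a site is the remaining jump
  length of the particle travelling over it (0 if there is none).\<close>

definition nextc :: "nat \<Rightarrow> bool \<Rightarrow> bool \<Rightarrow> nat \<Rightarrow> nat" where
  "nextc c s chi j = (if s then (if c = 0 \<and> chi then 0 else j) else c - 1)"

definition nexto :: "nat \<Rightarrow> bool \<Rightarrow> bool \<Rightarrow> bool" where
  "nexto c s chi = (if s then c \<noteq> 0 \<or> chi else c = 1)"

fun scan :: "(int \<Rightarrow> bool) \<Rightarrow> (int \<Rightarrow> nat) \<Rightarrow> int set \<Rightarrow> int \<Rightarrow> nat \<Rightarrow> nat \<Rightarrow> nat" where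
  "scan chi j S a c 0 = c"
| "scan chi j S a c (Suc n) = scan chi j S (a + 1) (nextc c (a \<in> S) (chi a) (j a)) n"

lemma scan_Suc_end:
  "scan chi j S a c (Suc n) = nextc (scan chi j S a c n) (a + int n \<in> S) (chi (a + int n)) (j (a + int n))"
proof (induction n arbitrary: a c)
  case (Suc n)
  let ?c = "nextc c (a \<in> S) (chi a) (j a)"
  have "scan chi j S a c (Suc (Suc n)) = scan chi j S (a + 1) ?c (Suc n)" by (simp only: scan.simps(2))
  also have "\<dots> = nextc (scan chi j S (a + 1) ?c n) (a + 1 + int n \<in> S) (chi (a + 1 + int n)) (j (a + 1 + int n))"
    by (rule Suc.IH)
  also have "scan chi j S (a + 1) ?c n = scan chi j S a c (Suc n)" by (simp only: scan.simps(2))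
  also have "a + 1 + int n = a + int (Suc n)" by simp
  finally show ?case .
qed simp

lemma sv_step_ge:
  assumes "\<And>x. 1 \<le> j x" "sorted_wrt (<) l" "z \<in> set (sv_step chi j prev l)"
  shows "\<exists>x\<in>set l. x \<le> z"
  using assms(2,3)
proof (induction l arbitrary: prev)
  case (Cons x rest)
  let ?jump = "case rest of [] \<Rightarrow> x + int (j x) | y # _ \<Rightarrow> min (x + int (j x)) y"
  have "x \<le> ?jump" using Cons.prems(1) by (auto split: list.splits)
  then show ?case using Cons by (force simp: Let_def split: if_splits)
qed simp

lemma sv_step_sorted:
  assumes j: "\<And>x. 1 \<le> j x"
  shows "sorted_wrt (<) l \<Longrightarrow> (\<And>p. prev = Some p \<Longrightarrow> \<forall>x\<in>set l. p \<le> x) \<Longrightarrow>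
    sorted_wrt (<) (sv_step chi j prev l) \<and> (\<forall>p. prev = Some p \<longrightarrow> (\<forall>z\<in>set (sv_step chi j prev l). p < z))"
proof (induction l arbitrary: prev)
  case (Cons x rest)
  define jump where "jump = (case rest of [] \<Rightarrow> x + int (j x) | y # _ \<Rightarrow> min (x + int (j x)) y)"
  define new where "new = (if prev = Some x then jump else if chi x then x else jump)"
  have st: "sv_step chi j prev (x # rest) = new # sv_step chi j (Some new) rest"
    by (simp add: new_def jump_def Let_def)
  have jx: "x < jump" using Cons.prems(1) j[of x] by (auto simp: jump_def split: list.splits)
  have nx: "new \<le> y" if "y \<in> set rest" for y
  proof -
    have "jump \<le> y" using that Cons.prems(1) by (cases rest) (auto simp: jump_def)
    moreover have "x \<le> y" using that Cons.prems(1) by auto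
    ultimately show ?thesis by (simp add: new_def)
  qed
  have IH: "sorted_wrt (<) (sv_step chi j (Some new) rest) \<and> (\<forall>z\<in>set (sv_step chi j (Some new) rest). new < z)"
    using Cons.IH[of "Some new"] Cons.prems(1) nx by auto
  have pn: "p < new" if "prev = Some p" for p
    using that Cons.prems(2)[OF that] jx by (auto simp: new_def)
  show ?case unfolding st using IH pn by fastforce
qed simp

text \<open>The particle in flight belongs to a list entry already consumed, so its target must be
  added to the positions still to be computed. A carry \<open>c\<close> at \<open>a\<close> takes it
  \<open>c - 1\<close> sites beyond \<open>a\<close> unless the next particle stops it
  earlier.\<close>

definition landing :: "nat \<Rightarrow> int \<Rightarrow> int list \<Rightarrow> int set" where
  "landing c a l = (if c = 0 then {} else {case l of [] \<Rightarrow> a + int c - 1 | y # _ \<Rightarrow> min (a + int c - 1) y})"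

text \<open>The hypothesis on \<open>prev\<close> is the invariant linking the list and the site
  reading. While particles remain, a positive carry means that \<open>prev\<close> is the target of
  the flight, hence equal to the next position exactly when a push occurs; carry 0 means that
  \<open>prev\<close> lies strictly left of \<open>a\<close>.\<close>

lemma sv_step_scan:
  assumes j: "\<And>x. 1 \<le> j x"
  shows "sorted_wrt (<) l \<Longrightarrow> \<forall>x\<in>set l. a \<le> x \<Longrightarrow> \<forall>z\<ge>a. z \<in> S \<longleftrightarrow> z \<in> set l \<Longrightarrow>
    (\<forall>y r. l = y # r \<longrightarrow> (if c = 0 then (\<forall>p. prev = Some p \<longrightarrow> p < a) else prev = Some (min (a + int c - 1) y))) \<Longrightarrow>
    nexto (scan chi j S a c n) (a + int n \<in> S) (chi (a + int n)) \<longleftrightarrow>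
      a + int n \<in> set (sv_step chi j prev l) \<union> landing c a l"
proof (induction n arbitrary: a c prev l)
  case 0
  show ?case
  proof (cases "a \<in> set l")
    case True
    then obtain rest where l: "l = a # rest" using 0(1,2)
      by (cases l) force+
    define jump where "jump = (case rest of [] \<Rightarrow> a + int (j a) | y # _ \<Rightarrow> min (a + int (j a)) y)"
    have jx: "a < jump" using 0(1) j[of a] by (auto simp: jump_def l split: list.splits)
    have rest: "a \<notin> set (sv_step chi j p rest)" for p
      using sv_step_ge[of j rest a chi p] j 0(1) by (fastforce simp: l)
    have "a \<in> S" using 0(3) True by simp
    show ?thesis
    proof (cases "c = 0")
      case c: True
      have "prev \<noteq> Some a" using 0(4) c l by auto
      then show ?thesis using jx c \<open>a \<in> S\<close> rest
        by (simp add: nexto_def landing_def l Let_def jump_def[symmetric])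
    next
      case False
      then show ?thesis using \<open>a \<in> S\<close> by (simp add: nexto_def landing_def l)
    qed
  next
    case False
    then have "a \<notin> S" using 0(3) by simp
    moreover have "a \<notin> set (sv_step chi j prev l)"
      using sv_step_ge[of j l a chi prev] j 0(1,2) False by force
    moreover have "a \<in> landing c a l \<longleftrightarrow> c = 1"
      using 0(2) False by (cases l) (auto simp: landing_def min_def)
    ultimately show ?thesis by (simp add: nexto_def)
  qed
next
  case (Suc n)
  have shift: "a + int (Suc n) = (a + 1) + int n" by simp
  have ne: "(a + 1) + int n \<noteq> a" by simp
  show ?case
  proof (cases "a \<in> set l")
    case True
    then obtain rest where l: "l = a # rest" using Suc.prems(1,2)
      by (cases l) force+
    define jump where "jump = (case rest of [] \<Rightarrow> a + int (j a) | y # _ \<Rightarrow> min (a + int (j a)) y)"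
    define new where "new = (if prev = Some a then jump else if chi a then a else jump)"
    define c' where "c' = nextc c True (chi a) (j a)"
    have st: "sv_step chi j prev l = new # sv_step chi j (Some new) rest"
      by (simp add: new_def jump_def Let_def l)
    have aS: "a \<in> S" using Suc.prems(3) True by simp
    have moves: "new = jump \<and> c' = j a" if "\<not> (c = 0 \<and> chi a)"
      using that Suc.prems(4) by (auto simp: new_def c'_def nextc_def l split: if_splits)
    have stays: "new = a \<and> c' = 0" if "c = 0 \<and> chi a"
      using that Suc.prems(4) by (auto simp: new_def c'_def nextc_def l)
    have ja: "j a \<noteq> 0" using j[of a] by simp
    have land: "landing c' (a + 1) rest = (if c = 0 \<and> chi a then {} else {new})"
      using moves stays ja by (auto simp: landing_def jump_def split: list.splits)
    have "nexto (scan chi j S (a + 1) c' n) ((a + 1) + int n \<in> S) (chi ((a + 1) + int n)) \<longleftrightarrow>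
      (a + 1) + int n \<in> set (sv_step chi j (Some new) rest) \<union> landing c' (a + 1) rest"
    proof (rule Suc.IH)
      show "sorted_wrt (<) rest" using Suc.prems(1) by (simp add: l)
      show "\<forall>x\<in>set rest. a + 1 \<le> x" using Suc.prems(1) by (auto simp: l)
      show "\<forall>z\<ge>a + 1. z \<in> S \<longleftrightarrow> z \<in> set rest" using Suc.prems(3) by (auto simp: l)
      show "\<forall>y r. rest = y # r \<longrightarrow> (if c' = 0 then \<forall>p. Some new = Some p \<longrightarrow> p < a + 1
           else Some new = Some (min (a + 1 + int c' - 1) y))"
        using moves stays ja by (cases "c = 0 \<and> chi a") (auto simp: jump_def)
    qed
    moreover have "(a + 1) + int n \<in> landing c a l \<longleftrightarrow> False"
      using ne by (auto simp: landing_def l)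
    ultimately show ?thesis unfolding shift st scan.simps using aS land stays ne
      by (auto simp: c'_def[symmetric])
  next
    case False
    then have aS: "a \<notin> S" using Suc.prems(3) by simp
    have gt: "\<forall>x\<in>set l. a + 1 \<le> x" using Suc.prems(2) False by (metis dual_order.order_iff_strict zless_imp_add1_zle)
    have land: "(a + 1) + int n \<in> landing (c - 1) (a + 1) l \<longleftrightarrow> (a + 1) + int n \<in> landing c a l"
      using gt by (cases l; cases "c = 1") (auto simp: landing_def of_nat_diff min_def)
    have "nexto (scan chi j S (a + 1) (c - 1) n) ((a + 1) + int n \<in> S) (chi ((a + 1) + int n)) \<longleftrightarrow>
      (a + 1) + int n \<in> set (sv_step chi j prev l) \<union> landing (c - 1) (a + 1) l"
    proof (rule Suc.IH)
      show "\<forall>z\<ge>a + 1. z \<in> S \<longleftrightarrow> z \<in> set l" using Suc.prems(3) by auto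
      show "\<forall>y r. l = y # r \<longrightarrow> (if c - 1 = 0 then \<forall>p. prev = Some p \<longrightarrow> p < a + 1
           else prev = Some (min (a + 1 + int (c - 1) - 1) y))"
      proof (intro allI impI)
        fix y r assume l: "l = y # r"
        then have y: "a < y" using gt by auto
        show "if c - 1 = 0 then \<forall>p. prev = Some p \<longrightarrow> p < a + 1 else prev = Some (min (a + 1 + int (c - 1) - 1) y)"
          using Suc.prems(4)[rule_format, OF l] y by (cases "c = 0"; cases "c = 1") (auto simp: of_nat_diff)
      qed
    qed (use Suc.prems(1) gt in auto)
    then show ?thesis unfolding shift scan.simps using aS land by (simp add: nextc_def)
  qed
qed

section \<open>Truncated systems, carries and locks\<close>

definition occ :: "(sv_src \<Rightarrow> nat) \<Rightarrow> nat \<Rightarrow> nat \<Rightarrow> int \<Rightarrow> bool" where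
  "occ \<omega> M t z \<longleftrightarrow> z \<in> set (sv_trunc \<omega> M t)"

definition car :: "(sv_src \<Rightarrow> nat) \<Rightarrow> nat \<Rightarrow> nat \<Rightarrow> int \<Rightarrow> nat" where
  "car \<omega> M t z = (if z < - int M then 0 else
     scan (\<lambda>x. \<omega> (Chi (Suc t) x) = 1) (\<lambda>x. \<omega> (Jmp (Suc t) x)) (set (sv_trunc \<omega> M t)) (- int M) 0 (nat (z + int M)))"

text \<open>A lock forgets the configuration to its left: no particle jumps over all of the \<open>g\<close> sites from
  \<open>y\<close> on, and a particle found there moves whatever comes from the left.\<close>

definition lock :: "(sv_src \<Rightarrow> nat) \<Rightarrow> nat \<Rightarrow> nat \<Rightarrow> int \<Rightarrow> bool" where
  "lock \<omega> g t y \<longleftrightarrow> (\<forall>z. y \<le> z \<and> z < y + int g \<longrightarrow> \<omega> (Chi (Suc t) z) \<noteq> 1) \<and>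
     (\<forall>z<y. int (\<omega> (Jmp (Suc t) z)) \<le> int g + (y - 1 - z))"

text \<open>Locks in consecutive time steps, each at least \<open>g\<close> sites to the left of the
  next: row \<open>N\<close> to the right of \<open>B\<close> then sees nothing to the left of
  \<open>A\<close>.\<close>

fun chain :: "(sv_src \<Rightarrow> nat) \<Rightarrow> nat \<Rightarrow> nat \<Rightarrow> int \<Rightarrow> int \<Rightarrow> bool" where
  "chain \<omega> g 0 A B \<longleftrightarrow> A \<le> B"
| "chain \<omega> g (Suc N) A B \<longleftrightarrow> (\<exists>y. chain \<omega> g N A y \<and> y + int g \<le> B \<and> lock \<omega> g N y)"

lemma chain_mono: "chain \<omega> g N A B \<Longrightarrow> B \<le> B' \<Longrightarrow> chain \<omega> g N A B'"
  by (cases N) auto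

context
  fixes \<omega> :: "sv_src \<Rightarrow> nat"
  assumes jpos: "\<And>t x. 1 \<le> \<omega> (Jmp t x)"
begin

lemma sv_trunc_sorted: "sorted_wrt (<) (sv_trunc \<omega> M t) \<and> (\<forall>x\<in>set (sv_trunc \<omega> M t). - int M \<le> x)"
proof (induction t)
  case 0
  have "finite {x. \<bar>x\<bar> \<le> int M \<and> \<omega> (Init x) = 1}"
    by (rule finite_subset[of _ "{- int M..int M}"]) auto
  then show ?case by (auto simp: strict_sorted_list_of_set[unfolded strict_sorted_iff[symmetric]] abs_le_iff)
next
  case (Suc t)
  then show ?case
    using sv_step_sorted[of "\<lambda>x. \<omega> (Jmp (Suc t) x)" "sv_trunc \<omega> M t" None "\<lambda>x. \<omega> (Chi (Suc t) x) = 1"] jpos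
      sv_step_ge[of "\<lambda>x. \<omega> (Jmp (Suc t) x)" "sv_trunc \<omega> M t" _ "\<lambda>x. \<omega> (Chi (Suc t) x) = 1" None]
    by (fastforce intro: order_trans)
qed

lemma car_0: "z \<le> - int M \<Longrightarrow> car \<omega> M t z = 0"
  by (simp add: car_def)

lemma occ_False: "z < - int M \<Longrightarrow> \<not> occ \<omega> M t z"
  using sv_trunc_sorted[of M t] by (auto simp: occ_def)

lemma car_step: "car \<omega> M t (z + 1) = nextc (car \<omega> M t z) (occ \<omega> M t z) (\<omega> (Chi (Suc t) z) = 1) (\<omega> (Jmp (Suc t) z))"
proof (cases "z < - int M")
  case True
  then show ?thesis using car_0[of "z + 1" M t] car_0[of z M t] occ_False[OF True] by (simp add: nextc_def)
next
  case False
  then have "nat (z + 1 + int M) = Suc (nat (z + int M))" "- int M + int (nat (z + int M)) = z" by auto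
  then show ?thesis using False unfolding car_def occ_def by (simp only: scan_Suc_end) simp
qed

lemma occ_step: "occ \<omega> M (Suc t) z \<longleftrightarrow> nexto (car \<omega> M t z) (occ \<omega> M t z) (\<omega> (Chi (Suc t) z) = 1)"
proof (cases "z < - int M")
  case True
  then show ?thesis using car_0[of z M t] occ_False[OF True] by (simp add: nexto_def)
next
  case False
  then have z: "- int M + int (nat (z + int M)) = z" by auto
  have "nexto (scan (\<lambda>x. \<omega> (Chi (Suc t) x) = 1) (\<lambda>x. \<omega> (Jmp (Suc t) x)) (set (sv_trunc \<omega> M t)) (- int M) 0 (nat (z + int M)))
      (- int M + int (nat (z + int M)) \<in> set (sv_trunc \<omega> M t)) (\<omega> (Chi (Suc t) (- int M + int (nat (z + int M)))) = 1) \<longleftrightarrow>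
      - int M + int (nat (z + int M)) \<in> set (sv_step (\<lambda>x. \<omega> (Chi (Suc t) x) = 1) (\<lambda>x. \<omega> (Jmp (Suc t) x)) None (sv_trunc \<omega> M t)) \<union> landing 0 (- int M) (sv_trunc \<omega> M t)"
    by (rule sv_step_scan) (use jpos sv_trunc_sorted[of M t] in auto)
  then show ?thesis using False unfolding z by (simp add: occ_def car_def landing_def)
qed

text \<open>A positive carry is the rest of a single jump begun at some \<open>w\<close> <
  \<open>z\<close>, which has lost at least one unit on each empty site passed since.\<close>

lemma car_origin: "car \<omega> M t z = 0 \<or> (\<exists>w<z. int (car \<omega> M t z) \<le> int (\<omega> (Jmp (Suc t) w)) - (z - 1 - w))"
proof (cases "z \<le> - int M")
  case True
  then show ?thesis using car_0 by blast
next
  case False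
  have "- int M \<le> z" using False by simp
  then show ?thesis
  proof (induction z rule: int_ge_induct)
    case base
    then show ?case using car_0 by simp
  next
    case (step z)
    show ?case
    proof (cases "occ \<omega> M t z")
      case True
      then show ?thesis using car_step[of M t z] by (auto simp: nextc_def intro!: exI[of _ z])
    next
      case F: False
      then have c: "car \<omega> M t (z + 1) = car \<omega> M t z - 1" using car_step[of M t z] by (simp add: nextc_def)
      show ?thesis
      proof (cases "car \<omega> M t z = 0")
        case False
        then obtain w where "w < z" "int (car \<omega> M t z) \<le> int (\<omega> (Jmp (Suc t) w)) - (z - 1 - w)" using step.IH by auto
        then show ?thesis unfolding c using False by (intro disjI2 exI[of _ w]) (auto simp: of_nat_diff)
      qed (simp add: c)
    qed
  qed
qed

lemma lock_car: "lock \<omega> g t y \<Longrightarrow> car \<omega> M t y \<le> g"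
  using car_origin[of M t y] unfolding lock_def by force

text \<open>Inside the lock an occupied site resets both carries to its own jump, and an empty site
  lowers both by 1. As they are at most \<open>g\<close> at \<open>y\<close>, they have been reset
  to a common value or are both exhausted after \<open>g\<close> sites.\<close>

lemma lock_merge:
  assumes "lock \<omega> g t y" and eq: "\<And>z. y \<le> z \<Longrightarrow> z \<le> X \<Longrightarrow> occ \<omega> M t z = occ \<omega> M' t z"
    and "y + int g \<le> z" "z \<le> X"
  shows "car \<omega> M t z = car \<omega> M' t z"
proof -
  have step: "car \<omega> M t (y + int i) = car \<omega> M' t (y + int i) \<or> (car \<omega> M t (y + int i) \<le> g - i \<and> car \<omega> M' t (y + int i) \<le> g - i)"
    if "i \<le> g" "y + int i \<le> X" for i
    using that
  proof (induction i)
    case 0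
    then show ?case using lock_car[OF assms(1)] by simp
  next
    case (Suc i)
    have e: "y + int (Suc i) = y + int i + 1" by simp
    have o: "occ \<omega> M t (y + int i) = occ \<omega> M' t (y + int i)" using eq[of "y + int i"] Suc.prems by simp
    have chi: "\<omega> (Chi (Suc t) (y + int i)) \<noteq> 1" using assms(1) Suc.prems unfolding lock_def by auto
    show ?case unfolding e car_step o using Suc.IH Suc.prems chi by (auto simp: nextc_def)
  qed
  have "y + int g \<le> z \<Longrightarrow> z \<le> X \<Longrightarrow> car \<omega> M t z = car \<omega> M' t z" for z
  proof (induction z rule: int_ge_induct)
    case base
    then show ?case using step[of g] by auto
  next
    case (step z)
    then show ?case using eq[of z] by (simp add: car_step)
  qed
  then show ?thesis using assms by blast
qed

lemma chain_agree:
  assumes "- int M \<le> A" "- int M' \<le> A" "X \<le> int M" "X \<le> int M'"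
  shows "chain \<omega> g N A B \<Longrightarrow> B \<le> z \<Longrightarrow> z \<le> X \<Longrightarrow> occ \<omega> M N z = occ \<omega> M' N z"
proof (induction N arbitrary: B z)
  case 0
  have fin: "finite {x. \<bar>x\<bar> \<le> int K \<and> \<omega> (Init x) = 1}" for K
    by (rule finite_subset[of _ "{- int K..int K}"]) auto
  have s0: "z \<in> set (sv_trunc \<omega> K 0) \<longleftrightarrow> \<bar>z\<bar> \<le> int K \<and> \<omega> (Init z) = 1" for K using fin[of K] by simp
  have "A \<le> B" using 0(1) by simp
  then have "\<bar>z\<bar> \<le> int M" "\<bar>z\<bar> \<le> int M'" using 0(2,3) assms by linarith+
  then show ?case unfolding occ_def s0 by simp
next
  case (Suc N)
  obtain y where y: "chain \<omega> g N A y" "y + int g \<le> B" "lock \<omega> g N y" using Suc.prems(1) by auto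
  have eq: "occ \<omega> M N z = occ \<omega> M' N z" if "y \<le> z" "z \<le> X" for z
    using Suc.IH[OF y(1) that] .
  have "car \<omega> M N z = car \<omega> M' N z" by (rule lock_merge[OF y(3) eq]) (use y Suc.prems in auto)
  then show ?case unfolding occ_step using eq[of z] y Suc.prems by auto
qed

text \<open>All truncations from \<open>M\<close> on agree in the window, so the eventual value is
  already the value at \<open>M\<close>.\<close>

lemma sv_config_eq_occ:
  assumes "chain \<omega> g N (- int M) (- w)" "w \<le> int M" "- w \<le> z" "z \<le> w"
  shows "sv_config \<omega> N z = occ \<omega> M N z"
proof -
  have "(z \<in> set (sv_trunc \<omega> M' N)) = occ \<omega> M N z" if "M \<le> M'" for M'
  proof -
    have "occ \<omega> M N z = occ \<omega> M' N z"
      by (rule chain_agree[OF _ _ _ _ assms(1,3,4)]) (use that assms in auto)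
    then show ?thesis by (simp add: occ_def)
  qed
  then have "\<forall>\<^sub>F M' in sequentially. (z \<in> set (sv_trunc \<omega> M' N)) = occ \<omega> M N z"
    unfolding eventually_sequentially by blast
  then have "sv_config \<omega> N z = (\<forall>\<^sub>F M' in sequentially. occ \<omega> M N z)"
    unfolding sv_config_def by (rule eventually_subst)
  then show ?thesis by simp
qed

end

section \<open>Laws of one row and locality\<close>

text \<open>List forms of a row update, which allow the law of a row to be computed by induction on
  the row.\<close>

fun rowJ :: "(int \<Rightarrow> bool) \<Rightarrow> (int \<Rightarrow> nat) \<Rightarrow> int \<Rightarrow> nat \<Rightarrow> bool list \<Rightarrow> bool list" where
  "rowJ chi j a c [] = []"
| "rowJ chi j a c (b # bs) = nexto c b (chi a) # rowJ chi j (a + 1) (nextc c b (chi a) (j a)) bs"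

fun rowV :: "(nat \<Rightarrow> bool) \<Rightarrow> (nat \<Rightarrow> bool) \<Rightarrow> nat \<Rightarrow> bool \<Rightarrow> bool list \<Rightarrow> bool list" where
  "rowV c d x h [] = []"
| "rowV c d x h (b # bs) = vtop (c x) (d x) b h # rowV c d (Suc x) (vright (c x) (d x) b h) bs"

lemma rowJ_map:
  assumes "\<And>z. cc (z + 1) = nextc (cc z) (os z) (chi z) (j z)"
  shows "map (\<lambda>i. nexto (cc (a + int i)) (os (a + int i)) (chi (a + int i))) [0..<n] =
    rowJ chi j a (cc a) (map (\<lambda>i. os (a + int i)) [0..<n])"
proof (induction n arbitrary: a)
  case (Suc n)
  have sh: "a + int (Suc i) = (a + 1) + int i" for i by simp
  show ?case using Suc[of "a + 1"] unfolding map_upt_Suc sh by (simp add: assms)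
qed simp

lemma rowV_map:
  "map (\<lambda>i. Vx c d v h (Suc t) (x + i)) [0..<n] =
    rowV (c t) (d t) x (Hx c d v h t x) (map (\<lambda>i. Vx c d v h t (x + i)) [0..<n])"
proof (induction n arbitrary: x)
  case (Suc n)
  have sh: "x + Suc i = Suc x + i" for i by simp
  show ?case using Suc[of "Suc x"] unfolding map_upt_Suc sh by simp
qed simp

lemma length_rowJ: "length (rowJ chi j a c bs) = length bs"
  by (induction bs arbitrary: a c) auto

lemma sv_step_cong:
  "(\<And>x. x \<in> set l \<Longrightarrow> chi x = chi' x \<and> j x = j' x) \<Longrightarrow> sv_step chi j prev l = sv_step chi' j' prev l"
proof (induction l arbitrary: prev)
  case (Cons x l)
  have e: "chi x = chi' x" "j x = j' x" using Cons.prems[of x] by auto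
  have IH: "sv_step chi j p l = sv_step chi' j' p l" for p using Cons by simp
  show ?case unfolding sv_step.simps Let_def e IH ..
qed simp

context riemann_problem
begin

section \<open>Events and laws of the particle sources\<close>

sublocale sv: coordinate_space "\<lambda>i. measure_pmf (sv_law b1 b2 \<theta> \<rho> i)"
  by (rule coordinate_space.intro) (simp_all add: measure_pmf.prob_space_axioms)

text \<open>The sources are natural numbers, so any predicate of finitely many of them is a
  countable union of cylinders. Measurability for the particle dynamics thereby reduces to
  \<open>dep_on\<close>.\<close>

lemma sv_ev_finite: "finite I \<Longrightarrow> dep_on I P \<Longrightarrow> sv.ev P"
proof (induction I arbitrary: P rule: finite_induct)
  case empty
  then have "P \<omega> = P undefined" for \<omega> unfolding dep_on_def by blast
  then have "{\<omega>. P \<omega>} = UNIV \<or> {\<omega>. P \<omega>} = {}" by (cases "P undefined") auto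
  then show ?case using sets.top[of sv.PM] by auto
next
  case (insert i I)
  have e: "{\<omega>. P \<omega>} = (\<Union>v. {\<omega>. \<omega> i = v} \<inter> {\<omega>. P (fun_upd \<omega> i v)})"
  proof (intro set_eqI iffI)
    fix \<omega> assume "\<omega> \<in> {\<omega>. P \<omega>}"
    then show "\<omega> \<in> (\<Union>v. {\<omega>. \<omega> i = v} \<inter> {\<omega>. P (fun_upd \<omega> i v)})" by (auto intro!: exI[of _ "\<omega> i"])
  qed auto
  have "sv.ev (\<lambda>\<omega>. P (fun_upd \<omega> i v))" for v
  proof (rule insert.IH, rule dep_onI)
    fix \<omega> \<omega>' :: "sv_src \<Rightarrow> nat" assume "\<And>k. k \<in> I \<Longrightarrow> \<omega> k = \<omega>' k"
    then show "P (fun_upd \<omega> i v) = P (fun_upd \<omega>' i v)" by (intro dep_onD[OF insert.prems]) auto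
  qed
  moreover have "sv.ev (\<lambda>\<omega>. \<omega> i = v)" for v by (rule sv.ev_coord) simp
  ultimately show ?case unfolding e by (intro sets.countable_UN sets.Int image_subsetI) auto
qed

lemma sv_pred_coord [measurable]: "Measurable.pred sv.PM (\<lambda>\<omega>. Q (\<omega> i))"
  using sv.ev_coord[of Q i] by (simp only: sv.ev_iff_pred[symmetric]) simp

lemma pr_chi: "sv.pr (\<lambda>\<omega>. \<omega> (Chi t x) = 1) = b1"
proof -
  have "sv.pr (\<lambda>\<omega>. \<omega> (Chi t x) = 1) = measure_pmf.prob (map_pmf of_bool (bernoulli_pmf b1)) {v. v = (1::nat)}"
    by (subst sv.pr_coord) (simp, simp only: sv_law_def sv_src.case)
  also have "\<dots> = measure_pmf.prob (bernoulli_pmf b1) {True}"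
    unfolding measure_map_pmf by (rule arg_cong[where f="measure_pmf.prob _"]) (auto simp: of_bool_def split: if_splits)
  finally show ?thesis using b1 by (simp add: measure_pmf_single)
qed

lemma pr_init: "sv.pr (\<lambda>\<omega>. \<omega> (Init x) = 1) = (if x \<le> 0 then \<theta> else \<rho>)"
proof -
  have "sv.pr (\<lambda>\<omega>. \<omega> (Init x) = 1) = measure_pmf.prob (map_pmf of_bool (bernoulli_pmf (if x \<le> 0 then \<theta> else \<rho>))) {v. v = (1::nat)}"
    by (subst sv.pr_coord) (simp, simp only: sv_law_def sv_src.case)
  also have "\<dots> = measure_pmf.prob (bernoulli_pmf (if x \<le> 0 then \<theta> else \<rho>)) {True}"
    unfolding measure_map_pmf by (rule arg_cong[where f="measure_pmf.prob _"]) (auto simp: of_bool_def split: if_splits)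
  finally show ?thesis using theta rho by (simp add: measure_pmf_single)
qed

lemma pr_jmp_eq: "sv.pr (\<lambda>\<omega>. \<omega> (Jmp t x) = Suc r) = b2 ^ r * (1 - b2)"
proof -
  have "sv.pr (\<lambda>\<omega>. \<omega> (Jmp t x) = Suc r) = measure_pmf.prob (map_pmf Suc (geometric_pmf (1 - b2))) {v. v = Suc r}"
    by (subst sv.pr_coord) (simp, simp only: sv_law_def sv_src.case)
  also have "\<dots> = measure_pmf.prob (geometric_pmf (1 - b2)) {r}"
    unfolding measure_map_pmf by (rule arg_cong[where f="measure_pmf.prob _"]) auto
  finally show ?thesis using b2 by (simp add: measure_pmf_single)
qed

lemma pr_jmp_gt: "sv.pr (\<lambda>\<omega>. m < \<omega> (Jmp t x)) = b2 ^ m"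
proof -
  have "sv.pr (\<lambda>\<omega>. m < \<omega> (Jmp t x)) = measure_pmf.prob (geometric_pmf (1 - b2)) {g. m < Suc g}"
    by (subst sv.pr_coord) (simp_all add: sv_law_def vimage_def)
  also have "{g. m < Suc g} = - {..<m}" by auto
  also have "measure_pmf.prob (geometric_pmf (1 - b2)) (- {..<m}) = 1 - measure_pmf.prob (geometric_pmf (1 - b2)) {..<m}"
    using measure_pmf.prob_compl[of "{..<m}" "geometric_pmf (1 - b2)"] by (simp add: Compl_eq_Diff_UNIV)
  also have "measure_pmf.prob (geometric_pmf (1 - b2)) {..<m} = (\<Sum>r<m. b2 ^ r * (1 - b2))"
    using b2 by (subst measure_measure_pmf_finite) auto
  also have "\<dots> = 1 - b2 ^ m"
    by (simp add: one_diff_power_eq sum_distrib_left mult.commute)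
  finally show ?thesis by simp
qed

lemma AE_jpos: "AE \<omega> in sv.PM. \<forall>t x. 1 \<le> \<omega> (Jmp t x)"
proof -
  have "AE \<omega> in sv.PM. 1 \<le> \<omega> (Jmp t x)" for t x
  proof -
    have "sv.pr (\<lambda>\<omega>. 0 < \<omega> (Jmp t x)) = 1" using pr_jmp_gt[of 0] by simp
    then have "AE \<omega> in sv.PM. \<omega> \<in> {\<omega>. 0 < \<omega> (Jmp t x)}" by (rule sv.AE_prob_1)
    then show ?thesis by (simp add: Suc_le_eq)
  qed
  then show ?thesis by (simp add: AE_all_countable)
qed

lemma measurable_lock [measurable]: "Measurable.pred sv.PM (\<lambda>\<omega>. lock \<omega> g t y)"
  unfolding lock_def by measurable

lemma measurable_chain [measurable]: "Measurable.pred sv.PM (\<lambda>\<omega>. chain \<omega> g N A B)"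
proof (induction N arbitrary: B)
  case (Suc N)
  note [measurable] = Suc
  show ?case unfolding chain.simps by measurable
qed simp

section \<open>Locks far to the left\<close>

text \<open>A local version of \<open>lock\<close>: jumps are inspected only from the
  \<open>D\<close> sites to the left, so that copies at distance \<open>D + g\<close> are
  independent. Violations from farther away are estimated by \<open>pr_long_jump\<close>.\<close>

definition quiet :: "nat \<Rightarrow> nat \<Rightarrow> nat \<Rightarrow> int \<Rightarrow> (sv_src \<Rightarrow> nat) \<Rightarrow> bool" where
  "quiet g D t y \<omega> \<longleftrightarrow> (\<forall>z\<in>{y..<y + int g}. \<omega> (Chi (Suc t) z) \<noteq> 1) \<and> \<not> (\<exists>d\<in>{..<D}. g + d < \<omega> (Jmp (Suc t) (y - 1 - int d)))"

lemma pr_long_jump: "sv.pr (\<lambda>\<omega>. \<exists>d. g + (D + d) < \<omega> (Jmp (Suc t) (y - 1 - int (D + d)))) \<le> b2 ^ (g + D) / (1 - b2)"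
proof -
  have e: "{\<omega>. \<exists>d. g + (D + d) < \<omega> (Jmp (Suc t) (y - 1 - int (D + d)))} = (\<Union>d. {\<omega>. g + (D + d) < \<omega> (Jmp (Suc t) (y - 1 - int (D + d)))})"
    by auto
  have s: "(\<lambda>d. b2 ^ (g + D) * b2 ^ d) sums (b2 ^ (g + D) * (1 / (1 - b2)))"
    using b2 by (intro sums_mult geometric_sums) auto
  have "measure sv.PM (\<Union>d. {\<omega>. g + (D + d) < \<omega> (Jmp (Suc t) (y - 1 - int (D + d)))}) \<le>
      (\<Sum>d. sv.pr (\<lambda>\<omega>. g + (D + d) < \<omega> (Jmp (Suc t) (y - 1 - int (D + d)))))"
  proof (rule sv.finite_measure_subadditive_countably)
    have "sv.ev (\<lambda>\<omega>. g + (D + d) < \<omega> (Jmp (Suc t) (y - 1 - int (D + d))))" for d by (rule sv.ev_coord) simp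
    then show "range (\<lambda>d. {\<omega>. g + (D + d) < \<omega> (Jmp (Suc t) (y - 1 - int (D + d)))}) \<subseteq> sv.events" by blast
    show "summable (\<lambda>d. sv.pr (\<lambda>\<omega>. g + (D + d) < \<omega> (Jmp (Suc t) (y - 1 - int (D + d)))))"
      using sums_summable[OF s] unfolding pr_jmp_gt by (simp add: power_add mult.assoc)
  qed
  also have "\<dots> = b2 ^ (g + D) * (1 / (1 - b2))" using sums_unique[OF s] unfolding pr_jmp_gt by (simp add: power_add mult.assoc)
  finally show ?thesis unfolding e by simp
qed

lemma dep_quiet: "dep_on ((\<lambda>z. Chi (Suc t) z) ` {y - int D..<y + int g} \<union> (\<lambda>z. Jmp (Suc t) z) ` {y - int D..<y + int g}) (quiet g D t y)"
  unfolding quiet_def[abs_def]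
  by (intro dep_on_conj dep_on_not dep_onI) (auto intro!: ball_cong bex_cong)

lemma ev_quiet: "sv.ev (quiet g D t y)"
  by (rule sv_ev_finite[OF _ dep_quiet]) auto

text \<open>The lower bound is uniform in \<open>D\<close>, which permits fixing the number of
  trials before \<open>D\<close>.\<close>

lemma pr_quiet:
  assumes g: "b2 ^ g / (1 - b2) \<le> 1 / 2"
  shows "(1 - b1) ^ g / 2 \<le> sv.pr (quiet g D t y)"
proof -
  let ?A = "\<lambda>\<omega>. \<forall>z\<in>{y..<y + int g}. \<omega> (Chi (Suc t) z) \<noteq> 1"
  let ?B = "\<lambda>\<omega>. \<exists>d\<in>{..<D}. g + d < \<omega> (Jmp (Suc t) (y - 1 - int d))"
  have dA: "dep_on ((\<lambda>z. Chi (Suc t) z) ` {y..<y + int g}) ?A" by (rule dep_onI) auto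
  have dB: "dep_on ((\<lambda>d. Jmp (Suc t) (y - 1 - int d)) ` {..<D}) ?B" by (rule dep_onI) auto
  have eA: "sv.ev ?A" by (rule sv_ev_finite[OF _ dA]) auto
  have eB: "sv.ev ?B" by (rule sv_ev_finite[OF _ dB]) auto
  have enB: "sv.ev (\<lambda>\<omega>. \<not> ?B \<omega>)" by (rule sv_ev_finite[OF _ dep_on_not[OF dB]]) auto
  have "sv.pr ?A = sv.pr (\<lambda>\<omega>. \<forall>i\<in>(\<lambda>z. Chi (Suc t) z) ` {y..<y + int g}. \<omega> i \<in> {v. v \<noteq> 1})" by simp
  also have "\<dots> = (\<Prod>i\<in>(\<lambda>z. Chi (Suc t) z) ` {y..<y + int g}. measure (measure_pmf (sv_law b1 b2 \<theta> \<rho> i)) {v. v \<noteq> 1})"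
    by (rule sv.pr_cylinder) auto
  also have "\<dots> = (\<Prod>i\<in>(\<lambda>z. Chi (Suc t) z) ` {y..<y + int g}. 1 - b1)"
  proof (rule prod.cong[OF refl], clarify)
    fix z
    have "sv.pr (\<lambda>\<omega>. \<not> \<omega> (Chi (Suc t) z) = 1) = 1 - b1" using sv.pr_not[OF sv.ev_coord[of "\<lambda>v. v = 1" "Chi (Suc t) z"]] pr_chi by simp
    then show "measure_pmf.prob (sv_law b1 b2 \<theta> \<rho> (Chi (Suc t) z)) {v. v \<noteq> 1} = 1 - b1"
      by (subst (asm) sv.pr_coord) auto
  qed
  also have "\<dots> = (1 - b1) ^ g" by (simp add: card_image inj_on_def)
  finally have pA: "sv.pr ?A = (1 - b1) ^ g" .
  have "sv.pr ?B \<le> sv.pr (\<lambda>\<omega>. \<exists>d. g + (0 + d) < \<omega> (Jmp (Suc t) (y - 1 - int (0 + d))))"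
  proof (rule sv.pr_mono)
    show "sv.ev (\<lambda>\<omega>. \<exists>d. g + (0 + d) < \<omega> (Jmp (Suc t) (y - 1 - int (0 + d))))"
      unfolding sv.ev_iff_pred by measurable
  qed auto
  also have "\<dots> \<le> 1 / 2" by (rule order_trans[OF pr_long_jump]) (use g in simp)
  finally have pB: "sv.pr ?B \<le> 1 / 2" .
  have "sv.pr (quiet g D t y) = sv.pr ?A * sv.pr (\<lambda>\<omega>. \<not> ?B \<omega>)"
    unfolding quiet_def by (rule sv.pr_indep[OF eA enB dA dep_on_not[OF dB]]) auto
  also have "\<dots> = (1 - b1) ^ g * (1 - sv.pr ?B)" using sv.pr_not[OF eB] pA by simp
  also have "\<dots> \<ge> (1 - b1) ^ g * (1 / 2)" using pB b1 by (intro mult_left_mono) auto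
  finally show ?thesis by simp
qed

lemma lock_likely:
  assumes g: "b2 ^ g / (1 - b2) \<le> 1 / 2" and \<delta>: "0 < \<delta>"
  obtains A where "sv.pr (\<lambda>\<omega>. \<not> (\<exists>y. A \<le> y \<and> y + int g \<le> B \<and> lock \<omega> g t y)) \<le> \<delta>"
proof -
  define p0 where "p0 = (1 - b1) ^ g / 2"
  have p0: "0 < p0" "p0 \<le> 1" unfolding p0_def using b1 power_le_one[of "1 - b1" g] by auto
  obtain n where n: "(1 - p0) ^ n < \<delta> / 2" using real_arch_pow_inv[of "\<delta> / 2" "1 - p0"] \<delta> p0 by auto
  \<comment> \<open>Chosen after \<open>n\<close>, so that violations from beyond \<open>D\<close>
    in any of the \<open>n\<close> trials have total probability at most \<delta> / 2.\<close>
  obtain D where D: "b2 ^ D < \<delta> / 2 * (1 - b2) / (real n + 1)"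
    using real_arch_pow_inv[of "\<delta> / 2 * (1 - b2) / (real n + 1)" b2] \<delta> b2 by auto
  define y where "y = (\<lambda>i::nat. B - int g - int i * int (D + g))"
  let ?far = "\<lambda>i \<omega>. \<exists>d. g + (D + d) < \<omega> (Jmp (Suc t) (y i - 1 - int (D + d)))"
  have y_mono: "y j \<le> y i" if "i \<le> j" for i j
    unfolding y_def using that by (intro diff_left_mono mult_right_mono) auto
  have y_Suc: "y i = y (Suc i) + int D + int g" for i unfolding y_def by (simp add: algebra_simps)
  have none: "sv.pr (\<lambda>\<omega>. \<forall>i\<in>{..<k}. \<not> quiet g D t (y i) \<omega>) \<le> (1 - p0) ^ k" for k
  proof (induction k)
    case (Suc k)
    define I where "I = (\<lambda>z. Chi (Suc t) z) ` {y k + int g..<B} \<union> (\<lambda>z. Jmp (Suc t) z) ` {y k + int g..<B}"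
    have dA: "dep_on I (\<lambda>\<omega>. \<forall>i\<in>{..<k}. \<not> quiet g D t (y i) \<omega>)"
    proof (intro dep_on_all dep_on_not dep_on_mono[OF dep_quiet])
      fix i assume "i \<in> {..<k}"
      then have "y (Suc i) \<ge> y k" by (intro y_mono) auto
      then have "y k + int g \<le> y i - int D" using y_Suc[of i] by linarith
      moreover have "y i + int g \<le> B" by (simp add: y_def)
      ultimately show "(\<lambda>z. Chi (Suc t) z) ` {y i - int D..<y i + int g} \<union> (\<lambda>z. Jmp (Suc t) z) ` {y i - int D..<y i + int g} \<subseteq> I"
        unfolding I_def by (intro Un_mono image_mono) auto
    qed
    have eA: "sv.ev (\<lambda>\<omega>. \<forall>i\<in>{..<k}. \<not> quiet g D t (y i) \<omega>)" by (rule sv_ev_finite[OF _ dA]) (auto simp: I_def)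
    have eQ: "sv.ev (\<lambda>\<omega>. \<not> quiet g D t (y k) \<omega>)" by (rule sv_ev_finite[OF _ dep_on_not[OF dep_quiet]]) auto
    have disj: "I \<inter> ((\<lambda>z. Chi (Suc t) z) ` {y k - int D..<y k + int g} \<union> (\<lambda>z. Jmp (Suc t) z) ` {y k - int D..<y k + int g}) = {}"
      by (auto simp: I_def)
    have "(\<lambda>\<omega>. \<forall>i\<in>{..<Suc k}. \<not> quiet g D t (y i) \<omega>) = (\<lambda>\<omega>. (\<forall>i\<in>{..<k}. \<not> quiet g D t (y i) \<omega>) \<and> \<not> quiet g D t (y k) \<omega>)"
      by (auto simp: lessThan_Suc)
    then have "sv.pr (\<lambda>\<omega>. \<forall>i\<in>{..<Suc k}. \<not> quiet g D t (y i) \<omega>) =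
        sv.pr (\<lambda>\<omega>. \<forall>i\<in>{..<k}. \<not> quiet g D t (y i) \<omega>) * sv.pr (\<lambda>\<omega>. \<not> quiet g D t (y k) \<omega>)"
      using sv.pr_indep[OF eA eQ dA dep_on_not[OF dep_quiet]] disj by simp
    also have "sv.pr (\<lambda>\<omega>. \<not> quiet g D t (y k) \<omega>) \<le> 1 - p0"
      using sv.pr_not[OF ev_quiet, of g D t "y k"] pr_quiet[OF g, of D t "y k"] by (simp add: p0_def)
    then have "sv.pr (\<lambda>\<omega>. \<forall>i\<in>{..<k}. \<not> quiet g D t (y i) \<omega>) * sv.pr (\<lambda>\<omega>. \<not> quiet g D t (y k) \<omega>) \<le> (1 - p0) ^ k * (1 - p0)"
      using Suc p0 by (intro mult_mono) auto
    finally show ?case by (simp add: mult.commute)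
  qed simp
  have evf: "sv.ev (?far i)" for i unfolding sv.ev_iff_pred by measurable
  have "sv.pr (\<lambda>\<omega>. \<exists>i\<in>{..<n}. ?far i \<omega>) \<le> (\<Sum>i<n. sv.pr (?far i))"
    using evf by (intro sv.pr_Bex_le) auto
  also have "\<dots> \<le> (\<Sum>i<n. b2 ^ (g + D) / (1 - b2))" by (intro sum_mono pr_long_jump)
  also have "\<dots> = real n * (b2 ^ g * (b2 ^ D / (1 - b2)))" by (simp add: power_add)
  also have "\<dots> \<le> real n * (1 * (\<delta> / 2 / (real n + 1)))"
  proof (intro mult_left_mono mult_mono)
    show "b2 ^ D / (1 - b2) \<le> \<delta> / 2 / (real n + 1)" using D b2 by (simp add: field_simps)
    show "b2 ^ g \<le> 1" using b2 by (simp add: power_le_one)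
  qed (use b2 in auto)
  also have "\<dots> \<le> \<delta> / 2" using \<delta> by (simp add: field_simps)
  finally have far: "sv.pr (\<lambda>\<omega>. \<exists>i\<in>{..<n}. ?far i \<omega>) \<le> \<delta> / 2" .
  have lockI: "lock \<omega> g t (y i)" if "quiet g D t (y i) \<omega>" "\<not> ?far i \<omega>" for i \<omega>
    unfolding lock_def
  proof (intro conjI allI impI)
    fix z assume "y i \<le> z \<and> z < y i + int g"
    then show "\<omega> (Chi (Suc t) z) \<noteq> 1" using that(1) by (auto simp: quiet_def)
  next
    fix z assume z: "z < y i"
    define d where "d = nat (y i - 1 - z)"
    have zd: "z = y i - 1 - int d" using z by (simp add: d_def)
    have "\<omega> (Jmp (Suc t) (y i - 1 - int d)) \<le> g + d"
    proof (cases "d < D")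
      case True
      then show ?thesis using that(1) by (auto simp: quiet_def not_less)
    next
      case False
      then show ?thesis using that(2) by (metis le_add_diff_inverse not_less)
    qed
    then show "int (\<omega> (Jmp (Suc t) z)) \<le> int g + (y i - 1 - z)" unfolding zd by simp
  qed
  have eA: "sv.ev (\<lambda>\<omega>. \<forall>i\<in>{..<n}. \<not> quiet g D t (y i) \<omega>)"
  proof -
    have [measurable]: "Measurable.pred sv.PM (quiet g D t (y i))" for i using ev_quiet by (simp only: sv.ev_iff_pred)
    show ?thesis unfolding sv.ev_iff_pred by measurable
  qed
  have eF: "sv.ev (\<lambda>\<omega>. \<exists>i\<in>{..<n}. ?far i \<omega>)" unfolding sv.ev_iff_pred by measurable
  show ?thesis
  proof (rule that[of "y n"])
    have "sv.pr (\<lambda>\<omega>. \<not> (\<exists>z. y n \<le> z \<and> z + int g \<le> B \<and> lock \<omega> g t z)) \<le>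
       sv.pr (\<lambda>\<omega>. (\<forall>i\<in>{..<n}. \<not> quiet g D t (y i) \<omega>) \<or> (\<exists>i\<in>{..<n}. ?far i \<omega>))"
    proof (rule sv.pr_mono)
      fix \<omega> assume *: "\<not> (\<exists>z. y n \<le> z \<and> z + int g \<le> B \<and> lock \<omega> g t z)"
      have "\<not> lock \<omega> g t (y i)" if "i < n" for i
        using * y_mono[of i n] that by (auto simp: y_def)
      then show "(\<forall>i\<in>{..<n}. \<not> quiet g D t (y i) \<omega>) \<or> (\<exists>i\<in>{..<n}. ?far i \<omega>)" using lockI by blast
    next
      have [measurable]: "Measurable.pred sv.PM (quiet g D t (y i))" for i using ev_quiet by (simp only: sv.ev_iff_pred)
      show "sv.ev (\<lambda>\<omega>. (\<forall>i\<in>{..<n}. \<not> quiet g D t (y i) \<omega>) \<or> (\<exists>i\<in>{..<n}. ?far i \<omega>))"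
        unfolding sv.ev_iff_pred by measurable
    qed
    also have "\<dots> \<le> (1 - p0) ^ n + \<delta> / 2"
      using sv.pr_disj_le[OF eA eF] none[of n] far by linarith
    also have "\<dots> \<le> \<delta>" using n by simp
    finally show "sv.pr (\<lambda>\<omega>. \<not> (\<exists>z. y n \<le> z \<and> z + int g \<le> B \<and> lock \<omega> g t z)) \<le> \<delta>" .
  qed
qed

text \<open>Induction backwards in time: the last lock is found between \<open>A1\<close> and
  \<open>B\<close>, the earlier ones to the left of \<open>A1\<close>, and \<open>chain_mono\<close>
  bridges the gap.\<close>

lemma chain_likely:
  assumes g: "b2 ^ g / (1 - b2) \<le> 1 / 2"
  shows "0 < \<delta> \<Longrightarrow> \<exists>A. \<forall>A'\<le>A. sv.pr (\<lambda>\<omega>. \<not> chain \<omega> g N A' B) \<le> \<delta>"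
proof (induction N arbitrary: B \<delta>)
  case 0
  then show ?case by (intro exI[of _ B]) auto
next
  case (Suc N)
  obtain A1 where A1: "sv.pr (\<lambda>\<omega>. \<not> (\<exists>y. A1 \<le> y \<and> y + int g \<le> B \<and> lock \<omega> g N y)) \<le> \<delta> / 2"
    using lock_likely[OF g, of "\<delta> / 2" B N] Suc.prems by auto
  obtain A where A: "\<And>A'. A' \<le> A \<Longrightarrow> sv.pr (\<lambda>\<omega>. \<not> chain \<omega> g N A' A1) \<le> \<delta> / 2"
    using Suc.IH[of "\<delta> / 2" A1] Suc.prems by auto
  have "sv.pr (\<lambda>\<omega>. \<not> chain \<omega> g (Suc N) A' B) \<le> \<delta>" if "A' \<le> A" for A'
  proof -
    have ev: "sv.ev (\<lambda>\<omega>. \<not> chain \<omega> g N A' A1)" "sv.ev (\<lambda>\<omega>. \<not> (\<exists>y. A1 \<le> y \<and> y + int g \<le> B \<and> lock \<omega> g N y))"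
      "sv.ev (\<lambda>\<omega>. \<not> chain \<omega> g N A' A1 \<or> \<not> (\<exists>y. A1 \<le> y \<and> y + int g \<le> B \<and> lock \<omega> g N y))"
      unfolding sv.ev_iff_pred by measurable
    have "sv.pr (\<lambda>\<omega>. \<not> chain \<omega> g (Suc N) A' B) \<le> sv.pr (\<lambda>\<omega>. \<not> chain \<omega> g N A' A1 \<or> \<not> (\<exists>y. A1 \<le> y \<and> y + int g \<le> B \<and> lock \<omega> g N y))"
      by (rule sv.pr_mono[OF _ ev(3)]) (use chain_mono in auto)
    also have "\<dots> \<le> \<delta>" using sv.pr_disj_le[OF ev(1,2)] A[OF that] A1 by linarith
    finally show ?thesis .
  qed
  then show ?case by blast
qed

section \<open>Transition law of a particle row\<close>

text \<open>The common one-row transition probability of both models, from \<open>bs\<close> to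
  \<open>es\<close> when \<open>h\<close> tells whether a path enters from the left.\<close>

fun pv :: "bool \<Rightarrow> bool list \<Rightarrow> bool list \<Rightarrow> real" where
  "pv h [] es = of_bool (es = [])"
| "pv h (b # bs) [] = 0"
| "pv h (b # bs) (e # es) =
    (if b = h then (if e = b then pv h bs es else 0)
     else if b then (if e then b1 * pv False bs es else (1 - b1) * pv True bs es)
     else (if e then (1 - b2) * pv False bs es else b2 * pv True bs es))"

abbreviation rJ :: "nat \<Rightarrow> int \<Rightarrow> nat \<Rightarrow> bool list \<Rightarrow> (sv_src \<Rightarrow> nat) \<Rightarrow> bool list" where
  "rJ t a c bs \<omega> \<equiv> rowJ (\<lambda>x. \<omega> (Chi t x) = 1) (\<lambda>x. \<omega> (Jmp t x)) a c bs"

definition siteJ :: "nat \<Rightarrow> int \<Rightarrow> nat \<Rightarrow> sv_src set" where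
  "siteJ t a n = (\<lambda>z. Chi t z) ` {a..<a + int n} \<union> (\<lambda>z. Jmp t z) ` {a..<a + int n}"

lemma dep_rJ: "dep_on (siteJ t a (length bs)) (\<lambda>\<omega>. rJ t a c bs \<omega>)"
proof (induction bs arbitrary: a c)
  case (Cons b bs)
  show ?case
  proof (rule dep_onI)
    fix \<omega> \<omega>' :: "sv_src \<Rightarrow> nat"
    assume *: "\<And>i. i \<in> siteJ t a (length (b # bs)) \<Longrightarrow> \<omega> i = \<omega>' i"
    have "\<omega> (Chi t a) = \<omega>' (Chi t a)" "\<omega> (Jmp t a) = \<omega>' (Jmp t a)"
      by (rule *; force simp: siteJ_def)+
    moreover have "rJ t (a + 1) c' bs \<omega> = rJ t (a + 1) c' bs \<omega>'" for c'
      by (rule dep_onD[OF Cons], rule *) (force simp: siteJ_def)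
    ultimately show "rJ t a c (b # bs) \<omega> = rJ t a c (b # bs) \<omega>'" by simp
  qed
qed (auto simp: dep_on_def)

lemma dep_rJ_eq: "dep_on (siteJ t a (length bs)) (\<lambda>\<omega>. rJ t a c bs \<omega> = es)"
  by (rule dep_on_comp1[OF dep_rJ])

lemma finite_siteJ [simp]: "finite (siteJ t a n)" by (simp add: siteJ_def)

lemma ev_rJ: "sv.ev (\<lambda>\<omega>. rJ t a c bs \<omega> = es)"
  by (rule sv_ev_finite[OF finite_siteJ dep_rJ_eq])

lemma dep_jump_row: "dep_on (insert (Jmp t a) (siteJ t (a + 1) (length bs))) (\<lambda>\<omega>. rJ t (a + 1) (\<omega> (Jmp t a)) bs \<omega> = es)"
proof (rule dep_onI)
  fix \<omega> \<omega>' :: "sv_src \<Rightarrow> nat"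
  assume *: "\<And>i. i \<in> insert (Jmp t a) (siteJ t (a + 1) (length bs)) \<Longrightarrow> \<omega> i = \<omega>' i"
  have "\<omega> (Jmp t a) = \<omega>' (Jmp t a)" by (rule *) simp
  moreover have "rJ t (a + 1) c bs \<omega> = rJ t (a + 1) c bs \<omega>'" for c
    by (rule dep_onD[OF dep_rJ], rule *) simp
  ultimately show "(rJ t (a + 1) (\<omega> (Jmp t a)) bs \<omega> = es) = (rJ t (a + 1) (\<omega>' (Jmp t a)) bs \<omega>' = es)" by simp
qed

text \<open>Sum over the values of the jump, which is independent of the sites to its right; a jump
  of length 0 has probability zero.\<close>

lemma jump_row_law:
  assumes "(\<lambda>r. b2 ^ r * (1 - b2) * sv.pr (\<lambda>\<omega>. rJ t (a + 1) (Suc r) bs \<omega> = es)) sums p"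
  shows "sv.pr (\<lambda>\<omega>. rJ t (a + 1) (\<omega> (Jmp t a)) bs \<omega> = es) = p"
proof -
  let ?A = "\<lambda>r. {\<omega>. \<omega> (Jmp t a) = Suc r \<and> rJ t (a + 1) (Suc r) bs \<omega> = es}"
  have e1: "sv.ev (\<lambda>\<omega>. \<omega> (Jmp t a) = Suc r)" for r by (rule sv.ev_coord) simp
  have sets: "?A r \<in> sv.events" for r
    using sets.Int[OF e1 ev_rJ, of r t "a + 1" "Suc r" bs es] by (simp add: Collect_conj_eq)
  have "sv.prob (?A r) = sv.pr (\<lambda>\<omega>. \<omega> (Jmp t a) = Suc r) * sv.pr (\<lambda>\<omega>. rJ t (a + 1) (Suc r) bs \<omega> = es)" for r
    by (rule sv.pr_indep[OF e1 ev_rJ dep_on_coord[of "Jmp t a" "{Jmp t a}"] dep_rJ_eq]) (auto simp: siteJ_def)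
  then have "sv.prob (?A r) = b2 ^ r * (1 - b2) * sv.pr (\<lambda>\<omega>. rJ t (a + 1) (Suc r) bs \<omega> = es)" for r
    unfolding pr_jmp_eq .
  moreover have "(\<lambda>r. sv.prob (?A r)) sums sv.prob (\<Union>r. ?A r)"
    using sets by (intro sv.finite_measure_UNION) (auto simp: disjoint_family_on_def)
  ultimately have "sv.prob (\<Union>r. ?A r) = p" using assms sums_unique2 by simp
  moreover have "sv.prob (\<Union>r. ?A r) = sv.pr (\<lambda>\<omega>. rJ t (a + 1) (\<omega> (Jmp t a)) bs \<omega> = es)"
  proof (rule sv.finite_measure_eq_AE)
    show "AE \<omega> in sv.PM. (\<omega> \<in> (\<Union>r. ?A r)) = (\<omega> \<in> {\<omega>. rJ t (a + 1) (\<omega> (Jmp t a)) bs \<omega> = es})"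
      using AE_jpos
    proof eventually_elim
      case (elim \<omega>)
      have "1 \<le> \<omega> (Jmp t a)" using elim by blast
      then obtain r where "\<omega> (Jmp t a) = Suc r" by (cases "\<omega> (Jmp t a)") auto
      then show ?case by auto
    qed
    show "(\<Union>r. ?A r) \<in> sv.events" using sets by blast
    show "{\<omega>. rJ t (a + 1) (\<omega> (Jmp t a)) bs \<omega> = es} \<in> sv.events"
      by (rule sv_ev_finite[OF _ dep_jump_row]) simp
  qed
  ultimately show ?thesis by simp
qed

text \<open>The geometric law is memoryless, so a travelling particle stops at each empty site with
  probability \<open>1 - b2\<close>, independently of the past.\<close>

lemma rowJ_law:
  "sv.pr (\<lambda>\<omega>. rJ t a 0 bs \<omega> = es) = pv False bs es \<and>
   (\<lambda>r. b2 ^ r * (1 - b2) * sv.pr (\<lambda>\<omega>. rJ t a (Suc r) bs \<omega> = es)) sums pv True bs es"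
proof (induction bs arbitrary: a es)
  have geo: "(\<lambda>r. b2 ^ r * (1 - b2) * q) sums q" for q
    using sums_mult2[OF sums_mult2[OF geometric_sums[of b2], of "1 - b2"], of q] b2 by simp
  have UN: "sv.pr (\<lambda>\<omega>. True) = 1" using sv.P.prob_space by simp
  {
    case Nil
    show ?case using geo[of "of_bool (es = [])"] UN by (cases "es = []") auto
  next
    case (Cons b bs)
    show ?case
    proof (cases es)
      case Nil
      then show ?thesis by simp
    next
      case es: (Cons e es')
      let ?R = "\<lambda>c. sv.pr (\<lambda>\<omega>. rJ t (a + 1) c bs \<omega> = es')"
      note IH = Cons[of "a + 1" es']
      note J = jump_row_law[OF IH[THEN conjunct2]]
      have s0: "sv.pr (\<lambda>\<omega>. P \<and> X \<omega>) = of_bool P * sv.pr X" for P X by (cases P) auto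
      show ?thesis
      proof (cases b)
        case True
        let ?J = "\<lambda>\<omega>. rJ t (a + 1) (\<omega> (Jmp t a)) bs \<omega> = es'"
        let ?chi = "\<lambda>\<omega>. \<omega> (Chi t a) = 1"
        have evJ: "sv.ev ?J" by (rule sv_ev_finite[OF _ dep_jump_row]) simp
        have evc: "sv.ev ?chi" "sv.ev (\<lambda>\<omega>. \<not> ?chi \<omega>)" by (rule sv.ev_coord; simp)+
        have "sv.pr (\<lambda>\<omega>. ?chi \<omega> \<and> rJ t (a + 1) 0 bs \<omega> = es') = sv.pr ?chi * ?R 0"
          by (rule sv.pr_indep[OF evc(1) ev_rJ dep_on_coord[of "Chi t a" "{Chi t a}"] dep_rJ_eq]) (auto simp: siteJ_def)
        then have c1: "sv.pr (\<lambda>\<omega>. ?chi \<omega> \<and> rJ t (a + 1) 0 bs \<omega> = es') = b1 * pv False bs es'"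
          using pr_chi IH by simp
        have "sv.pr (\<lambda>\<omega>. \<not> ?chi \<omega> \<and> ?J \<omega>) = sv.pr (\<lambda>\<omega>. \<not> ?chi \<omega>) * sv.pr ?J"
          by (rule sv.pr_indep[OF evc(2) evJ dep_on_coord[of "Chi t a" "{Chi t a}"] dep_jump_row]) (auto simp: siteJ_def)
        then have c2: "sv.pr (\<lambda>\<omega>. \<not> ?chi \<omega> \<and> ?J \<omega>) = (1 - b1) * pv True bs es'"
          using sv.pr_not[OF evc(1)] pr_chi J by simp
        have z: "(rJ t a 0 (b # bs) \<omega> = es) = (if e then ?chi \<omega> \<and> rJ t (a + 1) 0 bs \<omega> = es' else \<not> ?chi \<omega> \<and> ?J \<omega>)" for \<omega>
          using True by (auto simp: es nexto_def nextc_def)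
        have p: "(rJ t a (Suc r) (b # bs) \<omega> = es) = (e \<and> ?J \<omega>)" for \<omega> r
          using True by (auto simp: es nexto_def nextc_def)
        have "sv.pr (\<lambda>\<omega>. rJ t a 0 (b # bs) \<omega> = es) = pv False (b # bs) es"
          unfolding z using c1 c2 True es by (cases e) simp_all
        moreover have "sv.pr (\<lambda>\<omega>. rJ t a (Suc r) (b # bs) \<omega> = es) = pv True (b # bs) es" for r
          unfolding p s0 J using True es by (cases e) simp_all
        ultimately show ?thesis using geo by simp
      next
        case False
        have z: "(rJ t a 0 (b # bs) \<omega> = es) = (\<not> e \<and> rJ t (a + 1) 0 bs \<omega> = es')" for \<omega>
          using False by (auto simp: es nexto_def nextc_def)
        have o: "(rJ t a (Suc 0) (b # bs) \<omega> = es) = (e \<and> rJ t (a + 1) 0 bs \<omega> = es')" for \<omega>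
          using False by (auto simp: es nexto_def nextc_def)
        have p: "(rJ t a (Suc (Suc r)) (b # bs) \<omega> = es) = (\<not> e \<and> rJ t (a + 1) (Suc r) bs \<omega> = es')" for \<omega> r
          using False by (auto simp: es nexto_def nextc_def)
        have "sv.pr (\<lambda>\<omega>. rJ t a 0 (b # bs) \<omega> = es) = pv False (b # bs) es"
          unfolding z s0 using IH False es by (cases e) simp_all
        moreover have "(\<lambda>r. b2 ^ r * (1 - b2) * sv.pr (\<lambda>\<omega>. rJ t a (Suc r) (b # bs) \<omega> = es)) sums pv True (b # bs) es"
        proof -
          \<comment> \<open>The term r = 0 is a stop at the present empty site. The remaining terms
            form the series of the next site times \<open>b2\<close>, which is the memoryless
            property.\<close>
          define F where "F = (\<lambda>r. b2 ^ r * (1 - b2) * sv.pr (\<lambda>\<omega>. rJ t a (Suc r) (b # bs) \<omega> = es))"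
          have "(\<lambda>r. of_bool (\<not> e) * b2 * (b2 ^ r * (1 - b2) * ?R (Suc r))) sums (of_bool (\<not> e) * b2 * pv True bs es')"
            by (rule sums_mult) (use IH in blast)
          moreover have "pv True (b # bs) es - F 0 = of_bool (\<not> e) * b2 * pv True bs es'"
            unfolding F_def o s0 using IH False es by (cases e) simp_all
          moreover have "F (Suc r) = of_bool (\<not> e) * b2 * (b2 ^ r * (1 - b2) * ?R (Suc r))" for r
            unfolding F_def p s0 by simp
          ultimately have "(\<lambda>r. F (Suc r)) sums (pv True (b # bs) es - F 0)" by simp
          then have "F sums (pv True (b # bs) es)" using sums_Suc_iff[of F "pv True (b # bs) es - F 0"] by simp
          then show ?thesis unfolding F_def .
        qed
        ultimately show ?thesis ..
      qed
    qed
  }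
qed

end

section \<open>Equality in law of particles and vertices\<close>

lemma map_upt_eq_iff: "map s [0..<n] = es \<longleftrightarrow> length es = n \<and> (\<forall>i<n. s i = es ! i)"
  by (auto simp: list_eq_iff_nth_eq)

context coordinate_space
begin

lemma pr_independent_bits:
  fixes n :: nat
  assumes e: "inj e" and Q: "\<And>i. ev (\<lambda>\<omega>. Q i (\<omega> (e i)))"
  shows "pr (\<lambda>\<omega>. \<forall>i<n. Q i (\<omega> (e i)) = s i) =
    (\<Prod>i<n. if s i then pr (\<lambda>\<omega>. Q i (\<omega> (e i))) else 1 - pr (\<lambda>\<omega>. Q i (\<omega> (e i))))"
proof (induction n)
  case 0
  then show ?case using P.prob_space by simp
next
  case (Suc n)
  have [measurable]: "Measurable.pred PM (\<lambda>\<omega>. Q i (\<omega> (e i)))" for i using Q by (simp only: ev_iff_pred)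
  have ev1: "ev (\<lambda>\<omega>. \<forall>i<n. Q i (\<omega> (e i)) = s i)" "ev (\<lambda>\<omega>. Q n (\<omega> (e n)) = s n)"
    unfolding ev_iff_pred by measurable
  have d1: "dep_on (e ` {..<n}) (\<lambda>\<omega>. \<forall>i<n. Q i (\<omega> (e i)) = s i)" by (rule dep_onI) auto
  have d2: "dep_on {e n} (\<lambda>\<omega>. Q n (\<omega> (e n)) = s n)" by (rule dep_onI) auto
  have "(\<forall>i<Suc n. Q i (\<omega> (e i)) = s i) \<longleftrightarrow> (\<forall>i<n. Q i (\<omega> (e i)) = s i) \<and> Q n (\<omega> (e n)) = s n" for \<omega>
    by (auto simp: less_Suc_eq)
  then have "pr (\<lambda>\<omega>. \<forall>i<Suc n. Q i (\<omega> (e i)) = s i) =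
      pr (\<lambda>\<omega>. \<forall>i<n. Q i (\<omega> (e i)) = s i) * pr (\<lambda>\<omega>. Q n (\<omega> (e n)) = s n)"
    using pr_indep[OF ev1 d1 d2] e by (simp add: inj_image_mem_iff)
  moreover have "pr (\<lambda>\<omega>. Q n (\<omega> (e n)) = s n) = (if s n then pr (\<lambda>\<omega>. Q n (\<omega> (e n))) else 1 - pr (\<lambda>\<omega>. Q n (\<omega> (e n))))"
    using pr_not[OF Q, of n] by auto
  ultimately show ?case using Suc by simp
qed

lemma pr_values:
  assumes "finite S" "\<And>\<omega>. X \<omega> \<in> S" and X: "\<And>x. ev (\<lambda>\<omega>. X \<omega> = x)" and R: "\<And>x. ev (R x)"
  shows "pr (\<lambda>\<omega>. R (X \<omega>) \<omega>) = (\<Sum>x\<in>S. pr (\<lambda>\<omega>. X \<omega> = x \<and> R x \<omega>))"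
proof -
  have "{\<omega>. R (X \<omega>) \<omega>} = (\<Union>x\<in>S. {\<omega>. X \<omega> = x \<and> R x \<omega>})" using assms(2) by auto
  moreover have "measure PM (\<Union>x\<in>S. {\<omega>. X \<omega> = x \<and> R x \<omega>}) = (\<Sum>x\<in>S. pr (\<lambda>\<omega>. X \<omega> = x \<and> R x \<omega>))"
  proof (rule finite_measure_finite_Union[OF assms(1)])
    have "{\<omega>. X \<omega> = x \<and> R x \<omega>} \<in> sets PM" for x using sets.Int[OF X R] by (simp add: Collect_conj_eq)
    then show "(\<lambda>x. {\<omega>. X \<omega> = x \<and> R x \<omega>}) ` S \<subseteq> events" by auto
    show "disjoint_family_on (\<lambda>x. {\<omega>. X \<omega> = x \<and> R x \<omega>}) S" by (auto simp: disjoint_family_on_def)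
  qed
  ultimately show ?thesis by simp
qed

end

context riemann_problem
begin

section \<open>Transition law of a vertex row\<close>

abbreviation rV :: "nat \<Rightarrow> nat \<Rightarrow> bool \<Rightarrow> bool list \<Rightarrow> (src \<Rightarrow> real) \<Rightarrow> bool list" where
  "rV t x h bs \<omega> \<equiv> rowV (\<lambda>x. \<omega> (Cn t x) \<le> b1) (\<lambda>x. \<omega> (Dn t x) \<le> b2) x h bs"

definition siteV :: "nat \<Rightarrow> nat \<Rightarrow> src set" where
  "siteV t x = (\<lambda>y. Cn t y) ` {x..} \<union> (\<lambda>y. Dn t y) ` {x..}"

lemma dep_rV: "dep_on (siteV t x) (\<lambda>\<omega>. rV t x h bs \<omega>)"
proof (induction bs arbitrary: x h)
  case (Cons b bs)
  show ?case
  proof (rule dep_onI)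
    fix \<omega> \<omega>' :: "src \<Rightarrow> real"
    assume *: "\<And>i. i \<in> siteV t x \<Longrightarrow> \<omega> i = \<omega>' i"
    have "\<omega> (Cn t x) = \<omega>' (Cn t x)" "\<omega> (Dn t x) = \<omega>' (Dn t x)"
      by (rule *; force simp: siteV_def)+
    moreover have "rV t (Suc x) h' bs \<omega> = rV t (Suc x) h' bs \<omega>'" for h'
      by (rule dep_onD[OF Cons], rule *) (force simp: siteV_def)
    ultimately show "rV t x h (b # bs) \<omega> = rV t x h (b # bs) \<omega>'" by simp
  qed
qed (auto simp: dep_on_def)

lemma measurable_rV [measurable]: "Measurable.pred PM (\<lambda>\<omega>. rV t x h bs \<omega> = es)"
proof (induction bs arbitrary: x h es)
  case (Cons b bs)
  note [measurable] = Cons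
  show ?case
  proof (cases es)
    case (Cons e es')
    have "(rV t x h (b # bs) \<omega> = es) \<longleftrightarrow> vtop (\<omega> (Cn t x) \<le> b1) (\<omega> (Dn t x) \<le> b2) b h = e \<and>
       (if vright (\<omega> (Cn t x) \<le> b1) (\<omega> (Dn t x) \<le> b2) b h then rV t (Suc x) True bs \<omega> = es' else rV t (Suc x) False bs \<omega> = es')" for \<omega>
      using Cons by simp
    then show ?thesis unfolding vtop_def vright_def by (simp only:) measurable
  qed simp
qed simp

lemma rowV_law: "pr (\<lambda>\<omega>. rV t x h bs \<omega> = es) = pv h bs es"
proof (induction bs arbitrary: x h es)
  case Nil
  then show ?case using P.prob_space by (cases "es = []") auto
next
  case (Cons b bs)
  show ?case
  proof (cases es)
    case es: (Cons e es')
    have evR: "ev (\<lambda>\<omega>. rV t (Suc x) h' bs \<omega> = es')" for h' unfolding ev_iff_pred by measurable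
    have dR: "dep_on (siteV t (Suc x)) (\<lambda>\<omega>. rV t (Suc x) h' bs \<omega> = es')" for h' by (rule dep_on_comp1[OF dep_rV])
    have key: "pr (\<lambda>\<omega>. X (\<omega> i) \<and> rV t (Suc x) h' bs \<omega> = es') = pr (\<lambda>\<omega>. X (\<omega> i)) * pv h' bs es'"
      if "i = Cn t x \<or> i = Dn t x" "ev (\<lambda>\<omega>. X (\<omega> i))" for X i h'
    proof -
      have "pr (\<lambda>\<omega>. X (\<omega> i) \<and> rV t (Suc x) h' bs \<omega> = es') = pr (\<lambda>\<omega>. X (\<omega> i)) * pr (\<lambda>\<omega>. rV t (Suc x) h' bs \<omega> = es')"
        by (rule pr_indep[OF that(2) evR dep_on_coord[of i "{i}"] dR]) (use that in \<open>auto simp: siteV_def\<close>)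
      then show ?thesis using Cons by simp
    qed
    have evs: "ev (\<lambda>\<omega>. \<omega> i \<le> q)" "ev (\<lambda>\<omega>. \<not> \<omega> i \<le> q)" for i q unfolding ev_iff_pred by measurable
    have prn: "pr (\<lambda>\<omega>. \<not> \<omega> i \<le> b1) = 1 - b1" "pr (\<lambda>\<omega>. \<not> \<omega> i \<le> b2) = 1 - b2" for i
      using pr_not[OF evs(1)[of i b1]] pr_not[OF evs(1)[of i b2]] pr_le[of b1 i] pr_le[of b2 i] b1 b2 by auto
    show ?thesis
    proof (cases "b = h")
      case True
      then have r: "(rV t x h (b # bs) \<omega> = es) \<longleftrightarrow> e = b \<and> rV t (Suc x) h bs \<omega> = es'" for \<omega>
        by (auto simp: es vtop_def vright_def)
      show ?thesis unfolding r using True Cons by (cases "e = b") (simp_all add: es)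
    next
      case False
      show ?thesis
      proof (cases b)
        case True
        then have r: "(rV t x h (b # bs) \<omega> = es) \<longleftrightarrow> (if e then \<omega> (Cn t x) \<le> b1 \<and> rV t (Suc x) False bs \<omega> = es'
            else \<not> \<omega> (Cn t x) \<le> b1 \<and> rV t (Suc x) True bs \<omega> = es')" for \<omega>
          using False by (auto simp: es vtop_def vright_def)
        show ?thesis unfolding r
          using True False key[of "Cn t x" "\<lambda>u. u \<le> b1" False] key[of "Cn t x" "\<lambda>u. \<not> u \<le> b1" True] evs prn pr_le[of b1] b1
          by (cases e) (simp_all add: es)
      next
        case bF: False
        then have r: "(rV t x h (b # bs) \<omega> = es) \<longleftrightarrow> (if e then \<not> \<omega> (Dn t x) \<le> b2 \<and> rV t (Suc x) False bs \<omega> = es'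
            else \<omega> (Dn t x) \<le> b2 \<and> rV t (Suc x) True bs \<omega> = es')" for \<omega>
          using False by (auto simp: es vtop_def vright_def)
        show ?thesis unfolding r
          using bF False key[of "Dn t x" "\<lambda>u. u \<le> b2" True] key[of "Dn t x" "\<lambda>u. \<not> u \<le> b2" False] evs prn pr_le[of b2] b2
          by (cases e) (simp_all add: es)
      qed
    qed
  qed simp
qed

section \<open>Equal laws of the rows of both models\<close>

fun particle_row :: "(sv_src \<Rightarrow> nat) \<Rightarrow> nat \<Rightarrow> nat \<Rightarrow> nat \<Rightarrow> bool list" where
  "particle_row \<omega> M n 0 = map (\<lambda>i. \<omega> (Init (- int M + int i)) = 1) [0..<n]"
| "particle_row \<omega> M n (Suc t) = rJ (Suc t) (- int M) 0 (particle_row \<omega> M n t) \<omega>"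

text \<open>Column i stands for site i - M, so \<open>M\<close> is the last column of density
  \<theta> and the jump sits at \<open>Suc M\<close>. The left boundary is empty because the
  truncated particle system has nothing left of -M.\<close>

definition vertex_row :: "(src \<Rightarrow> real) \<Rightarrow> nat \<Rightarrow> nat \<Rightarrow> nat \<Rightarrow> bool list" where
  "vertex_row \<omega> M n t = map (VS (thrV (pm (Suc M))) (\<lambda>_ _. False) \<omega> t) [0..<n]"

lemma particle_row_occ:
  assumes "\<And>t x. 1 \<le> \<omega> (Jmp t x)" "n \<le> 2 * M + 1"
  shows "particle_row \<omega> M n t = map (\<lambda>i. occ \<omega> M t (- int M + int i)) [0..<n]"
proof (induction t)
  case 0
  have "finite {x. \<bar>x\<bar> \<le> int M \<and> \<omega> (Init x) = 1}"
    by (rule finite_subset[of _ "{- int M..int M}"]) auto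
  then have "occ \<omega> M 0 z \<longleftrightarrow> \<bar>z\<bar> \<le> int M \<and> \<omega> (Init z) = 1" for z by (simp add: occ_def)
  then show ?case using assms(2) by (auto simp: abs_le_iff)
next
  case (Suc t)
  show ?case
    unfolding occ_step[of \<omega>, OF assms(1)] particle_row.simps Suc
    using rowJ_map[of "car \<omega> M t" "occ \<omega> M t" "\<lambda>z. \<omega> (Chi (Suc t) z) = 1" "\<lambda>z. \<omega> (Jmp (Suc t) z)" "- int M" n,
        OF car_step[of \<omega>, OF assms(1)]] car_0[of \<omega> "- int M" M t, OF assms(1)] by simp
qed

lemma length_particle_row [simp]: "length (particle_row \<omega> M n t) = n"
  by (induction t) (simp_all add: length_rowJ)

lemma length_vertex_row [simp]: "length (vertex_row \<omega> M n t) = n"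
  by (simp add: vertex_row_def)

lemma dep_particle_row:
  "dep_on (range Init \<union> (\<Union>s\<in>{1..t}. siteJ s (- int M) n)) (\<lambda>\<omega>. particle_row \<omega> M n t)"
  "dep_on ((\<lambda>i. Init (- int M + int i)) ` {..<n} \<union> (\<Union>s\<in>{1..t}. siteJ s (- int M) n)) (\<lambda>\<omega>. particle_row \<omega> M n t)"
proof -
  show *: "dep_on ((\<lambda>i. Init (- int M + int i)) ` {..<n} \<union> (\<Union>s\<in>{1..t}. siteJ s (- int M) n)) (\<lambda>\<omega>. particle_row \<omega> M n t)"
  proof (induction t)
    case 0
    show ?case by (rule dep_onI) auto
  next
    case (Suc t)
    show ?case
    proof (rule dep_onI)
      fix \<omega> \<omega>' :: "sv_src \<Rightarrow> nat"
      assume *: "\<And>i. i \<in> (\<lambda>i. Init (- int M + int i)) ` {..<n} \<union> (\<Union>s\<in>{1..Suc t}. siteJ s (- int M) n) \<Longrightarrow> \<omega> i = \<omega>' i"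
      have "particle_row \<omega> M n t = particle_row \<omega>' M n t"
        by (rule dep_onD[OF Suc], rule *) force
      moreover have "rJ (Suc t) (- int M) 0 (particle_row \<omega>' M n t) \<omega> = rJ (Suc t) (- int M) 0 (particle_row \<omega>' M n t) \<omega>'"
        by (rule dep_onD[OF dep_rJ], rule *) force
      ultimately show "particle_row \<omega> M n (Suc t) = particle_row \<omega>' M n (Suc t)" by simp
    qed
  qed
  show "dep_on (range Init \<union> (\<Union>s\<in>{1..t}. siteJ s (- int M) n)) (\<lambda>\<omega>. particle_row \<omega> M n t)"
    by (rule dep_on_mono[OF *]) auto
qed

lemma ev_particle_row: "sv.ev (\<lambda>\<omega>. B (particle_row \<omega> M n t))"
  by (rule sv_ev_finite[OF _ dep_on_comp1[OF dep_particle_row(2)]]) auto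

lemma measurable_vertex_row [measurable]: "Measurable.pred PM (\<lambda>\<omega>. vertex_row \<omega> M n t = es)"
proof -
  have [measurable]: "Measurable.pred PM (\<lambda>\<omega>. VS (thrV (pm (Suc M))) (\<lambda>_ _. False) \<omega> t x)" for x
    using measurable_VHS[of "thrV (pm (Suc M))" "\<lambda>_ _. False"] by simp
  show ?thesis unfolding vertex_row_def map_upt_eq_iff by measurable
qed

lemma ev_vertex_row: "ev (\<lambda>\<omega>. vertex_row \<omega> M n t = es)"
  using measurable_vertex_row by (simp only: ev_iff_pred)

lemma ev_rV: "ev (\<lambda>\<omega>. rV t x h bs \<omega> = es)"
  using measurable_rV by (simp only: ev_iff_pred)

text \<open>Both rows evolve as Markov chains with kernel \<open>pv\<close>, since the sources of a
  new row are independent of the earlier ones, and both start from the same product law.\<close>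

lemma row_law:
  assumes "n \<le> 2 * M + 1"
  shows "sv.pr (\<lambda>\<omega>. particle_row \<omega> M n t = es) = pr (\<lambda>\<omega>. vertex_row \<omega> M n t = es)"
proof (induction t arbitrary: es)
  case 0
  show ?case
  proof (cases "length es = n")
    case True
    have 1: "sv.pr (\<lambda>\<omega>. \<forall>i<n. (\<omega> (Init (- int M + int i)) = 1) = es ! i) =
      (\<Prod>i<n. if es ! i then sv.pr (\<lambda>\<omega>. \<omega> (Init (- int M + int i)) = 1) else 1 - sv.pr (\<lambda>\<omega>. \<omega> (Init (- int M + int i)) = 1))"
      by (rule sv.pr_independent_bits[where e="\<lambda>i. Init (- int M + int i)" and Q="\<lambda>_ v. v = 1"])
        (auto intro!: injI sv.ev_coord)
    have 2: "pr (\<lambda>\<omega>. \<forall>i<n. (\<omega> (Vn i) \<le> pm (Suc M) i) = es ! i) =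
      (\<Prod>i<n. if es ! i then pr (\<lambda>\<omega>. \<omega> (Vn i) \<le> pm (Suc M) i) else 1 - pr (\<lambda>\<omega>. \<omega> (Vn i) \<le> pm (Suc M) i))"
      by (rule pr_independent_bits[where e=Vn and Q="\<lambda>i v. v \<le> pm (Suc M) i"])
        (auto intro!: injI simp only: ev_iff_pred, measurable)
    have 3: "sv.pr (\<lambda>\<omega>. \<omega> (Init (- int M + int i)) = 1) = pr (\<lambda>\<omega>. \<omega> (Vn i) \<le> pm (Suc M) i)" for i
      unfolding pr_init using theta rho by (subst pr_le) (auto simp: pm_def)
    show ?thesis
      unfolding particle_row.simps vertex_row_def VS_0 thrV_def map_upt_eq_iff
      using 1 2 True unfolding 3 by simp
  next
    case False
    then have "{\<omega>. particle_row \<omega> M n 0 = es} = {}" "{\<omega>. vertex_row \<omega> M n 0 = es} = {}"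
      using length_particle_row length_vertex_row by blast+
    then show ?thesis by simp
  qed
next
  case (Suc t)
  let ?S = "{bs::bool list. set bs \<subseteq> UNIV \<and> length bs = n}"
  let ?I = "{i. case i of Cn s y \<Rightarrow> s < t | Dn s y \<Rightarrow> s < t | Vn y \<Rightarrow> True | Hn s \<Rightarrow> True}"
  have fin: "finite ?S" by (rule finite_lists_length_eq) simp
  have step: "rV t 0 False (vertex_row \<omega> M n t) \<omega> = vertex_row \<omega> M n (Suc t)" for \<omega>
    unfolding vertex_row_def VS_def
    using rowV_map[of "\<lambda>t x. \<omega> (Cn t x) \<le> b1" "\<lambda>t x. \<omega> (Dn t x) \<le> b2" "thrV (pm (Suc M)) \<omega>" "\<lambda>_. False" t 0 n] by (simp del: Vx.simps)
  have "sv.pr (\<lambda>\<omega>. particle_row \<omega> M n (Suc t) = es) =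
      (\<Sum>bs\<in>?S. sv.pr (\<lambda>\<omega>. particle_row \<omega> M n t = bs \<and> rJ (Suc t) (- int M) 0 bs \<omega> = es))"
    unfolding particle_row.simps
    by (rule sv.pr_values[OF fin, where R="\<lambda>bs \<omega>. rJ (Suc t) (- int M) 0 bs \<omega> = es"]) (simp, rule ev_particle_row, rule ev_rJ)
  also have "\<dots> = (\<Sum>bs\<in>?S. pr (\<lambda>\<omega>. vertex_row \<omega> M n t = bs) * pv False bs es)"
  proof (rule sum.cong[OF refl])
    fix bs assume "bs \<in> ?S"
    have "sv.pr (\<lambda>\<omega>. particle_row \<omega> M n t = bs \<and> rJ (Suc t) (- int M) 0 bs \<omega> = es) =
      sv.pr (\<lambda>\<omega>. particle_row \<omega> M n t = bs) * sv.pr (\<lambda>\<omega>. rJ (Suc t) (- int M) 0 bs \<omega> = es)"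
      by (rule sv.pr_indep[OF ev_particle_row ev_rJ dep_on_comp1[OF dep_particle_row(1)] dep_rJ_eq])
        (auto simp: siteJ_def)
    then show "sv.pr (\<lambda>\<omega>. particle_row \<omega> M n t = bs \<and> rJ (Suc t) (- int M) 0 bs \<omega> = es) = pr (\<lambda>\<omega>. vertex_row \<omega> M n t = bs) * pv False bs es"
      using Suc rowJ_law by simp
  qed
  also have "\<dots> = (\<Sum>bs\<in>?S. pr (\<lambda>\<omega>. vertex_row \<omega> M n t = bs \<and> rV t 0 False bs \<omega> = es))"
  proof (rule sum.cong[OF refl])
    fix bs
    have dV: "dep_on ?I (\<lambda>\<omega>. VS (thrV (pm (Suc M))) (\<lambda>_ _. False) \<omega> t x)" for x
      by (rule dep_on_mono[OF dep_VS[OF dep_thrV dep_on_const]]) (auto simp: depV_def split: src.splits)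
    have d: "dep_on ?I (\<lambda>\<omega>. vertex_row \<omega> M n t = bs)"
    proof (rule dep_onI)
      fix \<omega> \<omega>' :: "src \<Rightarrow> real" assume "\<And>i. i \<in> ?I \<Longrightarrow> \<omega> i = \<omega>' i"
      from dep_onD[OF dV this] have "vertex_row \<omega> M n t = vertex_row \<omega>' M n t" by (simp add: vertex_row_def)
      then show "(vertex_row \<omega> M n t = bs) = (vertex_row \<omega>' M n t = bs)" by simp
    qed
    have "pr (\<lambda>\<omega>. vertex_row \<omega> M n t = bs \<and> rV t 0 False bs \<omega> = es) = pr (\<lambda>\<omega>. vertex_row \<omega> M n t = bs) * pr (\<lambda>\<omega>. rV t 0 False bs \<omega> = es)"
      by (rule pr_indep[OF ev_vertex_row ev_rV d dep_on_comp1[OF dep_rV]]) (auto simp: siteV_def)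
    then show "pr (\<lambda>\<omega>. vertex_row \<omega> M n t = bs) * pv False bs es = pr (\<lambda>\<omega>. vertex_row \<omega> M n t = bs \<and> rV t 0 False bs \<omega> = es)"
      using rowV_law by simp
  qed
  also have "\<dots> = pr (\<lambda>\<omega>. rV t 0 False (vertex_row \<omega> M n t) \<omega> = es)"
    by (rule pr_values[OF fin, where R="\<lambda>bs \<omega>. rV t 0 False bs \<omega> = es", symmetric]) (simp, rule ev_vertex_row, rule ev_rV)
  also have "(\<lambda>\<omega>. rV t 0 False (vertex_row \<omega> M n t) \<omega> = es) = (\<lambda>\<omega>. vertex_row \<omega> M n (Suc t) = es)"
    by (intro ext) (simp only: step)
  finally show ?case .
qed

lemma row_event_law:
  assumes "n \<le> 2 * M + 1"
  shows "sv.pr (\<lambda>\<omega>. B (particle_row \<omega> M n t)) = pr (\<lambda>\<omega>. B (vertex_row \<omega> M n t))"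
proof -
  let ?S = "{bs::bool list. set bs \<subseteq> UNIV \<and> length bs = n}"
  have fin: "finite ?S" by (rule finite_lists_length_eq) simp
  have s0: "sv.pr (\<lambda>\<omega>. X \<omega> \<and> P) = of_bool P * sv.pr X" for P X by (cases P) auto
  have s1: "pr (\<lambda>\<omega>. X \<omega> \<and> P) = of_bool P * pr X" for P X by (cases P) auto
  have "sv.pr (\<lambda>\<omega>. B (particle_row \<omega> M n t)) = (\<Sum>bs\<in>?S. sv.pr (\<lambda>\<omega>. particle_row \<omega> M n t = bs \<and> B bs))"
    by (rule sv.pr_values[OF fin, where R="\<lambda>bs _. B bs"]) (simp, rule ev_particle_row, simp only: sv.ev_iff_pred, measurable)
  also have "\<dots> = (\<Sum>bs\<in>?S. pr (\<lambda>\<omega>. vertex_row \<omega> M n t = bs \<and> B bs))"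
    unfolding s0 s1 row_law[OF assms] ..
  also have "\<dots> = pr (\<lambda>\<omega>. B (vertex_row \<omega> M n t))"
    by (rule pr_values[OF fin, where R="\<lambda>bs _. B bs", symmetric]) (simp, rule ev_vertex_row, simp only: ev_iff_pred, measurable)
  finally show ?thesis .
qed

text \<open>At a vertex with \<open>c\<close> and \<open>d\<close> both false the paths always turn, so nothing to the left of it
  influences the row beyond it.\<close>

fun vchain :: "(src \<Rightarrow> real) \<Rightarrow> nat \<Rightarrow> nat \<Rightarrow> bool" where
  "vchain \<omega> 0 X \<longleftrightarrow> True"
| "vchain \<omega> (Suc N) X \<longleftrightarrow> (\<exists>x<X. vchain \<omega> N x \<and> b1 < \<omega> (Cn N x) \<and> b2 < \<omega> (Dn N x))"

text \<open>Allows the empty left boundary coming from the particle model to be replaced by the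
  stationary boundary flux \<open>f \<theta>\<close>.\<close>

lemma vchain_agree:
  "vchain \<omega> N X \<Longrightarrow> X \<le> x \<Longrightarrow> VS v h \<omega> N x = VS v h' \<omega> N x"
proof (induction N arbitrary: X x)
  case 0
  then show ?case by (simp add: VS_0)
next
  case (Suc N)
  obtain x0 where x0: "x0 < X" "vchain \<omega> N x0" "b1 < \<omega> (Cn N x0)" "b2 < \<omega> (Dn N x0)" using Suc.prems by auto
  have V: "VS v h \<omega> N y = VS v h' \<omega> N y" if "x0 \<le> y" for y using Suc.IH[OF x0(2) that] .
  have "Suc x0 \<le> y \<Longrightarrow> HS v h \<omega> N y = HS v h' \<omega> N y" for y
  proof (induction y rule: dec_induct)
    case base
    then show ?case using x0 V[of x0] by (auto simp: HS_Suc vright_def)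
  next
    case (step y)
    then show ?case using V[of y] by (simp add: HS_Suc)
  qed
  then show ?case using V[of x] x0(1) Suc.prems(2) by (simp add: VS_Suc)
qed

lemma vchain_mono: "vchain \<omega> N X \<Longrightarrow> X \<le> Y \<Longrightarrow> vchain \<omega> N Y"
  by (cases N) (auto intro: less_le_trans)

lemma measurable_vchain [measurable]: "Measurable.pred PM (\<lambda>\<omega>. vchain \<omega> N X)"
proof (induction N arbitrary: X)
  case (Suc N)
  note [measurable] = Suc
  show ?case unfolding vchain.simps by measurable
qed simp

lemma vchain_likely: "0 < \<delta> \<Longrightarrow> \<exists>X. \<forall>Y\<ge>X. pr (\<lambda>\<omega>. \<not> vchain \<omega> N Y) \<le> \<delta>"
proof (induction N arbitrary: \<delta>)
  case 0
  then show ?case by auto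
next
  case (Suc N)
  obtain X where X: "pr (\<lambda>\<omega>. \<not> vchain \<omega> N X) \<le> \<delta> / 2" using Suc.IH[of "\<delta> / 2"] Suc.prems by auto
  define q where "q = 1 - (1 - b1) * (1 - b2)"
  have q: "0 \<le> q" "q < 1" unfolding q_def using b1 b2 by (auto simp: mult_le_one)
  obtain L where L: "q ^ L < \<delta> / 2" using real_arch_pow_inv[of "\<delta> / 2" q] Suc.prems q by auto
  let ?l = "\<lambda>x \<omega>. \<not> \<omega> (Cn N x) \<le> b1 \<and> \<not> \<omega> (Dn N x) \<le> b2"
  have one: "pr (\<lambda>\<omega>. \<not> ?l x \<omega>) = q" for x
  proof -
    have evs: "ev (\<lambda>\<omega>. \<omega> i \<le> u)" "ev (\<lambda>\<omega>. \<not> \<omega> i \<le> u)" for i u unfolding ev_iff_pred by measurable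
    have "pr (?l x) = pr (\<lambda>\<omega>. \<not> \<omega> (Cn N x) \<le> b1) * pr (\<lambda>\<omega>. \<not> \<omega> (Dn N x) \<le> b2)"
      by (rule pr_indep[OF evs(2) evs(2) dep_on_coord[of "Cn N x" "{Cn N x}"] dep_on_coord[of "Dn N x" "{Dn N x}"]]) auto
    also have "\<dots> = 1 - q"
      using pr_not[OF evs(1)[of "Cn N x" b1]] pr_not[OF evs(1)[of "Dn N x" b2]] pr_le[of b1 "Cn N x"] pr_le[of b2 "Dn N x"] b1 b2
      by (auto simp: q_def)
    finally have "pr (?l x) = 1 - q" .
    moreover have "ev (?l x)" unfolding ev_iff_pred by measurable
    ultimately show ?thesis using pr_not[of "?l x"] by simp
  qed
  have none: "pr (\<lambda>\<omega>. \<forall>i<k. \<not> ?l (X + i) \<omega>) \<le> q ^ k" for k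
  proof (induction k)
    case (Suc k)
    have "(\<forall>i<Suc k. \<not> ?l (X + i) \<omega>) \<longleftrightarrow> (\<forall>i<k. \<not> ?l (X + i) \<omega>) \<and> \<not> ?l (X + k) \<omega>" for \<omega>
      by (auto simp: less_Suc_eq)
    moreover have "pr (\<lambda>\<omega>. (\<forall>i<k. \<not> ?l (X + i) \<omega>) \<and> \<not> ?l (X + k) \<omega>) = pr (\<lambda>\<omega>. \<forall>i<k. \<not> ?l (X + i) \<omega>) * pr (\<lambda>\<omega>. \<not> ?l (X + k) \<omega>)"
    proof (rule pr_indep)
      show "ev (\<lambda>\<omega>. \<forall>i<k. \<not> ?l (X + i) \<omega>)" "ev (\<lambda>\<omega>. \<not> ?l (X + k) \<omega>)" unfolding ev_iff_pred by measurable
      show "dep_on ((\<lambda>i. Cn N (X + i)) ` {..<k} \<union> (\<lambda>i. Dn N (X + i)) ` {..<k}) (\<lambda>\<omega>. \<forall>i<k. \<not> ?l (X + i) \<omega>)" by (rule dep_onI) auto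
      show "dep_on {Cn N (X + k), Dn N (X + k)} (\<lambda>\<omega>. \<not> ?l (X + k) \<omega>)" by (rule dep_onI) auto
    qed auto
    ultimately show ?case using mult_left_mono[OF Suc q(1)] one[of "X + k"] by (simp add: mult.commute)
  qed simp
  have "pr (\<lambda>\<omega>. \<not> vchain \<omega> (Suc N) Y) \<le> \<delta>" if Y: "X + L \<le> Y" for Y
  proof -
    have ev: "ev (\<lambda>\<omega>. \<not> vchain \<omega> N X)" "ev (\<lambda>\<omega>. \<forall>i<L. \<not> ?l (X + i) \<omega>)"
      "ev (\<lambda>\<omega>. \<not> vchain \<omega> N X \<or> (\<forall>i<L. \<not> ?l (X + i) \<omega>))"
      unfolding ev_iff_pred by measurable
    have "pr (\<lambda>\<omega>. \<not> vchain \<omega> (Suc N) Y) \<le> pr (\<lambda>\<omega>. \<not> vchain \<omega> N X \<or> (\<forall>i<L. \<not> ?l (X + i) \<omega>))"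
    proof (rule pr_mono[OF _ ev(3)])
      fix \<omega> assume n: "\<not> vchain \<omega> (Suc N) Y"
      have "\<not> ?l (X + i) \<omega>" if "vchain \<omega> N X" "i < L" for i
        using n vchain_mono[OF that(1), of "X + i"] that(2) Y by (auto simp: not_le)
      then show "\<not> vchain \<omega> N X \<or> (\<forall>i<L. \<not> ?l (X + i) \<omega>)" by blast
    qed
    also have "\<dots> \<le> \<delta>" using pr_disj_le[OF ev(1,2)] X none[of L] L by linarith
    finally show ?thesis .
  qed
  then show ?case by blast
qed

section \<open>Measurability of the infinite-volume process\<close>

text \<open>There are only countably many lists, so one may split over the previous list; the next
  step then depends on finitely many sources.\<close>

lemma measurable_sv_trunc: "Measurable.pred sv.PM (\<lambda>\<omega>. sv_trunc \<omega> M t = l)"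
proof (induction t arbitrary: l)
  case 0
  have "dep_on (Init ` {- int M..int M}) (\<lambda>\<omega>. sv_trunc \<omega> M 0 = l)"
  proof (rule dep_onI)
    fix \<omega> \<omega>' :: "sv_src \<Rightarrow> nat"
    assume "\<And>i. i \<in> Init ` {- int M..int M} \<Longrightarrow> \<omega> i = \<omega>' i"
    then have "{x. \<bar>x\<bar> \<le> int M \<and> \<omega> (Init x) = 1} = {x. \<bar>x\<bar> \<le> int M \<and> \<omega>' (Init x) = 1}" by (auto simp: abs_le_iff)
    then show "(sv_trunc \<omega> M 0 = l) = (sv_trunc \<omega>' M 0 = l)" by simp
  qed
  then have "sv.ev (\<lambda>\<omega>. sv_trunc \<omega> M 0 = l)" by (rule sv_ev_finite[rotated]) simp
  then show ?case by (simp only: sv.ev_iff_pred)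
next
  case (Suc t)
  note [measurable] = Suc
  let ?s = "\<lambda>l' \<omega>. sv_step (\<lambda>x. \<omega> (Chi (Suc t) x) = 1) (\<lambda>x. \<omega> (Jmp (Suc t) x)) None l' = l"
  have [measurable]: "Measurable.pred sv.PM (?s l')" for l'
  proof -
    have "dep_on (Chi (Suc t) ` set l' \<union> Jmp (Suc t) ` set l') (?s l')"
    proof (rule dep_onI)
      fix \<omega> \<omega>' :: "sv_src \<Rightarrow> nat"
      assume *: "\<And>i. i \<in> Chi (Suc t) ` set l' \<union> Jmp (Suc t) ` set l' \<Longrightarrow> \<omega> i = \<omega>' i"
      have "sv_step (\<lambda>x. \<omega> (Chi (Suc t) x) = 1) (\<lambda>x. \<omega> (Jmp (Suc t) x)) None l' =
        sv_step (\<lambda>x. \<omega>' (Chi (Suc t) x) = 1) (\<lambda>x. \<omega>' (Jmp (Suc t) x)) None l'"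
        by (rule sv_step_cong) (use * in auto)
      then show "?s l' \<omega> = ?s l' \<omega>'" by simp
    qed
    then have "sv.ev (?s l')" by (rule sv_ev_finite[rotated]) simp
    then show ?thesis by (simp only: sv.ev_iff_pred)
  qed
  have "(sv_trunc \<omega> M (Suc t) = l) \<longleftrightarrow> (\<exists>l'. sv_trunc \<omega> M t = l' \<and> ?s l' \<omega>)" for \<omega> by simp
  then show ?case by (simp only:) measurable
qed

lemma measurable_sv_config [measurable]: "Measurable.pred sv.PM (\<lambda>\<omega>. sv_config \<omega> t x)"
proof -
  note [measurable] = measurable_sv_trunc
  have "sv_config \<omega> t x \<longleftrightarrow> (\<exists>M0. \<forall>M\<ge>M0. \<exists>l. sv_trunc \<omega> M t = l \<and> x \<in> set l)" for \<omega>
    unfolding sv_config_def eventually_sequentially by simp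
  then show ?thesis by (simp only:) measurable
qed

end

section \<open>Concentration of the partial sums\<close>

lemma (in prob_space) markov_abs:
  fixes Z :: "'a \<Rightarrow> real"
  assumes "integrable M Z" "expectation (\<lambda>\<omega>. \<bar>Z \<omega>\<bar>) \<le> c" "0 < a"
  shows "prob {\<omega>\<in>space M. a < \<bar>Z \<omega>\<bar>} \<le> c / a"
proof -
  have [measurable]: "Z \<in> borel_measurable M" using assms(1) by simp
  have "prob {\<omega>\<in>space M. a < \<bar>Z \<omega>\<bar>} \<le> prob {\<omega>\<in>space M. a \<le> \<bar>Z \<omega>\<bar>}"
    by (intro finite_measure_mono) auto
  also have "\<dots> \<le> expectation (\<lambda>\<omega>. \<bar>Z \<omega>\<bar>) / a"
    using assms by (intro integral_Markov_inequality_measure[where A="{}"]) auto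
  also have "\<dots> \<le> c / a" using assms by (simp add: divide_right_mono)
  finally show ?thesis .
qed

text \<open>A 1-Lipschitz sequence changes by at most \<open>l\<close> from the preceding multiple
  of \<open>l\<close>, so \<open>w div l + 1\<close> points control the supremum.\<close>

lemma (in coordinate_space) pr_sup_grid:
  fixes D :: "nat \<Rightarrow> ('i \<Rightarrow> 'a) \<Rightarrow> real"
  assumes [measurable]: "\<And>x. D x \<in> borel_measurable PM"
    and lip: "\<And>x \<omega>. x < w \<Longrightarrow> \<bar>D (Suc x) \<omega> - D x \<omega>\<bar> \<le> 1"
    and l: "1 \<le> l" and p: "\<And>x. x \<le> w \<Longrightarrow> pr (\<lambda>\<omega>. \<eta> < \<bar>D x \<omega>\<bar>) \<le> p"
  shows "pr (\<lambda>\<omega>. \<exists>x\<le>w. \<eta> + real l < \<bar>D x \<omega>\<bar>) \<le> (real w / real l + 1) * p"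
proof -
  have "real (w div l * l) \<le> real w" by (simp only: of_nat_le_iff div_times_less_eq_dividend)
  then have dv: "real (w div l) \<le> real w / real l" using l by (simp add: pos_le_divide_eq)
  have lip': "x + j \<le> w \<Longrightarrow> \<bar>D (x + j) \<omega> - D x \<omega>\<bar> \<le> real j" for x j \<omega>
  proof (induction j)
    case (Suc j)
    then show ?case using lip[of "x + j" \<omega>] by simp
  qed simp
  have "pr (\<lambda>\<omega>. \<exists>x\<le>w. \<eta> + real l < \<bar>D x \<omega>\<bar>) \<le> pr (\<lambda>\<omega>. \<exists>j\<in>{..w div l}. \<eta> < \<bar>D (l * j) \<omega>\<bar>)"
  proof (rule pr_mono)
    fix \<omega> assume "\<exists>x\<le>w. \<eta> + real l < \<bar>D x \<omega>\<bar>"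
    then obtain x where x: "x \<le> w" "\<eta> + real l < \<bar>D x \<omega>\<bar>" by blast
    have "\<bar>D (l * (x div l) + x mod l) \<omega> - D (l * (x div l)) \<omega>\<bar> \<le> real (x mod l)"
      by (rule lip') (use x in simp)
    moreover have "x mod l \<le> l" using l by (simp add: less_imp_le)
    ultimately have "\<eta> < \<bar>D (l * (x div l)) \<omega>\<bar>" using x by simp
    then show "\<exists>j\<in>{..w div l}. \<eta> < \<bar>D (l * j) \<omega>\<bar>" using x(1) by (auto intro: div_le_mono)
  next
    show "ev (\<lambda>\<omega>. \<exists>j\<in>{..w div l}. \<eta> < \<bar>D (l * j) \<omega>\<bar>)" unfolding ev_iff_pred by measurable
  qed
  also have "\<dots> \<le> (\<Sum>j\<in>{..w div l}. pr (\<lambda>\<omega>. \<eta> < \<bar>D (l * j) \<omega>\<bar>))"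
    by (rule pr_Bex_le) (simp, simp only: ev_iff_pred, measurable)
  also have "\<dots> \<le> (\<Sum>j\<in>{..w div l}. p)"
  proof (intro sum_mono p)
    fix j assume "j \<in> {..w div l}"
    then have "l * j \<le> l * (w div l)" by simp
    also have "\<dots> \<le> w" by simp
    finally show "l * j \<le> w" .
  qed
  also have "\<dots> = (real (w div l) + 1) * p" by (simp add: add.commute)
  also have "\<dots> \<le> (real w / real l + 1) * p"
    using order_trans[OF pr_nonneg p[of 0]] dv by (intro mult_right_mono add_right_mono) auto
  finally show ?thesis .
qed

context riemann_problem
begin

section \<open>Limit profile and uniform concentration\<close>

text \<open>For \<open>x\<close> \<le> 0 both \<open>f k * t\<close> and \<open>- k * x\<close>
  increase with \<open>k\<close>, so \<theta> is extremal in the maximum as well as in the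
  minimum.\<close>

lemma prof_left: "0 \<le> t \<Longrightarrow> x \<le> 0 \<Longrightarrow> prof t x = f \<theta> * t - \<theta> * x"
proof -
  assume t: "0 \<le> t" and x: "x \<le> 0"
  have le: "f a * t - a * x \<le> f b * t - b * x" if "0 \<le> a" "a \<le> b" for a b
    using mult_right_mono[OF f_mono[OF that] t] mult_right_mono_neg[OF that(2) x] by simp
  show ?thesis
  proof (cases "\<rho> \<le> \<theta>")
    case True
    obtain k where k: "\<rho> \<le> k" "k \<le> \<theta>" "fan t x = f k * t - k * x" using fan_attained[OF True, of t x] by blast
    have "fan t x \<le> f \<theta> * t - \<theta> * x" using le[of k \<theta>] k rho by simp
    then show ?thesis using fan_ge[OF True order_refl, of t x] True by (simp add: prof_def)
  next
    case False
    then show ?thesis using le[of \<theta> \<rho>] theta by (simp add: prof_def shock_def)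
  qed
qed

lemma prof_lipschitz: "a \<le> b \<Longrightarrow> 0 \<le> prof t a - prof t b \<and> prof t a - prof t b \<le> b - a"
proof -
  assume ab: "a \<le> b"
  have mul: "0 \<le> k * (b - a) \<and> k * (b - a) \<le> b - a" if "0 \<le> k" "k \<le> 1" for k
    using mult_right_mono[OF that(2), of "b - a"] that ab by simp
  show ?thesis
  proof (cases "\<rho> \<le> \<theta>")
    case True
    obtain k where k: "\<rho> \<le> k" "k \<le> \<theta>" "fan t a = f k * t - k * a" using fan_attained[OF True, of t a] by blast
    obtain k' where k': "\<rho> \<le> k'" "k' \<le> \<theta>" "fan t b = f k' * t - k' * b" using fan_attained[OF True, of t b] by blast
    have "f k' * t - k' * a \<le> fan t a" "f k * t - k * b \<le> fan t b" using fan_ge[OF k'(1,2)] fan_ge[OF k(1,2)] by blast+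
    then have "fan t a - fan t b \<le> k * (b - a)" "k' * (b - a) \<le> fan t a - fan t b"
      using k(3) k'(3) by (simp_all add: algebra_simps)
    moreover have "0 \<le> k" "k \<le> 1" "0 \<le> k'" "k' \<le> 1" using k k' theta rho by auto
    ultimately have "0 \<le> fan t a - fan t b \<and> fan t a - fan t b \<le> b - a"
      using mul[of k] mul[of k'] by linarith
    then show ?thesis using True by (simp add: prof_def)
  next
    case False
    have "0 \<le> \<theta> * b - \<theta> * a" "\<theta> * b - \<theta> * a \<le> b - a" "0 \<le> \<rho> * b - \<rho> * a" "\<rho> * b - \<rho> * a \<le> b - a"
      using mul[OF theta] mul[OF rho] by (simp_all only: right_diff_distrib)
    then show ?thesis using False unfolding prof_def shock_def by (simp add: min_def)
  qed
qed

text \<open>Sums are split at column \<open>m\<close>. To its left the system sees only the density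
  \<theta> and is stationary, so Chebyshev applies; to its right the height theorem is used.\<close>

definition near :: "real \<Rightarrow> nat \<Rightarrow> nat \<Rightarrow> nat \<Rightarrow> (nat \<Rightarrow> bool) \<Rightarrow> bool" where
  "near \<eta> N w m s \<longleftrightarrow>
    (\<forall>x\<le>w. \<bar>(\<Sum>i<x. of_bool (s (m + i))) - (prof (real N) 0 - prof (real N) (real x))\<bar> \<le> \<eta>) \<and>
    (\<forall>x\<le>w. \<bar>(\<Sum>i<x. of_bool (s (m - x + i))) - real x * \<theta>\<bar> \<le> \<eta>)"

lemma near_cong:
  assumes "\<And>i. m - w \<le> i \<Longrightarrow> i < m + w \<Longrightarrow> s i = s' i" "w \<le> m"
  shows "near \<eta> N w m s = near \<eta> N w m s'"
proof -
  have "s (m + i) = s' (m + i)" "s (m - x + i) = s' (m - x + i)" if "i < x" "x \<le> w" for i x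
    using assms that by auto
  then show ?thesis unfolding near_def by simp
qed

lemma near_likely:
  assumes \<delta>: "0 < \<delta>" and \<gamma>: "0 < \<gamma>" and C: "0 \<le> C"
  shows "\<exists>N0. \<forall>N\<ge>N0. \<forall>m w. real w \<le> C * real N \<and> w \<le> m \<longrightarrow> pr (\<lambda>\<omega>. \<not> near (\<delta> * real N) N w m (VR m \<omega> N)) \<le> \<gamma>"
proof -
  \<comment> \<open>Bounds the number of points used by \<open>pr_sup_grid\<close> at the spacing
    \<open>l\<close> below; \<beta> is then chosen so that \<open>K\<close> Markov bounds add up to
    \<gamma> / 2.\<close>
  define K where "K = 4 * C / \<delta> + 1"
  have K: "0 < K" unfolding K_def using C \<delta> by (simp add: add_nonneg_pos)
  define \<beta> where "\<beta> = \<gamma> * \<delta> / (8 * K)"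
  have \<beta>: "0 < \<beta>" unfolding \<beta>_def using \<gamma> \<delta> K by simp
  obtain N1 where N1: "\<And>N m x. N1 \<le> N \<Longrightarrow> real x \<le> C * real N \<Longrightarrow>
      expectation (\<lambda>\<omega>. \<bar>hR m \<omega> N x - prof (real N) (real x)\<bar>) \<le> \<beta> * real N"
    using height_hydrodynamics[OF \<beta> C] by blast
  obtain N2 where N2: "4 / \<delta> + 8 * C * K / (\<delta>\<^sup>2 * \<gamma>) + 1 < real N2" using reals_Archimedean2 by blast
  have "pr (\<lambda>\<omega>. \<not> near (\<delta> * real N) N w m (VR m \<omega> N)) \<le> \<gamma>"
    if N: "max N1 N2 \<le> N" and w: "real w \<le> C * real N" "w \<le> m" for N m w
  proof -
    have N': "4 / \<delta> + 8 * C * K / (\<delta>\<^sup>2 * \<gamma>) + 1 < real N" using N2 N by simp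
    have nn: "0 \<le> 8 * C * K / (\<delta>\<^sup>2 * \<gamma>)" "0 \<le> 4 / \<delta>" using C K \<delta> \<gamma> by auto
    then have Npos: "1 < real N" and N4: "4 / \<delta> < real N" and N8: "8 * C * K / (\<delta>\<^sup>2 * \<gamma>) < real N"
      using N' by linarith+
    define l where "l = nat \<lfloor>\<delta> * real N / 2\<rfloor>"
    have dN: "4 \<le> \<delta> * real N" using N4 \<delta> by (simp add: field_simps)
    have l: "1 \<le> l" "real l \<le> \<delta> * real N / 2" "\<delta> * real N / 4 \<le> real l"
      unfolding l_def using dN by linarith+
    have wl: "real w / real l + 1 \<le> K"
    proof -
      have "real w / real l \<le> C * real N / (\<delta> * real N / 4)"
        using w l dN C by (intro frac_le) auto
      also have "\<dots> = 4 * C / \<delta>" using Npos \<delta> by (simp add: field_simps)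
      finally show ?thesis by (simp add: K_def)
    qed
    define \<eta> where "\<eta> = \<delta> * real N / 2"
    have \<eta>: "0 < \<eta>" "\<eta> + real l \<le> \<delta> * real N" unfolding \<eta>_def using dN l by auto
    define DR where "DR = (\<lambda>x \<omega>. (\<Sum>i<x. of_bool (VR m \<omega> N (m + i))) - (prof (real N) 0 - prof (real N) (real x)))"
    define DL where "DL = (\<lambda>x \<omega>. (\<Sum>i<x. of_bool (VR m \<omega> N (m - x + i))) - real x * \<theta>)"
    have mR: "DR x \<in> borel_measurable PM" for x unfolding DR_def by measurable
    have mL: "DL x \<in> borel_measurable PM" for x unfolding DL_def by measurable
    have lR: "\<bar>DR (Suc x) \<omega> - DR x \<omega>\<bar> \<le> 1" for x \<omega>
      using prof_lipschitz[of "real x" "real (Suc x)" "real N"] unfolding DR_def by (auto simp: of_bool_def)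
    have lL: "\<bar>DL (Suc x) \<omega> - DL x \<omega>\<bar> \<le> 1" if "x < w" for x \<omega>
    proof -
      have a: "m - Suc x + Suc i = m - x + i" for i using that w by simp
      have "DL (Suc x) \<omega> - DL x \<omega> = of_bool (VR m \<omega> N (m - Suc x)) - \<theta>"
        unfolding DL_def sum.lessThan_Suc_shift a by (simp add: distrib_right)
      then show ?thesis using theta by (auto simp: of_bool_def)
    qed
    have pR: "pr (\<lambda>\<omega>. \<eta> < \<bar>DR x \<omega>\<bar>) \<le> 2 * (\<beta> * real N) / \<eta>" if "x \<le> w" for x
    proof -
      let ?Z = "\<lambda>x \<omega>. hR m \<omega> N x - prof (real N) (real x)"
      have int: "integrable PM (?Z x)" for x
        by (intro Bochner_Integration.integrable_diff integrable_height integrable_const)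
      have DR: "DR x = (\<lambda>\<omega>. ?Z 0 \<omega> - ?Z x \<omega>)"
        unfolding DR_def height_def by (intro ext) simp
      have iD: "integrable PM (DR x)" unfolding DR by (intro Bochner_Integration.integrable_diff int)
      have "expectation (\<lambda>\<omega>. \<bar>DR x \<omega>\<bar>) \<le> expectation (\<lambda>\<omega>. \<bar>?Z 0 \<omega>\<bar> + \<bar>?Z x \<omega>\<bar>)"
        unfolding DR
        by (rule integral_mono[OF integrable_abs[OF Bochner_Integration.integrable_diff[OF int int]]
              Bochner_Integration.integrable_add[OF integrable_abs[OF int] integrable_abs[OF int]]]) (rule abs_triangle_ineq4)
      also have "\<dots> = expectation (\<lambda>\<omega>. \<bar>?Z 0 \<omega>\<bar>) + expectation (\<lambda>\<omega>. \<bar>?Z x \<omega>\<bar>)"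
        by (rule Bochner_Integration.integral_add[OF integrable_abs[OF int] integrable_abs[OF int]])
      also have "\<dots> \<le> \<beta> * real N + \<beta> * real N"
        by (intro add_mono N1) (use N w that C in auto)
      finally show ?thesis using markov_abs[OF iD _ \<eta>(1), of "2 * (\<beta> * real N)"] by simp
    qed
    have pL: "pr (\<lambda>\<omega>. \<eta> < \<bar>DL x \<omega>\<bar>) \<le> C * real N / \<eta>\<^sup>2" if "x \<le> w" for x
    proof -
      note st = theta f_bounds[OF theta] f_balance[OF theta(1)]
      have "VR m \<omega> N (m - x + i) = VT (\<lambda>_. \<theta>) (f \<theta>) \<omega> N (m - x + i)" if "i < x" for i \<omega>
        by (rule VT_cong) (use that \<open>x \<le> w\<close> w(2) in \<open>auto simp: pm_def\<close>)
      then have "DL x = (\<lambda>\<omega>. (\<Sum>i<x. of_bool (VT (\<lambda>_. \<theta>) (f \<theta>) \<omega> N (m - x + i))) - real x * \<theta>)"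
        unfolding DL_def by (intro ext) simp
      then have "pr (\<lambda>\<omega>. \<eta> < \<bar>DL x \<omega>\<bar>) \<le> real x / \<eta>\<^sup>2"
        using stationary_V_sum(2)[OF st \<eta>(1), where n=x and t=N and x="m - x"] by simp
      also have "\<dots> \<le> C * real N / \<eta>\<^sup>2" using that w by (intro divide_right_mono) auto
      finally show ?thesis .
    qed
    have bR: "(real w / real l + 1) * (2 * (\<beta> * real N) / \<eta>) \<le> \<gamma> / 2"
    proof -
      have "(real w / real l + 1) * (2 * (\<beta> * real N) / \<eta>) \<le> K * (2 * (\<beta> * real N) / \<eta>)"
        using wl \<beta> \<eta> by (intro mult_right_mono) auto
      also have "\<dots> = \<gamma> / 2" unfolding \<beta>_def \<eta>_def using K \<delta> Npos by (simp add: field_simps)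
      finally show ?thesis .
    qed
    have bL: "(real w / real l + 1) * (C * real N / \<eta>\<^sup>2) \<le> \<gamma> / 2"
    proof -
      have "(real w / real l + 1) * (C * real N / \<eta>\<^sup>2) \<le> K * (C * real N / \<eta>\<^sup>2)"
        using wl C \<eta> by (intro mult_right_mono) auto
      also have "\<dots> = (8 * C * K / (\<delta>\<^sup>2 * \<gamma>)) * (\<gamma> / 2) / real N"
        unfolding \<eta>_def using \<delta> \<gamma> Npos by (simp add: field_simps power2_eq_square)
      also have "\<dots> \<le> real N * (\<gamma> / 2) / real N"
        using N8 \<gamma> by (intro divide_right_mono mult_right_mono) auto
      finally show ?thesis using Npos by simp
    qed
    have evs: "ev (\<lambda>\<omega>. \<exists>x\<le>w. \<eta> + real l < \<bar>DR x \<omega>\<bar>)" "ev (\<lambda>\<omega>. \<exists>x\<le>w. \<eta> + real l < \<bar>DL x \<omega>\<bar>)"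
      "ev (\<lambda>\<omega>. (\<exists>x\<le>w. \<eta> + real l < \<bar>DR x \<omega>\<bar>) \<or> (\<exists>x\<le>w. \<eta> + real l < \<bar>DL x \<omega>\<bar>))"
      using mR mL unfolding ev_iff_pred by measurable
    have "pr (\<lambda>\<omega>. \<not> near (\<delta> * real N) N w m (VR m \<omega> N)) \<le>
        pr (\<lambda>\<omega>. (\<exists>x\<le>w. \<eta> + real l < \<bar>DR x \<omega>\<bar>) \<or> (\<exists>x\<le>w. \<eta> + real l < \<bar>DL x \<omega>\<bar>))"
    proof (rule pr_mono[OF _ evs(3)])
      fix \<omega> assume "\<not> near (\<delta> * real N) N w m (VR m \<omega> N)"
      then obtain x where "x \<le> w" "\<delta> * real N < \<bar>DR x \<omega>\<bar> \<or> \<delta> * real N < \<bar>DL x \<omega>\<bar>"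
        unfolding near_def DR_def DL_def by (auto simp: not_le)
      then show "(\<exists>x\<le>w. \<eta> + real l < \<bar>DR x \<omega>\<bar>) \<or> (\<exists>x\<le>w. \<eta> + real l < \<bar>DL x \<omega>\<bar>)"
        using \<eta>(2) by (meson le_less_trans)
    qed
    also have "\<dots> \<le> pr (\<lambda>\<omega>. \<exists>x\<le>w. \<eta> + real l < \<bar>DR x \<omega>\<bar>) + pr (\<lambda>\<omega>. \<exists>x\<le>w. \<eta> + real l < \<bar>DL x \<omega>\<bar>)"
      by (rule pr_disj_le[OF evs(1,2)])
    also have "\<dots> \<le> \<gamma> / 2 + \<gamma> / 2"
    proof (rule add_mono)
      show "pr (\<lambda>\<omega>. \<exists>x\<le>w. \<eta> + real l < \<bar>DR x \<omega>\<bar>) \<le> \<gamma> / 2"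
        by (rule order_trans[OF pr_sup_grid bR]) (use mR lR l(1) pR in auto)
      show "pr (\<lambda>\<omega>. \<exists>x\<le>w. \<eta> + real l < \<bar>DL x \<omega>\<bar>) \<le> \<gamma> / 2"
        by (rule order_trans[OF pr_sup_grid bL]) (use mL lL l(1) pL in auto)
    qed
    finally show ?thesis by simp
  qed
  then show ?thesis by blast
qed

text \<open>The sum is a difference of signed partial sums at \<open>X2\<close> and
  \<open>X1 - 1\<close>, each with error \<eta>; replacing \<open>X1 - 1\<close> by
  \<open>X1\<close> in the profile costs at most 1. Site \<open>x\<close> is column
  \<open>m - 1 + x\<close>, so site 0 is the last column of density \<theta>.\<close>

lemma near_interval:
  assumes near: "near \<eta> N w m s" and wm: "w \<le> m" and N: "0 < N"
    and X: "- int w < X1" "X1 \<le> X2" "X2 \<le> int w"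
  shows "\<bar>(\<Sum>x\<in>{X1..X2}. of_bool (s (nat (int m - 1 + x))))
    - real N * (prof 1 (real_of_int X1 / real N) - prof 1 (real_of_int X2 / real N))\<bar> \<le> 2 * \<eta> + 1"
proof -
  define S :: "int \<Rightarrow> real" where "S x = (if 0 \<le> x then \<Sum>i<nat x. of_bool (s (m + i)) else - (\<Sum>i<nat (- x). of_bool (s (m - nat (- x) + i))))" for x
  have step: "S x = S (x - 1) + of_bool (s (nat (int m - 1 + x)))" if x: "- int w < x" for x
  proof (cases "0 < x")
    case True
    define k where "k = nat (x - 1)"
    have k: "x = int (Suc k)" using True by (simp add: k_def)
    have "nat (int m - 1 + x) = m + k" by (simp add: k)
    moreover have "S x = (\<Sum>i<Suc k. of_bool (s (m + i)))" unfolding S_def k nat_int by simp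
    moreover have "S (x - 1) = (\<Sum>i<k. of_bool (s (m + i)))" by (simp add: S_def k)
    ultimately show ?thesis by simp
  next
    case False
    define k where "k = nat (- x)"
    have k: "x = - int k" "k < w" using False x by (simp_all add: k_def)
    have a: "m - Suc k + Suc i = m - k + i" for i using k wm by simp
    have b: "nat (int m - 1 + x) = m - Suc k" using k wm by simp
    have "S (x - 1) = - (\<Sum>i<Suc k. of_bool (s (m - Suc k + i)))"
    proof -
      have "nat (- (x - 1)) = Suc k" "\<not> 0 \<le> x - 1" using k by auto
      then show ?thesis by (simp only: S_def if_False)
    qed
    also have "\<dots> = - of_bool (s (m - Suc k)) - (\<Sum>i<k. of_bool (s (m - k + i)))"
      unfolding sum.lessThan_Suc_shift a by simp
    finally have "S (x - 1) = - of_bool (s (m - Suc k)) - (\<Sum>i<k. of_bool (s (m - k + i)))" .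
    moreover have "S x = - (\<Sum>i<k. of_bool (s (m - k + i)))" using k by (simp add: S_def)
    ultimately show ?thesis unfolding b by simp
  qed
  have bound: "\<bar>S x - (prof (real N) 0 - prof (real N) (real_of_int x))\<bar> \<le> \<eta>" if x: "- int w \<le> x" "x \<le> int w" for x
  proof (cases "0 \<le> x")
    case True
    then have "nat x \<le> w" using x by simp
    then show ?thesis using near True unfolding near_def S_def by force
  next
    case False
    then have k: "nat (- x) \<le> w" "real (nat (- x)) = - real_of_int x" using x by auto
    have p: "prof (real N) 0 - prof (real N) (real_of_int x) = \<theta> * real_of_int x"
      using False prof_left[of "real N" 0] prof_left[of "real N" "real_of_int x"] by simp
    have "\<bar>(\<Sum>i<nat (- x). of_bool (s (m - nat (- x) + i))) - real (nat (- x)) * \<theta>\<bar> \<le> \<eta>"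
      using near k(1) unfolding near_def by blast
    then show ?thesis unfolding p k(2) using False by (simp add: S_def abs_le_iff mult.commute)
  qed
  have "(\<Sum>x\<in>{X1..X2}. of_bool (s (nat (int m - 1 + x)))) = S X2 - S (X1 - 1)"
    using X(2)
  proof (induction X2 rule: int_ge_induct)
    case base
    then show ?case using step[OF X(1)] by simp
  next
    case (step i)
    have "{X1..i + 1} = insert (i + 1) {X1..i}" using step.hyps by auto
    then show ?case using step.IH \<open>\<And>x. - int w < x \<Longrightarrow> S x = S (x - 1) + of_bool (s (nat (int m - 1 + x)))\<close>[of "i + 1"] step.hyps X(1)
      by simp
  qed
  moreover have sc: "prof (real N) y = real N * prof 1 (y / real N)" for y
    using prof_scale[of "real N" 1 "y / real N"] N by simp
  have "\<bar>real N * prof 1 (real_of_int (X1 - 1) / real N) - real N * prof 1 (real_of_int X1 / real N)\<bar> \<le> 1"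
    unfolding sc[symmetric] using prof_lipschitz[of "real_of_int (X1 - 1)" "real_of_int X1" "real N"] by simp
  ultimately show ?thesis using bound[of X2] bound[of "X1 - 1"] X unfolding sc right_diff_distrib by linarith
qed

lemma sums_concentrate:
  assumes \<epsilon>: "0 < \<epsilon>" and \<gamma>: "0 < \<gamma>"
  shows "\<exists>N0. \<forall>N\<ge>N0. sv.pr (\<lambda>\<omega>. \<exists>X1 X2. - real N / \<epsilon> < real_of_int X1 \<and> X1 < X2 \<and> real_of_int X2 < real N / \<epsilon> \<and>
        \<epsilon> < \<bar>(1 / real N) * (\<Sum>x\<in>{X1..X2}. of_bool (sv_config \<omega> N x))
          - (prof 1 (real_of_int X1 / real N) - prof 1 (real_of_int X2 / real N))\<bar>) \<le> \<gamma>"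
proof -
  \<comment> \<open>The \<open>+ 2\<close> absorbs the rounding of N / \<epsilon> and the extra site
    at the left end.\<close>
  define C where "C = 1 / \<epsilon> + 2"
  have C: "0 \<le> C" using \<epsilon> by (simp add: C_def)
  obtain N1 where N1: "\<And>N m w. N1 \<le> N \<Longrightarrow> real w \<le> C * real N \<Longrightarrow> w \<le> m \<Longrightarrow> pr (\<lambda>\<omega>. \<not> near (\<epsilon> / 4 * real N) N w m (VR m \<omega> N)) \<le> \<gamma> / 4"
    using near_likely[of "\<epsilon> / 4" "\<gamma> / 4" C] \<epsilon> \<gamma> C by auto
  \<comment> \<open>Ensures \<epsilon> N > 2, so that the additive 1 of \<open>near_interval\<close>
    is absorbed.\<close>
  obtain N2 where N2: "2 / \<epsilon> + 1 < real N2" using reals_Archimedean2 by blast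
  obtain g where "b2 ^ g < (1 - b2) / 2" using real_arch_pow_inv[of "(1 - b2) / 2" b2] b2 by auto
  then have g: "b2 ^ g / (1 - b2) \<le> 1 / 2" using b2 by (simp add: field_simps)
  have "sv.pr (\<lambda>\<omega>. \<exists>X1 X2. - real N / \<epsilon> < real_of_int X1 \<and> X1 < X2 \<and> real_of_int X2 < real N / \<epsilon> \<and>
        \<epsilon> < \<bar>(1 / real N) * (\<Sum>x\<in>{X1..X2}. of_bool (sv_config \<omega> N x))
          - (prof 1 (real_of_int X1 / real N) - prof 1 (real_of_int X2 / real N))\<bar>) \<le> \<gamma>" (is "sv.pr ?E \<le> _")
    if N: "max N1 N2 \<le> N" for N
  proof -
    have Nb: "2 / \<epsilon> + 1 < real N" using N N2 by simp
    have "0 < 2 / \<epsilon>" using \<epsilon> by simp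
    then have Np: "1 < real N" "2 / \<epsilon> < real N" using Nb by linarith+
    have Np2: "2 < \<epsilon> * real N" using Np(2) \<epsilon> by (simp add: field_simps)
    define w where "w = Suc (nat \<lceil>real N / \<epsilon>\<rceil>)"
    have "0 \<le> real N / \<epsilon>" using \<epsilon> by simp
    then have "real w = of_int \<lceil>real N / \<epsilon>\<rceil> + 1" unfolding w_def by simp
    then have w: "real N / \<epsilon> + 1 \<le> real w" "real w \<le> real N / \<epsilon> + 2"
      using ceiling_correct[of "real N / \<epsilon>"] by linarith+
    have wC: "real w \<le> C * real N" using w Np by (simp add: C_def algebra_simps)
    obtain A where A: "\<And>A'. A' \<le> A \<Longrightarrow> sv.pr (\<lambda>\<omega>. \<not> chain \<omega> g N A' (- int w)) \<le> \<gamma> / 4"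
      using chain_likely[OF g, of "\<gamma> / 4" N "- int w"] \<gamma> by auto
    obtain X where X: "\<And>Y. X \<le> Y \<Longrightarrow> pr (\<lambda>\<omega>. \<not> vchain \<omega> N Y) \<le> \<gamma> / 4"
      using vchain_likely[of "\<gamma> / 4" N] \<gamma> by auto
    \<comment> \<open>Far enough to the left for the locks of the particle system, through
      \<open>A\<close>, and those of the vertex system, through \<open>X\<close>, to lie outside the
      window of radius \<open>w\<close>.\<close>
    define M where "M = nat (- A) + w + X"
    define m where "m = Suc M"
    define n where "n = M + w + 1"
    have n: "n \<le> 2 * M + 1" and wm: "w \<le> m" and wM: "w \<le> M" by (auto simp: n_def m_def M_def)
    define B where "B = (\<lambda>bs::bool list. \<not> near (\<epsilon> / 4 * real N) N w m (\<lambda>i. bs ! i))"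
    have evB: "sv.ev (\<lambda>\<omega>. B (particle_row \<omega> M n N))" by (rule ev_particle_row)
    have evc: "sv.ev (\<lambda>\<omega>. \<not> chain \<omega> g N (- int M) (- int w))" unfolding sv.ev_iff_pred by measurable
    have "sv.pr ?E \<le> sv.pr (\<lambda>\<omega>. \<not> chain \<omega> g N (- int M) (- int w) \<or> B (particle_row \<omega> M n N))"
    proof (rule sv.finite_measure_mono_AE)
      show "sv.ev (\<lambda>\<omega>. \<not> chain \<omega> g N (- int M) (- int w) \<or> B (particle_row \<omega> M n N))"
        using sets.Un[OF evc evB] by (simp only: Collect_disj_eq)
      show "AE \<omega> in sv.PM. \<omega> \<in> {\<omega>. ?E \<omega>} \<longrightarrow> \<omega> \<in> {\<omega>. \<not> chain \<omega> g N (- int M) (- int w) \<or> B (particle_row \<omega> M n N)}"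
        using AE_jpos
      proof eventually_elim
        case (elim \<omega>)
        then have jpos: "\<And>t x. 1 \<le> \<omega> (Jmp t x)" by blast
        have "\<not> ?E \<omega>" if ch: "chain \<omega> g N (- int M) (- int w)" and nB: "\<not> B (particle_row \<omega> M n N)"
        proof (intro notI, elim exE conjE)
          fix X1 X2 assume X1: "- real N / \<epsilon> < real_of_int X1" and X12: "X1 < X2" and X2: "real_of_int X2 < real N / \<epsilon>"
            and big: "\<epsilon> < \<bar>(1 / real N) * (\<Sum>x\<in>{X1..X2}. of_bool (sv_config \<omega> N x))
              - (prof 1 (real_of_int X1 / real N) - prof 1 (real_of_int X2 / real N))\<bar>"
          let ?P = "prof 1 (real_of_int X1 / real N) - prof 1 (real_of_int X2 / real N)"
          have Xw: "- int w < X1" "X2 \<le> int w" using X1 X2 w by linarith+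
          have "sv_config \<omega> N x = particle_row \<omega> M n N ! nat (int m - 1 + x)" if "x \<in> {X1..X2}" for x
          proof -
            have x: "- int w \<le> x" "x \<le> int w" using that Xw by auto
            have i: "nat (int m - 1 + x) < n" "- int M + int (nat (int m - 1 + x)) = x"
              using x wM by (auto simp: n_def m_def)
            have "sv_config \<omega> N x = occ \<omega> M N x" by (rule sv_config_eq_occ[of \<omega>, OF jpos ch]) (use x wM in auto)
            then show ?thesis unfolding particle_row_occ[of \<omega>, OF jpos n] using i by simp
          qed
          then have "(\<Sum>x\<in>{X1..X2}. of_bool (sv_config \<omega> N x)) = (\<Sum>x\<in>{X1..X2}. of_bool (particle_row \<omega> M n N ! nat (int m - 1 + x)) :: real)"
            by (intro sum.cong) auto
          moreover have "\<bar>(\<Sum>x\<in>{X1..X2}. of_bool (particle_row \<omega> M n N ! nat (int m - 1 + x))) - real N * ?P\<bar> \<le> 2 * (\<epsilon> / 4 * real N) + 1"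
            by (rule near_interval[OF _ wm]) (use nB Np Xw X12 in \<open>auto simp: B_def\<close>)
          ultimately have le: "\<bar>(\<Sum>x\<in>{X1..X2}. of_bool (sv_config \<omega> N x)) - real N * ?P\<bar> \<le> \<epsilon> * real N"
            using Np2 by simp
          have "(1 / real N) * (\<Sum>x\<in>{X1..X2}. of_bool (sv_config \<omega> N x)) - ?P = ((\<Sum>x\<in>{X1..X2}. of_bool (sv_config \<omega> N x)) - real N * ?P) / real N"
            using Np(1) by (simp add: diff_divide_distrib)
          then have "\<bar>(1 / real N) * (\<Sum>x\<in>{X1..X2}. of_bool (sv_config \<omega> N x)) - ?P\<bar> \<le> \<epsilon>"
            using le Np(1) by (simp add: divide_le_eq)
          then show False using big by simp
        qed
        then show ?case by blast
      qed
    qed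
    also have "\<dots> \<le> \<gamma> / 4 + sv.pr (\<lambda>\<omega>. B (particle_row \<omega> M n N))"
    proof -
      have "sv.pr (\<lambda>\<omega>. \<not> chain \<omega> g N (- int M) (- int w)) \<le> \<gamma> / 4" by (rule A) (simp add: M_def)
      then show ?thesis using sv.pr_disj_le[OF evc evB] by linarith
    qed
    also have "sv.pr (\<lambda>\<omega>. B (particle_row \<omega> M n N)) = pr (\<lambda>\<omega>. B (vertex_row \<omega> M n N))"
      by (rule row_event_law[OF n])
    also have "\<dots> \<le> pr (\<lambda>\<omega>. \<not> vchain \<omega> N (m - w) \<or> \<not> near (\<epsilon> / 4 * real N) N w m (VR m \<omega> N))"
    proof (rule pr_mono)
      fix \<omega> assume Bv: "B (vertex_row \<omega> M n N)"
      have "near (\<epsilon> / 4 * real N) N w m (\<lambda>i. vertex_row \<omega> M n N ! i) = near (\<epsilon> / 4 * real N) N w m (VR m \<omega> N)"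
        if vc: "vchain \<omega> N (m - w)"
      proof (rule near_cong[OF _ wm])
        fix i assume i: "m - w \<le> i" "i < m + w"
        then have "i < n" by (simp add: n_def m_def)
        then have "vertex_row \<omega> M n N ! i = VS (thrV (pm m)) (\<lambda>_ _. False) \<omega> N i"
          by (simp add: vertex_row_def m_def)
        then show "vertex_row \<omega> M n N ! i = VR m \<omega> N i" using vchain_agree[OF vc i(1)] by simp
      qed
      then show "\<not> vchain \<omega> N (m - w) \<or> \<not> near (\<epsilon> / 4 * real N) N w m (VR m \<omega> N)" using Bv by (auto simp: B_def)
    next
      show "ev (\<lambda>\<omega>. \<not> vchain \<omega> N (m - w) \<or> \<not> near (\<epsilon> / 4 * real N) N w m (VR m \<omega> N))"
        unfolding ev_iff_pred near_def by measurable
    qed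
    also have "\<dots> \<le> pr (\<lambda>\<omega>. \<not> vchain \<omega> N (m - w)) + pr (\<lambda>\<omega>. \<not> near (\<epsilon> / 4 * real N) N w m (VR m \<omega> N))"
      by (rule pr_disj_le; unfold ev_iff_pred near_def; measurable)
    also have "\<dots> \<le> \<gamma> / 4 + \<gamma> / 4"
      by (intro add_mono X N1) (use N wC wm in \<open>auto simp: m_def M_def\<close>)
    finally show ?thesis using \<gamma> by simp
  qed
  then show ?thesis by blast
qed

end

theorem theorem4p2:
  fixes b1 b2 \<theta> \<rho> \<epsilon> :: real and G :: "real \<Rightarrow> real \<Rightarrow> real"
  assumes "0 < b1" "b1 < b2" "b2 < 1"
    and "0 \<le> \<theta>" "\<theta> \<le> 1" "0 \<le> \<rho>" "\<rho> \<le> 1"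
    and "0 < \<epsilon>"
    and "entropy_solution (sv_phi b1 b2) (\<lambda>x. if x \<le> 0 then \<theta> else \<rho>) G"
  defines "E \<equiv> \<lambda>N::nat. {\<omega> \<in> space (sv_space b1 b2 \<theta> \<rho>).
      \<exists>X1 X2 :: int. - real N / \<epsilon> < real_of_int X1 \<and> X1 < X2 \<and> real_of_int X2 < real N / \<epsilon> \<and>
        \<bar>(1 / real N) * (\<Sum>x\<in>{X1..X2}. of_bool (sv_config \<omega> N x))
          - (LINT x:{real_of_int X1 / real N..real_of_int X2 / real N}|lborel. G x 1)\<bar> > \<epsilon>}"
  shows "(\<forall>N. E N \<in> sets (sv_space b1 b2 \<theta> \<rho>)) \<and>
         (\<lambda>N. measure (sv_space b1 b2 \<theta> \<rho>) (E N)) \<longlonglongrightarrow> 0"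
proof -
  interpret riemann_problem b1 b2 \<theta> \<rho>
    using assms(1-7) by unfold_locales auto
  have ent: "entropy_solution f (\<lambda>x. if x \<le> 0 then \<theta> else \<rho>) G" using assms(9) by (simp add: f_def)
  have sp: "sv_space b1 b2 \<theta> \<rho> = sv.PM" by (simp add: sv_space_def)
  \<comment> \<open>Replacing the integral of \<open>G\<close> by the explicit profile also makes
    the events visibly measurable, as countable unions over \<open>X1\<close> and
    \<open>X2\<close>.\<close>
  have prof: "(LINT x:{real_of_int X1 / real N..real_of_int X2 / real N}|lborel. G x 1) =
      prof 1 (real_of_int X1 / real N) - prof 1 (real_of_int X2 / real N)" if "X1 < X2" for X1 X2 :: int and N :: nat
    using that by (intro entropy_profile[OF ent] divide_right_mono) auto
  have E: "E N = {\<omega>. \<exists>X1 X2. - real N / \<epsilon> < real_of_int X1 \<and> X1 < X2 \<and> real_of_int X2 < real N / \<epsilon> \<and>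
        \<epsilon> < \<bar>(1 / real N) * (\<Sum>x\<in>{X1..X2}. of_bool (sv_config \<omega> N x))
          - (prof 1 (real_of_int X1 / real N) - prof 1 (real_of_int X2 / real N))\<bar>}" for N
    unfolding E_def sp sv.space_PM by (simp only: UNIV_I simp_thms, intro Collect_cong ex_cong1 conj_cong refl) (simp only: prof)
  have "E N \<in> sets sv.PM" for N
    unfolding E sv.ev_iff_pred by measurable
  moreover have "(\<lambda>N. measure sv.PM (E N)) \<longlonglongrightarrow> 0"
  proof (rule LIMSEQ_I)
    fix r :: real assume r: "0 < r"
    obtain N0 where N0: "\<And>N. N0 \<le> N \<Longrightarrow> measure sv.PM (E N) \<le> r / 2"
      unfolding E using sums_concentrate[OF assms(8), of "r / 2"] r by auto
    have "norm (measure sv.PM (E N) - 0) < r" if "N0 \<le> N" for N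
      using N0[OF that] r by simp
    then show "\<exists>N0. \<forall>N\<ge>N0. norm (measure sv.PM (E N) - 0) < r" by blast
  qed
  ultimately show ?thesis unfolding sp by blast
qed

end
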